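(* Consider the finite memory change-point model with fixed $\kappa\ge0$, whose link function $\Psi=\Psi_\alpha$ (and prior probability $\pi_0$) may depend on $\alpha\in(0,1)$, while $K$ and the densities $\{f_x,g_x\}$ are fixed. Assume that for each $x\in[K]$, $0<V_x^I<\infty$ and $V_x^J<\infty$, and that there is a constant $c\in(0,1)$ such that $\sup_{t\ge0,z\in[K]^t}\pi_t(z;\alpha)\le1-c$ for all small enough $\alpha$. Let $(\widetilde{\mathcal X}^*,\widetilde T^* )$ be the proposed (modified) procedure with initial sequence $z_0^*$, acceleration block $\Xi_1^*$, detection block $\Xi_2^*$ and thresholds $$b_2=\frac{1-\alpha}{\alpha},\quad b_1=\min\Big\{b_2,\ \frac{\widetilde\lambda(\Xi_1^* )+\log(b_2)/\mathsf D(\Xi_2^* )}{1/\mathsf D(\Xi_1^* )-1/\mathsf D(\Xi_2^* )}-1\Big\},\quad d=b_1\,\frac{\widetilde\lambda(\Xi_1^* )+\log(b_2)/\mathsf D(\Xi_2^* )}{1/\mathsf D(\Xi_2^* )+1/J(\Xi_2^* )}.$$ Then $(\widetilde{\mathcal X}^*,\widetilde T^* )\in\mathcal C_\alpha$ for every $\alpha\in(0,1)$, and $\mathsf E[\widetilde T^*]\sim\inf_{(\mathcal X,T)\in\mathcal C_\alpha}\mathsf E[T]$ as $\alpha\to0$ (i.e. the ratio tends to $1$).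
   Context: Setup. Fix $2\le K<\infty$, $[K]=\{1,\dots,K\}$, $\mathbb N=\{1,2,\dots\}$. There is a latent process $L_t\in\{0,1\}$, $t\ge0$, with $L_t=0$ for $t<\Theta$ and $L_t=1$ for $t\ge\Theta$ ($\Theta$ is the change-point). At each $t\in\mathbb N$ a treatment $X_t\in[K]$ is selected and a response $Y_t$ in a Polish space $\mathbb Y$ is observed; $\mathcal F_t=\sigma(X_s,Y_s:1\le s\le t)$, $\mathcal F_0$ trivial. An assignment rule $\mathcal X=\{X_t\}$ has $X_1$ deterministic and $X_t$ a measurable function of $X_1,\dots,X_{t-1},Y_1,\dots,Y_{t-1}$. Response model: for each $x\in[K]$, $f_x,g_x$ are densities with respect to a $\sigma$-finite measure $\mu$ on $\mathbb Y$; given $X_t=x,L_t=i,\mathcal F_{t-1},L_0,\dots,L_{t-1}$, $Y_t$ has density $f_x$ if $i=0$, $g_x$ if $i=1$. Change-point model: $\mathsf P(L_0=1)=\pi_0\in[0,1)$, $\mathsf P(L_t=1\mid L_{t-1}=0,\mathcal F_{t-1},X_t)=\Pi_t=\pi_t(X_1,\dots,X_t)$. The change-point under $\mathcal X$ is written $\Theta_{\mathcal X}$. Posterior odds: $\Gamma_t=\mathsf P(L_t=1|\mathcal F_t)/\mathsf P(L_t=0|\mathcal F_t)$; $\Lambda_t=g_{X_t}(Y_t)/f_{X_t}(Y_t)$. $\mathcal C_\alpha$ is the class of pairs $(\mathcal X,T)$ with $\mathcal X$ an assignment rule, $T$ an $\{\mathcal F_t\}$-stopping time and $\mathsf P(T<\Theta_{\mathcal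 X})\le\alpha$. Finite memory model: $\Pi_t=\Psi(X_t,\mathbb S_{t-1})$ with $\mathbb S_t=(X_t,\dots,X_{t-\kappa+1})\in[K]^\kappa$, i.e. $\mathbb S_t=\Phi(X_t,\mathbb S_{t-1})$, $\Phi(x,(x_\kappa,\dots,x_1))=(x,x_\kappa,\dots,x_2)$, for a given initial state $\mathbb S_0\in[K]^\kappa$ and $\Psi:[K]\times[K]^\kappa\to[0,1)$. So $\pi_t(x_1,\dots,x_t)=\Psi(x_t,x_{t-1},\dots,x_{t-\kappa})$, entries with non-positive index being taken from $\mathbb S_0$. Blocks. A block of length $\ell$ is $\Xi\in[K]^\ell$, extended cyclically; $\Xi(1:s)=(\Xi(1),\dots,\Xi(s))$. $I_x=\int\log(g_x/f_x)g_x\,d\mu$, $J_x=\int\log(f_x/g_x)f_x\,d\mu$, $V_x^I=\int(\log(g_x/f_x)-I_x)^2g_x\,d\mu$, $V_x^J=\int(\log(f_x/g_x)-J_x)^2f_x\,d\mu$; $I(\Xi),J(\Xi)$ are averages of $I_{\Xi(i)},J_{\Xi(i)}$ over $1\le i\le\ell$. $\omega(x)=|\log(1-x)|$, $d(\Xi)=\frac1\ell\sum_{j=1}^\ell\omega(\Psi(\Xi(j),\Xi(j-1),\dots,\Xi(j-\kappa)))$, $\mathsf D(\Xi)=I(\Xi)+d(\Xi)$. $\widetilde\lambda(\Xi)=\sup_{m\ge0,z\in[K]^m}\{1+\sum_{t\ge1}\prod_{s=1}^t(1-\pi_{m+s}(z,\Xi(1:s)))\}$. If $\mathsf D(\Xi_1^*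 )=\mathsf D(\Xi_2^* )$ the quotient in $b_1$ is read as $+\infty$, so $b_1=b_2$. Optimal $z_0^*,\Xi_1^*$. Let $V^*(\mathbb S)=\inf_{(x_1,x_2,\dots)\in[K]^\infty}\sum_{t\ge1}\prod_{s=1}^t(1-\Psi(x_s,\mathbb S_{s-1}))$ with $\mathbb S_0=\mathbb S$, $\mathbb S_t=\Phi(x_t,\mathbb S_{t-1})$; $\upsilon^*(\mathbb S)\in\arg\min_{x\in[K]}(1-\Psi(x,\mathbb S))(1+V^*(\Phi(x,\mathbb S)))$. Starting from the model's initial state $\mathbb S_0^*=\mathbb S_0$, let $x_t^*=\upsilon^*(\mathbb S_{t-1}^* )$, $\mathbb S_t^*=\Phi(x_t^*,\mathbb S_{t-1}^* )$; $u^*=\inf\{t\ge1:\mathbb S_t^*=\mathbb S_\ell^*\text{ for some }0\le\ell<t\}$, $\ell^*\in[0,u^* )$ the integer with $\mathbb S^*_{\ell^*}=\mathbb S^*_{u^*}$; $z_0^*=(x_1^*,\dots,x_{\ell^*}^* )$, $\Xi_1^*=(x^*_{\ell^*+1},\dots,x^*_{u^*})$. Optimal $\Xi_2^*$. Let $r(x,\mathbb S)=I_x+\omega(\Psi(x,\mathbb S))$, and let $\lambda'\in\mathbb R$ and $h':[K]^\kappa\to\mathbb R$ solve $\lambda'+h'(\mathbb S)=\max_{x\in[K]}[r(x,\mathbb S)+h'(\Phi(x,\mathbb S))]$ for all $\mathbb S\in[K]^\kappa$ (here $\lambda'$ is the optimal value of maximizing $\liminf_M\frac1M\sum_{t=1}^Mr(x_t,\mathbb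 S_{t-1})$ over treatment sequences, which does not depend on the initial state); $\upsilon'(\mathbb S)\in\arg\max_x[r(x,\mathbb S)+h'(\Phi(x,\mathbb S))]$. With $\mathbb S_0'=\mathbb S_0$, $x_t'=\upsilon'(\mathbb S_{t-1}')$, $\mathbb S_t'=\Phi(x_t',\mathbb S_{t-1}')$, let $u'=\inf\{t\ge1:\mathbb S_t'=\mathbb S_\ell'\text{ for some }0\le\ell<t\}$, $\ell'\in[0,u')$ with $\mathbb S'_{\ell'}=\mathbb S'_{u'}$, and $\Xi_2^*=(x'_{\ell'+1},\dots,x'_{u'})$. Proposed (modified) procedure with $z_0\in[K]^{t_0}$, $\Xi_1,\Xi_2,b_1,b_2,d$. Let $\sigma(t;b)=\inf\{s\ge0:\Gamma_{t+s}\ge b\}$, $\tau(t;d)=\inf\{s\ge1:\prod_{j=1}^s\Lambda_{t+j}\le1/d\}$. $S_0=0$; for $m\ge1$, $S_{2m-1}=S_{2m-2}+\sigma(S_{2m-2};b_1)$, $S_{2m}=S_{2m-1}+\min\{\sigma(S_{2m-1};b_2),\tau(S_{2m-1};d)\}$. Treatments: $\Xi_1(t-S_{2m-2})$ at $t\in(S_{2m-2},S_{2m-1}]$, $\Xi_2(t-S_{2m-1})$ at $t\in(S_{2m-1},S_{2m}]$, except that on $1\le t\le S_1$ one uses $z_0(t)$ if $t\le t_0$ and $\Xi_1(t-t_0)$ if $t>t_0$. Stop at $\widetilde T=S_{2N}$, $N=\inf\{m\ge1:\Gamma_{S_{2m}}\ge b_2\}$. *)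

theory Defs
  imports "HOL-Probability.Probability"
begin

section \<open>Densities and information numbers\<close>

definition is_density :: "'y measure \<Rightarrow> ('y \<Rightarrow> real) \<Rightarrow> bool" where
  "is_density \<mu> p \<longleftrightarrow>
     p \<in> borel_measurable \<mu> \<and> (\<forall>y. 0 \<le> p y) \<and> (\<integral>\<^sup>+ y. ennreal (p y) \<partial>\<mu>) = 1"

text \<open>\<open>I\<^sub>x = kl_number \<mu> (g x) (f x)\<close> and \<open>J\<^sub>x = kl_number \<mu> (f x) (g x)\<close>; the numbers
  \<open>V\<close> are \<open>llr_variance\<close> with the same arguments.\<close>

definition kl_number :: "'y measure \<Rightarrow> ('y \<Rightarrow> real) \<Rightarrow> ('y \<Rightarrow> real) \<Rightarrow> real" where
  "kl_number \<mu> p q = (\<integral>y. ln (p y / q y) * p y \<partial>\<mu>)"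

text \<open>The log-likelihood ratio is \<open>\<infinity>\<close> where \<open>p > 0 = q\<close>, which \<^term>\<open>ln (p y / q y)\<close> does not
  express; the case distinction does. If \<open>q > 0\<close> almost everywhere on \<open>{p > 0}\<close> but the integral
  defining \<^const>\<open>kl_number\<close> does not exist (so that its value is \<open>0\<close> by convention), the integral
  below is \<open>\<infinity>\<close>. Hence finiteness of \<open>llr_variance\<close> entails that \<open>p\<close> is absolutely continuous with
  respect to \<open>q\<close> and that \<^const>\<open>kl_number\<close> is a genuine, finite integral.\<close>

definition llr_variance :: "'y measure \<Rightarrow> ('y \<Rightarrow> real) \<Rightarrow> ('y \<Rightarrow> real) \<Rightarrow> ennreal" where
  "llr_variance \<mu> p q =
     (\<integral>\<^sup>+ y. (if q y = 0 then \<infinity> else ennreal ((ln (p y / q y) - kl_number \<mu> p q)\<^sup>2)) * ennreal (p y) \<partial>\<mu>)"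

section \<open>The controlled change-point model\<close>

text \<open>Everything lives on the path space: at time \<open>t\<close> a path records the pair \<open>(L\<^sub>t, Y\<^sub>t)\<close>. There
  is no response at time \<open>0\<close>; the second component at time \<open>0\<close> is a dummy.\<close>

type_synonym 'y path = "nat \<Rightarrow> bool \<times> 'y"

definition latent :: "nat \<Rightarrow> 'y path \<Rightarrow> bool" where
  "latent t \<omega> = fst (\<omega> t)"

definition response :: "nat \<Rightarrow> 'y path \<Rightarrow> 'y" where
  "response t \<omega> = snd (\<omega> t)"

definition change_point :: "'y path \<Rightarrow> enat" where
  "change_point \<omega> = Inf (enat ` {t. latent t \<omega>})"

definition obs_filtration :: "(nat \<Rightarrow> 'y::topological_space path \<Rightarrow> nat) \<Rightarrow> nat \<Rightarrow> 'y path measure" where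
  "obs_filtration X t = sigma UNIV
     (\<Union>s\<in>{1..t}. range (\<lambda>A. X s -` A) \<union> (\<lambda>B. response s -` B) ` sets borel)"

text \<open>An assignment rule is given by the treatment process it generates. Being a measurable function
  of the treatments and responses up to time \<open>t - 1\<close> is measurability with respect to the
  \<open>\<sigma>\<close>-algebra they generate; for \<open>t = 1\<close> this \<open>\<sigma>\<close>-algebra is trivial, so \<open>X 1\<close> is constant.
  \<open>X 0\<close> plays no role.\<close>

definition assignment_rule :: "nat \<Rightarrow> (nat \<Rightarrow> 'y::topological_space path \<Rightarrow> nat) \<Rightarrow> bool" where
  "assignment_rule K X \<longleftrightarrow>
     (\<forall>t\<ge>1. X t \<in> measurable (obs_filtration X (t - 1)) (count_space {1..K}))"

text \<open>A link function \<open>\<pi>\<close> maps \<open>[x\<^sub>1, \<dots>, x\<^sub>t]\<close> to \<open>\<pi>\<^sub>t(x\<^sub>1, \<dots>, x\<^sub>t)\<close>; its value at \<open>[]\<close>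
  is the prior probability \<open>\<pi>\<^sub>0\<close>.\<close>

definition change_prob ::
  "(nat list \<Rightarrow> real) \<Rightarrow> (nat \<Rightarrow> 'y path \<Rightarrow> nat) \<Rightarrow> nat \<Rightarrow> 'y path \<Rightarrow> real" where
  "change_prob \<pi> X t \<omega> =
     (if latent (t - 1) \<omega> then 1 else \<pi> (map (\<lambda>s. X s \<omega>) [1..<Suc t]))"

definition step_space :: "(bool \<times> 'y::topological_space) measure" where
  "step_space = count_space UNIV \<Otimes>\<^sub>M borel"

text \<open>Conditional law of \<open>(L\<^sub>t, Y\<^sub>t)\<close> given the path up to time \<open>t - 1\<close>, for \<open>t \<ge> 1\<close> as a density
  with respect to the product of the counting measure and \<open>\<mu>\<close>: first \<open>L\<^sub>t\<close> is drawn, then \<open>Y\<^sub>t\<close>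
  from \<open>f\<close> or \<open>g\<close>. Since \<open>X t\<close> is predictable, its value at a path does not depend on the
  coordinates from \<open>t\<close> on.\<close>

definition step_kernel ::
  "'y::topological_space measure \<Rightarrow> (nat \<Rightarrow> 'y \<Rightarrow> real) \<Rightarrow> (nat \<Rightarrow> 'y \<Rightarrow> real) \<Rightarrow> (nat list \<Rightarrow> real)
     \<Rightarrow> (nat \<Rightarrow> 'y path \<Rightarrow> nat) \<Rightarrow> nat \<Rightarrow> 'y path \<Rightarrow> (bool \<times> 'y) measure" where
  "step_kernel \<mu> f g \<pi> X t \<omega> =
     (if t = 0 then distr (measure_pmf (bernoulli_pmf (\<pi> []))) step_space (\<lambda>l. (l, undefined))
      else density (count_space UNIV \<Otimes>\<^sub>M \<mu>)
        (\<lambda>(l, y). ennreal (if l then change_prob \<pi> X t \<omega> * g (X t \<omega>) y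
                           else (1 - change_prob \<pi> X t \<omega>) * f (X t \<omega>) y)))"

definition path_law ::
  "'y::topological_space measure \<Rightarrow> (nat \<Rightarrow> 'y \<Rightarrow> real) \<Rightarrow> (nat \<Rightarrow> 'y \<Rightarrow> real) \<Rightarrow> (nat list \<Rightarrow> real)
     \<Rightarrow> (nat \<Rightarrow> 'y path \<Rightarrow> nat) \<Rightarrow> 'y path measure" where
  "path_law \<mu> f g \<pi> X =
     projective_family.lim UNIV
       (Ionescu_Tulcea.CI (step_kernel \<mu> f g \<pi> X) (\<lambda>_. step_space)) (\<lambda>_. step_space)"

text \<open>For an assignment rule the kernels satisfy the hypotheses of the Ionescu-Tulcea theorem, so
  \<^const>\<open>path_law\<close> is the unique law on paths with these conditional distributions.\<close>

lemma measurable_obs_filtration_restr: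
  fixes X :: "nat \<Rightarrow> 'y::polish_space path \<Rightarrow> nat"
  assumes X: "assignment_rule K X"
  shows "n < t \<Longrightarrow> (\<lambda>h. h) \<in> measurable (PiM {0..<t} (\<lambda>_. step_space)) (obs_filtration X n)"
proof (induction n rule: less_induct)
  case (less n)
  let ?P = "PiM {0..<t} (\<lambda>_. step_space :: (bool \<times> 'y) measure)"
  show ?case unfolding obs_filtration_def
  proof (rule measurable_measure_of)
    fix A assume "A \<in> (\<Union>s\<in>{1..n}. range (\<lambda>A. X s -` A) \<union> (\<lambda>B. response s -` B) ` sets borel)"
    then obtain s where s: "1 \<le> s" "s \<le> n"
      and A: "(\<exists>C. A = X s -` C) \<or> (\<exists>B\<in>sets borel. A = response s -` B)" by fastforce
    from A show "(\<lambda>h. h) -` A \<inter> space ?P \<in> sets ?P"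
    proof
      assume "\<exists>C. A = X s -` C"
      then obtain C where C: "A = X s -` C" by auto
      have "(\<lambda>h. h) \<in> measurable ?P (obs_filtration X (s - 1))"
        using less s by auto
      moreover have "X s \<in> measurable (obs_filtration X (s - 1)) (count_space {1..K})"
        using X s by (auto simp: assignment_rule_def)
      ultimately have m: "(\<lambda>h. X s h) \<in> measurable ?P (count_space {1..K})"
        by (rule measurable_compose)
      have "(\<lambda>h. h) -` A \<inter> space ?P = (\<lambda>h. X s h) -` (C \<inter> {1..K}) \<inter> space ?P"
        using measurable_space[OF m] C by auto
      also have "\<dots> \<in> sets ?P" by (rule measurable_sets[OF m]) auto
      finally show ?thesis .
    next
      assume "\<exists>B\<in>sets borel. A = response s -` B"
      then obtain B where B: "B \<in> sets borel" "A = response s -` B" by auto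
      have hs: "(\<lambda>h. h s) \<in> measurable ?P step_space"
        by (rule measurable_component_singleton) (use s less in auto)
      have m: "(\<lambda>h. snd (h s)) \<in> measurable ?P borel"
        by (rule measurable_compose[OF hs]) (simp add: step_space_def)
      have "(\<lambda>h. h) -` A \<inter> space ?P = (\<lambda>h. snd (h s)) -` B \<inter> space ?P"
        using B by (auto simp: response_def)
      then show ?thesis using measurable_sets[OF m B(1)] by simp
    qed
  qed auto
qed

lemma Ionescu_Tulcea_step_kernel:
  fixes \<mu> :: "'y::polish_space measure"
  assumes \<mu>: "sigma_finite_measure \<mu>" and sets_\<mu>: "sets \<mu> = sets borel"
    and f: "\<And>x. x \<in> {1..K} \<Longrightarrow> is_density \<mu> (f x)"
    and g: "\<And>x. x \<in> {1..K} \<Longrightarrow> is_density \<mu> (g x)"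
    and \<pi>: "\<And>z. z \<in> lists {1..K} \<Longrightarrow> 0 \<le> \<pi> z \<and> \<pi> z \<le> 1"
    and X: "assignment_rule K X"
  shows "Ionescu_Tulcea (step_kernel \<mu> f g \<pi> X) (\<lambda>_. step_space)"
proof -
  let ?P = "\<lambda>t. PiM {0..<t} (\<lambda>_. step_space :: (bool \<times> 'y) measure)"
  let ?N = "count_space (UNIV :: bool set) \<Otimes>\<^sub>M \<mu>"
  interpret sigma_finite_measure \<mu> by (rule \<mu>)
  have sets_N: "sets ?N = sets step_space"
    unfolding step_space_def by (rule sets_pair_measure_cong) (auto simp: sets_\<mu>)
  have X_meas: "(\<lambda>h. X s h) \<in> measurable (?P t) (count_space {1..K})" if "1 \<le> s" "s \<le> t" for s t
  proof -
    have 1: "(\<lambda>h. h) \<in> measurable (?P t) (obs_filtration X (s - 1))"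
      by (rule measurable_obs_filtration_restr[OF X]) (use that in auto)
    have 2: "X s \<in> measurable (obs_filtration X (s - 1)) (count_space {1..K})"
      using X that by (auto simp: assignment_rule_def)
    show ?thesis using measurable_compose[OF 1 2] .
  qed
  have X_meas': "(\<lambda>h. X s h) \<in> measurable (?P t) (count_space UNIV)" if "1 \<le> s" "s \<le> t" for s t
    using X_meas[OF that] by (rule measurable_compose) auto
  have X_in: "X s h \<in> {1..K}" if "1 \<le> s" "s \<le> t" "h \<in> space (?P t)" for s t h
    using measurable_space[OF X_meas[OF that(1,2)] that(3)] by simp
  have map_meas: "(\<lambda>h. map (\<lambda>s. X s h) ss) \<in> measurable (?P t) (count_space UNIV)"
    if "set ss \<subseteq> {1..t}" for ss t
    using that
  proof (induction ss)
    case (Cons s ss)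
    have IH: "(\<lambda>h. map (\<lambda>s. X s h) ss) \<in> measurable (?P t) (count_space UNIV)"
      using Cons by simp
    have 1: "(\<lambda>h. x # map (\<lambda>s. X s h) ss) \<in> measurable (?P t) (count_space UNIV)" for x
      by (rule measurable_compose[OF IH]) simp
    have 2: "(\<lambda>h. X s h) \<in> measurable (?P t) (count_space UNIV)"
      using Cons.prems X_meas'[of s t] by simp
    have "(\<lambda>h. X s h # map (\<lambda>s. X s h) ss) \<in> measurable (?P t) (count_space UNIV)"
      by (rule measurable_compose_countable[OF 1 2])
    then show ?case by simp
  qed auto
  have cp_meas: "(\<lambda>h. change_prob \<pi> X t h) \<in> borel_measurable (?P t)" if "1 \<le> t" for t
  proof -
    have ht: "(\<lambda>h. h (t - 1)) \<in> measurable (?P t) step_space"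
      by (rule measurable_component_singleton) (use that in auto)
    have [measurable]: "(\<lambda>h. fst (h (t - 1))) \<in> measurable (?P t) (count_space UNIV)"
      by (rule measurable_compose[OF ht]) (simp add: step_space_def)
    have [measurable]: "(\<lambda>h. \<pi> (map (\<lambda>s. X s h) [1..<Suc t])) \<in> borel_measurable (?P t)"
      by (rule measurable_compose[OF map_meas]) auto
    show ?thesis unfolding change_prob_def latent_def by measurable
  qed
  have cp_range: "0 \<le> change_prob \<pi> X t h \<and> change_prob \<pi> X t h \<le> 1"
    if "h \<in> space (?P t)" for t h
    using that X_in[of _ t h] by (auto simp: change_prob_def intro!: \<pi> simp del: upt_Suc)
  define G where "G d (l::bool) A x = (\<integral>\<^sup>+ y. ennreal (d x y) * indicator A (l, y) \<partial>\<mu>)"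
    for d :: "nat \<Rightarrow> 'y \<Rightarrow> real" and l A x
  have f_meas: "(\<lambda>y. f x y) \<in> borel_measurable \<mu>"
    and g_meas: "(\<lambda>y. g x y) \<in> borel_measurable \<mu>" if "x \<in> {1..K}" for x
    using f[OF that] g[OF that] by (auto simp: is_density_def)
  have kernel_eq: "emeasure (step_kernel \<mu> f g \<pi> X t h) A =
      ennreal (change_prob \<pi> X t h) * G g True A (X t h) + ennreal (1 - change_prob \<pi> X t h) * G f False A (X t h)"
    if t: "1 \<le> t" and h: "h \<in> space (?P t)" and A: "A \<in> sets step_space" for t h A
  proof -
    have x: "X t h \<in> {1..K}" using X_in t h by auto
    note [measurable] = f_meas[OF x] g_meas[OF x]
    have [measurable]: "A \<in> sets ?N" using A sets_N by simp
    let ?d = "\<lambda>(l, y). ennreal (if l then change_prob \<pi> X t h * g (X t h) y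
                           else (1 - change_prob \<pi> X t h) * f (X t h) y)"
    have d [measurable]: "?d \<in> borel_measurable ?N"
      unfolding split_beta' by measurable
    have "emeasure (step_kernel \<mu> f g \<pi> X t h) A = (\<integral>\<^sup>+ z. ?d z * indicator A z \<partial>?N)"
      using t by (simp add: step_kernel_def emeasure_density)
    also have "\<dots> = (\<integral>\<^sup>+ l. (\<integral>\<^sup>+ y. ?d (l, y) * indicator A (l, y) \<partial>\<mu>) \<partial>count_space UNIV)"
      by (subst nn_integral_fst[symmetric]) auto
    also have "\<dots> = (\<integral>\<^sup>+ y. ?d (True, y) * indicator A (True, y) \<partial>\<mu>)
        + (\<integral>\<^sup>+ y. ?d (False, y) * indicator A (False, y) \<partial>\<mu>)"
      by (simp add: nn_integral_count_space_finite UNIV_bool add.commute)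
    also have "(\<integral>\<^sup>+ y. ?d (True, y) * indicator A (True, y) \<partial>\<mu>)
        = ennreal (change_prob \<pi> X t h) * G g True A (X t h)"
      using cp_range[OF h] unfolding G_def
      by (subst nn_integral_cmult[symmetric]) (auto simp: ennreal_mult' mult.assoc)
    also have "(\<integral>\<^sup>+ y. ?d (False, y) * indicator A (False, y) \<partial>\<mu>)
        = ennreal (1 - change_prob \<pi> X t h) * G f False A (X t h)"
      using cp_range[OF h] unfolding G_def
      by (subst nn_integral_cmult[symmetric]) (auto simp: ennreal_mult' mult.assoc)
    finally show ?thesis .
  qed
  have sets_K: "sets (step_kernel \<mu> f g \<pi> X t h) = sets step_space" for t h
    by (simp add: step_kernel_def sets_N)
  have space_K: "space (step_kernel \<mu> f g \<pi> X t h) = UNIV" for t h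
    using sets_eq_imp_space_eq[OF sets_K[of t h]] by (simp add: step_space_def space_pair_measure)
  have prob: "prob_space (step_kernel \<mu> f g \<pi> X t h)" if h: "h \<in> space (?P t)" for t h
  proof (cases "t = 0")
    case True
    have "prob_space (distr (measure_pmf (bernoulli_pmf (\<pi> []))) step_space (\<lambda>l. (l, undefined :: 'y)))"
      by (rule measure_pmf.prob_space_distr) (simp add: step_space_def space_pair_measure)
    then show ?thesis using True by (simp add: step_kernel_def)
  next
    case False
    then have t: "1 \<le> t" by simp
    have x: "X t h \<in> {1..K}" using X_in t h by auto
    have "UNIV \<in> sets (step_space :: (bool \<times> 'y) measure)"
      using sets.top[of "step_kernel \<mu> f g \<pi> X t h"] sets_K space_K by simp
    moreover have "G g True UNIV (X t h) = 1" "G f False UNIV (X t h) = 1"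
      using f[OF x] g[OF x] by (auto simp: G_def is_density_def)
    ultimately have "emeasure (step_kernel \<mu> f g \<pi> X t h) UNIV = 1"
      using t h cp_range[OF h] by (simp add: kernel_eq flip: ennreal_plus)
    then show ?thesis
      by (intro prob_spaceI) (simp add: space_K)
  qed
  have meas: "step_kernel \<mu> f g \<pi> X t \<in> measurable (?P t) (subprob_algebra step_space)" for t
  proof (rule measurable_subprob_algebra)
    show "subprob_space (step_kernel \<mu> f g \<pi> X t h)" if "h \<in> space (?P t)" for h
      using prob[OF that] by (rule prob_space_imp_subprob_space)
    show "sets (step_kernel \<mu> f g \<pi> X t h) = sets step_space" for h
      by (rule sets_K)
    show "(\<lambda>h. emeasure (step_kernel \<mu> f g \<pi> X t h) A) \<in> borel_measurable (?P t)"
      if A: "A \<in> sets step_space" for A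
    proof (cases "t = 0")
      case True
      then show ?thesis by (simp add: step_kernel_def)
    next
      case False
      then have t: "1 \<le> t" by simp
      note [measurable] = cp_meas[OF t]
      have [measurable]: "(\<lambda>h. G d l A (X t h)) \<in> borel_measurable (?P t)" for d l
        by (rule measurable_compose[OF X_meas']) (use t in auto)
      have "(\<lambda>h. ennreal (change_prob \<pi> X t h) * G g True A (X t h)
          + ennreal (1 - change_prob \<pi> X t h) * G f False A (X t h)) \<in> borel_measurable (?P t)"
        by measurable
      then show ?thesis
        by (rule measurable_cong[THEN iffD1, rotated]) (rule kernel_eq[OF t _ A, symmetric])
    qed
  qed
  show ?thesis using meas prob by (rule Ionescu_Tulcea.intro)
qed

text \<open>Every process \<open>\<Gamma>\<close> of \<open>\<F>\<^sub>t\<close>-measurable versions of the posterior odds is admitted. The odds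
  are \<open>\<infinity>\<close> where \<open>P(L\<^sub>t = 0 | \<F>\<^sub>t) = 0\<close>.\<close>

definition posterior_odds ::
  "'y::topological_space path measure \<Rightarrow> (nat \<Rightarrow> 'y path \<Rightarrow> nat) \<Rightarrow> (nat \<Rightarrow> 'y path \<Rightarrow> ereal) \<Rightarrow> bool" where
  "posterior_odds P X \<Gamma> \<longleftrightarrow> (\<forall>t. \<Gamma> t \<in> borel_measurable (obs_filtration X t) \<and>
     (AE \<omega> in P. \<Gamma> t \<omega> =
        ereal (real_cond_exp P (obs_filtration X t) (indicator {\<omega>. latent t \<omega>}) \<omega>)
        / ereal (real_cond_exp P (obs_filtration X t) (indicator {\<omega>. \<not> latent t \<omega>}) \<omega>)))"

definition obs_stopping_time ::
  "(nat \<Rightarrow> 'y::topological_space path \<Rightarrow> nat) \<Rightarrow> ('y path \<Rightarrow> enat) \<Rightarrow> bool" where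
  "obs_stopping_time X T \<longleftrightarrow> (\<forall>t. {\<omega>. T \<omega> \<le> enat t} \<in> sets (obs_filtration X t))"

text \<open>The class \<open>\<C>\<^sub>\<alpha>\<close>.\<close>

definition admissible ::
  "nat \<Rightarrow> 'y::topological_space measure \<Rightarrow> (nat \<Rightarrow> 'y \<Rightarrow> real) \<Rightarrow> (nat \<Rightarrow> 'y \<Rightarrow> real) \<Rightarrow> (nat list \<Rightarrow> real)
     \<Rightarrow> real \<Rightarrow> ((nat \<Rightarrow> 'y path \<Rightarrow> nat) \<times> ('y path \<Rightarrow> enat)) set" where
  "admissible K \<mu> f g \<pi> \<alpha> =
     {(X, T). assignment_rule K X \<and> obs_stopping_time X T \<and>
        measure (path_law \<mu> f g \<pi> X) {\<omega>. T \<omega> < change_point \<omega>} \<le> \<alpha>}"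

definition expected_time :: "'a measure \<Rightarrow> ('a \<Rightarrow> enat) \<Rightarrow> ennreal" where
  "expected_time P T = (\<integral>\<^sup>+ \<omega>. ennreal_of_enat (T \<omega>) \<partial>P)"

definition optimal_time ::
  "nat \<Rightarrow> 'y::topological_space measure \<Rightarrow> (nat \<Rightarrow> 'y \<Rightarrow> real) \<Rightarrow> (nat \<Rightarrow> 'y \<Rightarrow> real) \<Rightarrow> (nat list \<Rightarrow> real)
     \<Rightarrow> real \<Rightarrow> ennreal" where
  "optimal_time K \<mu> f g \<pi> \<alpha> =
     (INF (X, T)\<in>admissible K \<mu> f g \<pi> \<alpha>. expected_time (path_law \<mu> f g \<pi> X) T)"

section \<open>The finite memory model\<close>

text \<open>A state is the list of the last \<open>\<kappa>\<close> treatments, most recent first. Treatment sequences and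
  blocks, in contrast, are listed in chronological order.\<close>

definition states :: "nat \<Rightarrow> nat \<Rightarrow> nat list set" where
  "states \<kappa> K = {s. length s = \<kappa> \<and> set s \<subseteq> {1..K}}"

definition shift :: "nat \<Rightarrow> nat \<Rightarrow> nat list \<Rightarrow> nat list" where
  "shift \<kappa> x s = take \<kappa> (x # s)"

definition state_after :: "nat \<Rightarrow> nat list \<Rightarrow> nat list \<Rightarrow> nat list" where
  "state_after \<kappa> s z = foldl (\<lambda>s x. shift \<kappa> x s) s z"

definition memory_link ::
  "nat \<Rightarrow> (nat \<Rightarrow> nat list \<Rightarrow> real) \<Rightarrow> nat list \<Rightarrow> real \<Rightarrow> nat list \<Rightarrow> real" where
  "memory_link \<kappa> \<Psi> s\<^sub>0 \<pi>\<^sub>0 z =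
     (if z = [] then \<pi>\<^sub>0 else \<Psi> (last z) (state_after \<kappa> s\<^sub>0 (butlast z)))"

section \<open>Blocks\<close>

text \<open>\<open>\<Xi>(j)\<close> for a cyclically extended block; \<open>j\<close> counts from \<open>1\<close> and may be non-positive.\<close>

definition cyc :: "nat list \<Rightarrow> int \<Rightarrow> nat" where
  "cyc \<Xi> j = \<Xi> ! nat ((j - 1) mod int (length \<Xi>))"

definition block_average :: "(nat \<Rightarrow> real) \<Rightarrow> nat list \<Rightarrow> real" where
  "block_average I \<Xi> = (\<Sum>i<length \<Xi>. I (\<Xi> ! i)) / length \<Xi>"

definition survival_rate :: "real \<Rightarrow> real" where
  "survival_rate x = \<bar>ln (1 - x)\<bar>"

definition block_drift :: "nat \<Rightarrow> (nat \<Rightarrow> nat list \<Rightarrow> real) \<Rightarrow> nat list \<Rightarrow> real" where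
  "block_drift \<kappa> \<Psi> \<Xi> =
     (\<Sum>j=1..length \<Xi>. survival_rate (\<Psi> (cyc \<Xi> (int j)) (map (\<lambda>i. cyc \<Xi> (int j - int i)) [1..<Suc \<kappa>])))
       / length \<Xi>"

text \<open>\<open>\<lambda>~(\<Xi>)\<close>; it is \<open>\<infinity>\<close> if the change may never occur under the block.\<close>

definition worst_mean_change :: "nat \<Rightarrow> (nat list \<Rightarrow> real) \<Rightarrow> nat list \<Rightarrow> ereal" where
  "worst_mean_change K \<pi> \<Xi> = (SUP z\<in>lists {1..K}.
     1 + (\<Sum>t. ereal (\<Prod>s=1..Suc t. 1 - \<pi> (z @ map (\<lambda>i. cyc \<Xi> (int i)) [1..<Suc s]))))"

section \<open>Optimal blocks\<close>

definition mean_change_value :: "nat \<Rightarrow> nat \<Rightarrow> (nat \<Rightarrow> nat list \<Rightarrow> real) \<Rightarrow> nat list \<Rightarrow> ereal" where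
  "mean_change_value \<kappa> K \<Psi> s = (INF x\<in>{x :: nat \<Rightarrow> nat. \<forall>t\<ge>1. x t \<in> {1..K}}.
     \<Sum>t. ereal (\<Prod>r=1..Suc t. 1 - \<Psi> (x r) (state_after \<kappa> s (map x [1..<r]))))"

definition policy_state :: "nat \<Rightarrow> (nat list \<Rightarrow> nat) \<Rightarrow> nat list \<Rightarrow> nat \<Rightarrow> nat list" where
  "policy_state \<kappa> \<upsilon> s\<^sub>0 t = ((\<lambda>s. shift \<kappa> (\<upsilon> s) s) ^^ t) s\<^sub>0"

definition policy_treatment :: "nat \<Rightarrow> (nat list \<Rightarrow> nat) \<Rightarrow> nat list \<Rightarrow> nat \<Rightarrow> nat" where
  "policy_treatment \<kappa> \<upsilon> s\<^sub>0 t = \<upsilon> (policy_state \<kappa> \<upsilon> s\<^sub>0 (t - 1))"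

definition first_return :: "nat \<Rightarrow> (nat list \<Rightarrow> nat) \<Rightarrow> nat list \<Rightarrow> nat" where
  "first_return \<kappa> \<upsilon> s\<^sub>0 =
     (LEAST u. 1 \<le> u \<and> (\<exists>l<u. policy_state \<kappa> \<upsilon> s\<^sub>0 u = policy_state \<kappa> \<upsilon> s\<^sub>0 l))"

definition cycle_start :: "nat \<Rightarrow> (nat list \<Rightarrow> nat) \<Rightarrow> nat list \<Rightarrow> nat" where
  "cycle_start \<kappa> \<upsilon> s\<^sub>0 = (THE l. l < first_return \<kappa> \<upsilon> s\<^sub>0 \<and>
     policy_state \<kappa> \<upsilon> s\<^sub>0 l = policy_state \<kappa> \<upsilon> s\<^sub>0 (first_return \<kappa> \<upsilon> s\<^sub>0))"

definition policy_prefix :: "nat \<Rightarrow> (nat list \<Rightarrow> nat) \<Rightarrow> nat list \<Rightarrow> nat list" where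
  "policy_prefix \<kappa> \<upsilon> s\<^sub>0 =
     map (policy_treatment \<kappa> \<upsilon> s\<^sub>0) [1..<Suc (cycle_start \<kappa> \<upsilon> s\<^sub>0)]"

definition policy_block :: "nat \<Rightarrow> (nat list \<Rightarrow> nat) \<Rightarrow> nat list \<Rightarrow> nat list" where
  "policy_block \<kappa> \<upsilon> s\<^sub>0 =
     map (policy_treatment \<kappa> \<upsilon> s\<^sub>0) [Suc (cycle_start \<kappa> \<upsilon> s\<^sub>0)..<Suc (first_return \<kappa> \<upsilon> s\<^sub>0)]"

section \<open>The proposed procedure\<close>

definition odds_crossing :: "(nat \<Rightarrow> ereal) \<Rightarrow> ereal \<Rightarrow> nat \<Rightarrow> enat" where
  "odds_crossing \<Gamma> b t = Inf (enat ` {s. b \<le> \<Gamma> (t + s)})"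

definition lr_crossing :: "(nat \<Rightarrow> real) \<Rightarrow> ereal \<Rightarrow> nat \<Rightarrow> enat" where
  "lr_crossing \<Lambda> d t = Inf (enat ` {s. 1 \<le> s \<and> ereal (\<Prod>j=1..s. \<Lambda> (t + j)) \<le> 1 / d})"

text \<open>The switching times \<open>S\<^sub>n\<close>; an odd \<open>n\<close> ends an acceleration stage.\<close>

primrec switch_time ::
  "(nat \<Rightarrow> ereal) \<Rightarrow> (nat \<Rightarrow> real) \<Rightarrow> ereal \<Rightarrow> ereal \<Rightarrow> ereal \<Rightarrow> nat \<Rightarrow> enat" where
  "switch_time \<Gamma> \<Lambda> b1 b2 d 0 = 0"
| "switch_time \<Gamma> \<Lambda> b1 b2 d (Suc n) =
     (case switch_time \<Gamma> \<Lambda> b1 b2 d n of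
        \<infinity> \<Rightarrow> \<infinity>
      | enat t \<Rightarrow> enat t + (if even n then odds_crossing \<Gamma> b1 t
                             else min (odds_crossing \<Gamma> b2 t) (lr_crossing \<Lambda> d t)))"

text \<open>In the first case \<open>n\<close> is the index with \<open>S\<^sub>n < t \<le> S\<^bsub>n+1\<^esub>\<close>. The second case concerns only
  times after the procedure has stopped, where the treatments are immaterial.\<close>

definition treatment :: "nat list \<Rightarrow> nat list \<Rightarrow> nat list \<Rightarrow> (nat \<Rightarrow> enat) \<Rightarrow> nat \<Rightarrow> nat" where
  "treatment z\<^sub>0 \<Xi>\<^sub>1 \<Xi>\<^sub>2 S t =
     (if \<exists>n. enat t \<le> S (Suc n)
      then let n = (LEAST n. enat t \<le> S (Suc n))
        in if n = 0 then (if t \<le> length z\<^sub>0 then z\<^sub>0 ! (t - 1) else cyc \<Xi>\<^sub>1 (int t - int (length z\<^sub>0)))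
           else if even n then cyc \<Xi>\<^sub>1 (int t - int (the_enat (S n)))
           else cyc \<Xi>\<^sub>2 (int t - int (the_enat (S n)))
      else cyc \<Xi>\<^sub>1 (int t))"

definition procedure_time :: "(nat \<Rightarrow> ereal) \<Rightarrow> ereal \<Rightarrow> (nat \<Rightarrow> enat) \<Rightarrow> enat" where
  "procedure_time \<Gamma> b2 S =
     (let stop = (\<lambda>m. 1 \<le> m \<and> (\<exists>t. S (2 * m) = enat t \<and> b2 \<le> \<Gamma> t))
      in if \<exists>m. stop m then S (2 * (LEAST m. stop m)) else \<infinity>)"

text \<open>The posterior odds driving the procedure are those under the law induced by the treatments
  it selects; the circularity is harmless because \<open>\<Gamma> t\<close> involves only the treatments up to \<open>t\<close>,
  and \<open>X t\<close> only \<open>\<Gamma> 0, \<dots>, \<Gamma> (t - 1)\<close>.\<close>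

definition proposed_procedure ::
  "'y::topological_space measure \<Rightarrow> (nat \<Rightarrow> 'y \<Rightarrow> real) \<Rightarrow> (nat \<Rightarrow> 'y \<Rightarrow> real) \<Rightarrow> (nat list \<Rightarrow> real)
     \<Rightarrow> nat list \<Rightarrow> nat list \<Rightarrow> nat list \<Rightarrow> ereal \<Rightarrow> ereal \<Rightarrow> ereal
     \<Rightarrow> (nat \<Rightarrow> 'y path \<Rightarrow> nat) \<Rightarrow> ('y path \<Rightarrow> enat) \<Rightarrow> bool" where
  "proposed_procedure \<mu> f g \<pi> z\<^sub>0 \<Xi>\<^sub>1 \<Xi>\<^sub>2 b1 b2 d X T \<longleftrightarrow>
     (\<exists>\<Gamma> \<Lambda> S. posterior_odds (path_law \<mu> f g \<pi> X) X \<Gamma> \<and>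
        (\<forall>t \<omega>. \<Lambda> t \<omega> = g (X t \<omega>) (response t \<omega>) / f (X t \<omega>) (response t \<omega>)) \<and>
        (\<forall>n \<omega>. S n \<omega> = switch_time (\<lambda>t. \<Gamma> t \<omega>) (\<lambda>t. \<Lambda> t \<omega>) b1 b2 d n) \<and>
        (\<forall>t\<ge>1. \<forall>\<omega>. X t \<omega> = treatment z\<^sub>0 \<Xi>\<^sub>1 \<Xi>\<^sub>2 (\<lambda>n. S n \<omega>) t) \<and>
        (\<forall>\<omega>. T \<omega> = procedure_time (\<lambda>t. \<Gamma> t \<omega>) b2 (\<lambda>n. S n \<omega>)))"

section \<open>Asymptotic equivalence of expected times\<close>

text \<open>If under every assignment rule the change fails to occur with positive probability, all
  procedures with small error probability have infinite expectation. The ratio \<open>\<infinity>/\<infinity>\<close>, which is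
  \<open>0\<close> in \<^typ>\<open>ennreal\<close>, is therefore read as \<open>1\<close>.\<close>

definition time_ratio :: "ennreal \<Rightarrow> ennreal \<Rightarrow> ennreal" where
  "time_ratio a b = (if a = \<infinity> \<and> b = \<infinity> then 1 else a / b)"

end

theory Submission
  imports Defs
begin

text \<open>Let \<open>G\<close> denote the posterior odds. For the lower bound, \<open>ln (1 + G)\<close>, corrected by the value function \<open>h'\<close> of
  the Bellman equation, gains on average at most \<open>\<lambda>'\<close> per step once the change has occurred and nothing before it, while
  a false alarm probability of at most \<open>\<alpha>\<close> forces it to be about \<open>ln (1 / \<alpha>)\<close> on average at the stopping time. So
  every admissible procedure needs on average \<open>ln (1 / \<alpha>) / \<lambda>'\<close> steps after the change, which itself takes at least
  \<open>V\<^sup>*\<close> steps. For the upper bound, a Lyapunov function adapted to the stage of the procedure and built from truncated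
  log-likelihood ratios shows that the proposed procedure exceeds this bound only by a fraction \<open>O(\<epsilon>)\<close> of it and an
  amount logarithmic in it, uniformly in the link function: \<open>b1\<close> and \<open>d\<close> balance the cost of false starts and of
  false returns against the smaller drift of the acceleration block. If the change probability vanishes identically,
  all admissible procedures have infinite expectation for small \<open>\<alpha>\<close>.\<close>

section \<open>The controlled model\<close>

text \<open>Conditional expectations serve only to identify the given posterior odds with the
  recursion \<open>odds\<close>. The rest consists of inequalities between \<open>ennreal\<close>
  integrals, propagated by integrating out one coordinate at a time; finite telescoping replaces
  optional stopping. In the upper bound no pathwise inequality survives an entry into detection
  before the change, where the Lyapunov function may jump up by \<open>C00\<close>. But the entry is
  an observable event with odds at least \<open>B1\<close>, on which the change is missing with
  probability at most 1 / (1 + \<open>B1\<close>), so the average price \<open>c0\<close> can be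
  paid in advance. The restart price \<open>R\<close> occurs in the constants that it has to
  dominate; this is harmless because it comes back divided by 1 + \<open>B1\<close> or by
  \<open>dd\<close>. The other obstacle is uniformity: the largest change probability p may tend to
  0, and then the mean time to the change is unbounded. Their product is at most \<kappa> + 1, so an
  error of order p per step before the change remains bounded in total. The lower bound uses ln (1 +
  G), not ln G, since it is nonnegative and its increment, apart from - ln (1 - q), is the logarithm
  of a mixture of 1 and the likelihood ratio.\<close>

definition hist :: "nat \<Rightarrow> 'y::topological_space path measure" where
  "hist t = vimage_algebra UNIV (\<lambda>\<omega>. restrict \<omega> {0..<Suc t}) (PiM {0..<Suc t} (\<lambda>_. step_space))"

section \<open>The sigma-algebras of the first coordinates, latent states included\<close>

lemma space_step_space [simp]: "space step_space = UNIV"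
  by (simp add: step_space_def space_pair_measure)

lemma space_PiM_step_space [simp]: "space (PiM UNIV (\<lambda>_. step_space)) = UNIV"
  by (auto simp: space_PiM)

lemma space_hist [simp]: "space (hist t) = UNIV"
  by (simp add: hist_def)

lemma measurable_hist_restrict:
  "(\<lambda>\<omega>. restrict \<omega> {0..<Suc t}) \<in> measurable (hist t) (PiM {0..<Suc t} (\<lambda>_. step_space))"
  unfolding hist_def by (rule measurable_vimage_algebra1) (auto simp: space_PiM)

lemma measurable_hist_coord: "i \<le> t \<Longrightarrow> (\<lambda>\<omega>. \<omega> i) \<in> measurable (hist t) step_space"
proof -
  assume "i \<le> t"
  then have "(\<lambda>\<omega>. (restrict \<omega> {0..<Suc t}) i) \<in> measurable (hist t) step_space"
    by (intro measurable_compose[OF measurable_hist_restrict] measurable_component_singleton) auto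
  with \<open>i \<le> t\<close> show ?thesis by simp
qed

lemma measurable_latent: "i \<le> t \<Longrightarrow> latent i \<in> measurable (hist t) (count_space UNIV)"
  unfolding latent_def[abs_def]
  by (rule measurable_compose[OF measurable_hist_coord]) (auto simp: step_space_def)

lemma measurable_response: "i \<le> t \<Longrightarrow> response i \<in> measurable (hist t) borel"
  unfolding response_def[abs_def]
  by (rule measurable_compose[OF measurable_hist_coord]) (auto simp: step_space_def)

lemma measurable_into_hist:
  assumes "\<And>i. i \<le> t \<Longrightarrow> (\<lambda>x. F x i) \<in> measurable M step_space"
  shows "F \<in> measurable M (hist t)"
  unfolding hist_def
proof (rule measurable_vimage_algebra2)
  show "(\<lambda>x. restrict (F x) {0..<Suc t}) \<in> M \<rightarrow>\<^sub>M PiM {0..<Suc t} (\<lambda>_. step_space)"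
    by (rule measurable_restrict) (use assms in auto)
qed auto

lemma measurable_hist_mono:
  assumes "f \<in> measurable (hist s) N" "s \<le> t" shows "f \<in> measurable (hist t) N"
proof -
  have "(\<lambda>\<omega>. \<omega>) \<in> measurable (hist t) (hist s)"
    by (rule measurable_into_hist) (use assms(2) in \<open>auto intro!: measurable_hist_coord\<close>)
  from measurable_compose[OF this assms(1)] show ?thesis by simp
qed

lemma measurable_hist_PiM:
  assumes "f \<in> measurable (hist t) N" shows "f \<in> measurable (PiM UNIV (\<lambda>_. step_space)) N"
proof -
  have "(\<lambda>\<omega>. \<omega>) \<in> measurable (PiM UNIV (\<lambda>_. step_space)) (hist t)"
    by (rule measurable_into_hist) (auto intro!: measurable_component_singleton)
  from measurable_compose[OF this assms] show ?thesis by simp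
qed

text \<open>The finite-dimensional laws of the Ionescu-Tulcea construction live on extensional
  functions. These are ordinary paths, so a function on the full path space can be integrated there
  unchanged.\<close>

lemma measurable_hist_initial:
  assumes "f \<in> measurable (hist t) N" shows "f \<in> measurable (PiM {0..<Suc t} (\<lambda>_. step_space)) N"
proof -
  have "(\<lambda>\<omega>. \<omega>) \<in> measurable (PiM {0..<Suc t} (\<lambda>_. step_space)) (hist t)"
    by (rule measurable_into_hist) (auto intro!: measurable_component_singleton)
  from measurable_compose[OF this assms] show ?thesis by simp
qed

text \<open>Each set of \<open>hist t\<close> is a preimage under the restriction to the coordinates
  up to t, hence cannot separate paths with the same restriction.\<close>

lemma hist_sets_cong:
  assumes "A \<in> sets (hist t)" "\<And>i. i \<le> t \<Longrightarrow> \<omega> i = \<omega>' i" shows "\<omega> \<in> A \<longleftrightarrow> \<omega>' \<in> A"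
proof -
  have "restrict \<omega> {0..<Suc t} = restrict \<omega>' {0..<Suc t}" using assms(2) by (auto simp: restrict_def)
  moreover obtain B where "A = (\<lambda>\<omega>. restrict \<omega> {0..<Suc t}) -` B"
    using assms(1) unfolding hist_def by (auto simp: sets_vimage_algebra2 space_PiM PiE_def)
  ultimately show ?thesis by simp
qed

text \<open>The preimage of the singleton of a value is a set of \<open>hist t\<close>, so it
  contains both paths or neither.\<close>

lemma hist_cong:
  fixes f :: "'y::topological_space path \<Rightarrow> 'b"
  assumes f: "f \<in> measurable (hist t) N" and N: "\<And>x. x \<in> space N \<Longrightarrow> {x} \<in> sets N"
    and eq: "\<And>i. i \<le> t \<Longrightarrow> \<omega> i = \<omega>' i"
  shows "f \<omega> = f \<omega>'"
proof -
  have "f \<omega>' \<in> space N" using measurable_space[OF f, of \<omega>'] by simp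
  then have "f -` {f \<omega>'} \<in> sets (hist t)" using measurable_sets[OF f N] by simp
  then have "\<omega> \<in> f -` {f \<omega>'} \<longleftrightarrow> \<omega>' \<in> f -` {f \<omega>'}" by (rule hist_sets_cong) (rule eq)
  then show ?thesis by simp
qed

lemma hist_upd:
  assumes "f \<in> measurable (hist t) N" "\<And>x. x \<in> space N \<Longrightarrow> {x} \<in> sets N" "t < n"
  shows "f ((\<omega>)(n := z)) = f \<omega>"
  by (rule hist_cong[OF assms(1,2)]) (use assms(3) in auto)

lemma latent_upd [simp]: "latent i ((\<omega>)(j := z)) = (if i = j then fst z else latent i \<omega>)"
  by (simp add: latent_def)

lemma response_upd [simp]: "response i ((\<omega>)(j := z)) = (if i = j then snd z else response i \<omega>)"
  by (simp add: response_def)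

section \<open>The filtration of treatments and responses\<close>

lemma obs_generators_subset: 
  "(\<Union>s\<in>{1..t}. range (\<lambda>A. X s -` A) \<union> (\<lambda>B. response s -` B) ` sets borel) \<subseteq> Pow UNIV"
  by auto

lemma space_obs_filtration [simp]: "space (obs_filtration X t) = UNIV"
  by (simp add: obs_filtration_def)

lemma measurable_into_obs:
  assumes X: "\<And>s. 1 \<le> s \<Longrightarrow> s \<le> t \<Longrightarrow> (\<lambda>x. X s (F x)) \<in> measurable M (count_space UNIV)"
    and Y: "\<And>s. 1 \<le> s \<Longrightarrow> s \<le> t \<Longrightarrow> (\<lambda>x. response s (F x)) \<in> measurable M borel"
  shows "F \<in> measurable M (obs_filtration X t)"
  unfolding obs_filtration_def
proof (rule measurable_measure_of)
  fix A assume "A \<in> (\<Union>s\<in>{1..t}. range (\<lambda>A. X s -` A) \<union> (\<lambda>B. response s -` B) ` sets borel)"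
  then obtain s where s: "1 \<le> s" "s \<le> t" and "(\<exists>C. A = X s -` C) \<or> (\<exists>B\<in>sets borel. A = response s -` B)"
    by fastforce
  then show "F -` A \<inter> space M \<in> sets M"
  proof (elim disjE exE bexE)
    fix C assume "A = X s -` C"
    then have "F -` A \<inter> space M = (\<lambda>x. X s (F x)) -` C \<inter> space M" by auto
    then show ?thesis using measurable_sets[OF X[OF s], of C] by simp
  next
    fix B assume "B \<in> sets borel" "A = response s -` B"
    then have "F -` A \<inter> space M = (\<lambda>x. response s (F x)) -` B \<inter> space M" by auto
    then show ?thesis using measurable_sets[OF Y[OF s] \<open>B \<in> sets borel\<close>] by simp
  qed
qed (auto simp: space_pair_measure)

lemma obs_mono:
  assumes "f \<in> measurable (obs_filtration X s) N" "s \<le> t" shows "f \<in> measurable (obs_filtration X t) N"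
proof -
  have "sets (obs_filtration X s) \<subseteq> sets (obs_filtration X t)"
    unfolding obs_filtration_def
    unfolding sets_measure_of[OF obs_generators_subset]
    by (intro sigma_sets_mono' UN_mono) (use assms(2) in auto)
  then have "measurable (obs_filtration X s) N \<subseteq> measurable (obs_filtration X t) N"
    by (intro measurable_mono) auto
  with assms(1) show ?thesis by auto
qed

lemma measurable_response_obs: "1 \<le> s \<Longrightarrow> s \<le> t \<Longrightarrow> response s \<in> measurable (obs_filtration X t) borel"
proof (rule measurableI)
  fix A :: "'a set" assume "1 \<le> s" "s \<le> t" "A \<in> sets borel"
  then have "response s -` A \<in> sigma_sets UNIV (\<Union>s\<in>{1..t}. range (\<lambda>A. X s -` A) \<union> (\<lambda>B. response s -` B) ` sets borel)"
    by (intro sigma_sets.Basic UN_I[of s]) auto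
  then show "response s -` A \<inter> space (obs_filtration X t) \<in> sets (obs_filtration X t)"
    unfolding obs_filtration_def by (simp add: sets_measure_of)
qed auto

lemma measurable_treatment_obs:
  "1 \<le> s \<Longrightarrow> s \<le> t \<Longrightarrow> X s \<in> measurable (obs_filtration X t) (count_space UNIV)"
proof (rule measurableI)
  fix A :: "nat set" assume "1 \<le> s" "s \<le> t"
  then have "X s -` A \<in> sigma_sets UNIV (\<Union>s\<in>{1..t}. range (\<lambda>A. X s -` A) \<union> (\<lambda>B. response s -` B) ` sets borel)"
    by (intro sigma_sets.Basic UN_I[of s]) auto
  then show "X s -` A \<inter> space (obs_filtration X t) \<in> sets (obs_filtration X t)"
    unfolding obs_filtration_def by (simp add: sets_measure_of)
qed auto


section \<open>The path law under an assignment rule\<close>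

locale densities =
  fixes K :: nat and \<mu> :: "'y::polish_space measure" and f g :: "nat \<Rightarrow> 'y \<Rightarrow> real"
  assumes K: "2 \<le> K" and sigma_finite: "sigma_finite_measure \<mu>" and sets_\<mu> [measurable_cong]: "sets \<mu> = sets borel"
    and f: "\<And>x. x \<in> {1..K} \<Longrightarrow> is_density \<mu> (f x)" and g: "\<And>x. x \<in> {1..K} \<Longrightarrow> is_density \<mu> (g x)"
begin

sublocale \<mu>: sigma_finite_measure \<mu> by (rule sigma_finite)

lemma f_measurable [measurable (raw)]: "x \<in> {1..K} \<Longrightarrow> f x \<in> borel_measurable borel"
  using f[of x] measurable_cong_sets[OF sets_\<mu> refl] by (auto simp: is_density_def)
lemma g_measurable [measurable (raw)]: "x \<in> {1..K} \<Longrightarrow> g x \<in> borel_measurable borel"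
  using g[of x] measurable_cong_sets[OF sets_\<mu> refl] by (auto simp: is_density_def)
lemma f_nonneg: "x \<in> {1..K} \<Longrightarrow> 0 \<le> f x y" and g_nonneg: "x \<in> {1..K} \<Longrightarrow> 0 \<le> g x y"
  using f g by (auto simp: is_density_def)
lemma nn_integral_f: "x \<in> {1..K} \<Longrightarrow> (\<integral>\<^sup>+ y. ennreal (f x y) \<partial>\<mu>) = 1"
  and nn_integral_g: "x \<in> {1..K} \<Longrightarrow> (\<integral>\<^sup>+ y. ennreal (g x y) \<partial>\<mu>) = 1"
  using f g by (auto simp: is_density_def)

end

locale controlled_model = densities K \<mu> f g for K \<mu> and f g :: "nat \<Rightarrow> 'y::polish_space \<Rightarrow> real" +
  fixes \<pi> :: "nat list \<Rightarrow> real" and X :: "nat \<Rightarrow> 'y path \<Rightarrow> nat"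
  assumes \<pi>: "\<And>z. z \<in> lists {1..K} \<Longrightarrow> 0 \<le> \<pi> z \<and> \<pi> z < 1"
    and X: "assignment_rule K X"
begin

abbreviation "P \<equiv> path_law \<mu> f g \<pi> X"

sublocale IT: Ionescu_Tulcea "step_kernel \<mu> f g \<pi> X" "\<lambda>_. step_space"
  by (rule Ionescu_Tulcea_step_kernel[OF sigma_finite sets_\<mu> f g _ X]) (use \<pi> in fastforce)+

lemma sets_P [measurable_cong]: "sets P = sets (PiM UNIV (\<lambda>_. step_space))"
  by (simp add: path_law_def)

lemma space_P [simp]: "space P = UNIV"
  using sets_eq_imp_space_eq[OF sets_P] by simp

lemma hist_P: "F \<in> measurable (hist t) N \<Longrightarrow> F \<in> measurable P N"
  using measurable_hist_PiM measurable_cong_sets[OF sets_P refl] by blast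

lemma X_obs: "1 \<le> t \<Longrightarrow> X t \<in> measurable (obs_filtration X (t - 1)) (count_space {1..K})"
  using X by (auto simp: assignment_rule_def)

lemma X_obs_UNIV: "1 \<le> t \<Longrightarrow> X t \<in> measurable (obs_filtration X (t - 1)) (count_space UNIV)"
  by (rule measurable_compose[OF X_obs]) auto

lemma X_range: "1 \<le> t \<Longrightarrow> X t \<omega> \<in> {1..K}"
  using measurable_space[OF X_obs, of t \<omega>] by simp

text \<open>Strong induction is used because \<open>obs_filtration X t\<close> is generated by the
  treatments themselves, whose measurability is known only relative to the filtration one step
  earlier.\<close>

lemma id_hist_obs: "(\<lambda>\<omega>. \<omega>) \<in> measurable (hist t) (obs_filtration X t)"
proof (induction t rule: less_induct)
  case (less t)
  show ?case
  proof (rule measurable_into_obs)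
    fix s assume s: "1 \<le> s" "s \<le> t"
    then have "(\<lambda>\<omega>. \<omega>) \<in> measurable (hist (s-1)) (obs_filtration X (s-1))" by (intro less) auto
    from measurable_compose[OF this X_obs_UNIV] s have "X s \<in> measurable (hist (s-1)) (count_space UNIV)" by simp
    then show "X s \<in> measurable (hist t) (count_space UNIV)" by (rule measurable_hist_mono) (use s in auto)
    show "response s \<in> measurable (hist t) borel" using s by (intro measurable_response)
  qed
qed

lemma obs_hist: "F \<in> measurable (obs_filtration X t) N \<Longrightarrow> F \<in> measurable (hist t) N"
  by (rule measurable_compose[OF id_hist_obs])

lemma obs_P: "F \<in> measurable (obs_filtration X t) N \<Longrightarrow> F \<in> measurable P N"
  by (intro hist_P obs_hist)

lemma X_hist: "1 \<le> s \<Longrightarrow> s \<le> Suc t \<Longrightarrow> X s \<in> measurable (hist t) (count_space UNIV)"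
  by (rule measurable_hist_mono[OF obs_hist[OF X_obs_UNIV]]) auto

lemma X_upd: "1 \<le> s \<Longrightarrow> s \<le> n \<Longrightarrow> X s ((\<omega>)(n := z)) = X s \<omega>"
  by (rule hist_upd[OF obs_hist[OF X_obs_UNIV]]) auto

lemma X_list_obs: "set ss \<subseteq> {1..Suc t} \<Longrightarrow>
    (\<lambda>\<omega>. map (\<lambda>s. X s \<omega>) ss) \<in> measurable (obs_filtration X t) (count_space UNIV)"
proof (induction ss)
  case (Cons s ss)
  have IH: "(\<lambda>\<omega>. map (\<lambda>s. X s \<omega>) ss) \<in> measurable (obs_filtration X t) (count_space UNIV)"
    using Cons by simp
  have 1: "(\<lambda>\<omega>. x # map (\<lambda>s. X s \<omega>) ss) \<in> measurable (obs_filtration X t) (count_space UNIV)" for x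
    by (rule measurable_compose[OF IH]) simp
  have 2: "(\<lambda>\<omega>. X s \<omega>) \<in> measurable (obs_filtration X t) (count_space UNIV)"
    by (rule obs_mono[OF X_obs_UNIV]) (use Cons.prems in auto)
  have "(\<lambda>\<omega>. X s \<omega> # map (\<lambda>s. X s \<omega>) ss) \<in> measurable (obs_filtration X t) (count_space UNIV)"
    by (rule measurable_compose_countable[OF 1 2])
  then show ?case by simp
qed auto

definition link :: "nat \<Rightarrow> 'y path \<Rightarrow> real" where
  "link t \<omega> = \<pi> (map (\<lambda>s. X s \<omega>) [1..<Suc t])"

lemma link_range: "0 \<le> link t \<omega> \<and> link t \<omega> < 1"
  unfolding link_def by (rule \<pi>) (use X_range in auto)

lemma link_obs: "link (Suc t) \<in> borel_measurable (obs_filtration X t)"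
  unfolding link_def[abs_def] by (rule measurable_compose[OF X_list_obs]) auto

lemma link_upd: "n \<le> t \<Longrightarrow> link n ((\<omega>)(t := z)) = link n \<omega>"
  unfolding link_def by (intro arg_cong[where f=\<pi>] map_cong) (auto simp: X_upd simp del: upt_Suc)

lemma change_prob_eq: "change_prob \<pi> X (Suc t) \<omega> = (if latent t \<omega> then 1 else link (Suc t) \<omega>)"
  by (simp add: change_prob_def link_def)

lemma X_restrict: "1 \<le> s \<Longrightarrow> s \<le> Suc t \<Longrightarrow> X s (restrict \<omega> {0..<Suc t}) = X s \<omega>"
  by (rule hist_cong[OF X_hist]) auto

text \<open>The marginal of the projective limit on the coordinates up to t is the composition of
  the first t + 1 kernels, started from the empty history, which is represented by
  \<open>\<lambda>_. undefined\<close>.\<close>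

lemma nn_integral_hist_restrict:
  assumes F: "F \<in> borel_measurable (hist t)"
  shows "(\<integral>\<^sup>+\<omega>. F \<omega> \<partial>P) = (\<integral>\<^sup>+\<omega>. F \<omega> \<partial>IT.C 0 (Suc t) (\<lambda>_. undefined))"
proof -
  let ?J = "{0..<Suc t}"
  have F0: "F \<in> borel_measurable (PiM ?J (\<lambda>_. step_space))" by (rule measurable_hist_initial[OF F])
  \<comment> \<open>\<open>CI\<close> composes as many kernels as \<open>up_to\<close> prescribes,
    namely enough to cover the index set.\<close>
  have up: "IT.up_to ?J = Suc t"
    by (rule antisym) (use IT.up_to_less[of ?J t] in \<open>auto simp: IT.up_to_iff\<close>)
  have "(\<integral>\<^sup>+\<omega>. F \<omega> \<partial>P) = (\<integral>\<^sup>+\<omega>. F (restrict \<omega> ?J) \<partial>P)"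
    by (intro nn_integral_cong hist_cong[OF F]) auto
  also have "\<dots> = (\<integral>\<^sup>+\<omega>. F \<omega> \<partial>distr P (PiM ?J (\<lambda>_. step_space)) (\<lambda>\<omega>. restrict \<omega> ?J))"
    by (subst nn_integral_distr) (use F0 in \<open>auto simp: path_law_def measurable_cong_sets[OF IT.PF.sets_lim refl] intro!: measurable_restrict_subset\<close>)
  also have "distr P (PiM ?J (\<lambda>_. step_space)) (\<lambda>\<omega>. restrict \<omega> ?J) = IT.CI ?J"
    unfolding path_law_def by (rule IT.distr_lim) auto
  also have "(\<integral>\<^sup>+\<omega>. F \<omega> \<partial>IT.CI ?J) = (\<integral>\<^sup>+\<omega>. F (restrict \<omega> ?J) \<partial>IT.C 0 (Suc t) (\<lambda>_. undefined))"
    unfolding IT.CI_def up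
  proof (rule nn_integral_distr)
    show "F \<in> borel_measurable (distr (IT.C 0 (Suc t) (\<lambda>x. undefined)) (PiM ?J (\<lambda>_. step_space)) (\<lambda>f. restrict f ?J))"
      using F0 by simp
    have sC: "sets (IT.C 0 (Suc t) (\<lambda>_. undefined)) = sets (PiM ?J (\<lambda>_. step_space))"
      using IT.sets_C[of "\<lambda>_. undefined" 0 "Suc t"] by (simp del: IT.C.simps add: space_PiM)
    show "(\<lambda>\<omega>. restrict \<omega> ?J) \<in> IT.C 0 (Suc t) (\<lambda>x. undefined) \<rightarrow>\<^sub>M PiM ?J (\<lambda>_. step_space)"
      by (subst measurable_cong_sets[OF sC refl]) (rule measurable_restrict_subset, simp)
  qed
  also have "\<dots> = (\<integral>\<^sup>+\<omega>. F \<omega> \<partial>IT.C 0 (Suc t) (\<lambda>_. undefined))"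
    by (intro nn_integral_cong hist_cong[OF F]) auto
  finally show ?thesis .
qed

lemma prob_space_P: "prob_space P"
proof
  have "emeasure P (space P) = (\<integral>\<^sup>+\<omega>. 1 \<partial>P)" by simp
  also have "\<dots> = (\<integral>\<^sup>+\<omega>. 1 \<partial>IT.C 0 (Suc 0) (\<lambda>_. undefined))"
    by (rule nn_integral_hist_restrict[of _ 0]) simp
  also have "\<dots> = 1"
    using prob_space.emeasure_space_1[OF IT.prob_space_C[of "\<lambda>_. undefined" 0 "Suc 0"]] by simp
  finally show "emeasure P (space P) = 1" .
qed

sublocale P: prob_space P by (rule prob_space_P)

lemma nn_integral_initial: "(\<integral>\<^sup>+\<omega>. F (latent 0 \<omega>) \<partial>P) = ennreal (\<pi> []) * F True + ennreal (1 - \<pi> []) * F False"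
proof -
  have m: "(\<lambda>\<omega>. F (latent 0 \<omega>)) \<in> borel_measurable (hist 0)"
    by (rule measurable_compose[OF measurable_latent]) auto
  have u: "(\<lambda>_. undefined) \<in> space (PiM {0..<0::nat} (\<lambda>_. step_space::(bool \<times> 'y) measure))" by (auto simp: space_PiM)
  have "(\<integral>\<^sup>+\<omega>. F (latent 0 \<omega>) \<partial>P) = (\<integral>\<^sup>+\<omega>. F (latent 0 \<omega>) \<partial>IT.C 0 (Suc 0) (\<lambda>_. undefined))"
    by (rule nn_integral_hist_restrict[OF m])
  also have "IT.C 0 (Suc 0) (\<lambda>_. undefined) = IT.eP 0 (\<lambda>_. undefined)"
    unfolding IT.C.simps add_0 by (rule bind_return[OF IT.measurable_eP]) (use u in auto)
  also have "(\<integral>\<^sup>+\<omega>. F (latent 0 \<omega>) \<partial>IT.eP 0 (\<lambda>_. undefined)) = (\<integral>\<^sup>+z. F (fst z) \<partial>step_kernel \<mu> f g \<pi> X 0 (\<lambda>_. undefined))"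
    by (subst IT.nn_integral_eP[OF u]) (use measurable_hist_initial[OF m] in auto)
  also have "\<dots> = (\<integral>\<^sup>+l. F l \<partial>measure_pmf (bernoulli_pmf (\<pi> [])))"
    unfolding step_kernel_def by (subst if_P, simp, subst nn_integral_distr) (auto simp: step_space_def space_pair_measure)
  also have "\<dots> = ennreal (\<pi> []) * F True + ennreal (1 - \<pi> []) * F False"
    using \<pi>[of "[]"] by (simp add: mult.commute)
  finally show ?thesis .
qed

lemma nn_integral_step_kernel:
  assumes [measurable]: "F \<in> borel_measurable (step_space::(bool \<times> 'y) measure)"
  shows "(\<integral>\<^sup>+z. F z \<partial>step_kernel \<mu> f g \<pi> X (Suc t) \<omega>) =
    ennreal (change_prob \<pi> X (Suc t) \<omega>) * (\<integral>\<^sup>+y. F (True, y) * ennreal (g (X (Suc t) \<omega>) y) \<partial>\<mu>) +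
    ennreal (1 - change_prob \<pi> X (Suc t) \<omega>) * (\<integral>\<^sup>+y. F (False, y) * ennreal (f (X (Suc t) \<omega>) y) \<partial>\<mu>)"
proof -
  have x: "X (Suc t) \<omega> \<in> {1..K}" by (rule X_range) simp
  note [measurable] = f_measurable[OF x] g_measurable[OF x]
  have cp: "0 \<le> change_prob \<pi> X (Suc t) \<omega>" "change_prob \<pi> X (Suc t) \<omega> \<le> 1"
    using link_range[of "Suc t" \<omega>] by (auto simp: change_prob_eq)
  let ?N = "count_space (UNIV :: bool set) \<Otimes>\<^sub>M \<mu>"
  have N: "sets ?N = sets step_space"
    unfolding step_space_def by (rule sets_pair_measure_cong) (auto simp: sets_\<mu>)
  have F [measurable]: "F \<in> borel_measurable ?N" using assms measurable_cong_sets[OF N refl] by blast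
  let ?d = "\<lambda>(l, y). ennreal (if l then change_prob \<pi> X (Suc t) \<omega> * g (X (Suc t) \<omega>) y
                           else (1 - change_prob \<pi> X (Suc t) \<omega>) * f (X (Suc t) \<omega>) y)"
  have [measurable]: "?d \<in> borel_measurable ?N" unfolding split_beta' by measurable
  have [measurable]: "(\<lambda>y. F (l, y)) \<in> borel_measurable \<mu>" for l by measurable
  have "(\<integral>\<^sup>+z. F z \<partial>step_kernel \<mu> f g \<pi> X (Suc t) \<omega>) = (\<integral>\<^sup>+z. ?d z * F z \<partial>?N)"
    by (simp add: step_kernel_def nn_integral_density)
  also have "\<dots> = (\<integral>\<^sup>+l. \<integral>\<^sup>+y. ?d (l, y) * F (l, y) \<partial>\<mu> \<partial>count_space UNIV)"
    by (subst \<mu>.nn_integral_fst[symmetric]) auto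
  also have "\<dots> = (\<integral>\<^sup>+y. ?d (True, y) * F (True, y) \<partial>\<mu>) + (\<integral>\<^sup>+y. ?d (False, y) * F (False, y) \<partial>\<mu>)"
    by (simp add: nn_integral_count_space_finite UNIV_bool add.commute)
  also have "(\<integral>\<^sup>+y. ?d (True, y) * F (True, y) \<partial>\<mu>) = ennreal (change_prob \<pi> X (Suc t) \<omega>) * (\<integral>\<^sup>+y. F (True, y) * ennreal (g (X (Suc t) \<omega>) y) \<partial>\<mu>)"
    using cp by (subst nn_integral_cmult[symmetric]) (auto simp: ennreal_mult' mult_ac g_nonneg[OF x])
  also have "(\<integral>\<^sup>+y. ?d (False, y) * F (False, y) \<partial>\<mu>) = ennreal (1 - change_prob \<pi> X (Suc t) \<omega>) * (\<integral>\<^sup>+y. F (False, y) * ennreal (f (X (Suc t) \<omega>) y) \<partial>\<mu>)"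
    using cp by (subst nn_integral_cmult[symmetric]) (auto simp: ennreal_mult' mult_ac f_nonneg[OF x])
  finally show ?thesis .
qed

text \<open>Expectation of \<open>F\<close> over the next response, given the past and the next
  latent state \<open>l\<close>. Being defined at every path, it replaces a conditional expectation,
  which would be fixed only almost everywhere.\<close>

definition next_value :: "('y path \<Rightarrow> ennreal) \<Rightarrow> nat \<Rightarrow> 'y path \<Rightarrow> bool \<Rightarrow> ennreal" where
  "next_value F t \<omega> l = (\<integral>\<^sup>+y. F ((\<omega>)(Suc t := (l, y))) * ennreal ((if l then g else f) (X (Suc t) \<omega>) y) \<partial>\<mu>)"

text \<open>Peels the last kernel off the composition. From here on the path law is used only
  through this identity, \<open>nn_integral_initial\<close> and its total mass 1.\<close>

theorem nn_integral_step:
  assumes F: "F \<in> borel_measurable (hist (Suc t))"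
  shows "(\<integral>\<^sup>+\<omega>. F \<omega> \<partial>P) = (\<integral>\<^sup>+\<omega>. ennreal (change_prob \<pi> X (Suc t) \<omega>) * next_value F t \<omega> True
      + ennreal (1 - change_prob \<pi> X (Suc t) \<omega>) * next_value F t \<omega> False \<partial>P)" (is "_ = (\<integral>\<^sup>+\<omega>. ?R \<omega> \<partial>P)")
proof -
  let ?M = "\<lambda>t. PiM {0..<Suc t} (\<lambda>_. step_space::(bool \<times> 'y) measure)"
  let ?u = "\<lambda>_::nat. undefined::bool \<times> 'y"
  have F1: "(\<lambda>z. F ((\<omega>)(Suc t := z))) \<in> borel_measurable step_space" for \<omega>
  proof -
    have "(\<lambda>z. (\<omega>)(Suc t := z)) \<in> measurable step_space (hist (Suc t))"
      by (rule measurable_into_hist) (auto simp: fun_upd_def le_Suc_eq)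
    from measurable_compose[OF this F] show ?thesis .
  qed
  have R: "?R \<omega> = (\<integral>\<^sup>+z. F ((\<omega>)(Suc t := z)) \<partial>step_kernel \<mu> f g \<pi> X (Suc t) \<omega>)" for \<omega>
    by (simp add: nn_integral_step_kernel[OF F1] next_value_def)
  have u: "?u \<in> space (PiM {0..<0::nat} (\<lambda>_. step_space::(bool \<times> 'y) measure))" by (auto simp: space_PiM)
  have F0: "F \<in> borel_measurable (?M (Suc t))" by (rule measurable_hist_initial[OF F])
  have "(\<integral>\<^sup>+\<omega>. F \<omega> \<partial>P) = (\<integral>\<^sup>+\<omega>. F \<omega> \<partial>IT.C 0 (Suc (Suc t)) ?u)"
    by (rule nn_integral_hist_restrict[OF F])
  also have "\<dots> = (\<integral>\<^sup>+\<omega>. \<integral>\<^sup>+\<omega>'. F \<omega>' \<partial>IT.eP (Suc t) \<omega> \<partial>IT.C 0 (Suc t) ?u)"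
  proof -
    have "IT.C 0 (Suc (Suc t)) ?u = IT.C 0 (Suc t) ?u \<bind> IT.eP (Suc t)"
      by (simp only: IT.C.simps(2)[of 0 "Suc t"] add_0)
    moreover have "IT.eP (Suc t) \<in> measurable (IT.C 0 (Suc t) ?u) (subprob_algebra (?M (Suc t)))"
    proof -
      have sC: "sets (IT.C 0 (Suc t) ?u) = sets (?M t)"
        using IT.sets_C[OF u, of "Suc t"] by (simp del: IT.C.simps)
      show ?thesis by (subst measurable_cong_sets[OF sC refl]) (rule IT.measurable_eP)
    qed
    ultimately show ?thesis
      by (simp del: IT.C.simps add: nn_integral_bind[OF F0])
  qed
  also have "\<dots> = (\<integral>\<^sup>+\<omega>. ?R \<omega> \<partial>IT.C 0 (Suc t) ?u)"
    by (intro nn_integral_cong, subst IT.nn_integral_eP)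
      (use F0 IT.space_C[OF u, of "Suc t"] in \<open>auto simp: R simp del: IT.C.simps\<close>)
  also have "\<dots> = (\<integral>\<^sup>+\<omega>. ?R \<omega> \<partial>P)"
  proof -
    \<comment> \<open>The integrand sees only the coordinates up to t. This makes it measurable for
      \<open>hist t\<close>, which the way back from the finite-dimensional law to \<open>P\<close>
      requires.\<close>
    have e: "?R \<omega> = ?R (restrict \<omega> {0..<Suc t})" for \<omega>
    proof -
      have "F ((\<omega>)(Suc t := z)) = F ((restrict \<omega> {0..<Suc t})(Suc t := z))" for z
        by (rule hist_cong[OF F]) (auto simp: le_Suc_eq)
      moreover have "X (Suc t) (restrict \<omega> {0..<Suc t}) = X (Suc t) \<omega>" by (rule X_restrict) auto
      moreover have "map (\<lambda>s. X s (restrict \<omega> {0..<Suc t})) [1..<Suc (Suc t)] = map (\<lambda>s. X s \<omega>) [1..<Suc (Suc t)]"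
        by (intro map_cong X_restrict) auto
      then have "link (Suc t) (restrict \<omega> {0..<Suc t}) = link (Suc t) \<omega>" unfolding link_def by (simp only:)
      moreover have "latent t (restrict \<omega> {0..<Suc t}) = latent t \<omega>" by (simp add: latent_def)
      ultimately show ?thesis by (simp add: next_value_def change_prob_eq)
    qed
    have m: "?R \<in> borel_measurable (?M t)"
    proof -
      have "(\<lambda>\<omega>. \<integral>\<^sup>+\<omega>'. F \<omega>' \<partial>IT.eP (Suc t) \<omega>) \<in> borel_measurable (?M t)"
        using IT.measurable_eP[of "Suc t"] F0 by (intro nn_integral_measurable_subprob_algebra2[where N="?M (Suc t)"]) auto
      then show ?thesis
        by (rule measurable_cong[THEN iffD1, rotated]) (subst IT.nn_integral_eP, use F0 in \<open>auto simp: R\<close>)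
    qed
    have "?R \<in> borel_measurable (hist t)"
      by (subst e[abs_def]) (rule measurable_compose[OF measurable_hist_restrict m])
    from nn_integral_hist_restrict[OF this] show ?thesis by simp
  qed
  finally show ?thesis .
qed

end

section \<open>Likelihood ratios and posterior odds\<close>

lemma Inf_enat_gt: "enat n < Inf (enat ` A) \<longleftrightarrow> (\<forall>k\<in>A. n < k)"
proof -
  have "enat n < Inf (enat ` A) \<longleftrightarrow> enat (Suc n) \<le> Inf (enat ` A)" by (simp add: Suc_ile_eq)
  also have "\<dots> \<longleftrightarrow> (\<forall>k\<in>A. Suc n \<le> k)" by (simp add: le_Inf_iff)
  finally show ?thesis by (simp add: Suc_le_eq)
qed

text \<open>With absolute continuity in both directions, the quotient g / f, which is 0 where f = 0
  by convention, is almost everywhere the true likelihood ratio and positive.\<close>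

locale regular_model = controlled_model +
  assumes f_0_imp_g_0: "x \<in> {1..K} \<Longrightarrow> AE y in \<mu>. f x y = 0 \<longrightarrow> g x y = 0"
    and g_0_imp_f_0: "x \<in> {1..K} \<Longrightarrow> AE y in \<mu>. g x y = 0 \<longrightarrow> f x y = 0"
begin

definition lr :: "nat \<Rightarrow> 'a path \<Rightarrow> real" where
  "lr t \<omega> = g (X t \<omega>) (response t \<omega>) / f (X t \<omega>) (response t \<omega>)"

text \<open>Bayes' rule in two moves: a possible change with probability q turns odds G into (G + q)
  / (1 - q), then the response multiplies them by its likelihood ratio. Real values suffice because
  change probabilities are below 1.\<close>

primrec odds :: "nat \<Rightarrow> 'a path \<Rightarrow> real" where
  "odds 0 \<omega> = \<pi> [] / (1 - \<pi> [])"
| "odds (Suc t) \<omega> = (odds t \<omega> + link (Suc t) \<omega>) / (1 - link (Suc t) \<omega>) * lr (Suc t) \<omega>"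

lemma borel_imp_\<mu>: "F \<in> measurable borel N \<Longrightarrow> F \<in> measurable \<mu> N"
  by (subst measurable_cong_sets[OF sets_\<mu> refl])

lemma latent_P: "latent t \<in> measurable P (count_space UNIV)"
  by (rule hist_P[OF measurable_latent[OF order_refl]])

lemma lr_nonneg: "1 \<le> t \<Longrightarrow> 0 \<le> lr t \<omega>"
  unfolding lr_def using X_range[of t \<omega>] f_nonneg g_nonneg by simp

lemma odds_nonneg: "0 \<le> odds t \<omega>"
proof (induction t)
  case (Suc t)
  then show ?case using link_range[of "Suc t" \<omega>] lr_nonneg[of "Suc t" \<omega>] by simp
qed (use \<pi>[of "[]"] in simp)

lemma X_response_measurable:
  assumes "\<And>x. x \<in> {1..K} \<Longrightarrow> h x \<in> borel_measurable borel" "1 \<le> t"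
  shows "(\<lambda>\<omega>. h (X t \<omega>) (response t \<omega>) :: real) \<in> borel_measurable (obs_filtration X t)"
proof -
  have [measurable]: "response t \<in> borel_measurable (obs_filtration X t)"
    using assms(2) by (intro measurable_response_obs) auto
  have 1: "(\<lambda>\<omega>. (if x \<in> {1..K} then h x (response t \<omega>) else 0)) \<in> borel_measurable (obs_filtration X t)" for x
  proof (cases "x \<in> {1..K}")
    case True
    then have "(\<lambda>\<omega>. h x (response t \<omega>)) \<in> borel_measurable (obs_filtration X t)"
      by (intro measurable_compose[OF _ assms(1)]) auto
    then show ?thesis using True by simp
  qed auto
  have 2: "X t \<in> measurable (obs_filtration X t) (count_space UNIV)"
    using assms(2) by (intro measurable_treatment_obs) auto
  have "(\<lambda>\<omega>. (if X t \<omega> \<in> {1..K} then h (X t \<omega>) (response t \<omega>) else 0)) \<in> borel_measurable (obs_filtration X t)"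
    by (rule measurable_compose_countable[OF 1 2])
  then show ?thesis using X_range[OF assms(2)] by simp
qed

lemma lr_obs: assumes "1 \<le> t" shows "lr t \<in> borel_measurable (obs_filtration X t)"
proof -
  have [measurable]: "(\<lambda>\<omega>. f (X t \<omega>) (response t \<omega>)) \<in> borel_measurable (obs_filtration X t)"
    "(\<lambda>\<omega>. g (X t \<omega>) (response t \<omega>)) \<in> borel_measurable (obs_filtration X t)"
    using assms f_measurable g_measurable by (auto intro!: X_response_measurable)
  show ?thesis unfolding lr_def[abs_def] by measurable
qed

lemma odds_obs: "odds t \<in> borel_measurable (obs_filtration X t)"
proof (induction t)
  case (Suc t)
  note [measurable] = obs_mono[OF Suc, of "Suc t", simplified] obs_mono[OF link_obs, of t "Suc t", simplified] lr_obs[of "Suc t", simplified]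
  show ?case by simp
qed simp

lemma lr_Suc_upd: "lr (Suc t) ((\<omega>)(Suc t := (l, y))) = g (X (Suc t) \<omega>) y / f (X (Suc t) \<omega>) y"
  by (simp add: lr_def X_upd)

lemma odds_upd: "n < t \<Longrightarrow> odds n ((\<omega>)(t := z)) = odds n \<omega>"
  by (rule hist_upd[OF obs_hist[OF odds_obs]]) auto

lemma odds_Suc_upd: "odds (Suc t) ((\<omega>)(Suc t := (l, y))) =
    (odds t \<omega> + link (Suc t) \<omega>) / (1 - link (Suc t) \<omega>) * (g (X (Suc t) \<omega>) y / f (X (Suc t) \<omega>) y)"
  by (simp add: lr_Suc_upd odds_upd link_upd)

lemma obs_section_measurable:
  "(\<lambda>(\<omega>, y). (\<omega>)(Suc t := (l, y))) \<in> measurable (obs_filtration X t \<Otimes>\<^sub>M borel) (obs_filtration X (Suc t))"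
proof (rule measurable_into_obs)
  let ?M = "obs_filtration X t \<Otimes>\<^sub>M (borel :: 'a measure)"
  fix s assume s: "1 \<le> s" "s \<le> Suc t"
  have 1: "X s \<in> measurable (obs_filtration X t) (count_space UNIV)"
    by (rule obs_mono[OF X_obs_UNIV]) (use s in auto)
  have "(\<lambda>z. X s (fst z)) \<in> measurable ?M (count_space UNIV)"
    by (rule measurable_compose[OF measurable_fst 1])
  then show "(\<lambda>x. X s (case x of (\<omega>, y) \<Rightarrow> (\<omega>)(Suc t := (l, y)))) \<in> measurable ?M (count_space UNIV)"
    using s by (simp add: split_beta' X_upd)
  show "(\<lambda>x. response s (case x of (\<omega>, y) \<Rightarrow> (\<omega>)(Suc t := (l, y)))) \<in> borel_measurable ?M"
  proof (cases "s = Suc t")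
    case False
    then have "response s \<in> borel_measurable (obs_filtration X t)" using s by (intro measurable_response_obs) auto
    from measurable_compose[OF measurable_fst this] show ?thesis using False by (simp add: split_beta')
  qed (simp add: split_beta')
qed

text \<open>The generators of the observation filtration see the last coordinate only through its
  response, and this property passes to the generated sigma-algebra.\<close>

lemma obs_section:
  fixes \<phi> :: "'a path \<Rightarrow> ennreal"
  assumes \<phi>: "\<phi> \<in> borel_measurable (obs_filtration X (Suc t))"
  shows "\<phi> ((\<omega>)(Suc t := (l, y))) = \<phi> ((\<omega>)(Suc t := (l', y)))"
proof -
  define A where "A = {B. ((\<omega>)(Suc t := (l, y)) \<in> B) = ((\<omega>)(Suc t := (l', y)) \<in> B)}"
  have "sigma_sets UNIV (\<Union>s\<in>{1..Suc t}. range (\<lambda>A. X s -` A) \<union> (\<lambda>B. response s -` B) ` sets borel) \<subseteq> A"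
  proof
    fix B assume "B \<in> sigma_sets UNIV (\<Union>s\<in>{1..Suc t}. range (\<lambda>A. X s -` A) \<union> (\<lambda>B. response s -` B) ` sets borel)"
    then show "B \<in> A" by induction (auto simp: A_def X_upd)
  qed
  moreover have "\<phi> -` {\<phi> ((\<omega>)(Suc t := (l', y)))} \<in> sets (obs_filtration X (Suc t))"
    using measurable_sets[OF \<phi>, of "{\<phi> ((\<omega>)(Suc t := (l', y)))}"] by simp
  ultimately have "\<phi> -` {\<phi> ((\<omega>)(Suc t := (l', y)))} \<in> A"
    unfolding obs_filtration_def sets_measure_of[OF obs_generators_subset] by blast
  then show ?thesis by (simp add: A_def)
qed

text \<open>Integrating out the last response of an observable weight leaves an observable weight;
  this allows the induction hypothesis of \<open>odds_filter\<close> to be applied to it.\<close>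

lemma next_value_obs:
  fixes \<phi> :: "'a path \<Rightarrow> ennreal"
  assumes \<phi>: "\<phi> \<in> borel_measurable (obs_filtration X (Suc t))"
  shows "(\<lambda>\<omega>. next_value \<phi> t \<omega> l) \<in> borel_measurable (obs_filtration X t)"
proof -
  let ?h = "if l then g else f"
  have [measurable]: "?h x \<in> borel_measurable borel" if "x \<in> {1..K}" for x
    using that f_measurable g_measurable by auto
  have "(\<lambda>z. \<phi> ((fst z)(Suc t := (l, snd z)))) \<in> borel_measurable (obs_filtration X t \<Otimes>\<^sub>M \<mu>)"
  proof -
    have "sets (obs_filtration X t \<Otimes>\<^sub>M \<mu>) = sets (obs_filtration X t \<Otimes>\<^sub>M borel)"
      by (rule sets_pair_measure_cong) (auto simp: sets_\<mu>)
    from measurable_cong_sets[OF this refl] measurable_compose[OF obs_section_measurable \<phi>, of l]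
    show ?thesis by (simp add: split_beta')
  qed
  note [measurable] = this
  have 1: "(\<lambda>\<omega>. (if x \<in> {1..K} then \<integral>\<^sup>+y. \<phi> ((\<omega>)(Suc t := (l, y))) * ennreal (?h x y) \<partial>\<mu> else 0)) \<in> borel_measurable (obs_filtration X t)" for x
  proof (cases "x \<in> {1..K}")
    case True
    have [measurable]: "?h x \<in> borel_measurable \<mu>"
      using True borel_imp_\<mu>[OF f_measurable] borel_imp_\<mu>[OF g_measurable] by simp
    have "(\<lambda>z. \<phi> ((fst z)(Suc t := (l, snd z))) * ennreal (?h x (snd z))) \<in> borel_measurable (obs_filtration X t \<Otimes>\<^sub>M \<mu>)"
      by measurable
    then have "(\<lambda>\<omega>. \<integral>\<^sup>+y. \<phi> ((\<omega>)(Suc t := (l, y))) * ennreal (?h x y) \<partial>\<mu>) \<in> borel_measurable (obs_filtration X t)"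
      by (intro \<mu>.borel_measurable_nn_integral) (simp add: split_beta')
    then show ?thesis using True by simp
  qed auto
  have 2: "X (Suc t) \<in> measurable (obs_filtration X t) (count_space UNIV)"
    using X_obs_UNIV[of "Suc t"] by simp
  have "(\<lambda>\<omega>. (if X (Suc t) \<omega> \<in> {1..K} then \<integral>\<^sup>+y. \<phi> ((\<omega>)(Suc t := (l, y))) * ennreal (?h (X (Suc t) \<omega>) y) \<partial>\<mu> else 0)) \<in> borel_measurable (obs_filtration X t)"
    by (rule measurable_compose_countable[OF 1 2])
  then show ?thesis using X_range[of "Suc t"] by (simp add: next_value_def)
qed

lemma upd_measurable: "(\<lambda>y. (\<omega>)(Suc t := (l, y))) \<in> measurable borel (hist (Suc t))"
  by (rule measurable_into_hist) (auto simp: fun_upd_def le_Suc_eq step_space_def space_pair_measure)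

lemma section_measurable: "F \<in> measurable (hist (Suc t)) N \<Longrightarrow> (\<lambda>y. F ((\<omega>)(Suc t := (l, y)))) \<in> measurable borel N"
  by (rule measurable_compose[OF upd_measurable])

text \<open>Bayes' rule in integrated form, for all nonnegative observable weights. In the induction
  the last coordinate is integrated out. On the event of a change this leaves a weight at time t, to
  which the hypothesis applies; without a change the density f cancels against the likelihood ratio,
  and the factor 1 - q against the denominator of the recursion.\<close>

theorem odds_filter:
  assumes "\<phi> \<in> borel_measurable (obs_filtration X t)"
  shows "(\<integral>\<^sup>+\<omega>. \<phi> \<omega> * of_bool (latent t \<omega>) \<partial>P) = (\<integral>\<^sup>+\<omega>. \<phi> \<omega> * ennreal (odds t \<omega>) * of_bool (\<not> latent t \<omega>) \<partial>P)"
  using assms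
proof (induction t arbitrary: \<phi>)
  case 0
  \<comment> \<open>At time 0 nothing has been observed: the filtration has an empty generator, so
    the weight is constant.\<close>
  have "\<phi> \<omega> = \<phi> \<omega>'" for \<omega> \<omega>'
  proof -
    have "\<phi> -` {\<phi> \<omega>'} \<in> sets (obs_filtration X 0)"
      using measurable_sets[OF 0, of "{\<phi> \<omega>'}"] by simp
    then have "\<phi> -` {\<phi> \<omega>'} = {} \<or> \<phi> -` {\<phi> \<omega>'} = UNIV"
      by (simp add: obs_filtration_def sigma_sets_empty_eq)
    then show ?thesis by auto
  qed
  then obtain c where c: "\<phi> = (\<lambda>_. c)" by blast
  have p: "0 \<le> \<pi> []" "\<pi> [] < 1" using \<pi>[of "[]"] by auto
  have "(\<integral>\<^sup>+\<omega>. \<phi> \<omega> * of_bool (latent 0 \<omega>) \<partial>P) = ennreal (\<pi> []) * c"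
    using nn_integral_initial[of "\<lambda>l. c * of_bool l"] by (simp add: c)
  also have "\<dots> = ennreal (1 - \<pi> []) * (c * ennreal (\<pi> [] / (1 - \<pi> [])))"
  proof -
    have "ennreal (\<pi> []) = ennreal (1 - \<pi> []) * ennreal (\<pi> [] / (1 - \<pi> []))"
      using p by (subst ennreal_mult[symmetric]) auto
    then show ?thesis by (simp add: mult_ac)
  qed
  also have "\<dots> = (\<integral>\<^sup>+\<omega>. \<phi> \<omega> * ennreal (odds 0 \<omega>) * of_bool (\<not> latent 0 \<omega>) \<partial>P)"
    using nn_integral_initial[of "\<lambda>l. c * ennreal (\<pi> [] / (1 - \<pi> [])) * of_bool (\<not> l)"] by (simp add: c)
  finally show ?case .
next
  case (Suc t)
  note \<phi> [measurable] = Suc.prems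
  have [measurable]: "\<phi> \<in> borel_measurable (hist (Suc t))" "latent (Suc t) \<in> measurable (hist (Suc t)) (count_space UNIV)"
    "odds (Suc t) \<in> borel_measurable (hist (Suc t))"
    using obs_hist[OF \<phi>] obs_hist[OF odds_obs] measurable_latent by auto
  have [measurable]: "latent t \<in> measurable P (count_space UNIV)" "odds t \<in> borel_measurable P"
    "link (Suc t) \<in> borel_measurable P" 
    using hist_P[OF measurable_latent] obs_P[OF odds_obs] obs_P[OF link_obs] by auto
  define \<psi> where "\<psi> = (\<lambda>\<omega>. next_value \<phi> t \<omega> True)"
  have \<psi>: "\<psi> \<in> borel_measurable (obs_filtration X t)"
    unfolding \<psi>_def by (rule next_value_obs[OF \<phi>])
  note [measurable] = obs_P[OF \<psi>]
  have q: "0 \<le> link (Suc t) \<omega>" "link (Suc t) \<omega> < 1" for \<omega> using link_range by auto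
  have "(\<integral>\<^sup>+\<omega>. \<phi> \<omega> * of_bool (latent (Suc t) \<omega>) \<partial>P) = (\<integral>\<^sup>+\<omega>. ennreal (change_prob \<pi> X (Suc t) \<omega>) * \<psi> \<omega> \<partial>P)"
    by (subst nn_integral_step[of _ t]) (auto simp: next_value_def \<psi>_def)
  also have "\<dots> = (\<integral>\<^sup>+\<omega>. \<psi> \<omega> * of_bool (latent t \<omega>) + (ennreal (link (Suc t) \<omega>) * \<psi> \<omega>) * of_bool (\<not> latent t \<omega>) \<partial>P)"
    by (intro nn_integral_cong) (auto simp: change_prob_eq)
  also have "\<dots> = (\<integral>\<^sup>+\<omega>. \<psi> \<omega> * of_bool (latent t \<omega>) \<partial>P) + (\<integral>\<^sup>+\<omega>. (ennreal (link (Suc t) \<omega>) * \<psi> \<omega>) * of_bool (\<not> latent t \<omega>) \<partial>P)"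
    by (rule nn_integral_add) auto
  also have "(\<integral>\<^sup>+\<omega>. \<psi> \<omega> * of_bool (latent t \<omega>) \<partial>P) = (\<integral>\<^sup>+\<omega>. \<psi> \<omega> * ennreal (odds t \<omega>) * of_bool (\<not> latent t \<omega>) \<partial>P)"
    by (rule Suc.IH[OF \<psi>])
  also have "\<dots> + (\<integral>\<^sup>+\<omega>. (ennreal (link (Suc t) \<omega>) * \<psi> \<omega>) * of_bool (\<not> latent t \<omega>) \<partial>P) =
     (\<integral>\<^sup>+\<omega>. \<psi> \<omega> * ennreal (odds t \<omega> + link (Suc t) \<omega>) * of_bool (\<not> latent t \<omega>) \<partial>P)"
    by (subst nn_integral_add[symmetric])
      (auto intro!: nn_integral_cong simp: odds_nonneg q ennreal_plus algebra_simps distrib_left)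
  also have "\<dots> = (\<integral>\<^sup>+\<omega>. \<phi> \<omega> * ennreal (odds (Suc t) \<omega>) * of_bool (\<not> latent (Suc t) \<omega>) \<partial>P)"
  proof (rule sym, subst nn_integral_step[of _ t])
    show "(\<lambda>\<omega>. \<phi> \<omega> * ennreal (odds (Suc t) \<omega>) * of_bool (\<not> latent (Suc t) \<omega>)) \<in> borel_measurable (hist (Suc t))"
      by measurable
    have "next_value (\<lambda>\<omega>. \<phi> \<omega> * ennreal (odds (Suc t) \<omega>) * of_bool (\<not> latent (Suc t) \<omega>)) t \<omega> False =
       \<psi> \<omega> * ennreal ((odds t \<omega> + link (Suc t) \<omega>) / (1 - link (Suc t) \<omega>))" for \<omega>
    proof -
      let ?x = "X (Suc t) \<omega>" and ?u = "(odds t \<omega> + link (Suc t) \<omega>) / (1 - link (Suc t) \<omega>)"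
      have x: "?x \<in> {1..K}" by (rule X_range) simp
      have u: "0 \<le> ?u" using q[of \<omega>] odds_nonneg[of t \<omega>] by simp
      have [measurable]: "(\<lambda>y. \<phi> ((\<omega>)(Suc t := (True, y)))) \<in> borel_measurable \<mu>" 
        by (rule borel_imp_\<mu>, rule section_measurable, rule obs_hist, rule \<phi>)
      have [measurable]: "g ?x \<in> borel_measurable \<mu>" by (rule borel_imp_\<mu>[OF g_measurable[OF x]])
      have "next_value (\<lambda>\<omega>. \<phi> \<omega> * ennreal (odds (Suc t) \<omega>) * of_bool (\<not> latent (Suc t) \<omega>)) t \<omega> False =
        (\<integral>\<^sup>+y. \<phi> ((\<omega>)(Suc t := (False, y))) * ennreal (?u * (g ?x y / f ?x y)) * ennreal (f ?x y) \<partial>\<mu>)"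
        by (simp only: next_value_def odds_Suc_upd) simp
      \<comment> \<open>Cancelling f uses that f = 0 implies g = 0 almost everywhere; exchanging the
        latent labels False and True uses \<open>obs_section\<close>.\<close>
      also have "\<dots> = (\<integral>\<^sup>+y. \<phi> ((\<omega>)(Suc t := (True, y))) * ennreal (g ?x y) * ennreal ?u \<partial>\<mu>)"
      proof (rule nn_integral_cong_AE, use f_0_imp_g_0[OF x] in eventually_elim)
        fix y assume y: "f ?x y = 0 \<longrightarrow> g ?x y = 0"
        have "ennreal (?u * (g ?x y / f ?x y)) * ennreal (f ?x y) = ennreal (?u * (g ?x y / f ?x y) * f ?x y)"
          by (intro ennreal_mult[symmetric] mult_nonneg_nonneg[OF u] divide_nonneg_nonneg f_nonneg[OF x] g_nonneg[OF x])
        also have "?u * (g ?x y / f ?x y) * f ?x y = g ?x y * ?u" using y by (cases "f ?x y = 0") auto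
        also have "ennreal (g ?x y * ?u) = ennreal (g ?x y) * ennreal ?u"
          by (rule ennreal_mult) (use u g_nonneg[OF x, of y] in auto)
        finally show "\<phi> ((\<omega>)(Suc t := (False, y))) * ennreal (?u * (g ?x y / f ?x y)) * ennreal (f ?x y) = \<phi> ((\<omega>)(Suc t := (True, y))) * ennreal (g ?x y) * ennreal ?u"
          by (simp only: mult.assoc obs_section[OF \<phi>, where l=False and l'=True])
      qed
      also have "\<dots> = \<psi> \<omega> * ennreal ?u"
        by (subst nn_integral_multc) (auto simp: \<psi>_def next_value_def)
      finally show ?thesis .
    qed
    moreover have "next_value (\<lambda>\<omega>. \<phi> \<omega> * ennreal (odds (Suc t) \<omega>) * of_bool (\<not> latent (Suc t) \<omega>)) t \<omega> True = 0" for \<omega>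
      by (simp add: next_value_def)
    moreover have "ennreal (1 - link (Suc t) \<omega>) * (\<psi> \<omega> * ennreal ((odds t \<omega> + link (Suc t) \<omega>) / (1 - link (Suc t) \<omega>)))
       = \<psi> \<omega> * ennreal (odds t \<omega> + link (Suc t) \<omega>)" for \<omega>
      using q[of \<omega>] odds_nonneg[of t \<omega>] by (subst mult.left_commute) (simp add: ennreal_mult[symmetric] del: ennreal_plus)
    ultimately show "(\<integral>\<^sup>+\<omega>. ennreal (change_prob \<pi> X (Suc t) \<omega>) * next_value (\<lambda>\<omega>. \<phi> \<omega> * ennreal (odds (Suc t) \<omega>) * of_bool (\<not> latent (Suc t) \<omega>)) t \<omega> True +
         ennreal (1 - change_prob \<pi> X (Suc t) \<omega>) * next_value (\<lambda>\<omega>. \<phi> \<omega> * ennreal (odds (Suc t) \<omega>) * of_bool (\<not> latent (Suc t) \<omega>)) t \<omega> False \<partial>P) =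
      (\<integral>\<^sup>+\<omega>. \<psi> \<omega> * ennreal (odds t \<omega> + link (Suc t) \<omega>) * of_bool (\<not> latent t \<omega>) \<partial>P)"
      by (intro nn_integral_cong) (auto simp: change_prob_eq)
  qed
  finally show ?case .
qed

section \<open>From the filter identity to posterior probabilities\<close>

lemma obs_subalgebra: "subalgebra P (obs_filtration X t)"
proof -
  have "A \<in> sets P" if "A \<in> sets (obs_filtration X t)" for A
    using measurable_sets[OF obs_P[of "\<lambda>\<omega>. \<omega>" t "obs_filtration X t"] that] by simp
  then show ?thesis by (auto simp: subalgebra_def)
qed

text \<open>Split the indicator of L = 1 with the weights G / (1 + G) and 1 / (1 + G). By
  \<open>odds_filter\<close> the second part equals an integral over L = 0 with weight G / (1 + G),
  which completes the first part. The second identity follows by taking complements.\<close>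

lemma nn_integral_latent_obs:
  assumes A: "A \<in> sets (obs_filtration X t)"
  shows "(\<integral>\<^sup>+\<omega>\<in>A. of_bool (latent t \<omega>) \<partial>P) = (\<integral>\<^sup>+\<omega>\<in>A. ennreal (odds t \<omega> / (1 + odds t \<omega>)) \<partial>P)"
    and "(\<integral>\<^sup>+\<omega>\<in>A. of_bool (\<not> latent t \<omega>) \<partial>P) = (\<integral>\<^sup>+\<omega>\<in>A. ennreal (1 / (1 + odds t \<omega>)) \<partial>P)"
proof -
  have [measurable]: "A \<in> sets P" using A obs_subalgebra by (auto simp: subalgebra_def)
  note [measurable] = A odds_obs obs_P[OF odds_obs, of t]
  have [measurable]: "latent t \<in> measurable P (count_space UNIV)" by (rule latent_P)
  have G: "0 \<le> odds t \<omega>" "0 < 1 + odds t \<omega>" for \<omega> using odds_nonneg[of t \<omega>] by auto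
  have E: "ennreal (1 / (1 + odds t \<omega>)) * ennreal (odds t \<omega>) = ennreal (odds t \<omega> / (1 + odds t \<omega>))" for \<omega>
    using G[of \<omega>] by (simp add: ennreal_mult[symmetric])
  have S: "ennreal (1 / (1 + odds t \<omega>)) + ennreal (odds t \<omega> / (1 + odds t \<omega>)) = 1" for \<omega>
    using G[of \<omega>] by (subst ennreal_plus[symmetric]) (auto simp: add_divide_distrib[symmetric])
  have 1: "(\<integral>\<^sup>+\<omega>. (ennreal (1 / (1 + odds t \<omega>)) * indicator A \<omega>) * of_bool (latent t \<omega>) \<partial>P) =
      (\<integral>\<^sup>+\<omega>. (ennreal (1 / (1 + odds t \<omega>)) * indicator A \<omega>) * ennreal (odds t \<omega>) * of_bool (\<not> latent t \<omega>) \<partial>P)"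
    by (rule odds_filter) measurable
  have 2: "(\<integral>\<^sup>+\<omega>. (ennreal (odds t \<omega> / (1 + odds t \<omega>)) * indicator A \<omega>) * of_bool (latent t \<omega>) \<partial>P) + 
       (\<integral>\<^sup>+\<omega>. (ennreal (1 / (1 + odds t \<omega>)) * indicator A \<omega>) * of_bool (latent t \<omega>) \<partial>P)
     = (\<integral>\<^sup>+\<omega>\<in>A. of_bool (latent t \<omega>) \<partial>P)"
    by (subst nn_integral_add[symmetric])
       (auto intro!: nn_integral_cong simp: distrib_right[symmetric] S add.commute mult.commute split: split_indicator)
  have 3: "(\<integral>\<^sup>+\<omega>. (ennreal (odds t \<omega> / (1 + odds t \<omega>)) * indicator A \<omega>) * of_bool (latent t \<omega>) \<partial>P) +
     (\<integral>\<^sup>+\<omega>. (ennreal (1 / (1 + odds t \<omega>)) * indicator A \<omega>) * ennreal (odds t \<omega>) * of_bool (\<not> latent t \<omega>) \<partial>P)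
     = (\<integral>\<^sup>+\<omega>\<in>A. ennreal (odds t \<omega> / (1 + odds t \<omega>)) \<partial>P)"
    by (subst nn_integral_add[symmetric]) (auto intro!: nn_integral_cong simp: E split: split_indicator)
  show R1: "(\<integral>\<^sup>+\<omega>\<in>A. of_bool (latent t \<omega>) \<partial>P) = (\<integral>\<^sup>+\<omega>\<in>A. ennreal (odds t \<omega> / (1 + odds t \<omega>)) \<partial>P)"
    using 1 2 3 by simp
  have "(\<integral>\<^sup>+\<omega>\<in>A. of_bool (latent t \<omega>) \<partial>P) + (\<integral>\<^sup>+\<omega>\<in>A. of_bool (\<not> latent t \<omega>) \<partial>P) = (\<integral>\<^sup>+\<omega>\<in>A. 1 \<partial>P)"
  proof -
    have "of_bool (latent t \<omega>) * indicator A \<omega> + of_bool (\<not> latent t \<omega>) * indicator A \<omega> = (indicator A \<omega> :: ennreal)" for \<omega>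
      by auto
    then show ?thesis by (subst nn_integral_add[symmetric]) simp_all
  qed
  also have "\<dots> = (\<integral>\<^sup>+\<omega>\<in>A. ennreal (odds t \<omega> / (1 + odds t \<omega>)) \<partial>P) + (\<integral>\<^sup>+\<omega>\<in>A. ennreal (1 / (1 + odds t \<omega>)) \<partial>P)"
  proof -
    have "ennreal (odds t \<omega> / (1 + odds t \<omega>)) * indicator A \<omega> + ennreal (1 / (1 + odds t \<omega>)) * indicator A \<omega> = (indicator A \<omega> :: ennreal)" for \<omega>
      by (simp only: distrib_right[symmetric] S add.commute[of "ennreal (odds t \<omega> / (1 + odds t \<omega>))"] mult_1)
    then show ?thesis by (subst nn_integral_add[symmetric]) simp_all
  qed
  finally have "(\<integral>\<^sup>+\<omega>\<in>A. of_bool (latent t \<omega>) \<partial>P) + (\<integral>\<^sup>+\<omega>\<in>A. of_bool (\<not> latent t \<omega>) \<partial>P) =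
      (\<integral>\<^sup>+\<omega>\<in>A. of_bool (latent t \<omega>) \<partial>P) + (\<integral>\<^sup>+\<omega>\<in>A. ennreal (1 / (1 + odds t \<omega>)) \<partial>P)" by (simp add: R1)
  moreover have "(\<integral>\<^sup>+\<omega>\<in>A. of_bool (latent t \<omega>) \<partial>P) \<le> (\<integral>\<^sup>+\<omega>. 1 \<partial>P)"
    by (intro nn_integral_mono) (auto split: split_indicator)
  then have "(\<integral>\<^sup>+\<omega>\<in>A. of_bool (latent t \<omega>) \<partial>P) \<noteq> \<infinity>" using P.emeasure_space_1 by (auto simp: top_unique)
  ultimately show "(\<integral>\<^sup>+\<omega>\<in>A. of_bool (\<not> latent t \<omega>) \<partial>P) = (\<integral>\<^sup>+\<omega>\<in>A. ennreal (1 / (1 + odds t \<omega>)) \<partial>P)"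
    by (simp add: ennreal_add_left_cancel)
qed

lemma cond_exp_latent:
  fixes B :: "bool \<Rightarrow> bool" and h :: "real \<Rightarrow> real"
  assumes eq: "\<And>A. A \<in> sets (obs_filtration X t) \<Longrightarrow>
      (\<integral>\<^sup>+\<omega>\<in>A. of_bool (B (latent t \<omega>)) \<partial>P) = (\<integral>\<^sup>+\<omega>\<in>A. ennreal (h (odds t \<omega>)) \<partial>P)"
    and h [measurable]: "h \<in> borel_measurable borel" and h01: "\<And>u. 0 \<le> u \<Longrightarrow> 0 \<le> h u \<and> h u \<le> 1"
  shows "AE \<omega> in P. real_cond_exp P (obs_filtration X t) (indicator {\<omega>. B (latent t \<omega>)}) \<omega> = h (odds t \<omega>)"
proof -
  interpret finite_measure_subalgebra P "obs_filtration X t"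
    by standard (rule obs_subalgebra)
  have [measurable]: "latent t \<in> measurable P (count_space UNIV)" by (rule latent_P)
  note [measurable] = odds_obs obs_P[OF odds_obs, of t]
  have hb: "0 \<le> h (odds t \<omega>)" "h (odds t \<omega>) \<le> 1" for \<omega> using h01 odds_nonneg by auto
  have "{\<omega>. B (latent t \<omega>)} = {\<omega> \<in> space P. B (latent t \<omega>)}" by simp
  also have "\<dots> \<in> sets P" by measurable
  finally have BS [measurable]: "{\<omega>. B (latent t \<omega>)} \<in> sets P" .
  show ?thesis
  proof (rule real_cond_exp_charact)
    show i1: "integrable P (indicator {\<omega>. B (latent t \<omega>)} :: _ \<Rightarrow> real)"
      by (rule P.integrable_const_bound[of _ 1]) (auto split: split_indicator)
    show i2: "integrable P (\<lambda>\<omega>. h (odds t \<omega>))"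
      by (rule P.integrable_const_bound[of _ 1]) (use hb in auto)
    show "(\<lambda>\<omega>. h (odds t \<omega>)) \<in> borel_measurable (obs_filtration X t)" by measurable
    fix A assume A: "A \<in> sets (obs_filtration X t)"
    then have AP [measurable]: "A \<in> sets P" using obs_subalgebra by (auto simp: subalgebra_def)
    have "(\<integral>\<^sup>+\<omega>\<in>A. of_bool (B (latent t \<omega>)) \<partial>P) = (\<integral>\<^sup>+\<omega>. ennreal (indicator A \<omega> * indicator {\<omega>. B (latent t \<omega>)} \<omega>) \<partial>P)"
      by (intro nn_integral_cong) (auto split: split_indicator)
    moreover have "(\<integral>\<^sup>+\<omega>\<in>A. ennreal (h (odds t \<omega>)) \<partial>P) = (\<integral>\<^sup>+\<omega>. ennreal (indicator A \<omega> * h (odds t \<omega>)) \<partial>P)"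
      by (intro nn_integral_cong) (auto split: split_indicator)
    ultimately have "(\<integral>\<^sup>+\<omega>. ennreal (indicator A \<omega> * indicator {\<omega>. B (latent t \<omega>)} \<omega>) \<partial>P) = (\<integral>\<^sup>+\<omega>. ennreal (indicator A \<omega> * h (odds t \<omega>)) \<partial>P)"
      using eq[OF A] by simp
    then show "set_lebesgue_integral P A (indicator {\<omega>. B (latent t \<omega>)}) = set_lebesgue_integral P A (\<lambda>\<omega>. h (odds t \<omega>))"
      unfolding set_lebesgue_integral_def
      by (subst (1 2) integral_eq_nn_integral) (use hb in \<open>auto split: split_indicator\<close>)
  qed
qed

text \<open>Removes the freedom in the choice of versions: G / (1 + G) divided by 1 / (1 + G) is G,
  and countably many times share one null set.\<close>

theorem posterior_odds_eq:
  assumes "posterior_odds P X \<Gamma>"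
  shows "AE \<omega> in P. \<forall>t. \<Gamma> t \<omega> = ereal (odds t \<omega>)"
proof (subst AE_all_countable, rule allI)
  fix t
  have 1: "AE \<omega> in P. real_cond_exp P (obs_filtration X t) (indicator {\<omega>. latent t \<omega>}) \<omega> = odds t \<omega> / (1 + odds t \<omega>)"
    using cond_exp_latent[of t "\<lambda>l. l" "\<lambda>u. u / (1 + u)"] nn_integral_latent_obs(1)[of _ t] by simp
  have 2: "AE \<omega> in P. real_cond_exp P (obs_filtration X t) (indicator {\<omega>. \<not> latent t \<omega>}) \<omega> = 1 / (1 + odds t \<omega>)"
    using cond_exp_latent[of t "\<lambda>l. \<not> l" "\<lambda>u. 1 / (1 + u)"] nn_integral_latent_obs(2)[of _ t] by simp
  have "AE \<omega> in P. \<Gamma> t \<omega> =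
        ereal (real_cond_exp P (obs_filtration X t) (indicator {\<omega>. latent t \<omega>}) \<omega>)
        / ereal (real_cond_exp P (obs_filtration X t) (indicator {\<omega>. \<not> latent t \<omega>}) \<omega>)"
    using assms by (simp add: posterior_odds_def)
  with 1 2 show "AE \<omega> in P. \<Gamma> t \<omega> = ereal (odds t \<omega>)"
  proof eventually_elim
    case (elim \<omega>)
    have "1 + odds t \<omega> \<noteq> 0" using odds_nonneg[of t \<omega>] by simp
    then show ?case using elim by simp
  qed
qed

text \<open>Use the indicator of G = 0 as the weight in \<open>odds_filter\<close>. The logarithm of
  the odds is therefore meaningful once the change has occurred.\<close>

lemma AE_latent_odds_pos: "AE \<omega> in P. \<forall>t. latent t \<omega> \<longrightarrow> 0 < odds t \<omega>"
proof (subst AE_all_countable, rule allI)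
  fix t
  note [measurable] = odds_obs obs_P[OF odds_obs, of t]
  have [measurable]: "latent t \<in> measurable P (count_space UNIV)" by (rule latent_P)
  have "(\<integral>\<^sup>+\<omega>. of_bool (odds t \<omega> = 0) * of_bool (latent t \<omega>) \<partial>P) = (\<integral>\<^sup>+\<omega>. of_bool (odds t \<omega> = 0) * ennreal (odds t \<omega>) * of_bool (\<not> latent t \<omega>) \<partial>P)"
    by (rule odds_filter) measurable
  also have "\<dots> = (\<integral>\<^sup>+\<omega>. 0 \<partial>P)" by (intro nn_integral_cong) auto
  finally have "(\<integral>\<^sup>+\<omega>. of_bool (odds t \<omega> = 0) * of_bool (latent t \<omega>) \<partial>P) = 0" by simp
  then have "AE \<omega> in P. of_bool (odds t \<omega> = 0) * of_bool (latent t \<omega>) = (0::ennreal)"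
    by (subst (asm) nn_integral_0_iff_AE) auto
  then show "AE \<omega> in P. latent t \<omega> \<longrightarrow> 0 < odds t \<omega>"
    by eventually_elim (use odds_nonneg[of t] in \<open>auto simp: less_le of_bool_def split: if_splits\<close>)
qed

section \<open>Almost sure properties of paths\<close>

lemma AE_step:
  assumes F: "{\<omega>. Q \<omega>} \<in> sets (hist (Suc t))"
    and ae: "\<And>\<omega> l. AE y in \<mu>. (if l then g else f) (X (Suc t) \<omega>) y \<noteq> 0 \<longrightarrow> Q ((\<omega>)(Suc t := (l, y)))"
  shows "AE \<omega> in P. Q \<omega>"
proof -
  have [measurable]: "Measurable.pred (hist (Suc t)) Q" using F by (simp add: pred_def)
  have Q: "{\<omega>. Q \<omega>} \<in> sets P" using F sets_P hist_P[of Q "Suc t" "count_space UNIV"] by (simp add: pred_def)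
  have z: "next_value (\<lambda>\<omega>. of_bool (\<not> Q \<omega>)) t \<omega> l = 0" for \<omega> l
  proof -
    have "next_value (\<lambda>\<omega>. of_bool (\<not> Q \<omega>)) t \<omega> l = (\<integral>\<^sup>+y. 0 \<partial>\<mu>)"
      unfolding next_value_def
      by (rule nn_integral_cong_AE, use ae[of l \<omega>] in eventually_elim) (auto simp: of_bool_def)
    then show ?thesis by simp
  qed
  have "(\<integral>\<^sup>+\<omega>. of_bool (\<not> Q \<omega>) \<partial>P) = 0"
    by (subst nn_integral_step[of _ t]) (auto simp: z)
  then have "AE \<omega> in P. of_bool (\<not> Q \<omega>) = (0::ennreal)"
    using Q hist_P[of Q "Suc t" "count_space UNIV"] by (subst (asm) nn_integral_0_iff_AE) auto
  then show ?thesis by eventually_elim (auto simp: of_bool_def split: if_splits)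
qed

lemma AE_lr_pos: "AE \<omega> in P. \<forall>t. 0 < lr (Suc t) \<omega>"
proof (subst AE_all_countable, rule allI)
  fix t
  have "lr (Suc t) \<in> borel_measurable (hist (Suc t))" by (rule obs_hist[OF lr_obs]) simp
  then have "{\<omega> \<in> space (hist (Suc t)). 0 < lr (Suc t) \<omega>} \<in> sets (hist (Suc t))" by measurable
  then show "AE \<omega> in P. 0 < lr (Suc t) \<omega>"
  proof (intro AE_step)
    fix \<omega> :: "'a path" and l
    have x: "X (Suc t) \<omega> \<in> {1..K}" by (rule X_range) simp
    show "AE y in \<mu>. (if l then g else f) (X (Suc t) \<omega>) y \<noteq> 0 \<longrightarrow> 0 < lr (Suc t) ((\<omega>)(Suc t := (l, y)))"
      using f_0_imp_g_0[OF x] g_0_imp_f_0[OF x]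
      by eventually_elim (use f_nonneg[OF x] g_nonneg[OF x] in \<open>auto simp: lr_Suc_upd less_le split: if_splits\<close>)
  qed simp
qed

text \<open>The path space also contains paths whose latent state returns to 0; the kernel gives
  them no mass.\<close>

lemma AE_latent_mono: "AE \<omega> in P. \<forall>t. latent t \<omega> \<longrightarrow> latent (Suc t) \<omega>"
proof (subst AE_all_countable, rule allI)
  fix t
  have m [measurable]: "latent t \<in> measurable (hist (Suc t)) (count_space UNIV)" "latent (Suc t) \<in> measurable (hist (Suc t)) (count_space UNIV)"
    by (auto intro!: measurable_latent)
  have "(\<integral>\<^sup>+\<omega>. of_bool (latent t \<omega> \<and> \<not> latent (Suc t) \<omega>) \<partial>P) = 0"
  proof (subst nn_integral_step[of _ t])
    have "ennreal (change_prob \<pi> X (Suc t) \<omega>) * next_value (\<lambda>\<omega>. of_bool (latent t \<omega> \<and> \<not> latent (Suc t) \<omega>)) t \<omega> True +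
      ennreal (1 - change_prob \<pi> X (Suc t) \<omega>) * next_value (\<lambda>\<omega>. of_bool (latent t \<omega> \<and> \<not> latent (Suc t) \<omega>)) t \<omega> False = 0" for \<omega>
      by (cases "latent t \<omega>") (simp_all add: next_value_def change_prob_eq)
    from nn_integral_cong[OF this] show "(\<integral>\<^sup>+\<omega>. ennreal (change_prob \<pi> X (Suc t) \<omega>) * next_value (\<lambda>\<omega>. of_bool (latent t \<omega> \<and> \<not> latent (Suc t) \<omega>)) t \<omega> True +
      ennreal (1 - change_prob \<pi> X (Suc t) \<omega>) * next_value (\<lambda>\<omega>. of_bool (latent t \<omega> \<and> \<not> latent (Suc t) \<omega>)) t \<omega> False \<partial>P) = 0"
      by simp
  qed auto
  then have "AE \<omega> in P. of_bool (latent t \<omega> \<and> \<not> latent (Suc t) \<omega>) = (0::ennreal)"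
    using m[THEN hist_P] by (subst (asm) nn_integral_0_iff_AE) auto
  then show "AE \<omega> in P. latent t \<omega> \<longrightarrow> latent (Suc t) \<omega>"
    by eventually_elim (auto simp: of_bool_def split: if_splits)
qed

text \<open>The posterior probability of no change is 1 / (1 + G). The bound is used twice: for the
  false alarm probability, and for the average price of entering detection too early.\<close>

lemma prob_not_latent_le:
  assumes A: "A \<in> sets (obs_filtration X t)" and b: "0 < 1 + b" "\<And>\<omega>. \<omega> \<in> A \<Longrightarrow> b \<le> odds t \<omega>"
  shows "emeasure P (A \<inter> {\<omega>. \<not> latent t \<omega>}) \<le> ennreal (1 / (1 + b)) * emeasure P A"
proof -
  have AP: "A \<in> sets P" using A obs_subalgebra by (auto simp: subalgebra_def)
  have [measurable]: "latent t \<in> measurable P (count_space UNIV)" by (rule latent_P)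
  have "{\<omega>. \<not> latent t \<omega>} = {\<omega> \<in> space P. \<not> latent t \<omega>}" by simp
  also have "\<dots> \<in> sets P" by measurable
  finally have "emeasure P (A \<inter> {\<omega>. \<not> latent t \<omega>}) = (\<integral>\<^sup>+\<omega>. indicator (A \<inter> {\<omega>. \<not> latent t \<omega>}) \<omega> \<partial>P)"
    using AP by (intro nn_integral_indicator[symmetric]) auto
  also have "\<dots> = (\<integral>\<^sup>+\<omega>\<in>A. of_bool (\<not> latent t \<omega>) \<partial>P)"
    by (intro nn_integral_cong) (auto split: split_indicator)
  also have "\<dots> = (\<integral>\<^sup>+\<omega>\<in>A. ennreal (1 / (1 + odds t \<omega>)) \<partial>P)" by (rule nn_integral_latent_obs[OF A])
  also have "\<dots> \<le> (\<integral>\<^sup>+\<omega>. ennreal (1 / (1 + b)) * indicator A \<omega> \<partial>P)"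
    using b by (intro nn_integral_mono) (auto split: split_indicator intro!: ennreal_leI divide_left_mono mult_pos_pos intro: less_le_trans)
  also have "\<dots> = ennreal (1 / (1 + b)) * emeasure P A" using AP by (rule nn_integral_cmult_indicator)
  finally show ?thesis .
qed

lemma not_latent_sets: "{\<omega>. \<not> latent t \<omega>} \<in> sets P"
proof -
  have [measurable]: "latent t \<in> measurable P (count_space UNIV)" by (rule latent_P)
  have "{\<omega> \<in> space P. \<not> latent t \<omega>} \<in> sets P" by measurable
  then show ?thesis by simp
qed

lemma stopping_time_sets: "obs_stopping_time X T \<Longrightarrow> {\<omega>. T \<omega> \<le> enat t} \<in> sets P"
  using obs_subalgebra[of t] by (auto simp: obs_stopping_time_def subalgebra_def)

lemma AE_less_change_point: "AE \<omega> in P. \<forall>t. \<not> latent t \<omega> \<longrightarrow> enat t < change_point \<omega>"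
  using AE_latent_mono
proof eventually_elim
  case (elim \<omega>)
  have mono: "latent (s + k) \<omega>" if "latent s \<omega>" for s k
    by (induction k) (use that elim in simp_all)
  show ?case
  proof (intro allI impI)
    fix t assume t: "\<not> latent t \<omega>"
    show "enat t < change_point \<omega>"
      unfolding change_point_def Inf_enat_gt
    proof
      fix s assume "s \<in> {t. latent t \<omega>}"
      then show "t < s" using mono[of s "t - s"] t by (cases "t < s") auto
    qed
  qed
qed

lemma early_stop_sets:
  assumes T: "obs_stopping_time X T"
  shows "{\<omega>. T \<omega> < change_point \<omega>} \<in> sets P"
proof -
  have "{\<omega>. T \<omega> < change_point \<omega>} = (\<Union>t. ({\<omega>. T \<omega> \<le> enat t}) \<inter> (\<Inter>s\<in>{..t}. {\<omega>. \<not> latent s \<omega>}))"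
  proof (rule set_eqI)
    fix \<omega> :: "'a path"
    have eq: "(\<forall>k\<in>{t. latent t \<omega>}. n < k) \<longleftrightarrow> (\<forall>s\<in>{..n}. \<not> latent s \<omega>)" for n by (auto simp: not_le[symmetric])
    show "\<omega> \<in> {\<omega>. T \<omega> < change_point \<omega>} \<longleftrightarrow> \<omega> \<in> (\<Union>t. ({\<omega>. T \<omega> \<le> enat t}) \<inter> (\<Inter>s\<in>{..t}. {\<omega>. \<not> latent s \<omega>}))"
      (is "?l \<longleftrightarrow> ?r")
    proof
      assume l: ?l
      then obtain n where n: "T \<omega> = enat n" by (cases "T \<omega>") auto
      with l eq[of n] have "\<forall>s\<in>{..n}. \<not> latent s \<omega>" by (simp add: change_point_def Inf_enat_gt)
      then show ?r using n by auto
    next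
      assume ?r
      then obtain n where "T \<omega> \<le> enat n" "\<forall>s\<in>{..n}. \<not> latent s \<omega>" by auto
      moreover from this(2) eq[of n] have "enat n < change_point \<omega>" by (simp add: change_point_def Inf_enat_gt)
      ultimately show ?l by (auto intro: le_less_trans)
    qed
  qed
  also have "\<dots> \<in> sets P"
    using stopping_time_sets[OF T] not_latent_sets by (intro sets.countable_UN image_subsetI sets.Int sets.finite_INT) auto
  finally show ?thesis .
qed

text \<open>Decompose by the value of \<open>T\<close>. At each such time the posterior probability
  of no change is at most 1 / (1 + (1 - \<alpha>) / \<alpha>) = \<alpha>; this is the origin of the
  upper threshold.\<close>

theorem false_alarm_le:
  assumes T: "obs_stopping_time X T" and \<alpha>: "0 < \<alpha>" "\<alpha> < 1"
    and stop: "AE \<omega> in P. \<forall>t. T \<omega> = enat t \<longrightarrow> (1 - \<alpha>) / \<alpha> \<le> odds t \<omega>"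
  shows "measure P {\<omega>. T \<omega> < change_point \<omega>} \<le> \<alpha>"
proof -
  define S where "S t = {\<omega>. T \<omega> = enat t \<and> (1 - \<alpha>) / \<alpha> \<le> odds t \<omega>}" for t
  have T': "{\<omega>. T \<omega> = enat t} \<in> sets (obs_filtration X t)" for t
  proof (cases t)
    case 0
    then show ?thesis using T unfolding obs_stopping_time_def by (auto simp: zero_enat_def[symmetric] dest!: spec[of _ 0])
  next
    case (Suc n)
    have "{\<omega>. T \<omega> \<le> enat n} \<in> sets (obs_filtration X (Suc n))"
      using T obs_mono[of "\<lambda>\<omega>. T \<omega> \<le> enat n" X n "count_space UNIV" "Suc n"] by (simp add: obs_stopping_time_def pred_def)
    then have "{\<omega>. T \<omega> \<le> enat (Suc n)} - {\<omega>. T \<omega> \<le> enat n} \<in> sets (obs_filtration X (Suc n))"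
      using T by (auto simp: obs_stopping_time_def)
    also have "{\<omega>. T \<omega> \<le> enat (Suc n)} - {\<omega>. T \<omega> \<le> enat n} = {\<omega>. T \<omega> = enat (Suc n)}"
    proof (rule set_eqI)
      show "\<omega> \<in> {\<omega>. T \<omega> \<le> enat (Suc n)} - {\<omega>. T \<omega> \<le> enat n} \<longleftrightarrow> \<omega> \<in> {\<omega>. T \<omega> = enat (Suc n)}" for \<omega>
        by (cases "T \<omega>") auto
    qed
    finally show ?thesis using Suc by simp
  qed
  have S [measurable]: "S t \<in> sets (obs_filtration X t)" for t
  proof -
    note [measurable] = odds_obs
    have "S t = {\<omega>. T \<omega> = enat t} \<inter> {\<omega> \<in> space (obs_filtration X t). (1 - \<alpha>) / \<alpha> \<le> odds t \<omega>}" by (auto simp: S_def)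
    also have "\<dots> \<in> sets (obs_filtration X t)" by (intro sets.Int T') measurable
    finally show ?thesis .
  qed
  have SP: "S t \<in> sets P" for t using S[of t] obs_subalgebra[of t] by (auto simp: subalgebra_def)
  note L = not_latent_sets
  have "emeasure P {\<omega>. T \<omega> < change_point \<omega>} \<le> emeasure P (\<Union>t. S t \<inter> {\<omega>. \<not> latent t \<omega>})"
  proof (rule emeasure_mono_AE)
    show "AE \<omega> in P. \<omega> \<in> {\<omega>. T \<omega> < change_point \<omega>} \<longrightarrow> \<omega> \<in> (\<Union>t. S t \<inter> {\<omega>. \<not> latent t \<omega>})"
      using stop
    proof eventually_elim
      case (elim \<omega>)
      show ?case
      proof
        assume "\<omega> \<in> {\<omega>. T \<omega> < change_point \<omega>}"
        moreover from this obtain t where "T \<omega> = enat t" by (cases "T \<omega>") auto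
        moreover have "change_point \<omega> \<le> enat t" if "latent t \<omega>" for t
          using that by (auto simp: change_point_def intro!: Inf_lower)
        ultimately show "\<omega> \<in> (\<Union>t. S t \<inter> {\<omega>. \<not> latent t \<omega>})"
          using elim by (fastforce simp: S_def not_le[symmetric])
      qed
    qed
    show "(\<Union>t. S t \<inter> {\<omega>. \<not> latent t \<omega>}) \<in> sets P" using SP L by auto
  qed
  also have "\<dots> \<le> (\<Sum>t. emeasure P (S t \<inter> {\<omega>. \<not> latent t \<omega>}))"
    using SP L by (intro emeasure_subadditive_countably) auto
  also have "\<dots> \<le> (\<Sum>t. ennreal \<alpha> * emeasure P (S t))"
  proof (intro suminf_le)
    fix t
    have "1 / (1 + (1 - \<alpha>) / \<alpha>) = \<alpha>" using \<alpha> by (simp add: field_simps)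
    moreover have "emeasure P (S t \<inter> {\<omega>. \<not> latent t \<omega>}) \<le> ennreal (1 / (1 + (1 - \<alpha>) / \<alpha>)) * emeasure P (S t)"
    proof (rule prob_not_latent_le[OF S])
      have "0 < (1 - \<alpha>) / \<alpha>" using \<alpha> by simp
      then show "0 < 1 + (1 - \<alpha>) / \<alpha>" by linarith
    qed (simp add: S_def)
    ultimately show "emeasure P (S t \<inter> {\<omega>. \<not> latent t \<omega>}) \<le> ennreal \<alpha> * emeasure P (S t)" by simp
  qed auto
  also have "\<dots> = ennreal \<alpha> * emeasure P (\<Union>t. S t)"
    using SP by (subst ennreal_suminf_cmult, subst suminf_emeasure) (auto simp: disjoint_family_on_def S_def)
  also have "\<dots> \<le> ennreal \<alpha> * 1" by (intro mult_left_mono P.emeasure_le_1) auto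
  finally show ?thesis using \<alpha> by (simp add: P.emeasure_eq_measure)
qed

end

section \<open>Log-likelihood ratios\<close>

locale density_pair =
  fixes \<mu> :: "'y measure" and p q :: "'y \<Rightarrow> real"
  assumes p: "is_density \<mu> p" and q: "is_density \<mu> q" and finite_variance: "llr_variance \<mu> p q < \<infinity>"
begin

lemma p_measurable [measurable]: "p \<in> borel_measurable \<mu>" and q_measurable [measurable]: "q \<in> borel_measurable \<mu>"
  and p_nonneg: "0 \<le> p y" and q_nonneg: "0 \<le> q y"
  and nn_p: "(\<integral>\<^sup>+y. ennreal (p y) \<partial>\<mu>) = 1" and nn_q: "(\<integral>\<^sup>+y. ennreal (q y) \<partial>\<mu>) = 1"
  using p q by (auto simp: is_density_def)

lemma integrable_p: "integrable \<mu> p" and integral_p: "(\<integral>y. p y \<partial>\<mu>) = 1"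
  and integrable_q: "integrable \<mu> q" and integral_q: "(\<integral>y. q y \<partial>\<mu>) = 1"
proof -
  show "integrable \<mu> p" using nn_p p_nonneg by (intro integrableI_nonneg) auto
  show "integrable \<mu> q" using nn_q q_nonneg by (intro integrableI_nonneg) auto
  show "(\<integral>y. p y \<partial>\<mu>) = 1" using nn_p p_nonneg by (subst integral_eq_nn_integral) auto
  show "(\<integral>y. q y \<partial>\<mu>) = 1" using nn_q q_nonneg by (subst integral_eq_nn_integral) auto
qed

lemma AE_absolutely_continuous: "AE y in \<mu>. q y = 0 \<longrightarrow> p y = 0"
proof -
  have "AE y in \<mu>. (if q y = 0 then \<infinity> else ennreal ((ln (p y / q y) - kl_number \<mu> p q)\<^sup>2)) * ennreal (p y) \<noteq> \<infinity>"
    by (rule nn_integral_noteq_infinite) (use finite_variance in \<open>auto simp: llr_variance_def\<close>)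
  then show ?thesis
    by eventually_elim (use p_nonneg in \<open>auto simp: ennreal_top_mult less_le split: if_splits\<close>)
qed

lemma variance_eq: "llr_variance \<mu> p q = (\<integral>\<^sup>+y. ennreal ((ln (p y / q y) - kl_number \<mu> p q)\<^sup>2 * p y) \<partial>\<mu>)"
  unfolding llr_variance_def
  by (rule nn_integral_cong_AE, use AE_absolutely_continuous in eventually_elim)
     (use p_nonneg in \<open>auto simp: ennreal_mult\<close>)

text \<open>The variance is centred at \<open>kl_number\<close>, which a priori might be only the
  default value of an integral that does not exist. The estimate |u| \<le> (u - k)^2 + 1 + |k| holds
  for every centre k.\<close>

lemma integrable_llr: "integrable \<mu> (\<lambda>y. ln (p y / q y) * p y)"
proof -
  let ?k = "kl_number \<mu> p q"
  have "integrable \<mu> (\<lambda>y. (ln (p y / q y) - ?k)\<^sup>2 * p y)"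
    using finite_variance p_nonneg by (intro integrableI_nonneg) (auto simp: variance_eq)
  then have "integrable \<mu> (\<lambda>y. (ln (p y / q y) - ?k)\<^sup>2 * p y + (1 + \<bar>?k\<bar>) * p y)"
    using integrable_p by auto
  then show ?thesis
  proof (rule Bochner_Integration.integrable_bound)
    have "\<bar>u\<bar> \<le> (u - k)\<^sup>2 + (1 + \<bar>k\<bar>)" for u k :: real
    proof -
      have "\<bar>u - k\<bar> \<le> (u - k)\<^sup>2 + 1"
      proof -
        have "0 \<le> (\<bar>u - k\<bar> - 1 / 2)\<^sup>2" by simp
        then have "0 \<le> \<bar>u - k\<bar>\<^sup>2 - \<bar>u - k\<bar> + 1 / 4" by (simp add: power2_eq_square algebra_simps)
        then have "0 \<le> (u - k)\<^sup>2 - \<bar>u - k\<bar> + 1 / 4" unfolding power2_abs .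
        then show ?thesis by linarith
      qed
      then show ?thesis by linarith
    qed
    from mult_right_mono[OF this p_nonneg]
    have *: "\<bar>ln (p y / q y)\<bar> * p y \<le> (ln (p y / q y) - ?k)\<^sup>2 * p y + (1 + \<bar>?k\<bar>) * p y" for y
      by (simp only: distrib_right[symmetric])
    have "norm (ln (p y / q y) * p y) \<le> norm ((ln (p y / q y) - ?k)\<^sup>2 * p y + (1 + \<bar>?k\<bar>) * p y)" for y
    proof -
      have "norm (ln (p y / q y) * p y) = \<bar>ln (p y / q y)\<bar> * p y" using p_nonneg[of y] by (simp add: abs_mult)
      also note *[of y]
      finally show ?thesis by (simp only: real_norm_def)
    qed
    then show "AE y in \<mu>. norm (ln (p y / q y) * p y) \<le> norm ((ln (p y / q y) - ?k)\<^sup>2 * p y + (1 + \<bar>?k\<bar>) * p y)"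
      by simp
  qed measurable
qed

lemma kl_eq: "(\<integral>y. ln (p y / q y) * p y \<partial>\<mu>) = kl_number \<mu> p q"
  by (simp add: kl_number_def)

text \<open>Integrand p ln (p / q) - p + q of the Kullback-Leibler number, nonnegative by ln x \<le>
  x - 1. Where q = 0 < p the quotient is a default value and the sign would be lost, so this null
  set is overridden.\<close>

definition gap :: "'y \<Rightarrow> real" where
  "gap y = (if p y = 0 \<or> q y = 0 then q y else ln (p y / q y) * p y - p y + q y)"

lemma gap_nonneg: "0 \<le> gap y"
proof (cases "p y = 0 \<or> q y = 0")
  case False
  then have pq: "0 < p y" "0 < q y" using p_nonneg[of y] q_nonneg[of y] by auto
  then have "ln (q y / p y) \<le> q y / p y - 1" by (intro ln_le_minus_one) auto
  then have "- ln (p y / q y) \<le> q y / p y - 1" using pq by (simp add: ln_div)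
  then have "- ln (p y / q y) * p y \<le> (q y / p y - 1) * p y" using pq by (intro mult_right_mono) auto
  then show ?thesis using False pq by (auto simp: gap_def left_diff_distrib)
qed (auto simp: gap_def q_nonneg)

lemma gap_eq: "AE y in \<mu>. gap y = ln (p y / q y) * p y - p y + q y"
  using AE_absolutely_continuous by eventually_elim (auto simp: gap_def)

lemma gap_measurable [measurable]: "gap \<in> borel_measurable \<mu>"
  unfolding gap_def[abs_def] by measurable

lemma gap_integral: "integrable \<mu> gap" "(\<integral>y. gap y \<partial>\<mu>) = kl_number \<mu> p q"
proof -
  have i: "integrable \<mu> (\<lambda>y. ln (p y / q y) * p y - p y + q y)"
    using integrable_llr integrable_p integrable_q by auto
  show "integrable \<mu> gap"
    using i by (subst integrable_cong_AE[OF _ _ gap_eq]) auto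
  have "(\<integral>y. gap y \<partial>\<mu>) = (\<integral>y. ln (p y / q y) * p y - p y + q y \<partial>\<mu>)"
    using gap_eq by (intro integral_cong_AE) auto
  also have "\<dots> = kl_number \<mu> p q"
    using integrable_llr integrable_p integrable_q by (simp add: kl_eq integral_p integral_q)
  finally show "(\<integral>y. gap y \<partial>\<mu>) = kl_number \<mu> p q" .
qed

lemma kl_nonneg: "0 \<le> kl_number \<mu> p q"
  unfolding gap_integral(2)[symmetric] by (intro integral_nonneg_AE) (auto simp: gap_nonneg)

lemma kl_zero_imp: assumes "kl_number \<mu> p q = 0" shows "AE y in \<mu>. p y = q y"
proof -
  have "AE y in \<mu>. gap y = 0"
    using gap_integral assms gap_nonneg by (subst integral_nonneg_eq_0_iff_AE[symmetric]) auto
  with AE_absolutely_continuous show ?thesis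
  proof eventually_elim
    case (elim y)
    show ?case
    proof (cases "p y = 0 \<or> q y = 0")
      case True
      then have "q y = 0" using elim by (simp add: gap_def)
      then show ?thesis using elim by simp
    next
      case False
      then have pq: "0 < p y" "0 < q y" using p_nonneg[of y] q_nonneg[of y] by auto
      have "ln (p y / q y) * p y = p y - q y" using elim False by (simp add: gap_def)
      then have "ln (q y / p y) = q y / p y - 1" using pq by (simp add: ln_div field_simps)
      then have "q y / p y = 1" using pq by (intro ln_eq_minus_one) auto
      then show ?thesis using pq by simp
    qed
  qed
qed

text \<open>If the number vanished, p and q would agree almost everywhere, and so the variance would
  vanish too.\<close>

lemma kl_pos: assumes "0 < llr_variance \<mu> p q" shows "0 < kl_number \<mu> p q"
proof (rule ccontr)
  assume "\<not> 0 < kl_number \<mu> p q"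
  then have k: "kl_number \<mu> p q = 0" using kl_nonneg by simp
  have "llr_variance \<mu> p q = (\<integral>\<^sup>+y. 0 \<partial>\<mu>)"
    unfolding variance_eq k
    by (rule nn_integral_cong_AE, use kl_zero_imp[OF k] in eventually_elim) auto
  then show False using assms by simp
qed

text \<open>The correction u (q / p) - v has mean at most u - v \<le> 0 under p. It leaves room for
  a pointwise bound by a tangent of the logarithm.\<close>

lemma nn_integral_affine_llr_le:
  assumes h [measurable]: "h \<in> borel_measurable \<mu>" and b: "\<And>y. 0 \<le> h y"
    and le: "AE y in \<mu>. 0 < p y \<longrightarrow> 0 < q y \<longrightarrow> h y \<le> B + ln (p y / q y) + (u * (q y / p y) - v)"
    and uv: "0 \<le> u" "u \<le> v"
  shows "(\<integral>\<^sup>+y. ennreal (h y) * ennreal (p y) \<partial>\<mu>) \<le> ennreal (B + kl_number \<mu> p q)"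
proof -
  let ?R = "\<lambda>y. B * p y + ln (p y / q y) * p y + u * q y - v * p y"
  have hp: "AE y in \<mu>. h y * p y \<le> ?R y"
    using le AE_absolutely_continuous
  proof eventually_elim
    case (elim y)
    show ?case
    proof (cases "p y = 0")
      case False
      then have pq: "0 < p y" "0 < q y" using elim p_nonneg[of y] q_nonneg[of y] by (auto simp: less_le)
      then have "h y * p y \<le> (B + ln (p y / q y) + (u * (q y / p y) - v)) * p y"
        using elim by (intro mult_right_mono) auto
      also have "\<dots> = ?R y" using pq by (simp add: field_simps)
      finally show ?thesis .
    qed (use uv q_nonneg[of y] in simp)
  qed
  have iR: "integrable \<mu> ?R" using integrable_llr integrable_p integrable_q by auto
  have R0: "AE y in \<mu>. 0 \<le> ?R y" using hp by eventually_elim (rule order_trans[OF mult_nonneg_nonneg[OF b p_nonneg]])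
  have "(\<integral>\<^sup>+y. ennreal (h y) * ennreal (p y) \<partial>\<mu>) = (\<integral>\<^sup>+y. ennreal (h y * p y) \<partial>\<mu>)"
    by (simp add: ennreal_mult b p_nonneg)
  also have "\<dots> \<le> (\<integral>\<^sup>+y. ennreal (?R y) \<partial>\<mu>)"
    by (rule nn_integral_mono_AE, use hp in eventually_elim) (rule ennreal_leI)
  also have "\<dots> = ennreal (\<integral>y. ?R y \<partial>\<mu>)" by (rule nn_integral_eq_integral[OF iR R0])
  also have "(\<integral>y. ?R y \<partial>\<mu>) = B + kl_number \<mu> p q + u - v"
    using integrable_llr integrable_p integrable_q by (simp add: kl_eq integral_p integral_q)
  also have "ennreal \<dots> \<le> ennreal (B + kl_number \<mu> p q)" using uv by (intro ennreal_leI) auto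
  finally show ?thesis .
qed

lemma nn_integral_likelihood_ratio_le: "(\<integral>\<^sup>+y. ennreal (q y / p y) * ennreal (p y) \<partial>\<mu>) \<le> 1"
proof -
  have "(\<integral>\<^sup>+y. ennreal (q y / p y) * ennreal (p y) \<partial>\<mu>) \<le> (\<integral>\<^sup>+y. ennreal (q y) \<partial>\<mu>)"
    using p_nonneg q_nonneg by (intro nn_integral_mono) (auto simp: ennreal_mult[symmetric])
  then show ?thesis by (simp add: nn_q)
qed

text \<open>Dominated convergence: cutting the log-likelihood ratio off from above costs at most
  \<epsilon> of its mean. The cut bounds the overshoot over a threshold, and B - min (..) M is
  nonnegative, so that its integral can be an \<open>ennreal\<close> one.\<close>

lemma truncated_llr_integral:
  assumes "0 < \<epsilon>"
  shows "\<exists>N. \<forall>M\<ge>N. 0 \<le> M \<longrightarrow> (\<forall>B\<ge>M. (\<integral>\<^sup>+y. ennreal (B - min (ln (p y / q y)) M) * ennreal (p y) \<partial>\<mu>)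
      \<le> ennreal (B - (kl_number \<mu> p q - \<epsilon>)))"
proof -
  let ?l = "\<lambda>y. ln (p y / q y)"
  have int: "integrable \<mu> (\<lambda>y. min (?l y) M * p y)" if "0 \<le> M" for M
    by (rule Bochner_Integration.integrable_bound[OF integrable_llr])
       (use that in \<open>auto simp: abs_mult intro!: mult_right_mono\<close>)
  have "(\<lambda>n. \<integral>y. min (?l y) (real n) * p y \<partial>\<mu>) \<longlonglongrightarrow> (\<integral>y. ?l y * p y \<partial>\<mu>)"
  proof (rule integral_dominated_convergence[where w="\<lambda>y. \<bar>?l y * p y\<bar>"])
    show "integrable \<mu> (\<lambda>y. \<bar>?l y * p y\<bar>)" using integrable_llr by (rule integrable_abs)
    show "AE y in \<mu>. (\<lambda>n. min (?l y) (real n) * p y) \<longlonglongrightarrow> ?l y * p y"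
    proof (rule AE_I2)
      fix y
      have "eventually (\<lambda>n. ?l y \<le> real n) sequentially"
        using filterlim_real_sequentially by (auto simp: filterlim_at_top)
      then have "eventually (\<lambda>n. min (?l y) (real n) * p y = ?l y * p y) sequentially"
        by eventually_elim simp
      then show "(\<lambda>n. min (?l y) (real n) * p y) \<longlonglongrightarrow> ?l y * p y" by (rule tendsto_eventually)
    qed
    show "AE y in \<mu>. norm (min (?l y) (real n) * p y) \<le> \<bar>?l y * p y\<bar>" for n
      by (auto simp: abs_mult intro!: AE_I2 mult_right_mono)
  qed auto
  then have "eventually (\<lambda>n. kl_number \<mu> p q - \<epsilon> < (\<integral>y. min (?l y) (real n) * p y \<partial>\<mu>)) sequentially"
    using assms by (intro order_tendstoD(1)) (auto simp: kl_eq)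
  then obtain N where N: "kl_number \<mu> p q - \<epsilon> < (\<integral>y. min (?l y) (real N) * p y \<partial>\<mu>)"
    by (auto simp: eventually_sequentially)
  show ?thesis
  proof (intro exI[of _ "real N"] allI impI)
    fix M B :: real assume M: "real N \<le> M" "0 \<le> M" and B: "M \<le> B"
    have "(\<integral>y. min (?l y) (real N) * p y \<partial>\<mu>) \<le> (\<integral>y. min (?l y) M * p y \<partial>\<mu>)"
      by (rule integral_mono[OF int int]) (use M p_nonneg in \<open>auto intro!: mult_right_mono\<close>)
    with N have k: "kl_number \<mu> p q - \<epsilon> \<le> (\<integral>y. min (?l y) M * p y \<partial>\<mu>)" by simp
    have "(\<integral>\<^sup>+y. ennreal (B - min (?l y) M) * ennreal (p y) \<partial>\<mu>) = (\<integral>\<^sup>+y. ennreal (B * p y - min (?l y) M * p y) \<partial>\<mu>)"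
      using B p_nonneg by (intro nn_integral_cong) (auto simp: ennreal_mult[symmetric] left_diff_distrib min_le_iff_disj)
    also have "\<dots> = ennreal (\<integral>y. B * p y - min (?l y) M * p y \<partial>\<mu>)"
    proof (rule nn_integral_eq_integral)
      show "integrable \<mu> (\<lambda>y. B * p y - min (?l y) M * p y)" using int[OF M(2)] integrable_p by auto
      have "0 \<le> (B - min (?l y) M) * p y" for y
        using B p_nonneg[of y] by (intro mult_nonneg_nonneg) (auto simp: min_le_iff_disj)
      then show "AE y in \<mu>. 0 \<le> B * p y - min (?l y) M * p y" by (simp only: left_diff_distrib AE_I2)
    qed
    also have "(\<integral>y. B * p y - min (?l y) M * p y \<partial>\<mu>) = B - (\<integral>y. min (?l y) M * p y \<partial>\<mu>)"
      using int[OF M(2)] integrable_p by (simp add: integral_p)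
    also have "ennreal \<dots> \<le> ennreal (B - (kl_number \<mu> p q - \<epsilon>))" using k by (intro ennreal_leI) simp
    finally show "(\<integral>\<^sup>+y. ennreal (B - min (?l y) M) * ennreal (p y) \<partial>\<mu>) \<le> ennreal (B - (kl_number \<mu> p q - \<epsilon>))" .
  qed
qed

end

locale informative_densities = densities +
  assumes V_I: "\<And>x. x \<in> {1..K} \<Longrightarrow> 0 < llr_variance \<mu> (g x) (f x) \<and> llr_variance \<mu> (g x) (f x) < \<infinity>"
    and V_J: "\<And>x. x \<in> {1..K} \<Longrightarrow> llr_variance \<mu> (f x) (g x) < \<infinity>"
begin

abbreviation "I x \<equiv> kl_number \<mu> (g x) (f x)"
abbreviation "J x \<equiv> kl_number \<mu> (f x) (g x)"

lemma gf: "x \<in> {1..K} \<Longrightarrow> density_pair \<mu> (g x) (f x)" and fg: "x \<in> {1..K} \<Longrightarrow> density_pair \<mu> (f x) (g x)"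
  using f g V_I V_J by (auto intro!: density_pair.intro)

lemma f_0_imp_g_0: "x \<in> {1..K} \<Longrightarrow> AE y in \<mu>. f x y = 0 \<longrightarrow> g x y = 0"
  and g_0_imp_f_0: "x \<in> {1..K} \<Longrightarrow> AE y in \<mu>. g x y = 0 \<longrightarrow> f x y = 0"
  using density_pair.AE_absolutely_continuous[OF gf] density_pair.AE_absolutely_continuous[OF fg] by auto

lemma I_pos: "x \<in> {1..K} \<Longrightarrow> 0 < I x"
  using V_I by (intro density_pair.kl_pos[OF gf]) auto

text \<open>J = 0 would give f = g almost everywhere and hence I = 0, although only the variance
  under g is assumed to be positive.\<close>

lemma J_pos: assumes x: "x \<in> {1..K}" shows "0 < J x"
proof (rule ccontr)
  interpret fg: density_pair \<mu> "f x" "g x" by (rule fg[OF x])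
  interpret gf: density_pair \<mu> "g x" "f x" by (rule gf[OF x])
  assume "\<not> 0 < J x"
  then have "AE y in \<mu>. f x y = g x y" using fg.kl_nonneg by (intro fg.kl_zero_imp) auto
  then have "I x = (\<integral>y. 0 \<partial>\<mu>)" unfolding kl_number_def
    by (intro integral_cong_AE) (auto elim!: eventually_mono)
  then show False using I_pos[OF x] by simp
qed

text \<open>Here w is the probability, just before the response, that the change has occurred, and
  (1 - w) + w (g / f) is the resulting mixture. Under g, its logarithm exceeds ln (g / f) by at most
  (1 - w) (f / g - 1), which has nonpositive mean; under f, it is at most w (g / f - 1), also of
  nonpositive mean. The condition on B keeps the integrands nonnegative.\<close>

lemma llr_gt:
  assumes x: "x \<in> {1..K}" and w: "0 \<le> w" "w < 1" and B: "- ln (1 - w) \<le> B"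
  shows "(\<integral>\<^sup>+y. ennreal (B + ln ((1 - w) + w * (g x y / f x y))) * ennreal (g x y) \<partial>\<mu>) \<le> ennreal (B + I x)"
    and "(\<integral>\<^sup>+y. ennreal (B + ln ((1 - w) + w * (g x y / f x y))) * ennreal (f x y) \<partial>\<mu>) \<le> ennreal B"
proof -
  interpret fg: density_pair \<mu> "f x" "g x" by (rule fg[OF x])
  interpret gf: density_pair \<mu> "g x" "f x" by (rule gf[OF x])
  have pos: "0 \<le> B + ln ((1 - w) + w * (g x y / f x y))" for y
  proof -
    have "ln (1 - w) \<le> ln ((1 - w) + w * (g x y / f x y))"
      using w fg.p_nonneg[of y] fg.q_nonneg[of y] by (subst ln_le_cancel_iff) (auto intro!: add_pos_nonneg)
    then show ?thesis using B by linarith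
  qed
  have m: "0 < (1 - w) + w * (g x y / f x y)" for y
    using w fg.p_nonneg[of y] fg.q_nonneg[of y] by (intro add_pos_nonneg) auto
  show "(\<integral>\<^sup>+y. ennreal (B + ln ((1 - w) + w * (g x y / f x y))) * ennreal (g x y) \<partial>\<mu>) \<le> ennreal (B + I x)"
  proof (rule gf.nn_integral_affine_llr_le[OF _ pos, where u="1 - w" and v="1 - w"])
    show "AE y in \<mu>. 0 < g x y \<longrightarrow> 0 < f x y \<longrightarrow> B + ln ((1 - w) + w * (g x y / f x y))
        \<le> B + ln (g x y / f x y) + ((1 - w) * (f x y / g x y) - (1 - w))"
    proof (intro AE_I2 impI)
      fix y assume y: "0 < g x y" "0 < f x y"
      let ?m = "(1 - w) + w * (g x y / f x y)"
      have "ln (?m / (g x y / f x y)) \<le> ?m / (g x y / f x y) - 1"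
        using y m[of y] by (intro ln_le_minus_one) auto
      moreover have "ln (?m / (g x y / f x y)) = ln ?m - ln (g x y / f x y)"
        by (rule ln_divide_pos) (use y m[of y] in auto)
      moreover have "?m / (g x y / f x y) - 1 = (1 - w) * (f x y / g x y) - (1 - w)"
        using y by (simp add: field_simps)
      ultimately show "B + ln ?m \<le> B + ln (g x y / f x y) + ((1 - w) * (f x y / g x y) - (1 - w))" by linarith
    qed
  qed (use w in auto)
  have "(\<integral>\<^sup>+y. ennreal (B + ln ((1 - w) + w * (g x y / f x y))) * ennreal (f x y) \<partial>\<mu>)
     \<le> (\<integral>\<^sup>+y. ennreal ((B - w) * f x y + w * g x y) \<partial>\<mu>)"
  proof (rule nn_integral_mono_AE, use g_0_imp_f_0[OF x] in eventually_elim)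
    fix y
    have l: "ln ((1 - w) + w * (g x y / f x y)) \<le> w * (g x y / f x y) - w"
      using ln_le_minus_one[OF m[of y]] by simp
    have "(B + ln ((1 - w) + w * (g x y / f x y))) * f x y \<le> (B + (w * (g x y / f x y) - w)) * f x y"
      using l fg.p_nonneg[of y] by (intro mult_right_mono) auto
    also have "\<dots> \<le> (B - w) * f x y + w * g x y"
    proof (cases "f x y = 0")
      case False
      then have "g x y / f x y * f x y = g x y" by simp
      then have "w * (g x y / f x y) * f x y = w * g x y" by (simp only: mult.assoc)
      then show ?thesis by (simp add: ring_distribs)
    qed (use w fg.q_nonneg[of y] in simp)
    finally show "ennreal (B + ln ((1 - w) + w * (g x y / f x y))) * ennreal (f x y) \<le> ennreal ((B - w) * f x y + w * g x y)"
      using pos fg.p_nonneg[of y] by (subst ennreal_mult[symmetric]) (auto intro: ennreal_leI)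
  qed
  also have "\<dots> = ennreal (\<integral>y. (B - w) * f x y + w * g x y \<partial>\<mu>)"
  proof (rule nn_integral_eq_integral)
    have "w \<le> B" using B ln_le_minus_one[of "1 - w"] w by simp
    then show "AE y in \<mu>. 0 \<le> (B - w) * f x y + w * g x y"
      using w fg.p_nonneg fg.q_nonneg by auto
  qed (use fg.integrable_p fg.integrable_q in auto)
  also have "(\<integral>y. (B - w) * f x y + w * g x y \<partial>\<mu>) = B"
    using fg.integrable_p fg.integrable_q by (simp add: fg.integral_p fg.integral_q)
  finally show "(\<integral>\<^sup>+y. ennreal (B + ln ((1 - w) + w * (g x y / f x y))) * ennreal (f x y) \<partial>\<mu>) \<le> ennreal B" .
qed

lemma truncation_level:
  assumes "0 < \<epsilon>"
  obtains M where "0 \<le> M"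
    "\<And>x B. x \<in> {1..K} \<Longrightarrow> M \<le> B \<Longrightarrow> (\<integral>\<^sup>+y. ennreal (B - min (ln (g x y / f x y)) M) * ennreal (g x y) \<partial>\<mu>) \<le> ennreal (B - (I x - \<epsilon>))"
    "\<And>x B. x \<in> {1..K} \<Longrightarrow> M \<le> B \<Longrightarrow> (\<integral>\<^sup>+y. ennreal (B - min (ln (f x y / g x y)) M) * ennreal (f x y) \<partial>\<mu>) \<le> ennreal (B - (J x - \<epsilon>))"
proof -
  have "\<forall>x\<in>{1..K}. \<exists>N. \<forall>M\<ge>N. 0 \<le> M \<longrightarrow> (\<forall>B\<ge>M. 
     (\<integral>\<^sup>+y. ennreal (B - min (ln (g x y / f x y)) M) * ennreal (g x y) \<partial>\<mu>) \<le> ennreal (B - (I x - \<epsilon>)))"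
    by (intro ballI density_pair.truncated_llr_integral[OF gf assms])
  from bchoice[OF this] obtain N1 where N1: "\<forall>x\<in>{1..K}. \<forall>M\<ge>N1 x. 0 \<le> M \<longrightarrow> (\<forall>B\<ge>M.
     (\<integral>\<^sup>+y. ennreal (B - min (ln (g x y / f x y)) M) * ennreal (g x y) \<partial>\<mu>) \<le> ennreal (B - (I x - \<epsilon>)))" ..
  have "\<forall>x\<in>{1..K}. \<exists>N. \<forall>M\<ge>N. 0 \<le> M \<longrightarrow> (\<forall>B\<ge>M. 
     (\<integral>\<^sup>+y. ennreal (B - min (ln (f x y / g x y)) M) * ennreal (f x y) \<partial>\<mu>) \<le> ennreal (B - (J x - \<epsilon>)))"
    by (intro ballI density_pair.truncated_llr_integral[OF fg assms])
  from bchoice[OF this] obtain N2 where N2: "\<forall>x\<in>{1..K}. \<forall>M\<ge>N2 x. 0 \<le> M \<longrightarrow> (\<forall>B\<ge>M.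
     (\<integral>\<^sup>+y. ennreal (B - min (ln (f x y / g x y)) M) * ennreal (f x y) \<partial>\<mu>) \<le> ennreal (B - (J x - \<epsilon>)))" ..
  define M where "M = Max (insert 0 (N1 ` {1..K} \<union> N2 ` {1..K}))"
  have M: "0 \<le> M" "N1 x \<le> M" "N2 x \<le> M" if "x \<in> {1..K}" for x
    unfolding M_def by (rule Max_ge, simp, use that in blast)+
  have M0: "0 \<le> M" unfolding M_def by (rule Max_ge) auto
  show thesis
  proof (rule that[OF M0])
    fix x B assume x: "x \<in> {1..K}" and B: "M \<le> B"
    show "(\<integral>\<^sup>+y. ennreal (B - min (ln (g x y / f x y)) M) * ennreal (g x y) \<partial>\<mu>) \<le> ennreal (B - (I x - \<epsilon>))"
      by (rule N1[rule_format, OF x M(2)[OF x] M0 B])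
    show "(\<integral>\<^sup>+y. ennreal (B - min (ln (f x y / g x y)) M) * ennreal (f x y) \<partial>\<mu>) \<le> ennreal (B - (J x - \<epsilon>))"
      by (rule N2[rule_format, OF x M(3)[OF x] M0 B])
  qed
qed

end

section \<open>The two-stage rule\<close>

text \<open>The switching times are functions of whole sequences, whereas a Lyapunov argument needs
  a state updated step by step. The argument of \<open>Acc\<close> is a position in the initial
  sequence followed by the acceleration block; that of \<open>Det\<close> counts the steps since the
  last switch to detection.\<close>

datatype stage = Acc nat | Det nat | Stop

instance stage :: countable by countable_datatype

lemma Inf_enat_eq: "k \<in> A \<Longrightarrow> (\<And>j. j \<in> A \<Longrightarrow> k \<le> j) \<Longrightarrow> Inf (enat ` A) = enat k"
  by (intro antisym Inf_lower Inf_greatest) auto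

lemma odds_crossing_gt: "enat n < odds_crossing \<Gamma> b a \<longleftrightarrow> (\<forall>s\<in>{a..a+n}. \<Gamma> s < b)"
proof -
  have "(\<forall>k\<in>{s. b \<le> \<Gamma> (a + s)}. n < k) \<longleftrightarrow> (\<forall>k\<le>n. \<Gamma> (a + k) < b)" by (auto simp: not_le[symmetric])
  also have "\<dots> \<longleftrightarrow> (\<forall>s\<in>{a..a+n}. \<Gamma> s < b)"
  proof safe
    fix s assume "\<forall>k\<le>n. \<Gamma> (a + k) < b" "s \<in> {a..a+n}"
    then show "\<Gamma> s < b" by (auto dest!: spec[of _ "s - a"])
  qed auto
  finally show ?thesis unfolding odds_crossing_def Inf_enat_gt .
qed

lemma odds_crossing_eq:
  assumes "a \<le> t" "\<forall>s\<in>{a..<t}. \<Gamma> s < b" "b \<le> \<Gamma> t" shows "odds_crossing \<Gamma> b a = enat (t - a)"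
  unfolding odds_crossing_def
proof (rule Inf_enat_eq)
  fix j assume j: "j \<in> {s. b \<le> \<Gamma> (a + s)}"
  show "t - a \<le> j"
  proof (rule ccontr)
    assume "\<not> t - a \<le> j"
    then have "a + j \<in> {a..<t}" by auto
    with assms(2) j show False by (auto simp: not_le[symmetric])
  qed
qed (use assms in simp)

locale staged_rule =
  fixes z\<^sub>0 \<Xi>\<^sub>1 \<Xi>\<^sub>2 :: "nat list" and b1 b2 d :: ereal
  assumes b1_le_b2: "b1 \<le> b2"
begin

text \<open>The crossing time of the odds may be 0, so stages of length 0 occur: odds above
  \<open>b1\<close> end an acceleration stage at once, and odds above \<open>b2\<close> end the
  following detection stage as well.\<close>

definition enter :: "nat \<Rightarrow> ereal \<Rightarrow> stage" where
  "enter n \<gamma> = (if b2 \<le> \<gamma> then Stop else if b1 \<le> \<gamma> then Det 0 else Acc n)"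

text \<open>If the odds and the likelihood ratio cross together, the procedure stops; hence
  \<open>b2\<close> is tested first. A restart begins at position \<open>length\<close> of the
  initial sequence, which is used only once.\<close>

primrec stage_step :: "stage \<Rightarrow> ereal \<Rightarrow> (nat \<Rightarrow> real) \<Rightarrow> stage" where
  "stage_step (Acc n) \<gamma> Z = enter (Suc n) \<gamma>"
| "stage_step (Det n) \<gamma> Z = (if b2 \<le> \<gamma> then Stop
     else if ereal (Z (Suc n)) \<le> 1 / d then enter (length z\<^sub>0) \<gamma> else Det (Suc n))"
| "stage_step Stop \<gamma> Z = Stop"

definition recent_lr :: "(nat \<Rightarrow> real) \<Rightarrow> nat \<Rightarrow> nat \<Rightarrow> real" where
  "recent_lr \<Lambda> t n = (\<Prod>i<n. \<Lambda> (t - i))"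

primrec stage :: "(nat \<Rightarrow> ereal) \<Rightarrow> (nat \<Rightarrow> real) \<Rightarrow> nat \<Rightarrow> stage" where
  "stage \<Gamma> \<Lambda> 0 = enter 0 (\<Gamma> 0)"
| "stage \<Gamma> \<Lambda> (Suc t) = stage_step (stage \<Gamma> \<Lambda> t) (\<Gamma> (Suc t)) (recent_lr \<Lambda> (Suc t))"

definition acc_treatment :: "nat \<Rightarrow> nat" where
  "acc_treatment n = (if n < length z\<^sub>0 then z\<^sub>0 ! n else cyc \<Xi>\<^sub>1 (int (Suc n) - int (length z\<^sub>0)))"

definition det_treatment :: "nat \<Rightarrow> nat" where
  "det_treatment n = cyc \<Xi>\<^sub>2 (int (Suc n))"

primrec stage_treatment :: "nat \<Rightarrow> stage \<Rightarrow> nat" where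
  "stage_treatment t (Acc n) = acc_treatment n"
| "stage_treatment t (Det n) = det_treatment n"
| "stage_treatment t Stop = cyc \<Xi>\<^sub>1 (int (Suc t))"

section \<open>The automaton and the switching times\<close>

context
  fixes \<Gamma> :: "nat \<Rightarrow> ereal" and \<Lambda> :: "nat \<Rightarrow> real" and S :: "nat \<Rightarrow> enat"
  assumes S: "\<And>n. S n = switch_time \<Gamma> \<Lambda> b1 b2 d n"
begin

lemma S_0: "S 0 = 0" by (simp add: S)

lemma S_Suc: "S n = enat a \<Longrightarrow> S (Suc n) = enat a + (if even n then odds_crossing \<Gamma> b1 a
    else min (odds_crossing \<Gamma> b2 a) (lr_crossing \<Lambda> d a))"
  by (simp add: S)

lemma S_mono_Suc: "S n \<le> S (Suc n)"
  by (cases "S n") (simp_all add: S)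

lemma S_mono: "m \<le> n \<Longrightarrow> S m \<le> S n"
  using lift_Suc_mono_le[of S m n] S_mono_Suc by blast

definition no_stop :: "nat \<Rightarrow> bool" where
  "no_stop m \<longleftrightarrow> (\<forall>j a. 1 \<le> j \<longrightarrow> j \<le> m \<longrightarrow> S (2 * j) = enat a \<longrightarrow> \<Gamma> a < b2)"

text \<open>m counts the completed cycles. In the first cycle the position is the time itself; in
  later ones it is counted from the end of the initial sequence.\<close>

definition in_acc :: "nat \<Rightarrow> nat \<Rightarrow> nat \<Rightarrow> bool" where
  "in_acc t m n \<longleftrightarrow> (\<exists>a. S (2 * m) = enat a \<and> a \<le> t \<and> no_stop m \<and> (\<forall>s\<in>{a..t}. \<Gamma> s < b1) \<and>
     n = (if m = 0 then t else length z\<^sub>0 + (t - a)))"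

definition in_det :: "nat \<Rightarrow> nat \<Rightarrow> nat \<Rightarrow> bool" where
  "in_det t m n \<longleftrightarrow> (n \<le> t \<and> S (Suc (2 * m)) = enat (t - n) \<and> no_stop m \<and> (\<forall>s\<in>{t-n..t}. \<Gamma> s < b2) \<and>
     (\<forall>k\<in>{1..n}. \<not> ereal (\<Prod>j=1..k. \<Lambda> (t - n + j)) \<le> 1 / d))"

definition stopped :: "nat \<Rightarrow> nat \<Rightarrow> bool" where
  "stopped t m \<longleftrightarrow> (\<exists>a. 1 \<le> m \<and> S (2 * m) = enat a \<and> a \<le> t \<and> b2 \<le> \<Gamma> a)"

lemma in_acc_next: assumes "S (2 * m) = enat a" "a \<le> t" "\<forall>s\<in>{a..t}. \<Gamma> s < b1"
  shows "enat t < S (Suc (2 * m))"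
proof -
  have "enat (t - a) < odds_crossing \<Gamma> b1 a"
    unfolding odds_crossing_gt using assms(2,3) by auto
  then show ?thesis using S_Suc[OF assms(1)] assms(2) by (cases "odds_crossing \<Gamma> b1 a") auto
qed

lemma in_det_next:
  assumes "in_det t m n"
  shows "enat n < odds_crossing \<Gamma> b2 (t - n)" "enat n < lr_crossing \<Lambda> d (t - n)" "enat t < S (Suc (Suc (2 * m)))"
proof -
  have D: "n \<le> t" "S (Suc (2 * m)) = enat (t - n)" "\<forall>s\<in>{t-n..t}. \<Gamma> s < b2"
     "\<forall>k\<in>{1..n}. \<not> ereal (\<Prod>j=1..k. \<Lambda> (t - n + j)) \<le> 1 / d" using assms by (auto simp: in_det_def)
  show o: "enat n < odds_crossing \<Gamma> b2 (t - n)"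
    unfolding odds_crossing_gt using D by auto
  show l: "enat n < lr_crossing \<Lambda> d (t - n)"
    unfolding lr_crossing_def Inf_enat_gt
  proof
    fix k assume k: "k \<in> {s. 1 \<le> s \<and> ereal (\<Prod>j=1..s. \<Lambda> (t - n + j)) \<le> 1 / d}"
    show "n < k" using D(4)[rule_format, of k] k by (cases "n < k") auto
  qed
  have "enat n < min (odds_crossing \<Gamma> b2 (t - n)) (lr_crossing \<Lambda> d (t - n))" using o l by simp
  then show "enat t < S (Suc (Suc (2 * m)))" using S_Suc[OF D(2)] D(1)
    by (cases "min (odds_crossing \<Gamma> b2 (t - n)) (lr_crossing \<Lambda> d (t - n))") auto
qed

text \<open>The common case behind the start, a continued acceleration stage and a restart:
  acceleration has run since a without a crossing, and the odds at time t decide what comes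
  next.\<close>

lemma entered:
  assumes a: "S (2 * m) = enat a" "a \<le> t" "\<forall>s\<in>{a..<t}. \<Gamma> s < b1"
    and ns: "no_stop m" 
    and n: "n = (if m = 0 then t else length z\<^sub>0 + (t - a))"
  shows "case enter n (\<Gamma> t) of Acc k \<Rightarrow> in_acc t m k | Det k \<Rightarrow> in_det t m k | Stop \<Rightarrow> stopped t (Suc m)"
proof (cases "b1 \<le> \<Gamma> t")
  case False
  then have "\<forall>s\<in>{a..t}. \<Gamma> s < b1" using a by (auto simp: le_less)
  moreover have "\<not> b2 \<le> \<Gamma> t" using False b1_le_b2 by auto
  ultimately show ?thesis using False a n ns by (auto simp: enter_def in_acc_def)
next
  case True
  then have "odds_crossing \<Gamma> b1 a = enat (t - a)"
    by (intro odds_crossing_eq a)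
  then have S1: "S (Suc (2 * m)) = enat t" using S_Suc[OF a(1)] a(2) by simp
  show ?thesis
  proof (cases "b2 \<le> \<Gamma> t")
    case False
    then show ?thesis using True S1 ns by (auto simp: enter_def in_det_def)
  next
    case True
    then have "odds_crossing \<Gamma> b2 t = enat 0" using odds_crossing_eq[of t t \<Gamma> b2] by simp
    then have "S (2 * Suc m) = enat t" using S_Suc[OF S1] by (simp add: zero_enat_def[symmetric])
    then show ?thesis using True by (auto simp: enter_def stopped_def)
  qed
qed

lemma stage_invariant: "case stage \<Gamma> \<Lambda> t of Acc k \<Rightarrow> \<exists>m. in_acc t m k | Det k \<Rightarrow> \<exists>m. in_det t m k | Stop \<Rightarrow> \<exists>m. stopped t m"
proof (induction t)
  case 0
  have "case enter 0 (\<Gamma> 0) of Acc k \<Rightarrow> in_acc 0 0 k | Det k \<Rightarrow> in_det 0 0 k | Stop \<Rightarrow> stopped 0 (Suc 0)"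
    by (rule entered[where a=0]) (auto simp: S_0 zero_enat_def no_stop_def)
  then show ?case by (auto split: stage.splits)
next
  case (Suc t)
  show ?case
  proof (cases "stage \<Gamma> \<Lambda> t")
    case (Acc n)
    then obtain m where "in_acc t m n" using Suc by auto
    then obtain a where a: "S (2 * m) = enat a" "a \<le> t" "no_stop m" "\<forall>s\<in>{a..t}. \<Gamma> s < b1"
      "n = (if m = 0 then t else length z\<^sub>0 + (t - a))" by (auto simp: in_acc_def)
    have "case enter (Suc n) (\<Gamma> (Suc t)) of Acc k \<Rightarrow> in_acc (Suc t) m k | Det k \<Rightarrow> in_det (Suc t) m k | Stop \<Rightarrow> stopped (Suc t) (Suc m)"
      by (rule entered[OF a(1)]) (use a in \<open>auto simp: Suc_diff_le\<close>)
    then show ?thesis using Acc by (auto split: stage.splits)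
  next
    case (Det n)
    then obtain m where dt: "in_det t m n" using Suc by auto
    then have D: "n \<le> t" "S (Suc (2 * m)) = enat (t - n)" "no_stop m" "\<forall>s\<in>{t-n..t}. \<Gamma> s < b2"
     "\<forall>k\<in>{1..n}. \<not> ereal (\<Prod>j=1..k. \<Lambda> (t - n + j)) \<le> 1 / d" by (auto simp: in_det_def)
    let ?a = "t - n"
    have S2: "S (2 * Suc m) = enat ?a + min (odds_crossing \<Gamma> b2 ?a) (lr_crossing \<Lambda> d ?a)"
      using S_Suc[OF D(2)] by simp
    \<comment> \<open>Reverses the product: \<open>recent_lr\<close> counts back from the present,
      \<open>lr_crossing\<close> forward from the switch.\<close>
    have Z: "recent_lr \<Lambda> (Suc t) (Suc n) = (\<Prod>j=1..Suc n. \<Lambda> (?a + j))"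
      unfolding recent_lr_def
      by (rule prod.reindex_bij_witness[of _ "\<lambda>j. Suc n - j" "\<lambda>i. Suc n - i"]) (use D(1) in auto)
    show ?thesis
    proof (cases "b2 \<le> \<Gamma> (Suc t)")
      case True
      have "odds_crossing \<Gamma> b2 ?a = enat (Suc t - ?a)"
        by (rule odds_crossing_eq) (use D True in auto)
      moreover have "enat (Suc n) \<le> lr_crossing \<Lambda> d ?a" using in_det_next(2)[OF dt] by (simp add: Suc_ile_eq)
      ultimately have "S (2 * Suc m) = enat (Suc t)" using S2 D(1) by (simp add: min_absorb1)
      then have "stopped (Suc t) (Suc m)" using True by (auto simp: stopped_def)
      then show ?thesis using Det True by auto
    next
      case F: False
      show ?thesis
      proof (cases "ereal (recent_lr \<Lambda> (Suc t) (Suc n)) \<le> 1 / d")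
        case True
        have "lr_crossing \<Lambda> d ?a = enat (Suc n)"
          using in_det_next(2)[OF dt] unfolding lr_crossing_def Inf_enat_gt
          by (intro Inf_enat_eq) (use True[unfolded Z] in \<open>auto simp: Suc_le_eq\<close>)
        moreover have "enat (Suc n) \<le> odds_crossing \<Gamma> b2 ?a" using in_det_next(1)[OF dt] by (simp add: Suc_ile_eq)
        ultimately have S2': "S (2 * Suc m) = enat (Suc t)" using S2 D(1) by (simp add: min_absorb2)
        have ns: "no_stop (Suc m)" using D(3) S2' F by (auto simp: no_stop_def le_Suc_eq)
        have "case enter (length z\<^sub>0) (\<Gamma> (Suc t)) of Acc k \<Rightarrow> in_acc (Suc t) (Suc m) k | Det k \<Rightarrow> in_det (Suc t) (Suc m) k | Stop \<Rightarrow> stopped (Suc t) (Suc (Suc m))"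
          by (rule entered[OF S2']) (use ns in auto)
        then show ?thesis using Det True F by (auto split: stage.splits)
      next
        case False
        have "\<not> ereal (\<Prod>j=1..k. \<Lambda> (Suc t - Suc n + j)) \<le> 1 / d" if "k \<in> {1..Suc n}" for k
          using D(5) False[unfolded Z] that by (cases "k = Suc n") auto
        moreover have "\<forall>s\<in>{t-n..Suc t}. \<Gamma> s < b2" using D(4) F by (auto simp: le_Suc_eq)
        ultimately have "in_det (Suc t) m (Suc n)"
          using D(1-3) by (simp add: in_det_def del: prod.cl_ivl_Suc)
        then show ?thesis using Det F False by auto
      qed
    qed
  next
    case Stop
    then obtain m where "stopped t m" using Suc by auto
    then have "stopped (Suc t) m" by (auto simp: stopped_def)
    then show ?thesis using Stop by auto
  qed
qed

text \<open>Odds above both thresholds make all further crossing times 0, so the switching times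
  stay constant.\<close>

lemma S_after_stop: assumes "b2 \<le> \<Gamma> a" "S n = enat a" "n \<le> k" shows "S k = enat a"
  using assms(3)
proof (induction k rule: dec_induct)
  case (step k)
  have "odds_crossing \<Gamma> b1 a = 0" "odds_crossing \<Gamma> b2 a = 0"
    using odds_crossing_eq[of a a \<Gamma> b1] odds_crossing_eq[of a a \<Gamma> b2] assms(1) order_trans[OF b1_le_b2 assms(1)]
    by (simp_all add: zero_enat_def)
  then show ?case using S_Suc[OF step.IH] by (simp add: zero_enat_def[symmetric])
qed (rule assms(2))

lemma procedure_time_gt:
  assumes "no_stop m" "enat t < S (2 * Suc m)"
  shows "enat t < procedure_time \<Gamma> b2 S"
proof -
  define stop where "stop m \<longleftrightarrow> 1 \<le> m \<and> (\<exists>t. S (2 * m) = enat t \<and> b2 \<le> \<Gamma> t)" for m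
  have pt: "procedure_time \<Gamma> b2 S = (if \<exists>m. stop m then S (2 * (LEAST m. stop m)) else \<infinity>)"
    by (simp only: procedure_time_def Let_def stop_def)
  show ?thesis
  proof (cases "\<exists>m. stop m")
    case True
    then have st: "stop (LEAST m. stop m)" by (auto intro: LeastI)
    have less: "m < (LEAST m. stop m)"
    proof (rule ccontr)
      assume *: "\<not> m < (LEAST m. stop m)"
      obtain a where "1 \<le> (LEAST m. stop m)" "S (2 * (LEAST m. stop m)) = enat a" "b2 \<le> \<Gamma> a"
        using st unfolding stop_def[of "LEAST m. stop m"] by blast
      moreover from this(1,2) * have "\<Gamma> a < b2"
        using assms(1)[unfolded no_stop_def, rule_format, of "LEAST m. stop m" a] by simp
      ultimately show False by simp
    qed
    then have "S (2 * Suc m) \<le> S (2 * (LEAST m. stop m))" by (intro S_mono mult_le_mono2 Suc_leI)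
    then have "enat t < S (2 * (LEAST m. stop m))" by (rule less_le_trans[OF assms(2)])
    then show ?thesis using True by (simp only: pt if_True)
  qed (simp add: pt)
qed

text \<open>In the other two stages no earlier even switching time is a stop, and the next one lies
  beyond t.\<close>

lemma procedure_time_le_iff: "procedure_time \<Gamma> b2 S \<le> enat t \<longleftrightarrow> stage \<Gamma> \<Lambda> t = Stop"
proof (cases "stage \<Gamma> \<Lambda> t")
  case (Acc n)
  then obtain m where "in_acc t m n" using stage_invariant[of t] by auto
  then obtain a where a: "S (2 * m) = enat a" "a \<le> t" "no_stop m" "\<forall>s\<in>{a..t}. \<Gamma> s < b1" by (auto simp: in_acc_def)
  have "enat t < S (Suc (2 * m))" by (rule in_acc_next[OF a(1,2,4)])
  also have "\<dots> \<le> S (2 * Suc m)" by (intro S_mono) auto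
  finally have "enat t < procedure_time \<Gamma> b2 S" by (rule procedure_time_gt[OF a(3)])
  then show ?thesis using Acc by (simp add: not_le)
next
  case (Det n)
  then obtain m where dt: "in_det t m n" using stage_invariant[of t] by auto
  then have "no_stop m" by (simp add: in_det_def)
  then have "enat t < procedure_time \<Gamma> b2 S"
    by (rule procedure_time_gt) (use in_det_next(3)[OF dt] in simp)
  then show ?thesis using Det by (simp add: not_le)
next
  case Stop
  define stop where "stop m \<longleftrightarrow> 1 \<le> m \<and> (\<exists>t. S (2 * m) = enat t \<and> b2 \<le> \<Gamma> t)" for m
  from Stop obtain m a where "1 \<le> m" "S (2 * m) = enat a" "a \<le> t" "b2 \<le> \<Gamma> a"
    using stage_invariant[of t] by (auto simp: stopped_def)
  then have m: "stop m" "S (2 * m) \<le> enat t" by (auto simp: stop_def)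
  have "procedure_time \<Gamma> b2 S = S (2 * (LEAST m. stop m))"
    using m by (auto simp: procedure_time_def Let_def stop_def)
  also have "\<dots> \<le> S (2 * m)" using m by (intro S_mono mult_le_mono2 Least_le)
  finally show ?thesis using Stop m by auto
qed

lemma procedure_time_odds:
  assumes "procedure_time \<Gamma> b2 S = enat t" shows "b2 \<le> \<Gamma> t"
proof -
  define stop where "stop m \<longleftrightarrow> 1 \<le> m \<and> (\<exists>t. S (2 * m) = enat t \<and> b2 \<le> \<Gamma> t)" for m
  have "procedure_time \<Gamma> b2 S = (if \<exists>m. stop m then S (2 * (LEAST m. stop m)) else \<infinity>)"
    by (simp only: procedure_time_def Let_def stop_def)
  then have ex: "\<exists>m. stop m" and e: "S (2 * (LEAST m. stop m)) = enat t" using assms by (auto split: if_splits)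
  from LeastI_ex[OF ex] show ?thesis unfolding stop_def[of "LEAST m. stop m"] e by auto
qed

lemma treatment_eq: "treatment z\<^sub>0 \<Xi>\<^sub>1 \<Xi>\<^sub>2 S (Suc t) = stage_treatment t (stage \<Gamma> \<Lambda> t)"
proof -
  \<comment> \<open>The \<open>LEAST\<close> index is found by enclosing t between two consecutive
    switching times.\<close>
  have key: "treatment z\<^sub>0 \<Xi>\<^sub>1 \<Xi>\<^sub>2 S (Suc t) = 
      (if k = 0 then (if Suc t \<le> length z\<^sub>0 then z\<^sub>0 ! t else cyc \<Xi>\<^sub>1 (int (Suc t) - int (length z\<^sub>0)))
           else if even k then cyc \<Xi>\<^sub>1 (int (Suc t) - int a)
           else cyc \<Xi>\<^sub>2 (int (Suc t) - int a))" if "S k = enat a" "a \<le> t" "enat t < S (Suc k)" for k a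
  proof -
    have k: "enat (Suc t) \<le> S (Suc k)" using that by (simp add: Suc_ile_eq)
    have "(LEAST n. enat (Suc t) \<le> S (Suc n)) = k"
    proof (rule Least_equality)
      show "enat (Suc t) \<le> S (Suc k)" by (rule k)
      fix n assume n: "enat (Suc t) \<le> S (Suc n)"
      show "k \<le> n"
      proof (rule ccontr)
        assume "\<not> k \<le> n"
        then have "S (Suc n) \<le> S k" by (intro S_mono) auto
        with n have "enat (Suc t) \<le> S k" by (rule order_trans)
        with that show False by simp
      qed
    qed
    then show ?thesis using k that by (auto simp: treatment_def Let_def)
  qed
  show ?thesis
  proof (cases "stage \<Gamma> \<Lambda> t")
    case (Acc n)
    then obtain m where "in_acc t m n" using stage_invariant[of t] by auto
    then obtain a where a: "S (2 * m) = enat a" "a \<le> t" "no_stop m" "\<forall>s\<in>{a..t}. \<Gamma> s < b1"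
      "n = (if m = 0 then t else length z\<^sub>0 + (t - a))" by (auto simp: in_acc_def)
    from key[OF a(1,2) in_acc_next[OF a(1,2,4)]] show ?thesis using Acc a(2,5)
      by (cases "m = 0") (auto simp: acc_treatment_def of_nat_diff add_diff_eq)
  next
    case (Det n)
    then obtain m where dt: "in_det t m n" using stage_invariant[of t] by auto
    then have D: "n \<le> t" "S (Suc (2 * m)) = enat (t - n)" by (auto simp: in_det_def)
    from key[OF D(2) _ in_det_next(3)[OF dt]] show ?thesis using Det D by (simp add: det_treatment_def of_nat_diff)
  next
    case Stop
    then obtain m a where m: "1 \<le> m" "S (2 * m) = enat a" "a \<le> t" "b2 \<le> \<Gamma> a"
      using stage_invariant[of t] by (auto simp: stopped_def)
    \<comment> \<open>All switching times are at most a, hence at most t, so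
      \<open>treatment\<close> falls into its last branch, which \<open>stage_treatment\<close>
      copies for \<open>Stop\<close>.\<close>
    have "\<not> enat (Suc t) \<le> S (Suc n)" for n
    proof -
      have "S (Suc n) \<le> S (max (Suc n) (2 * m))" by (rule S_mono) simp
      also have "\<dots> = enat a" by (rule S_after_stop[OF m(4,2)]) simp
      finally have "S (Suc n) \<le> enat t" using m(3) by (auto intro: order_trans)
      then show ?thesis by (cases "S (Suc n)") auto
    qed
    then show ?thesis using Stop by (simp add: treatment_def)
  qed
qed

end

end

lemma cyc_range: assumes "\<Xi> \<noteq> []" "set \<Xi> \<subseteq> A" shows "cyc \<Xi> j \<in> A"
proof -
  have "(j - 1) mod int (length \<Xi>) < int (length \<Xi>)" using assms(1) by (intro pos_mod_bound) simp
  then have "nat ((j - 1) mod int (length \<Xi>)) < length \<Xi>" using assms(1) by (subst nat_less_iff) auto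
  then show ?thesis using assms(2) by (auto simp: cyc_def)
qed

section \<open>The finite memory model\<close>

locale memory_model =
  fixes K \<kappa> :: nat and \<Psi> :: "nat \<Rightarrow> nat list \<Rightarrow> real"
  assumes K: "2 \<le> K" and \<Psi>: "\<And>x s. x \<in> {1..K} \<Longrightarrow> s \<in> states \<kappa> K \<Longrightarrow> 0 \<le> \<Psi> x s \<and> \<Psi> x s < 1"
begin

section \<open>Treatment sequences, indexed from 0, and the states they produce\<close>

primrec run :: "nat list \<Rightarrow> (nat \<Rightarrow> nat) \<Rightarrow> nat \<Rightarrow> nat list" where
  "run s y 0 = s"
| "run s y (Suc n) = shift \<kappa> (y n) (run s y n)"

definition treatments :: "(nat \<Rightarrow> nat) set" where
  "treatments = {y. \<forall>i. y i \<in> {1..K}}"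

lemma shift_states: "x \<in> {1..K} \<Longrightarrow> s \<in> states \<kappa> K \<Longrightarrow> shift \<kappa> x s \<in> states \<kappa> K"
  using set_take_subset[of \<kappa> "x # s"] by (auto simp: states_def shift_def simp del: set_take_subset)

lemma run_states: "s \<in> states \<kappa> K \<Longrightarrow> y \<in> treatments \<Longrightarrow> run s y n \<in> states \<kappa> K"
  by (induction n) (auto simp: treatments_def intro!: shift_states)

lemma treatments_shift: "y \<in> treatments \<Longrightarrow> (\<lambda>i. y (n + i)) \<in> treatments"
  by (simp add: treatments_def)

lemma run_add: "run s y (m + n) = run (run s y m) (\<lambda>i. y (m + i)) n"
  by (induction n) auto

lemma run_Suc_shift: "run s y (Suc n) = run (shift \<kappa> (y 0) s) (\<lambda>i. y (Suc i)) n"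
  using run_add[of s y 1 n] by simp

lemma run_state_after: "run s y n = state_after \<kappa> s (map y [0..<n])"
  by (induction n) (auto simp: state_after_def)

lemma run_take: "length s = \<kappa> \<Longrightarrow> run s y n = take \<kappa> (map (\<lambda>i. y (n - 1 - i)) [0..<n] @ s)"
proof (induction n)
  case (Suc n)
  have "map (\<lambda>i. y (Suc n - 1 - i)) [0..<Suc n] = y n # map (\<lambda>i. y (n - 1 - i)) [0..<n]"
    by (simp add: map_upt_Suc del: upt_Suc)
  moreover have "take \<kappa> (a # take \<kappa> L) = take \<kappa> (a # L)" for a :: nat and L
    by (cases \<kappa>) (simp_all add: min_def)
  ultimately show ?case using Suc by (simp only: run.simps shift_def append_Cons)
qed simp

lemma run_recent: assumes "length s = \<kappa>" "\<kappa> \<le> n" shows "run s y n = map (\<lambda>i. y (n - 1 - i)) [0..<\<kappa>]"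
  using assms by (simp add: run_take take_map)

text \<open>States list treatments most recent first, so administering the reverse of the target
  fills the memory with it. Any state can thus be reached in \<kappa> steps; the additive \<kappa>
  in the comparisons below comes from here.\<close>

lemma state_after_reaches:
  assumes "s \<in> states \<kappa> K" "s' \<in> states \<kappa> K" shows "state_after \<kappa> s (rev s') = s'"
proof -
  let ?y = "\<lambda>i. rev s' ! i"
  have l: "length s = \<kappa>" "length s' = \<kappa>" using assms by (auto simp: states_def)
  have "rev s' = map ?y [0..<\<kappa>]" using l by (metis length_rev map_nth)
  then have "state_after \<kappa> s (rev s') = run s ?y \<kappa>" by (simp only: run_state_after)
  also have "\<dots> = map (\<lambda>i. ?y (\<kappa> - 1 - i)) [0..<\<kappa>]" using l by (simp add: run_recent)
  also have "\<dots> = s'" using l by (intro nth_equalityI) (auto simp: rev_nth)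
  finally show ?thesis .
qed

lemma finite_states: "finite (states \<kappa> K)" and card_states: "card (states \<kappa> K) = K ^ \<kappa>"
proof -
  have "states \<kappa> K = {xs. set xs \<subseteq> {1..K} \<and> length xs = \<kappa>}" by (auto simp: states_def)
  then show "finite (states \<kappa> K)" "card (states \<kappa> K) = K ^ \<kappa>"
    by (simp_all add: finite_lists_length_eq card_lists_length_eq)
qed

section \<open>Survival probabilities and the mean time to the change\<close>

definition survival :: "nat list \<Rightarrow> (nat \<Rightarrow> nat) \<Rightarrow> nat \<Rightarrow> real" where
  "survival s y n = (\<Prod>i<n. 1 - \<Psi> (y i) (run s y i))"

text \<open>The sum includes the empty product, hence exceeds the series in the definition of the
  optimal value by 1. Values in \<open>ennreal\<close> admit divergence.\<close>

definition mean_time :: "nat list \<Rightarrow> (nat \<Rightarrow> nat) \<Rightarrow> ennreal" where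
  "mean_time s y = (\<Sum>n. ennreal (survival s y n))"

definition min_time :: "nat list \<Rightarrow> ennreal" where
  "min_time s = (INF y\<in>treatments. mean_time s y)"

lemma \<Psi>_run: "s \<in> states \<kappa> K \<Longrightarrow> y \<in> treatments \<Longrightarrow> 0 \<le> \<Psi> (y i) (run s y i) \<and> \<Psi> (y i) (run s y i) < 1"
  by (intro \<Psi> run_states) (auto simp: treatments_def)

lemma survival_range: assumes "s \<in> states \<kappa> K" "y \<in> treatments" shows "0 < survival s y n" "survival s y n \<le> 1"
  unfolding survival_def using \<Psi>_run[OF assms] by (auto intro!: prod_pos prod_le_1 simp: less_imp_le)

lemma survival_Suc: "survival s y (Suc n) = (1 - \<Psi> (y 0) s) * survival (shift \<kappa> (y 0) s) (\<lambda>i. y (Suc i)) n"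
  unfolding survival_def prod.lessThan_Suc_shift using run_Suc_shift by simp

lemma mean_time_step:
  assumes "s \<in> states \<kappa> K" "y \<in> treatments"
  shows "mean_time s y = 1 + ennreal (1 - \<Psi> (y 0) s) * mean_time (shift \<kappa> (y 0) s) (\<lambda>i. y (Suc i))"
proof -
  have y: "y 0 \<in> {1..K}" using assms(2) by (simp add: treatments_def)
  have y': "(\<lambda>i. y (Suc i)) \<in> treatments" using treatments_shift[OF assms(2), of 1] by simp
  have c: "0 \<le> 1 - \<Psi> (y 0) s" using \<Psi>[OF y assms(1)] by simp
  have "mean_time s y = (\<Sum>n. ennreal (survival s y (Suc n))) + 1"
    unfolding mean_time_def using suminf_offset[of "\<lambda>n. ennreal (survival s y n)" 1] by (simp add: survival_def)
  also have "(\<Sum>n. ennreal (survival s y (Suc n))) = (\<Sum>n. ennreal (1 - \<Psi> (y 0) s) * ennreal (survival (shift \<kappa> (y 0) s) (\<lambda>i. y (Suc i)) n))"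
    using c survival_range[OF shift_states[OF y assms(1)] y'] by (simp add: survival_Suc ennreal_mult less_imp_le)
  also have "\<dots> = ennreal (1 - \<Psi> (y 0) s) * mean_time (shift \<kappa> (y 0) s) (\<lambda>i. y (Suc i))"
    by (simp add: mean_time_def)
  finally show ?thesis by (simp add: add.commute)
qed

lemma mean_time_shift_le:
  assumes "s \<in> states \<kappa> K" "y \<in> treatments"
  shows "mean_time s y \<le> of_nat n + mean_time (run s y n) (\<lambda>i. y (n + i))"
proof (induction n)
  case (Suc n)
  let ?s = "run s y n"
  have s: "?s \<in> states \<kappa> K" using assms by (rule run_states)
  have "mean_time ?s (\<lambda>i. y (n + i)) = 1 + ennreal (1 - \<Psi> (y n) ?s) * mean_time (run s y (Suc n)) (\<lambda>i. y (Suc n + i))"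
    using mean_time_step[OF s treatments_shift[OF assms(2)], of n] by simp
  also have "\<dots> \<le> 1 + 1 * mean_time (run s y (Suc n)) (\<lambda>i. y (Suc n + i))"
    using \<Psi>_run[OF assms, of n] by (intro add_left_mono mult_right_mono) (auto intro: order_trans[OF ennreal_leI[of _ 1]])
  finally have "of_nat n + mean_time ?s (\<lambda>i. y (n + i)) \<le> of_nat n + (1 + mean_time (run s y (Suc n)) (\<lambda>i. y (Suc n + i)))"
    by (intro add_left_mono) simp
  also have "\<dots> = of_nat (Suc n) + mean_time (run s y (Suc n)) (\<lambda>i. y (Suc n + i))" by (simp add: add_ac)
  finally show ?case using Suc by (rule order_trans[rotated])
qed simp

lemma treatments_case_nat: "x \<in> {1..K} \<Longrightarrow> y \<in> treatments \<Longrightarrow> case_nat x y \<in> treatments"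
  by (auto simp: treatments_def split: nat.split)

lemma min_time_le: "y \<in> treatments \<Longrightarrow> min_time s \<le> mean_time s y"
  unfolding min_time_def by (rule INF_lower)

text \<open>Half of the Bellman equation. Dividing by the positive factor reduces the claim to a
  bound for each single continuation, so that the infimum need not be pulled through the
  product.\<close>

lemma min_time_step:
  assumes x: "x \<in> {1..K}" and s: "s \<in> states \<kappa> K"
  shows "min_time s \<le> 1 + ennreal (1 - \<Psi> x s) * min_time (shift \<kappa> x s)"
proof -
  let ?c = "ennreal (1 - \<Psi> x s)"
  have c: "0 < ?c" "?c \<noteq> top" using \<Psi>[OF x s] by auto
  have "(min_time s - 1) / ?c \<le> min_time (shift \<kappa> x s)"
    unfolding min_time_def[of "shift \<kappa> x s"]
  proof (rule INF_greatest, rule divide_le_posI_ennreal[OF c(1)])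
    fix y assume y: "y \<in> treatments"
    have "min_time s \<le> mean_time s (case_nat x y)" by (intro min_time_le treatments_case_nat x y)
    also have "\<dots> = 1 + ?c * mean_time (shift \<kappa> x s) y"
      by (subst mean_time_step[OF s treatments_case_nat[OF x y]]) simp
    finally show "min_time s - 1 \<le> ?c * mean_time (shift \<kappa> x s) y"
      by (simp add: ennreal_minus_le_iff)
  qed
  then have "?c * ((min_time s - 1) / ?c) \<le> ?c * min_time (shift \<kappa> x s)" by (rule mult_left_mono) simp
  also have "?c * ((min_time s - 1) / ?c) = min_time s - 1"
    using c by (subst ennreal_times_divide, subst mult.commute, intro mult_divide_eq_ennreal) auto
  finally show ?thesis by (simp add: ennreal_minus_le_iff)
qed

lemma min_time_step_le: "x \<in> {1..K} \<Longrightarrow> s \<in> states \<kappa> K \<Longrightarrow> min_time s \<le> 1 + min_time (shift \<kappa> x s)"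
proof -
  assume x: "x \<in> {1..K}" and s: "s \<in> states \<kappa> K"
  have "ennreal (1 - \<Psi> x s) * min_time (shift \<kappa> x s) \<le> 1 * min_time (shift \<kappa> x s)"
    using \<Psi>[OF x s] by (intro mult_right_mono) (auto intro: order_trans[OF ennreal_leI[of _ 1]])
  then show ?thesis using min_time_step[OF x s] by (auto intro: order_trans add_left_mono)
qed

lemma min_time_state_after:
  "s \<in> states \<kappa> K \<Longrightarrow> set z \<subseteq> {1..K} \<Longrightarrow> min_time s \<le> of_nat (length z) + min_time (state_after \<kappa> s z)"
proof (induction z arbitrary: s)
  case (Cons x z)
  have x: "x \<in> {1..K}" using Cons.prems by simp
  have "min_time s \<le> 1 + min_time (shift \<kappa> x s)" by (rule min_time_step_le[OF x Cons.prems(1)])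
  also have "\<dots> \<le> 1 + (of_nat (length z) + min_time (state_after \<kappa> (shift \<kappa> x s) z))"
    using Cons by (intro add_left_mono Cons.IH shift_states) auto
  finally show ?case by (simp add: state_after_def add_ac)
qed (simp add: state_after_def)

lemma min_time_compare: "s \<in> states \<kappa> K \<Longrightarrow> s' \<in> states \<kappa> K \<Longrightarrow> min_time s \<le> of_nat \<kappa> + min_time s'"
  using min_time_state_after[of s "rev s'"] by (simp add: state_after_reaches) (auto simp: states_def)

lemma mean_time_ge_geometric:
  assumes s: "s \<in> states \<kappa> K" and y: "y \<in> treatments" and p: "0 < p" "\<And>x s. x \<in> {1..K} \<Longrightarrow> s \<in> states \<kappa> K \<Longrightarrow> \<Psi> x s \<le> p" "p \<le> 1"
  shows "ennreal (1 / p) \<le> mean_time s y"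
proof -
  have "ennreal (1 / p) = (\<Sum>n. ennreal ((1 - p) ^ n))"
    using geometric_sums[of "1 - p"] p by (intro suminf_ennreal_eq[symmetric]) auto
  also have "\<dots> \<le> mean_time s y"
    unfolding mean_time_def
  proof (intro suminf_le ennreal_leI)
    have "(1 - p) ^ n = (\<Prod>i<n. 1 - p)" for n by simp
    also have "\<dots> n \<le> survival s y n" for n
      unfolding survival_def using p run_states[OF s y] y by (intro prod_mono) (auto simp: treatments_def)
    finally show "(1 - p) ^ n \<le> survival s y n" for n .
  qed auto
  finally show ?thesis .
qed

lemma min_time_ge:
  assumes "s \<in> states \<kappa> K" "0 < p" "\<And>x s. x \<in> {1..K} \<Longrightarrow> s \<in> states \<kappa> K \<Longrightarrow> \<Psi> x s \<le> p" "p \<le> 1"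
  shows "ennreal (1 / p) \<le> min_time s"
  unfolding min_time_def by (intro INF_greatest mean_time_ge_geometric assms)

text \<open>Repeating a treatment that has change probability \<open>p\<close> in the state \<open>s'\<close>, with \<open>\<kappa>\<close> steps in between
  to return to \<open>s'\<close>, shows that the change occurs after at most \<open>(\<kappa> + 1) / p\<close> steps on average.\<close>

lemma min_time_bound:
  assumes s: "s \<in> states \<kappa> K" and x': "x' \<in> {1..K}" and s': "s' \<in> states \<kappa> K" and p: "\<Psi> x' s' = p" "0 < p"
  shows "min_time s \<le> ennreal ((\<kappa> + 1) / p)"
proof -
  \<comment> \<open>Partial sums are finite, so they can be subtracted in an inequality; the series
    is not yet known to converge.\<close>
  define psum where "psum s y n = (\<Sum>k<n. survival s y k)" for s y n
  have psum_mono: "psum s y m \<le> psum s y n" if "m \<le> n" "s \<in> states \<kappa> K" "y \<in> treatments" for s y m n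
    unfolding psum_def using that survival_range by (intro sum_mono2) (auto intro: less_imp_le)
  have psum_Suc: "psum s y (Suc n) = 1 + (1 - \<Psi> (y 0) s) * psum (shift \<kappa> (y 0) s) (\<lambda>i. y (Suc i)) n" for s y n
    unfolding psum_def sum.lessThan_Suc_shift by (simp add: survival_Suc sum_distrib_left) (simp add: survival_def)
  have psum_shift: "psum s y n \<le> real m + psum (run s y m) (\<lambda>i. y (m + i)) n"
    if "s \<in> states \<kappa> K" "y \<in> treatments" for s y m n
  proof (induction m)
    case (Suc m)
    let ?s = "run s y m" and ?y = "\<lambda>i. y (m + i)"
    have sy: "?s \<in> states \<kappa> K" "?y \<in> treatments" using that by (auto intro: run_states treatments_shift)
    have sy': "run s y (Suc m) \<in> states \<kappa> K" "(\<lambda>i. y (Suc m + i)) \<in> treatments"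
      using that by (blast intro: run_states treatments_shift)+
    have "psum ?s ?y n \<le> psum ?s ?y (Suc n)" by (rule psum_mono[OF _ sy]) simp
    also have "\<dots> = 1 + (1 - \<Psi> (y m) ?s) * psum (run s y (Suc m)) (\<lambda>i. y (Suc m + i)) n"
      by (simp add: psum_Suc)
    also have "\<dots> \<le> 1 + 1 * psum (run s y (Suc m)) (\<lambda>i. y (Suc m + i)) n"
    proof (intro add_left_mono mult_right_mono)
      show "0 \<le> psum (run s y (Suc m)) (\<lambda>i. y (Suc m + i)) n"
        unfolding psum_def by (intro sum_nonneg less_imp_le[OF survival_range(1)[OF sy']])
    qed (use \<Psi>_run[OF that, of m] in simp)
    finally show ?case using Suc by simp
  qed simp
  define y where "y i = (x' # rev s') ! (i mod (\<kappa> + 1))" for i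
  have len: "length s' = \<kappa>" "length s = \<kappa>" using s s' by (auto simp: states_def)
  have y: "y \<in> treatments"
  proof -
    have "y i \<in> set (x' # rev s')" for i unfolding y_def using len by (intro nth_mem) simp
    then show ?thesis using x' s' by (fastforce simp: treatments_def states_def)
  qed
  have y_period: "(\<lambda>i. y (Suc \<kappa> + i)) = y"
  proof
    fix i
    have "(Suc \<kappa> + i) mod (\<kappa> + 1) = i mod (\<kappa> + 1)" by (metis Suc_eq_plus1 mod_add_self1)
    then show "y (Suc \<kappa> + i) = y i" by (simp only: y_def)
  qed
  have y0: "y 0 = x'" by (simp add: y_def)
  have cycle: "run s' y (Suc \<kappa>) = s'"
  proof -
    have "run s' y (Suc \<kappa>) = map (\<lambda>i. y (Suc \<kappa> - 1 - i)) [0..<\<kappa>]" using len by (intro run_recent) auto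
    also have "\<dots> = s'" using len
      by (intro nth_equalityI) (auto simp: y_def nth_Cons' rev_nth)
    finally show ?thesis .
  qed
  \<comment> \<open>One period starting at \<open>s'\<close> gives P \<le> 1 + (1 - p) (\<kappa> +
    P) for a partial sum P, and this is solved for P.\<close>
  have Pn: "psum s' y n \<le> (\<kappa> + 1) / p - \<kappa>" for n
  proof -
    have "psum s' y n \<le> psum s' y (Suc n)" by (rule psum_mono[OF _ s' y]) simp
    also have "\<dots> = 1 + (1 - p) * psum (run s' y 1) (\<lambda>i. y (1 + i)) n" using p y0 by (simp add: psum_Suc)
    also have "\<dots> \<le> 1 + (1 - p) * (\<kappa> + psum s' y n)"
    proof (intro add_left_mono mult_left_mono)
      have "psum (run s' y 1) (\<lambda>i. y (1 + i)) n \<le> real \<kappa> + psum (run (run s' y 1) (\<lambda>i. y (1 + i)) \<kappa>) (\<lambda>i. y (1 + (\<kappa> + i))) n"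
        by (rule psum_shift) (use run_states[OF s' y, of 1] treatments_shift[OF y, of 1] in auto)
      also have "run (run s' y 1) (\<lambda>i. y (1 + i)) \<kappa> = s'" using run_add[of s' y 1 \<kappa>] cycle by simp
      also have "(\<lambda>i. y (1 + (\<kappa> + i))) = y" using y_period by simp
      finally show "psum (run s' y 1) (\<lambda>i. y (1 + i)) n \<le> \<kappa> + psum s' y n" .
    qed (use \<Psi>[OF x' s'] p in simp)
    finally have "p * psum s' y n \<le> 1 + (1 - p) * \<kappa>" by (simp add: algebra_simps)
    then have "psum s' y n \<le> (1 + (1 - p) * \<kappa>) / p" using p by (simp add: pos_le_divide_eq mult.commute)
    also have "\<dots> = (\<kappa> + 1) / p - \<kappa>" using p by (simp add: field_simps)
    finally show ?thesis .
  qed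
  have "mean_time s' y \<le> ennreal ((\<kappa> + 1) / p - \<kappa>)"
    unfolding mean_time_def
  proof (rule suminf_le_const)
    fix n
    have "(\<Sum>k<n. ennreal (survival s' y k)) = ennreal (psum s' y n)"
      unfolding psum_def using survival_range[OF s' y] by (intro sum_ennreal) (simp add: less_imp_le)
    also have "\<dots> \<le> ennreal ((\<kappa> + 1) / p - \<kappa>)" by (intro ennreal_leI Pn)
    finally show "(\<Sum>k<n. ennreal (survival s' y k)) \<le> ennreal ((\<kappa> + 1) / p - \<kappa>)" .
  qed simp
  with min_time_le[OF y] have "min_time s' \<le> ennreal ((\<kappa> + 1) / p - \<kappa>)" by (rule order_trans)
  then have "of_nat \<kappa> + min_time s' \<le> of_nat \<kappa> + ennreal ((\<kappa> + 1) / p - \<kappa>)" by (rule add_left_mono)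
  also have "\<dots> = ennreal ((\<kappa> + 1) / p)"
  proof -
    have "0 \<le> (\<kappa> + 1) / p - \<kappa>" using Pn[of 0] by (simp add: psum_def)
    then show ?thesis by (simp add: ennreal_of_nat_eq_real_of_nat ennreal_plus[symmetric] del: ennreal_plus)
  qed
  finally show ?thesis using min_time_compare[OF s s'] by (rule order_trans[rotated])
qed

lemma mean_time_series:
  assumes s: "s \<in> states \<kappa> K" and x: "\<forall>t\<ge>1. x t \<in> {1..K}"
  shows "1 + (\<Sum>t. ereal (\<Prod>r=1..Suc t. 1 - \<Psi> (x r) (state_after \<kappa> s (map x [1..<r])))) = enn2ereal (mean_time s (\<lambda>i. x (Suc i)))"
    and "0 \<le> (\<Sum>t. ereal (\<Prod>r=1..Suc t. 1 - \<Psi> (x r) (state_after \<kappa> s (map x [1..<r]))))"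
proof -
  let ?S = "\<Sum>t. ereal (\<Prod>r=1..Suc t. 1 - \<Psi> (x r) (state_after \<kappa> s (map x [1..<r])))"
  let ?y = "\<lambda>i. x (Suc i)"
  have y: "?y \<in> treatments" using x by (auto simp: treatments_def)
  have prod: "(\<Prod>r=1..Suc t. 1 - \<Psi> (x r) (state_after \<kappa> s (map x [1..<r]))) = survival s ?y (Suc t)" for t
  proof -
    have "(\<Prod>r=1..Suc t. 1 - \<Psi> (x r) (state_after \<kappa> s (map x [1..<r]))) =
       (\<Prod>i<Suc t. 1 - \<Psi> (x (Suc i)) (state_after \<kappa> s (map x [1..<Suc i])))"
      by (rule prod.reindex_bij_witness[of _ Suc "\<lambda>r. r - 1"]) auto
    also have "\<dots> = survival s ?y (Suc t)"
      unfolding survival_def run_state_after map_Suc_upt[symmetric] One_nat_def by (simp add: comp_def)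
    finally show ?thesis .
  qed
  have S: "?S = enn2ereal (\<Sum>t. ennreal (survival s ?y (Suc t)))"
    unfolding prod using survival_range[OF s y] by (simp add: suminf_enn2ereal[symmetric] less_imp_le del: suminf_enn2ereal)
  show "0 \<le> ?S" unfolding S by simp
  have "mean_time s ?y = 1 + (\<Sum>t. ennreal (survival s ?y (Suc t)))"
    unfolding mean_time_def using suminf_offset[of "\<lambda>n. ennreal (survival s ?y n)" 1] by (simp add: survival_def add.commute)
  then show "1 + ?S = enn2ereal (mean_time s ?y)" unfolding S by (simp add: plus_ennreal.rep_eq one_ennreal.rep_eq)
qed

lemma mean_change_value_eq: assumes s: "s \<in> states \<kappa> K" shows "1 + mean_change_value \<kappa> K \<Psi> s = enn2ereal (min_time s)"
proof -
  let ?A = "{x :: nat \<Rightarrow> nat. \<forall>t\<ge>1. x t \<in> {1..K}}"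
  let ?S = "\<lambda>x. \<Sum>t. ereal (\<Prod>r=1..Suc t. 1 - \<Psi> (x r) (state_after \<kappa> s (map x [1..<r])))"
  have eq: "1 + ?S x = enn2ereal (mean_time s (\<lambda>i. x (Suc i)))" and nn: "0 \<le> ?S x" if "x \<in> ?A" for x
    using mean_time_series[OF s, of x] that by auto
  have ne: "?A \<noteq> {}" using K by (auto intro!: exI[of _ "\<lambda>_. 1"])
  have "1 + mean_change_value \<kappa> K \<Psi> s = (INF x\<in>?A. 1 + ?S x)"
    unfolding mean_change_value_def using ne nn by (intro INF_ereal_add_right[symmetric]) auto
  also have "\<dots> = (INF x\<in>?A. enn2ereal (mean_time s (\<lambda>i. x (Suc i))))" by (intro INF_cong refl eq)
  also have "\<dots> = Inf (enn2ereal ` ((\<lambda>x. mean_time s (\<lambda>i. x (Suc i))) ` ?A))" by (simp add: image_comp comp_def)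
  also have "(\<lambda>x. mean_time s (\<lambda>i. x (Suc i))) ` ?A = mean_time s ` treatments"
  proof safe
    fix x :: "nat \<Rightarrow> nat" assume "\<forall>t\<ge>1. x t \<in> {1..K}"
    then show "mean_time s (\<lambda>i. x (Suc i)) \<in> mean_time s ` treatments"
      by (intro imageI) (auto simp: treatments_def)
  next
    fix y assume "y \<in> treatments"
    then show "mean_time s y \<in> (\<lambda>x. mean_time s (\<lambda>i. x (Suc i))) ` ?A"
      by (intro image_eqI[of _ _ "\<lambda>i. y (i - 1)"]) (auto simp: treatments_def)
  qed
  also have "Inf (enn2ereal ` (mean_time s ` treatments)) = enn2ereal (min_time s)"
    unfolding min_time_def by (simp add: Inf_ennreal.rep_eq)
  finally show ?thesis .
qed

end

section \<open>Stationary policies and their cycles\<close>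

lemma policy_state_Suc: "policy_state \<kappa> \<upsilon> s (Suc t) = shift \<kappa> (\<upsilon> (policy_state \<kappa> \<upsilon> s t)) (policy_state \<kappa> \<upsilon> s t)"
  by (simp add: policy_state_def)

locale stationary_policy = memory_model +
  fixes \<upsilon> :: "nat list \<Rightarrow> nat" and s\<^sub>0 :: "nat list"
  assumes \<upsilon>: "\<And>s. s \<in> states \<kappa> K \<Longrightarrow> \<upsilon> s \<in> {1..K}" and s0: "s\<^sub>0 \<in> states \<kappa> K"
begin

abbreviation "pstate \<equiv> policy_state \<kappa> \<upsilon> s\<^sub>0"
definition "plan n = policy_treatment \<kappa> \<upsilon> s\<^sub>0 (Suc n)"
abbreviation "start \<equiv> cycle_start \<kappa> \<upsilon> s\<^sub>0"
abbreviation "recur \<equiv> first_return \<kappa> \<upsilon> s\<^sub>0"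
abbreviation "block \<equiv> policy_block \<kappa> \<upsilon> s\<^sub>0"
abbreviation "lead_in \<equiv> policy_prefix \<kappa> \<upsilon> s\<^sub>0"

lemma plan_eq: "plan n = \<upsilon> (pstate n)"
  by (simp add: plan_def policy_treatment_def)

lemma pstate_0 [simp]: "pstate 0 = s\<^sub>0" by (simp add: policy_state_def)

lemma pstate_states: "pstate n \<in> states \<kappa> K"
  by (induction n) (auto simp: s0 policy_state_Suc intro!: shift_states \<upsilon>)

lemma plan_treatments: "plan \<in> treatments"
  using \<upsilon>[OF pstate_states] by (simp add: treatments_def plan_eq)

lemma run_plan: "run s\<^sub>0 plan n = pstate n"
  by (induction n) (auto simp: policy_state_Suc plan_eq)

lemma run_plan_from: "run (pstate m) (\<lambda>i. plan (m + i)) n = pstate (m + n)"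
  unfolding run_plan[symmetric] run_add ..

lemma pstate_determined: "pstate m = pstate n \<Longrightarrow> pstate (m + i) = pstate (n + i)"
  by (induction i) (auto simp: policy_state_Suc)

text \<open>Pigeonhole on the K^\<kappa> states. The explicit bound makes the block lengths, and
  with them all later constants, independent of the link function.\<close>

lemma recur_spec: "1 \<le> recur" "\<exists>l<recur. pstate recur = pstate l" "recur \<le> K ^ \<kappa>"
proof -
  let ?Q = "\<lambda>u. 1 \<le> u \<and> (\<exists>l<u. pstate u = pstate l)"
  have "\<not> inj_on pstate {..K ^ \<kappa>}"
  proof
    assume "inj_on pstate {..K ^ \<kappa>}"
    then have "card {..K ^ \<kappa>} \<le> card (states \<kappa> K)"
      by (rule card_inj_on_le) (use pstate_states finite_states in auto)
    then show False by (simp add: card_states)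
  qed
  then obtain a b where "a \<le> K ^ \<kappa>" "b \<le> K ^ \<kappa>" "a < b" "pstate a = pstate b"
    unfolding inj_on_def by (metis atMost_iff linorder_neqE_nat)
  then have Q: "?Q b" "b \<le> K ^ \<kappa>" by auto
  have "?Q recur" unfolding first_return_def by (rule LeastI[of ?Q, OF Q(1)])
  then show "1 \<le> recur" "\<exists>l<recur. pstate recur = pstate l" by auto
  show "recur \<le> K ^ \<kappa>" unfolding first_return_def using Least_le[of ?Q, OF Q(1)] Q(2) by linarith
qed

text \<open>A second earlier occurrence of the recurring state would be an even earlier return; this
  uniqueness gives the \<open>THE\<close> in \<open>cycle_start\<close> its meaning.\<close>

lemma start_spec: "start < recur" "pstate start = pstate recur"
proof -
  obtain l where l: "l < recur" "pstate recur = pstate l" using recur_spec(2) by blast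
  have unique: "l' = l" if l': "l' < recur" "pstate l' = pstate recur" for l'
  proof (rule ccontr)
    assume "l' \<noteq> l"
    define b a where "b = max l l'" and "a = min l l'"
    then have ab: "a < b" "b < recur" "pstate b = pstate a" using l l' \<open>l' \<noteq> l\<close> by (auto simp: max_def min_def)
    then have "recur \<le> b" unfolding first_return_def by (intro Least_le) auto
    then show False using ab by simp
  qed
  have "start < recur \<and> pstate start = pstate recur"
    unfolding cycle_start_def
  proof (rule theI)
    show "l < recur \<and> pstate l = pstate recur" using l(1) l(2)[symmetric] by (rule conjI)
    show "l' = l" if "l' < recur \<and> pstate l' = pstate recur" for l' using that unique by blast
  qed
  then show "start < recur" "pstate start = pstate recur" by auto
qed

lemma length_lead_in: "length lead_in = start" by (simp add: policy_prefix_def)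
lemma length_block: "length block = recur - start"
  using start_spec(1) by (simp add: policy_block_def del: upt_Suc)
lemma block_nonempty: "block \<noteq> []" using length_block start_spec(1) by auto

lemma length_bounds: "length lead_in \<le> K ^ \<kappa>" "length block \<le> K ^ \<kappa>"
  using length_lead_in length_block start_spec(1) recur_spec(3) by auto

lemma lead_in_nth: "n < start \<Longrightarrow> lead_in ! n = plan n"
  by (simp add: policy_prefix_def plan_def nth_upt del: upt_Suc)

lemma block_nth: "n < recur - start \<Longrightarrow> block ! n = plan (start + n)"
  by (simp add: policy_block_def plan_def nth_upt del: upt_Suc)

lemma plan_periodic: "plan (start + (n + k * (recur - start))) = plan (start + n)"
proof (induction k)
  case (Suc k)
  have "pstate (recur + m) = pstate (start + m)" for m
    using pstate_determined[OF start_spec(2)[symmetric]] .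
  from this[of "n + k * (recur - start)"] have "plan (recur + (n + k * (recur - start))) = plan (start + (n + k * (recur - start)))"
    by (simp add: plan_eq)
  moreover have "start + (n + Suc k * (recur - start)) = recur + (n + k * (recur - start))" using start_spec(1) by simp
  ultimately show ?case using Suc by (simp only:)
qed simp

lemma cyc_block: "cyc block (int (Suc n)) = plan (start + n)"
proof -
  let ?l = "recur - start"
  have l: "0 < ?l" using start_spec(1) by simp
  have "cyc block (int (Suc n)) = block ! (n mod ?l)"
    unfolding cyc_def length_block by (simp add: zmod_int[symmetric])
  also have "\<dots> = plan (start + n mod ?l)" using l by (intro block_nth) simp
  also have "\<dots> = plan (start + (n mod ?l + (n div ?l) * ?l))" by (simp only: plan_periodic)
  finally show ?thesis by (simp only: mod_div_mult_eq)
qed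

lemma lead_in_range: "set lead_in \<subseteq> {1..K}" and block_range: "set block \<subseteq> {1..K}"
  using \<upsilon>[OF pstate_states] by (auto simp: policy_prefix_def policy_block_def policy_treatment_def simp del: upt_Suc)

end

section \<open>Drifts and rewards\<close>

lemma cyc_period: "cyc \<Xi> (j + int (length \<Xi>)) = cyc \<Xi> j"
proof -
  have "(j + int (length \<Xi>) - 1) mod int (length \<Xi>) = (j - 1 + int (length \<Xi>)) mod int (length \<Xi>)"
    by (simp add: algebra_simps)
  then show ?thesis by (simp add: cyc_def)
qed

lemma cyc_nth: "i < length \<Xi> \<Longrightarrow> cyc \<Xi> (int (Suc i)) = \<Xi> ! i"
  by (simp add: cyc_def)

definition block_sequence :: "nat list \<Rightarrow> nat \<Rightarrow> nat" where
  "block_sequence \<Xi> i = cyc \<Xi> (int (Suc i))"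

lemma sum_full_period:
  fixes \<rho> :: "nat \<Rightarrow> real"
  assumes "\<And>n. \<rho> (n + l) = \<rho> n"
  shows "(\<Sum>k<l. \<rho> (c + k)) = (\<Sum>k<l. \<rho> k)"
proof (induction c)
  case (Suc c)
  show ?case
  proof (cases l)
    case (Suc m)
    have "(\<Sum>k<l. \<rho> (Suc c + k)) = (\<Sum>k<m. \<rho> (c + Suc k)) + \<rho> (c + l)"
      unfolding Suc by simp
    also have "\<dots> = \<rho> (c + 0) + (\<Sum>k<m. \<rho> (c + Suc k))" using assms[of c] by simp
    also have "\<dots> = (\<Sum>k<l. \<rho> (c + k))" unfolding Suc sum.lessThan_Suc_shift ..
    finally show ?thesis using \<open>(\<Sum>k<l. \<rho> (c + k)) = (\<Sum>k<l. \<rho> k)\<close> by simp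
  qed simp
qed simp

text \<open>Full periods contribute 0, and an incomplete one at most D per step because rewards are
  nonnegative.\<close>

lemma periodic_deficit_le:
  fixes \<rho> :: "nat \<Rightarrow> real"
  assumes per: "\<And>n. \<rho> (n + l) = \<rho> n" and sum: "(\<Sum>k<l. \<rho> k) = real l * D" and nn: "\<And>n. 0 \<le> \<rho> n" "0 \<le> D" "0 < l"
  shows "(\<Sum>j<n. D - \<rho> (b + j)) \<le> real l * D"
proof (induction n rule: less_induct)
  case (less n)
  show ?case
  proof (cases "n < l")
    case True
    have "(\<Sum>j<n. D - \<rho> (b + j)) \<le> (\<Sum>j<n. D)" using nn by (intro sum_mono) simp
    also have "\<dots> \<le> real l * D" using True nn by (simp add: mult_right_mono)
    finally show ?thesis .
  next
    case False
    then obtain m where n: "n = m + l" by (metis le_add_diff_inverse2 not_less)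
    have "(\<Sum>j<m + l. D - \<rho> (b + j)) = (\<Sum>j<m. D - \<rho> (b + j)) + (\<Sum>k<l. D - \<rho> (b + (m + k)))"
      by (induction l) auto
    also have "(\<Sum>k<l. D - \<rho> (b + (m + k))) = 0"
    proof -
      have "(\<Sum>k<l. \<rho> ((b + m) + k)) = (\<Sum>k<l. \<rho> k)" by (rule sum_full_period) (rule per)
      then show ?thesis using sum by (simp add: sum_subtractf add.assoc)
    qed
    finally show ?thesis using less.IH[of m] n nn by simp
  qed
qed

text \<open>Following the initial sequence and then the cyclic block reproduces the stationary
  policy for all times.\<close>

lemma (in stationary_policy) acc_treatment_plan: "staged_rule.acc_treatment lead_in block n = plan n"
proof -
  \<comment> \<open>The second block and the thresholds are placeholders;
    \<open>acc_treatment\<close> does not involve them.\<close>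
  interpret staged_rule lead_in block block 0 0 0 by standard simp
  show ?thesis
  proof (cases "n < start")
    case True
    then show ?thesis by (simp add: acc_treatment_def length_lead_in lead_in_nth)
  next
    case False
    then have "int (Suc n) - int start = int (Suc (n - start))" by simp
    then have "cyc block (int (Suc n) - int start) = plan n" using False cyc_block[of "n - start"] by (simp del: of_nat_Suc)
    then show ?thesis using False by (simp add: acc_treatment_def length_lead_in del: of_nat_Suc)
  qed
qed

lemma (in stationary_policy) block_sequence_plan: "block_sequence block i = plan (start + i)"
  unfolding block_sequence_def by (rule cyc_block)

context memory_model
begin

lemma arg_min_imp:
  assumes s: "s \<in> states \<kappa> K"
    and m: "is_arg_min (\<lambda>x. ereal (1 - \<Psi> x s) * (1 + mean_change_value \<kappa> K \<Psi> (shift \<kappa> x s))) (\<lambda>x. x \<in> {1..K}) v"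
  shows "v \<in> {1..K}" and "x \<in> {1..K} \<Longrightarrow> ennreal (1 - \<Psi> v s) * min_time (shift \<kappa> v s) \<le> ennreal (1 - \<Psi> x s) * min_time (shift \<kappa> x s)"
proof -
  show v: "v \<in> {1..K}" using m by (simp add: is_arg_min_def)
  have eq: "ereal (1 - \<Psi> x s) * (1 + mean_change_value \<kappa> K \<Psi> (shift \<kappa> x s)) = enn2ereal (ennreal (1 - \<Psi> x s) * min_time (shift \<kappa> x s))"
    if "x \<in> {1..K}" for x
    using \<Psi>[OF that s] by (simp add: mean_change_value_eq[OF shift_states[OF that s]] times_ennreal.rep_eq enn2ereal_ennreal)
  assume x: "x \<in> {1..K}"
  then have "\<not> ereal (1 - \<Psi> x s) * (1 + mean_change_value \<kappa> K \<Psi> (shift \<kappa> x s)) < ereal (1 - \<Psi> v s) * (1 + mean_change_value \<kappa> K \<Psi> (shift \<kappa> v s))"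
    using m by (auto simp: is_arg_min_def)
  then show "ennreal (1 - \<Psi> v s) * min_time (shift \<kappa> v s) \<le> ennreal (1 - \<Psi> x s) * min_time (shift \<kappa> x s)"
    unfolding eq[OF x] eq[OF v] by (simp add: not_less less_eq_ennreal.rep_eq)
qed

text \<open>Every state is the end of some prehistory, so the supremum over prehistories is one over
  states.\<close>

lemma mean_time_block_le_worst:
  assumes s: "s \<in> states \<kappa> K" and s0: "s\<^sub>0 \<in> states \<kappa> K" and \<Xi>: "\<Xi> \<noteq> []" "set \<Xi> \<subseteq> {1..K}"
  shows "enn2ereal (mean_time s (block_sequence \<Xi>)) \<le> worst_mean_change K (memory_link \<kappa> \<Psi> s\<^sub>0 \<pi>\<^sub>0) \<Xi>"
    and "(\<And>s. s \<in> states \<kappa> K \<Longrightarrow> mean_time s (block_sequence \<Xi>) \<le> B) \<Longrightarrow> worst_mean_change K (memory_link \<kappa> \<Psi> s\<^sub>0 \<pi>\<^sub>0) \<Xi> \<le> enn2ereal B"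
proof -
  let ?x = "\<lambda>i. cyc \<Xi> (int i)"
  have x: "\<forall>t\<ge>1. ?x t \<in> {1..K}" using cyc_range[OF \<Xi>] by auto
  have st: "state_after \<kappa> s\<^sub>0 z \<in> states \<kappa> K" if "set z \<subseteq> {1..K}" for z
    using that s0 
  proof (induction z arbitrary: s\<^sub>0)
    case (Cons a z)
    then show ?case using Cons.IH[OF _ shift_states[of a s\<^sub>0]] by (simp add: state_after_def)
  qed (simp add: state_after_def)
  have eq: "1 + (\<Sum>t. ereal (\<Prod>s=1..Suc t. 1 - memory_link \<kappa> \<Psi> s\<^sub>0 \<pi>\<^sub>0 (z @ map ?x [1..<Suc s]))) =
      enn2ereal (mean_time (state_after \<kappa> s\<^sub>0 z) (block_sequence \<Xi>))" if "z \<in> lists {1..K}" for z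
  proof -
    have "memory_link \<kappa> \<Psi> s\<^sub>0 \<pi>\<^sub>0 (z @ map ?x [1..<Suc s]) = \<Psi> (?x s) (state_after \<kappa> (state_after \<kappa> s\<^sub>0 z) (map ?x [1..<s]))"
      if "s \<in> {1..Suc t}" for s t
      using that by (simp add: memory_link_def butlast_append state_after_def)
    then have "(\<Prod>s=1..Suc t. 1 - memory_link \<kappa> \<Psi> s\<^sub>0 \<pi>\<^sub>0 (z @ map ?x [1..<Suc s])) =
      (\<Prod>s=1..Suc t. 1 - \<Psi> (?x s) (state_after \<kappa> (state_after \<kappa> s\<^sub>0 z) (map ?x [1..<s])))" for t
      by (intro prod.cong refl) (simp only:)
    then show ?thesis
      using mean_time_series(1)[OF st x, of z] that by (simp add: block_sequence_def[abs_def] lists_eq_set)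
  qed
  have w: "worst_mean_change K (memory_link \<kappa> \<Psi> s\<^sub>0 \<pi>\<^sub>0) \<Xi> = (SUP z\<in>lists {1..K}. enn2ereal (mean_time (state_after \<kappa> s\<^sub>0 z) (block_sequence \<Xi>)))"
    unfolding worst_mean_change_def by (intro SUP_cong refl eq)
  have "rev s \<in> lists {1..K}" using s by (auto simp: states_def)
  then have "enn2ereal (mean_time (state_after \<kappa> s\<^sub>0 (rev s)) (block_sequence \<Xi>)) \<le> worst_mean_change K (memory_link \<kappa> \<Psi> s\<^sub>0 \<pi>\<^sub>0) \<Xi>"
    unfolding w by (intro SUP_upper)
  then show "enn2ereal (mean_time s (block_sequence \<Xi>)) \<le> worst_mean_change K (memory_link \<kappa> \<Psi> s\<^sub>0 \<pi>\<^sub>0) \<Xi>"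
    by (simp only: state_after_reaches[OF s0 s])
  assume B: "\<And>s. s \<in> states \<kappa> K \<Longrightarrow> mean_time s (block_sequence \<Xi>) \<le> B"
  show "worst_mean_change K (memory_link \<kappa> \<Psi> s\<^sub>0 \<pi>\<^sub>0) \<Xi> \<le> enn2ereal B"
    unfolding w by (intro SUP_least) (use B st in \<open>auto simp: less_eq_ennreal.rep_eq[symmetric] lists_eq_set\<close>)
qed

section \<open>Rewards, average drifts and correctors\<close>

definition reward :: "(nat \<Rightarrow> real) \<Rightarrow> nat \<Rightarrow> nat list \<Rightarrow> real" where
  "reward I x s = I x + survival_rate (\<Psi> x s)"

definition block_reward :: "(nat \<Rightarrow> real) \<Rightarrow> nat list \<Rightarrow> nat \<Rightarrow> real" where
  "block_reward I \<Xi> n = reward I (cyc \<Xi> (int (Suc n))) (map (\<lambda>i. cyc \<Xi> (int (Suc n) - int i)) [1..<Suc \<kappa>])"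

definition drift :: "(nat \<Rightarrow> real) \<Rightarrow> nat list \<Rightarrow> real" where
  "drift I \<Xi> = block_average I \<Xi> + block_drift \<kappa> \<Psi> \<Xi>"

lemma block_reward_period: "block_reward I \<Xi> (n + length \<Xi>) = block_reward I \<Xi> n"
proof -
  have "int (Suc (n + length \<Xi>)) - int i = (int (Suc n) - int i) + int (length \<Xi>)" for i by simp
  then have "cyc \<Xi> (int (Suc (n + length \<Xi>)) - int i) = cyc \<Xi> (int (Suc n) - int i)" for i by (simp only: cyc_period)
  from this this[of 0] show ?thesis by (simp add: block_reward_def del: of_nat_Suc)
qed

lemma sum_block_reward: assumes "\<Xi> \<noteq> []" shows "(\<Sum>n<length \<Xi>. block_reward I \<Xi> n) = real (length \<Xi>) * drift I \<Xi>"
proof -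
  have "(\<Sum>n<length \<Xi>. block_reward I \<Xi> n) = (\<Sum>n<length \<Xi>. I (\<Xi> ! n)) +
     (\<Sum>n<length \<Xi>. survival_rate (\<Psi> (cyc \<Xi> (int (Suc n))) (map (\<lambda>i. cyc \<Xi> (int (Suc n) - int i)) [1..<Suc \<kappa>])))"
    unfolding block_reward_def reward_def sum.distrib by (intro arg_cong2[where f="(+)"] sum.cong refl) (simp add: cyc_nth del: of_nat_Suc)
  also have "(\<Sum>n<length \<Xi>. survival_rate (\<Psi> (cyc \<Xi> (int (Suc n))) (map (\<lambda>i. cyc \<Xi> (int (Suc n) - int i)) [1..<Suc \<kappa>]))) =
     (\<Sum>j=1..length \<Xi>. survival_rate (\<Psi> (cyc \<Xi> (int j)) (map (\<lambda>i. cyc \<Xi> (int j - int i)) [1..<Suc \<kappa>])))"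
    by (rule sum.reindex_bij_witness[of _ "\<lambda>j. j - 1" Suc]) auto
  finally show ?thesis using assms by (simp add: drift_def block_average_def block_drift_def field_simps del: upt_Suc)
qed

definition path_reward :: "(nat \<Rightarrow> real) \<Rightarrow> nat list \<Rightarrow> (nat \<Rightarrow> nat) \<Rightarrow> nat \<Rightarrow> real" where
  "path_reward I s y n = reward I (y n) (run s y n)"

text \<open>After \<kappa> steps within a block the memory contains nothing but entries of the
  block.\<close>

lemma path_reward_block:
  assumes s: "s \<in> states \<kappa> K" and y: "\<And>i. m \<le> i \<Longrightarrow> y i = block_sequence \<Xi> (a + (i - m))" and i: "m + \<kappa> \<le> i"
  shows "path_reward I s y i = block_reward I \<Xi> (a + (i - m))"
proof -
  have "run s y i = map (\<lambda>j. y (i - 1 - j)) [0..<\<kappa>]" using s i by (intro run_recent) (auto simp: states_def)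
  also have "\<dots> = map (\<lambda>j. cyc \<Xi> (int (Suc (a + (i - m))) - int j)) (map Suc [0..<\<kappa>])"
  proof (simp only: map_map comp_def, rule map_cong[OF refl])
    fix j assume "j \<in> set [0..<\<kappa>]"
    then have j: "m \<le> i - 1 - j" "j < \<kappa>" using i by auto
    have "int (Suc (a + (i - 1 - j - m))) = int (Suc (a + (i - m))) - int (Suc j)" using i j by simp
    then show "y (i - 1 - j) = cyc \<Xi> (int (Suc (a + (i - m))) - int (Suc j))"
      unfolding y[OF j(1)] block_sequence_def by (simp only:)
  qed
  also have "map Suc [0..<\<kappa>] = [1..<Suc \<kappa>]" by (simp add: map_Suc_upt del: upt_Suc)
  finally show ?thesis
    unfolding path_reward_def block_reward_def using i by (simp only: y block_sequence_def)
qed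

lemma reward_nonneg: "0 \<le> I x \<Longrightarrow> 0 \<le> reward I x s"
  by (simp add: reward_def survival_rate_def)

definition deficit :: "(nat \<Rightarrow> real) \<Rightarrow> real \<Rightarrow> nat list \<Rightarrow> (nat \<Rightarrow> nat) \<Rightarrow> nat \<Rightarrow> real" where
  "deficit I D s y n = (\<Sum>i<n. D - path_reward I s y i)"

text \<open>A supersolution of the Poisson equation: removing the first step shifts all partial sums
  by D minus the reward. Added to a Lyapunov function, it makes each step count as if it earned at
  least the average D.\<close>

definition corrector :: "(nat \<Rightarrow> real) \<Rightarrow> real \<Rightarrow> nat list \<Rightarrow> (nat \<Rightarrow> nat) \<Rightarrow> real" where
  "corrector I D s y = (SUP n. deficit I D s y n)"

text \<open>The first m + \<kappa> steps are charged in full; after that the rewards are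
  periodic.\<close>

lemma deficit_le:
  assumes s: "s \<in> states \<kappa> K" and \<Xi>: "\<Xi> \<noteq> []" and y: "y \<in> treatments" "\<And>i. m \<le> i \<Longrightarrow> y i = block_sequence \<Xi> (a + (i - m))"
    and I: "\<And>x. x \<in> {1..K} \<Longrightarrow> 0 \<le> I x" and \<Xi>r: "set \<Xi> \<subseteq> {1..K}"
  shows "deficit I (drift I \<Xi>) s y n \<le> real (m + \<kappa> + length \<Xi>) * drift I \<Xi>"
proof -
  let ?D = "drift I \<Xi>" and ?N = "m + \<kappa>"
  have br: "0 \<le> block_reward I \<Xi> n" for n
    unfolding block_reward_def by (intro reward_nonneg I cyc_range[OF \<Xi> \<Xi>r])
  have D: "0 \<le> ?D"
  proof -
    have "0 \<le> real (length \<Xi>) * ?D" unfolding sum_block_reward[OF \<Xi>, symmetric] by (intro sum_nonneg br)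
    then show ?thesis using \<Xi> by (simp add: zero_le_mult_iff)
  qed
  have pr: "0 \<le> path_reward I s y i" for i
    using y(1) unfolding path_reward_def treatments_def by (intro reward_nonneg I) auto
  show ?thesis
  proof (cases "n \<le> ?N")
    case True
    have "deficit I ?D s y n \<le> (\<Sum>i<n. ?D)" unfolding deficit_def using pr by (intro sum_mono) simp
    also have "\<dots> = real n * ?D" by simp
    also have "\<dots> \<le> real (m + \<kappa> + length \<Xi>) * ?D" using True D by (intro mult_right_mono) auto
    finally show ?thesis .
  next
    case False
    then obtain k where n: "n = ?N + k" by (metis le_add_diff_inverse nat_le_linear)
    have "deficit I ?D s y n = (\<Sum>i<?N. ?D - path_reward I s y i) + (\<Sum>j<k. ?D - path_reward I s y (?N + j))"
      unfolding deficit_def n by (induction k) auto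
    also have "(\<Sum>j<k. ?D - path_reward I s y (?N + j)) = (\<Sum>j<k. ?D - block_reward I \<Xi> ((a + \<kappa>) + j))"
      by (intro sum.cong refl arg_cong2[where f="(-)"], subst path_reward_block[OF s y(2)])
         (auto simp: algebra_simps)
    also have "\<dots> \<le> real (length \<Xi>) * ?D"
      by (rule periodic_deficit_le) (use block_reward_period sum_block_reward[OF \<Xi>] br D \<Xi> in auto)
    also have "(\<Sum>i<?N. ?D - path_reward I s y i) \<le> (\<Sum>i<?N. ?D)" using pr by (intro sum_mono) simp
    finally show ?thesis by (simp add: algebra_simps)
  qed
qed

lemma corrector_props:
  assumes bdd: "\<And>n. deficit I D s y n \<le> C" "\<And>n. deficit I D (shift \<kappa> (y 0) s) (\<lambda>i. y (Suc i)) n \<le> C"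
  shows "0 \<le> corrector I D s y" "corrector I D s y \<le> C"
    "D - reward I (y 0) s + corrector I D (shift \<kappa> (y 0) s) (\<lambda>i. y (Suc i)) \<le> corrector I D s y"
proof -
  have b: "bdd_above (range (deficit I D s y))" using bdd(1) by (auto intro!: bdd_aboveI)
  have le: "deficit I D s y n \<le> corrector I D s y" for n
    unfolding corrector_def by (rule cSUP_upper[OF _ b]) simp
  show "0 \<le> corrector I D s y" using le[of 0] by (simp add: deficit_def)
  show "corrector I D s y \<le> C" unfolding corrector_def by (rule cSUP_least) (use bdd in auto)
  have "corrector I D (shift \<kappa> (y 0) s) (\<lambda>i. y (Suc i)) \<le> corrector I D s y - (D - reward I (y 0) s)"
    unfolding corrector_def[of I D "shift \<kappa> (y 0) s"]
  proof (rule cSUP_least)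
    fix n
    have "deficit I D s y (Suc n) = (D - reward I (y 0) s) + deficit I D (shift \<kappa> (y 0) s) (\<lambda>i. y (Suc i)) n"
      unfolding deficit_def sum.lessThan_Suc_shift path_reward_def run_Suc_shift by simp
    with le[of "Suc n"] show "deficit I D (shift \<kappa> (y 0) s) (\<lambda>i. y (Suc i)) n \<le> corrector I D s y - (D - reward I (y 0) s)" by simp
  qed simp
  then show "D - reward I (y 0) s + corrector I D (shift \<kappa> (y 0) s) (\<lambda>i. y (Suc i)) \<le> corrector I D s y" by simp
qed

lemma drift_path:
  assumes s: "s \<in> states \<kappa> K" and \<Xi>: "\<Xi> \<noteq> []"
  shows "(\<Sum>k<length \<Xi>. path_reward I s (block_sequence \<Xi>) (\<kappa> + k)) = real (length \<Xi>) * drift I \<Xi>"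
    and "run s (block_sequence \<Xi>) (\<kappa> + length \<Xi>) = run s (block_sequence \<Xi>) \<kappa>"
proof -
  have "(\<Sum>k<length \<Xi>. path_reward I s (block_sequence \<Xi>) (\<kappa> + k)) = (\<Sum>k<length \<Xi>. block_reward I \<Xi> (\<kappa> + k))"
    by (intro sum.cong refl, subst path_reward_block[OF s, of 0 _ \<Xi> 0]) auto
  also have "\<dots> = real (length \<Xi>) * drift I \<Xi>"
    using sum_full_period[of "block_reward I \<Xi>" "length \<Xi>"] block_reward_period sum_block_reward[OF \<Xi>] by simp
  finally show "(\<Sum>k<length \<Xi>. path_reward I s (block_sequence \<Xi>) (\<kappa> + k)) = real (length \<Xi>) * drift I \<Xi>" .
  have l: "length s = \<kappa>" using s by (simp add: states_def)
  show "run s (block_sequence \<Xi>) (\<kappa> + length \<Xi>) = run s (block_sequence \<Xi>) \<kappa>"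
    unfolding run_recent[OF l le_add1] run_recent[OF l order_refl]
  proof (rule map_cong[OF refl])
    fix i assume "i \<in> set [0..<\<kappa>]"
    then have "int (Suc (\<kappa> + length \<Xi> - 1 - i)) = int (Suc (\<kappa> - 1 - i)) + int (length \<Xi>)" by simp
    then show "block_sequence \<Xi> (\<kappa> + length \<Xi> - 1 - i) = block_sequence \<Xi> (\<kappa> - 1 - i)"
      unfolding block_sequence_def by (simp only: cyc_period)
  qed
qed

text \<open>Summed over a period that closes up in the state space, the Bellman inequality loses its
  h terms.\<close>

lemma drift_le:
  assumes "states \<kappa> K \<noteq> {}" and \<Xi>: "\<Xi> \<noteq> []" "set \<Xi> \<subseteq> {1..K}"
    and h: "\<And>x s. x \<in> {1..K} \<Longrightarrow> s \<in> states \<kappa> K \<Longrightarrow> reward I x s + h (shift \<kappa> x s) \<le> lam + h s"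
  shows "drift I \<Xi> \<le> (lam :: real)"
proof -
  obtain s where s: "s \<in> states \<kappa> K" using assms(1) by auto
  let ?y = "block_sequence \<Xi>"
  have y: "?y \<in> treatments" using cyc_range[OF \<Xi>] by (simp add: treatments_def block_sequence_def)
  have "(\<Sum>k<n. path_reward I s ?y (\<kappa> + k)) + h (run s ?y (\<kappa> + n)) \<le> real n * lam + h (run s ?y \<kappa>)" for n
  proof (induction n)
    case (Suc n)
    have "path_reward I s ?y (\<kappa> + n) + h (run s ?y (\<kappa> + Suc n)) \<le> lam + h (run s ?y (\<kappa> + n))"
      unfolding path_reward_def using h[OF _ run_states[OF s y], of "?y (\<kappa> + n)" "\<kappa> + n"] y by (simp add: treatments_def)
    then show ?case using Suc by (simp add: algebra_simps)
  qed simp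
  from this[of "length \<Xi>"] have "real (length \<Xi>) * drift I \<Xi> \<le> real (length \<Xi>) * lam"
    unfolding drift_path[OF s \<Xi>(1)] by simp
  then show ?thesis using \<Xi>(1) by simp
qed

lemma drift_bounds:
  assumes \<Xi>: "\<Xi> \<noteq> []" "set \<Xi> \<subseteq> {1..K}" and lo: "\<And>x. x \<in> {1..K} \<Longrightarrow> lo \<le> I x"
    and hi: "\<And>x s. x \<in> {1..K} \<Longrightarrow> s \<in> states \<kappa> K \<Longrightarrow> reward I x s \<le> hi"
  shows "lo \<le> drift I \<Xi>" "drift I \<Xi> \<le> hi"
proof -
  have n: "0 < real (length \<Xi>)" using \<Xi> by simp
  have "real (length \<Xi>) * lo \<le> (\<Sum>n<length \<Xi>. block_reward I \<Xi> n)"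
    using sum_bounded_below[of "{..<length \<Xi>}" lo "block_reward I \<Xi>"] lo[OF cyc_range[OF \<Xi>]]
    by (force simp: block_reward_def reward_def survival_rate_def intro: add_increasing2)
  then show "lo \<le> drift I \<Xi>" unfolding sum_block_reward[OF \<Xi>(1)] using n by simp
  have "block_reward I \<Xi> n \<le> hi" for n
    unfolding block_reward_def by (intro hi) (use cyc_range[OF \<Xi>] in \<open>auto simp: states_def simp del: upt_Suc\<close>)
  then have "(\<Sum>n<length \<Xi>. block_reward I \<Xi> n) \<le> real (length \<Xi>) * hi"
    using sum_bounded_above[of "{..<length \<Xi>}" "block_reward I \<Xi>" hi] by simp
  then show "drift I \<Xi> \<le> hi" unfolding sum_block_reward[OF \<Xi>(1)] using n by simp
qed

text \<open>Move from one state to the other in \<kappa> steps: rewards are nonnegative, so h grows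
  by at most \<lambda>' per step.\<close>

lemma value_span:
  fixes h :: "nat list \<Rightarrow> real" and lam :: real
  assumes h: "\<And>x s. x \<in> {1..K} \<Longrightarrow> s \<in> states \<kappa> K \<Longrightarrow> reward I x s + h (shift \<kappa> x s) \<le> lam + h s"
    and I: "\<And>x. x \<in> {1..K} \<Longrightarrow> 0 \<le> I x" and s: "s \<in> states \<kappa> K" "s' \<in> states \<kappa> K"
  shows "h s' \<le> h s + \<kappa> * lam"
proof -
  have "h (state_after \<kappa> s z) \<le> h s + length z * lam" if "set z \<subseteq> {1..K}" "s \<in> states \<kappa> K" for z s
    using that
  proof (induction z arbitrary: s)
    case (Cons x z)
    have x: "x \<in> {1..K}" using Cons.prems by simp
    have "h (state_after \<kappa> (shift \<kappa> x s) z) \<le> h (shift \<kappa> x s) + length z * lam"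
      using Cons.prems by (intro Cons.IH shift_states) auto
    moreover have "h (shift \<kappa> x s) \<le> h s + lam"
      using h[OF x Cons.prems(2)] reward_nonneg[where I=I and x=x and s=s, OF I[OF x]] by simp
    ultimately show ?case by (simp add: state_after_def algebra_simps)
  qed (simp add: state_after_def)
  from this[of "rev s'" s] show ?thesis using s by (simp add: state_after_reaches) (auto simp: states_def)
qed

end

context stationary_policy
begin

text \<open>As in \<open>drift_le\<close>, but the policy attains the maximum at each step, so
  equality holds throughout.\<close>

lemma drift_eq:
  assumes h: "\<And>s. s \<in> states \<kappa> K \<Longrightarrow> reward I (\<upsilon> s) s + h (shift \<kappa> (\<upsilon> s) s) = lam + h s"
  shows "drift I block = (lam :: real)"
proof -
  let ?s = "pstate start" and ?y = "block_sequence block"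
  have y: "?y = (\<lambda>i. plan (start + i))" by (simp add: block_sequence_plan[abs_def])
  have run: "run ?s ?y n = pstate (start + n)" for n unfolding y by (rule run_plan_from)
  have "(\<Sum>k<n. path_reward I ?s ?y (\<kappa> + k)) + h (run ?s ?y (\<kappa> + n)) = real n * lam + h (run ?s ?y \<kappa>)" for n
  proof (induction n)
    case (Suc n)
    have "path_reward I ?s ?y (\<kappa> + n) + h (run ?s ?y (\<kappa> + Suc n)) = lam + h (run ?s ?y (\<kappa> + n))"
      unfolding path_reward_def run using h[OF pstate_states, of "start + (\<kappa> + n)"]
      by (simp add: y plan_eq policy_state_Suc)
    then show ?case using Suc by (simp add: algebra_simps)
  qed simp
  from this[of "length block"] have "real (length block) * drift I block = real (length block) * lam"
    unfolding drift_path[OF pstate_states block_nonempty] by simp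
  then show ?thesis using block_nonempty by simp
qed

text \<open>Verification argument: n steps of the policy plus the optimal remainder never exceed the
  optimum. Dropping the remainder bounds every partial sum, and no limit of the remainder is
  needed.\<close>

lemma plan_optimal:
  assumes opt: "\<And>s x. s \<in> states \<kappa> K \<Longrightarrow> x \<in> {1..K} \<Longrightarrow>
    ennreal (1 - \<Psi> (\<upsilon> s) s) * min_time (shift \<kappa> (\<upsilon> s) s) \<le> ennreal (1 - \<Psi> x s) * min_time (shift \<kappa> x s)"
  shows "mean_time (pstate m) (\<lambda>i. plan (m + i)) \<le> min_time (pstate m)"
proof -
  have step: "1 + ennreal (1 - \<Psi> (\<upsilon> s) s) * min_time (shift \<kappa> (\<upsilon> s) s) \<le> min_time s" if s: "s \<in> states \<kappa> K" for s
    unfolding min_time_def[of s]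
  proof (rule INF_greatest)
    fix y assume y: "y \<in> treatments"
    have "ennreal (1 - \<Psi> (\<upsilon> s) s) * min_time (shift \<kappa> (\<upsilon> s) s) \<le> ennreal (1 - \<Psi> (y 0) s) * min_time (shift \<kappa> (y 0) s)"
      using y by (intro opt s) (simp add: treatments_def)
    also have "\<dots> \<le> ennreal (1 - \<Psi> (y 0) s) * mean_time (shift \<kappa> (y 0) s) (\<lambda>i. y (Suc i))"
      using treatments_shift[OF y, of 1] by (intro mult_left_mono min_time_le) auto
    finally show "1 + ennreal (1 - \<Psi> (\<upsilon> s) s) * min_time (shift \<kappa> (\<upsilon> s) s) \<le> mean_time s y"
      unfolding mean_time_step[OF s y] by (rule add_left_mono)
  qed
  let ?y = "\<lambda>i. plan (m + i)"
  have y: "?y \<in> treatments" by (rule treatments_shift[OF plan_treatments])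
  note sr = survival_range[OF pstate_states y, of m]
  have key: "(\<Sum>k<n. ennreal (survival (pstate m) ?y k)) + ennreal (survival (pstate m) ?y n) * min_time (pstate (m + n)) \<le> min_time (pstate m)" for n
  proof (induction n)
    case (Suc n)
    let ?s = "pstate (m + n)"
    have c: "0 \<le> 1 - \<Psi> (\<upsilon> ?s) ?s" using \<Psi>[OF \<upsilon> pstate_states] pstate_states by (simp add: less_imp_le)
    have S: "survival (pstate m) ?y (Suc n) = survival (pstate m) ?y n * (1 - \<Psi> (\<upsilon> ?s) ?s)"
      by (simp only: survival_def prod.lessThan_Suc run_plan_from) (simp only: plan_eq)
    have "(\<Sum>k<Suc n. ennreal (survival (pstate m) ?y k)) + ennreal (survival (pstate m) ?y (Suc n)) * min_time (pstate (m + Suc n))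
       = (\<Sum>k<n. ennreal (survival (pstate m) ?y k)) + ennreal (survival (pstate m) ?y n) * (1 + ennreal (1 - \<Psi> (\<upsilon> ?s) ?s) * min_time (shift \<kappa> (\<upsilon> ?s) ?s))"
      unfolding S using c sr(1)[of n] by (simp add: ennreal_mult distrib_left mult.assoc add.assoc policy_state_Suc less_imp_le)
    also have "\<dots> \<le> (\<Sum>k<n. ennreal (survival (pstate m) ?y k)) + ennreal (survival (pstate m) ?y n) * min_time ?s"
      by (intro add_left_mono mult_left_mono step pstate_states) simp
    also note Suc
    finally show ?case .
  qed (simp add: survival_def)
  show ?thesis
    unfolding mean_time_def[of "pstate m"]
  proof (rule suminf_le_const)
    fix n
    show "(\<Sum>k<n. ennreal (survival (pstate m) ?y k)) \<le> min_time (pstate m)"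
      by (rule order_trans[OF _ key[of n]]) simp
  qed simp
qed

text \<open>After \<kappa> steps the block has erased the initial state and the path lies on the
  optimal cycle. One \<kappa> pays for these steps, the other for comparing the state reached with
  the initial one.\<close>

lemma mean_time_block_le:
  assumes opt: "\<And>s x. s \<in> states \<kappa> K \<Longrightarrow> x \<in> {1..K} \<Longrightarrow>
    ennreal (1 - \<Psi> (\<upsilon> s) s) * min_time (shift \<kappa> (\<upsilon> s) s) \<le> ennreal (1 - \<Psi> x s) * min_time (shift \<kappa> x s)"
    and s: "s \<in> states \<kappa> K"
  shows "mean_time s (block_sequence block) \<le> of_nat (2 * \<kappa>) + min_time s\<^sub>0"
proof -
  let ?y = "block_sequence block"
  have y: "?y = (\<lambda>i. plan (start + i))" by (simp add: block_sequence_plan[abs_def])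
  have yt: "?y \<in> treatments" unfolding y by (rule treatments_shift[OF plan_treatments])
  have l: "length s = \<kappa>" "length (pstate start) = \<kappa>" using s pstate_states by (auto simp: states_def)
  have "run s ?y \<kappa> = run (pstate start) ?y \<kappa>" using l by (simp add: run_recent)
  also have "\<dots> = pstate (start + \<kappa>)" unfolding y by (rule run_plan_from)
  finally have r: "run s ?y \<kappa> = pstate (start + \<kappa>)" .
  have "mean_time s ?y \<le> of_nat \<kappa> + mean_time (run s ?y \<kappa>) (\<lambda>i. ?y (\<kappa> + i))"
    by (rule mean_time_shift_le[OF s yt])
  also have "\<dots> = of_nat \<kappa> + mean_time (pstate (start + \<kappa>)) (\<lambda>i. plan ((start + \<kappa>) + i))"
    unfolding r by (simp add: y add.assoc)
  also have "\<dots> \<le> of_nat \<kappa> + min_time (pstate (start + \<kappa>))" by (intro add_left_mono plan_optimal opt)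
  also have "\<dots> \<le> of_nat \<kappa> + (of_nat \<kappa> + min_time s\<^sub>0)" by (intro add_left_mono min_time_compare pstate_states s0)
  finally show ?thesis by (simp add: mult_2 add.assoc)
qed

end

section \<open>The lower bound\<close>

lemma (in controlled_model) nn_integral_step_weighted:
  assumes F: "F \<in> borel_measurable (hist (Suc t))" and A: "A \<in> sets (hist t)"
  shows "(\<integral>\<^sup>+\<omega>. F \<omega> * indicator A \<omega> \<partial>P) = (\<integral>\<^sup>+\<omega>. (ennreal (change_prob \<pi> X (Suc t) \<omega>) * next_value F t \<omega> True
      + ennreal (1 - change_prob \<pi> X (Suc t) \<omega>) * next_value F t \<omega> False) * indicator A \<omega> \<partial>P)"
proof -
  have A': "A \<in> sets (hist (Suc t))"
    using measurable_hist_mono[of "\<lambda>\<omega>. \<omega> \<in> A" t "count_space UNIV" "Suc t"] A by (simp add: pred_def)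
  have "next_value (\<lambda>\<omega>. F \<omega> * indicator A \<omega>) t \<omega> l = next_value F t \<omega> l * indicator A \<omega>" for \<omega> l
  proof -
    have "(\<omega>)(Suc t := (l, y)) \<in> A \<longleftrightarrow> \<omega> \<in> A" for y by (rule hist_sets_cong[OF A]) simp
    then show ?thesis by (cases "\<omega> \<in> A") (simp_all add: next_value_def)
  qed
  then show ?thesis
    using nn_integral_step[of "\<lambda>\<omega>. F \<omega> * indicator A \<omega>" t] F A' by (simp add: distrib_right mult.assoc)
qed

text \<open>Optional stopping without subtraction: c n is an integral over T \<ge> n, split into b n
  over T = n and a n over T > n.\<close>

lemma stopped_sum_le:
  fixes a b c C D :: "nat \<Rightarrow> ennreal"
  assumes "\<And>n. c n = b n + a n" "\<And>n. c (Suc n) + C n \<le> a n + D n"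
  shows "(\<Sum>t<n. b t) + c n + (\<Sum>t<n. C t) \<le> c 0 + (\<Sum>t<n. D t)"
proof (induction n)
  case (Suc n)
  have "(\<Sum>t<Suc n. b t) + c (Suc n) + (\<Sum>t<Suc n. C t) = (\<Sum>t<n. b t) + b n + (\<Sum>t<n. C t) + (c (Suc n) + C n)"
    by (simp add: add_ac)
  also have "\<dots> \<le> (\<Sum>t<n. b t) + b n + (\<Sum>t<n. C t) + (a n + D n)" by (intro add_left_mono assms)
  also have "\<dots> = ((\<Sum>t<n. b t) + c n + (\<Sum>t<n. C t)) + D n" by (simp add: assms(1) add_ac)
  also have "\<dots> \<le> c 0 + (\<Sum>t<n. D t) + D n" by (rule add_right_mono[OF Suc])
  finally show ?case by (simp add: add_ac)
qed simp

lemma stopped_sum_ge: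
  fixes a b c D :: "nat \<Rightarrow> ennreal"
  assumes "\<And>n. c n = b n + a n" "\<And>n. a n \<le> c (Suc n) + D n"
  shows "c 0 \<le> (\<Sum>t<n. b t) + c n + (\<Sum>t<n. D t)"
proof (induction n)
  case (Suc n)
  have "c 0 \<le> (\<Sum>t<n. b t) + (b n + a n) + (\<Sum>t<n. D t)" using Suc by (simp add: assms(1))
  also have "\<dots> \<le> (\<Sum>t<n. b t) + (b n + (c (Suc n) + D n)) + (\<Sum>t<n. D t)"
    by (intro add_left_mono add_right_mono assms)
  finally show ?case by (simp add: add_ac)
qed simp

lemma minus_x_ln_le: "0 \<le> x \<Longrightarrow> - x * ln x \<le> 1 - (x::real)"
proof (cases "x = 0")
  case False
  assume "0 \<le> x"
  with False have x: "0 < x" by simp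
  then have "ln (1 / x) \<le> 1 / x - 1" by (intro ln_le_minus_one) simp
  then have "x * ln (1 / x) \<le> x * (1 / x - 1)" using x by (intro mult_left_mono) auto
  then show ?thesis using x by (simp add: ln_divide_pos right_diff_distrib)
qed simp

lemma (in regular_model) expected_time_eq:
  assumes T: "obs_stopping_time X T"
  shows "expected_time P T = (\<Sum>t. emeasure P {\<omega>. enat t < T \<omega>})"
proof -
  note le = stopping_time_sets[OF T]
  have E: "{\<omega>. T \<omega> = enat t} \<in> sets P" for t
  proof -
    have "{\<omega>. T \<omega> = enat t} = {\<omega>. T \<omega> \<le> enat t} - (\<Union>s\<in>{..<t}. {\<omega>. T \<omega> \<le> enat s})"
    proof (rule set_eqI)
      show "\<omega> \<in> {\<omega>. T \<omega> = enat t} \<longleftrightarrow> \<omega> \<in> {\<omega>. T \<omega> \<le> enat t} - (\<Union>s\<in>{..<t}. {\<omega>. T \<omega> \<le> enat s})" for \<omega>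
        by (cases "T \<omega>") (auto simp: not_le)
    qed
    also have "\<dots> \<in> sets P" by (intro sets.Diff sets.finite_UN le) auto
    finally show ?thesis .
  qed
  have "T \<in> measurable P (count_space UNIV)"
  proof (subst measurable_count_space_eq2_countable, intro conjI ballI)
    fix a
    show "T -` {a} \<inter> space P \<in> sets P"
    proof (cases a)
      case (enat t)
      then show ?thesis using E[of t] by (simp add: vimage_def)
    next
      case infinity
      have "T -` {a} \<inter> space P = space P - (\<Union>t. {\<omega>. T \<omega> = enat t})"
      proof (rule set_eqI)
        show "\<omega> \<in> T -` {a} \<inter> space P \<longleftrightarrow> \<omega> \<in> space P - (\<Union>t. {\<omega>. T \<omega> = enat t})" for \<omega>
          using infinity by (cases "T \<omega>") auto
      qed
      also have "\<dots> \<in> sets P" using E by blast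
      finally show ?thesis .
    qed
  qed auto
  then show ?thesis unfolding expected_time_def by (subst nn_integral_enat_function) auto
qed

section \<open>The model with finite memory\<close>

locale change_model = informative_densities K \<mu> f g + memory_model K \<kappa> \<Psi>
  for K \<kappa> and \<mu> and f g :: "nat \<Rightarrow> 'y::polish_space \<Rightarrow> real" and \<Psi> +
  fixes s\<^sub>0 :: "nat list" and \<pi>\<^sub>0 :: real and X :: "nat \<Rightarrow> 'y path \<Rightarrow> nat"
  assumes s0: "s\<^sub>0 \<in> states \<kappa> K" and \<pi>0: "0 \<le> \<pi>\<^sub>0" "\<pi>\<^sub>0 < 1" and X: "assignment_rule K X"
begin

lemma state_after_states: "s \<in> states \<kappa> K \<Longrightarrow> set z \<subseteq> {1..K} \<Longrightarrow> state_after \<kappa> s z \<in> states \<kappa> K"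
proof (induction z arbitrary: s)
  case (Cons a z)
  then show ?case using Cons.IH[OF shift_states[of a s]] by (simp add: state_after_def)
qed (simp add: state_after_def)

sublocale regular_model K \<mu> f g "memory_link \<kappa> \<Psi> s\<^sub>0 \<pi>\<^sub>0" X
proof
  show "0 \<le> memory_link \<kappa> \<Psi> s\<^sub>0 \<pi>\<^sub>0 z \<and> memory_link \<kappa> \<Psi> s\<^sub>0 \<pi>\<^sub>0 z < 1" if "z \<in> lists {1..K}" for z
  proof (cases "z = []")
    case False
    have "set (butlast z) \<subseteq> {1..K}" using that by (auto dest: in_set_butlastD)
    then show ?thesis using False that \<Psi>[OF _ state_after_states[OF s0], of "last z" "butlast z"] last_in_set[OF False]
      by (auto simp: memory_link_def)
  qed (use \<pi>0 in \<open>simp add: memory_link_def\<close>)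
qed (use X f_0_imp_g_0 g_0_imp_f_0 in auto)

definition state :: "nat \<Rightarrow> 'y path \<Rightarrow> nat list" where
  "state t \<omega> = state_after \<kappa> s\<^sub>0 (map (\<lambda>s. X s \<omega>) [1..<Suc t])"

lemma state_0 [simp]: "state 0 \<omega> = s\<^sub>0" by (simp add: state_def state_after_def)

lemma state_Suc: "state (Suc t) \<omega> = shift \<kappa> (X (Suc t) \<omega>) (state t \<omega>)"
  by (simp add: state_def state_after_def)

lemma state_states: "state t \<omega> \<in> states \<kappa> K"
  unfolding state_def by (intro state_after_states s0) (use X_range in auto)

lemma link_Suc: "link (Suc t) \<omega> = \<Psi> (X (Suc t) \<omega>) (state t \<omega>)"
  by (simp add: link_def memory_link_def state_def butlast_append)

lemma state_upd: "n \<le> t \<Longrightarrow> state n ((\<omega>)(t := z)) = state n \<omega>"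
  unfolding state_def by (intro arg_cong[where f="state_after \<kappa> s\<^sub>0"] map_cong) (auto simp: X_upd simp del: upt_Suc)

lemma state_hist: "state t \<in> measurable (hist t) (count_space UNIV)"
proof (cases t)
  case 0
  then have "state t = (\<lambda>\<omega>. s\<^sub>0)" by (simp add: fun_eq_iff)
  then show ?thesis by simp
next
  case (Suc n)
  have "(\<lambda>\<omega>. map (\<lambda>s. X s \<omega>) [1..<Suc t]) \<in> measurable (hist n) (count_space UNIV)"
    by (rule obs_hist[OF X_list_obs]) (use Suc in auto)
  from measurable_compose[OF this, of "state_after \<kappa> s\<^sub>0" "count_space UNIV"]
  have "state t \<in> measurable (hist n) (count_space UNIV)" by (simp add: state_def[abs_def])
  then show ?thesis by (rule measurable_hist_mono) (use Suc in simp)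
qed

text \<open>With w the probability of change before the response, 1 - w = (1 - q) / (1 + G). Hence 1
  + G is multiplied by 1 / (1 - q) and by the mixture treated in \<open>llr_gt\<close>.\<close>

lemma one_plus_odds_Suc_upd:
  fixes \<omega> t y l
  defines "q \<equiv> link (Suc t) \<omega>" and "G \<equiv> odds t \<omega>"
  defines "w \<equiv> (G + q) / (1 + G)"
  shows "0 \<le> w" "w < 1" "- ln (1 - w) = ln (1 + G) + survival_rate q"
    and "ln (1 + odds (Suc t) ((\<omega>)(Suc t := (l, y)))) =
      ln (1 + G) + survival_rate q + ln ((1 - w) + w * (g (X (Suc t) \<omega>) y / f (X (Suc t) \<omega>) y))"
proof -
  have q: "0 \<le> q" "q < 1" and G: "0 \<le> G" using link_range odds_nonneg by (auto simp: q_def G_def)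
  show w: "0 \<le> w" "w < 1" using q G by (auto simp: w_def)
  have w1: "1 - w = (1 - q) / (1 + G)" using G by (simp add: w_def field_simps)
  have sr: "survival_rate q = - ln (1 - q)" using q by (simp add: survival_rate_def)
  show "- ln (1 - w) = ln (1 + G) + survival_rate q" using q G by (simp add: w1 sr ln_divide_pos)
  let ?\<Lambda> = "g (X (Suc t) \<omega>) y / f (X (Suc t) \<omega>) y"
  have x: "X (Suc t) \<omega> \<in> {1..K}" by (rule X_range) simp
  have \<Lambda>: "0 \<le> ?\<Lambda>" using f_nonneg[OF x] g_nonneg[OF x] by simp
  have m: "0 < (1 - w) + w * ?\<Lambda>" using w by (intro add_pos_nonneg mult_nonneg_nonneg \<Lambda>) auto
  have "1 + odds (Suc t) ((\<omega>)(Suc t := (l, y))) = 1 + (G + q) / (1 - q) * ?\<Lambda>"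
    by (simp only: odds_Suc_upd q_def G_def)
  also have "\<dots> = (1 + G) / (1 - q) * ((1 - w) + w * ?\<Lambda>)"
  proof -
    have "(1 + G) / (1 - q) * (1 - w) = 1" using q G by (simp add: w1)
    moreover have "(1 + G) / (1 - q) * w = (G + q) / (1 - q)" using G by (simp add: w_def)
    ultimately show ?thesis by (simp only: distrib_left mult.assoc[symmetric])
  qed
  also have "ln \<dots> = ln ((1 + G) / (1 - q)) + ln ((1 - w) + w * ?\<Lambda>)" using q G m by (intro ln_mult_pos) auto
  finally show "ln (1 + odds (Suc t) ((\<omega>)(Suc t := (l, y)))) =
      ln (1 + G) + survival_rate q + ln ((1 - w) + w * ?\<Lambda>)" using q G by (simp add: sr ln_divide_pos)
qed

context
  fixes lam :: real and h :: "nat list \<Rightarrow> real"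
  assumes h: "\<And>x s. x \<in> {1..K} \<Longrightarrow> s \<in> states \<kappa> K \<Longrightarrow> reward I x s + h (shift \<kappa> x s) \<le> lam + h s"
    and h_range: "\<And>s. s \<in> states \<kappa> K \<Longrightarrow> 0 \<le> h s \<and> h s \<le> \<kappa> * lam" and lam: "0 < lam"
begin

text \<open>Before the change the value function is replaced by its largest possible value plus 1.
  When the change comes with probability q, this 1 is released and pays for the mean gain of - ln (1
  - q) without a change, since - (1 - q) ln (1 - q) \<le> q.\<close>

definition pot :: "nat \<Rightarrow> 'y path \<Rightarrow> ennreal" where
  "pot t \<omega> = ennreal (ln (1 + odds t \<omega>) + (if latent t \<omega> then h (state t \<omega>) else 1 + \<kappa> * lam))"

lemma pot_hist: "pot t \<in> borel_measurable (hist t)"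
proof -
  note [measurable] = obs_hist[OF odds_obs, of t] measurable_latent[of t t, simplified]
  have [measurable]: "(\<lambda>\<omega>. h (state t \<omega>)) \<in> borel_measurable (hist t)"
    by (rule measurable_compose[OF state_hist]) simp
  show ?thesis unfolding pot_def[abs_def] by measurable
qed

text \<open>After the change this is \<open>llr_gt\<close> combined with the Bellman inequality.
  Before the change only the possible change contributes, so the potential grows by \<lambda>' times
  the probability that the next latent state is 1.\<close>

lemma pot_step:
  "ennreal (change_prob (memory_link \<kappa> \<Psi> s\<^sub>0 \<pi>\<^sub>0) X (Suc t) \<omega>) * next_value (pot (Suc t)) t \<omega> True
      + ennreal (1 - change_prob (memory_link \<kappa> \<Psi> s\<^sub>0 \<pi>\<^sub>0) X (Suc t) \<omega>) * next_value (pot (Suc t)) t \<omega> False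
    \<le> pot t \<omega> + ennreal (lam * change_prob (memory_link \<kappa> \<Psi> s\<^sub>0 \<pi>\<^sub>0) X (Suc t) \<omega>)"
proof -
  define q G x s where "q = link (Suc t) \<omega>" and "G = odds t \<omega>" and "x = X (Suc t) \<omega>" and "s = state t \<omega>"
  define w where "w = (G + q) / (1 + G)"
  define B where "B = ln (1 + G) + survival_rate q"
  have x: "x \<in> {1..K}" unfolding x_def by (rule X_range) simp
  have s: "s \<in> states \<kappa> K" unfolding s_def by (rule state_states)
  have s': "shift \<kappa> x s \<in> states \<kappa> K" by (rule shift_states[OF x s])
  have q: "0 \<le> q" "q < 1" and G: "0 \<le> G" using link_range odds_nonneg by (auto simp: q_def G_def)
  have q\<Psi>: "q = \<Psi> x s" by (simp add: q_def x_def s_def link_Suc)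
  have w: "0 \<le> w" "w < 1" "- ln (1 - w) = B"
    using one_plus_odds_Suc_upd(1,2,3)[of t \<omega>] by (simp_all add: w_def B_def q_def G_def)
  have o: "ln (1 + odds (Suc t) ((\<omega>)(Suc t := (l, y)))) = B + ln ((1 - w) + w * (g x y / f x y))" for l y
    using one_plus_odds_Suc_upd(4)[of t \<omega> l y] by (simp add: w_def B_def q_def G_def x_def)
  have st: "state (Suc t) ((\<omega>)(Suc t := z)) = shift \<kappa> x s" for z
    by (simp add: state_Suc state_upd X_upd x_def s_def)
  have B0: "0 \<le> B" using G by (simp add: B_def survival_rate_def)
  have sr: "survival_rate q = - ln (1 - q)" using q by (simp add: survival_rate_def)
  have "next_value (pot (Suc t)) t \<omega> True = (\<integral>\<^sup>+y. ennreal ((B + h (shift \<kappa> x s)) + ln ((1 - w) + w * (g x y / f x y))) * ennreal (g x y) \<partial>\<mu>)"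
    unfolding next_value_def pot_def o st by (simp add: x_def add_ac)
  also have "\<dots> \<le> ennreal (B + h (shift \<kappa> x s) + I x)"
    by (rule llr_gt(1)[OF x w(1,2)]) (use w h_range[OF s'] in simp)
  finally have T: "next_value (pot (Suc t)) t \<omega> True \<le> ennreal (B + h (shift \<kappa> x s) + I x)" .
  have "next_value (pot (Suc t)) t \<omega> False = (\<integral>\<^sup>+y. ennreal ((B + (1 + \<kappa> * lam)) + ln ((1 - w) + w * (g x y / f x y))) * ennreal (f x y) \<partial>\<mu>)"
    unfolding next_value_def pot_def o by (simp add: x_def add_ac)
  also have "\<dots> \<le> ennreal (B + (1 + \<kappa> * lam))"
    by (rule llr_gt(2)[OF x w(1,2)]) (use w lam in simp)
  finally have F: "next_value (pot (Suc t)) t \<omega> False \<le> ennreal (B + (1 + \<kappa> * lam))" .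
  have bell: "I x + survival_rate q + h (shift \<kappa> x s) \<le> lam + h s" using h[OF x s] by (simp add: reward_def q\<Psi>)
  show ?thesis
  proof (cases "latent t \<omega>")
    case True
    then have "pot t \<omega> = ennreal (ln (1 + G) + h s)" by (simp add: pot_def G_def s_def)
    then have "pot t \<omega> + ennreal lam = ennreal (ln (1 + G) + h s + lam)"
      using G h_range[OF s] lam by (simp add: ennreal_plus)
    moreover have "next_value (pot (Suc t)) t \<omega> True \<le> ennreal (ln (1 + G) + h s + lam)"
      by (rule order_trans[OF T]) (use bell in \<open>auto intro!: ennreal_leI simp: B_def\<close>)
    ultimately show ?thesis using True by (simp add: change_prob_eq)
  next
    case False
    have "ennreal q * next_value (pot (Suc t)) t \<omega> True + ennreal (1 - q) * next_value (pot (Suc t)) t \<omega> False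
       \<le> ennreal q * ennreal (B + h (shift \<kappa> x s) + I x) + ennreal (1 - q) * ennreal (B + (1 + \<kappa> * lam))"
      by (intro add_mono mult_left_mono T F) auto
    also have "\<dots> = ennreal (q * (B + h (shift \<kappa> x s) + I x) + (1 - q) * (B + (1 + \<kappa> * lam)))"
      using q B0 h_range[OF s'] I_pos[OF x] lam by (simp add: ennreal_mult ennreal_plus)
    also have "\<dots> \<le> ennreal (ln (1 + G) + (1 + \<kappa> * lam) + lam * q)"
    proof (rule ennreal_leI)
      have "q * (I x + survival_rate q + h (shift \<kappa> x s)) \<le> q * (lam + \<kappa> * lam)"
        using bell h_range[OF s] q by (intro mult_left_mono) auto
      moreover have "(1 - q) * survival_rate q \<le> q"
        using minus_x_ln_le[of "1 - q"] q by (simp add: sr algebra_simps)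
      ultimately show "q * (B + h (shift \<kappa> x s) + I x) + (1 - q) * (B + (1 + \<kappa> * lam)) \<le> ln (1 + G) + (1 + \<kappa> * lam) + lam * q"
        unfolding B_def by (simp add: algebra_simps)
    qed
    also have "\<dots> = pot t \<omega> + ennreal (lam * q)"
      using False G lam q by (simp add: pot_def G_def ennreal_plus add.assoc)
    finally show ?thesis using False by (simp add: change_prob_eq q_def)
  qed
qed

lemma pot_initial: "(\<integral>\<^sup>+\<omega>. pot 0 \<omega> \<partial>P) \<le> ennreal (ln (1 / (1 - \<pi>\<^sub>0)) + 1 + \<kappa> * lam)"
proof -
  have o: "1 + odds 0 \<omega> = 1 / (1 - \<pi>\<^sub>0)" for \<omega> using \<pi>0 by (simp add: memory_link_def field_simps)
  have "pot 0 \<omega> \<le> ennreal (ln (1 / (1 - \<pi>\<^sub>0)) + 1 + \<kappa> * lam)" for \<omega>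
    unfolding pot_def o using h_range[OF s0] lam by (intro ennreal_leI) auto
  then have "(\<integral>\<^sup>+\<omega>. pot 0 \<omega> \<partial>P) \<le> (\<integral>\<^sup>+\<omega>. ennreal (ln (1 / (1 - \<pi>\<^sub>0)) + 1 + \<kappa> * lam) \<partial>P)" by (intro nn_integral_mono)
  also have "\<dots> = ennreal (ln (1 / (1 - \<pi>\<^sub>0)) + 1 + \<kappa> * lam)" using P.emeasure_space_1 by simp
  finally show ?thesis .
qed

text \<open>The Bellman inequality restricted to paths without a change; it turns the count of steps
  before the change into a bound by the optimal mean time.\<close>

lemma min_time_process_step:
  assumes fin: "\<And>s. s \<in> states \<kappa> K \<Longrightarrow> min_time s < top"
  shows "min_time (state t \<omega>) * of_bool (\<not> latent t \<omega>) \<le>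
    ennreal (1 - change_prob (memory_link \<kappa> \<Psi> s\<^sub>0 \<pi>\<^sub>0) X (Suc t) \<omega>) * min_time (state (Suc t) \<omega>) + of_bool (\<not> latent t \<omega>)"
proof (cases "latent t \<omega>")
  case False
  have "min_time (state t \<omega>) \<le> 1 + ennreal (1 - \<Psi> (X (Suc t) \<omega>) (state t \<omega>)) * min_time (state (Suc t) \<omega>)"
    unfolding state_Suc by (rule min_time_step[OF _ state_states]) (rule X_range, simp)
  then show ?thesis using False by (simp add: change_prob_eq link_Suc add.commute)
qed simp

text \<open>With \<open>\<eta> = 2 \<alpha>\<close>, the inequality \<open>- ln u \<ge> - ln \<eta> + 1 - u / \<eta>\<close> replaces Jensen's inequality for
  the posterior probability \<open>u = 1 / (1 + odds)\<close> that the change has not occurred.\<close>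

theorem lower_bound:
  fixes \<alpha> w\<^sub>0 :: real
  assumes T: "obs_stopping_time X T" and \<alpha>: "0 < \<alpha>" "2 * \<alpha> < 1"
    and err: "measure P {\<omega>. T \<omega> < change_point \<omega>} \<le> \<alpha>"
    and w: "min_time s\<^sub>0 = ennreal w\<^sub>0" "0 \<le> w\<^sub>0"
  shows "ennreal ((1 - \<pi>\<^sub>0) * w\<^sub>0 + (ln (1 / (2 * \<alpha>)) - (ln (1 / (1 - \<pi>\<^sub>0)) + 1 + \<kappa> * lam)) / lam - 2 * \<alpha> * (w\<^sub>0 + \<kappa>) - 1) \<le> expected_time P T"
proof (cases "expected_time P T = \<top>")
  case False
  let ?\<eta> = "2 * \<alpha>"
  let ?cp = "\<lambda>t \<omega>. change_prob (memory_link \<kappa> \<Psi> s\<^sub>0 \<pi>\<^sub>0) X (Suc t) \<omega>"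
  \<comment> \<open>\<open>R t\<close> means still running after t, \<open>E t\<close> stopped at t,
    \<open>Q t\<close> not stopped before t.\<close>
  define R where "R t = {\<omega>. enat t < T \<omega>}" for t
  define E where "E t = {\<omega>. T \<omega> = enat t}" for t
  define Q where "Q t = {\<omega>. enat t \<le> T \<omega>}" for t
  have R_obs: "R t \<in> sets (obs_filtration X t)" for t
  proof -
    have "R t = space (obs_filtration X t) - {\<omega>. T \<omega> \<le> enat t}" by (auto simp: R_def)
    also have "\<dots> \<in> sets (obs_filtration X t)" using T by (intro sets.compl_sets) (simp add: obs_stopping_time_def)
    finally show ?thesis .
  qed
  have Q_Suc: "Q (Suc t) = R t" and Q_0: "Q 0 = UNIV" for t
    by (auto simp: Q_def R_def Suc_ile_eq zero_enat_def[symmetric])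
  have Q_obs: "Q t \<in> sets (obs_filtration X t)" for t
  proof (cases t)
    case (Suc n)
    have "(\<lambda>\<omega>. \<omega> \<in> R n) \<in> measurable (obs_filtration X (Suc n)) (count_space UNIV)"
      by (rule obs_mono[of _ _ n]) (use R_obs[of n] in \<open>simp_all add: pred_def\<close>)
    then show ?thesis using Suc by (simp add: pred_def Q_Suc)
  qed (simp add: Q_0 sets.top[of "obs_filtration X 0", simplified])
  have EQ: "E t = Q t - R t" for t by (auto simp: E_def Q_def R_def)
  have E_obs: "E t \<in> sets (obs_filtration X t)" for t unfolding EQ using Q_obs R_obs by auto
  have to_P: "A \<in> sets (obs_filtration X t) \<Longrightarrow> A \<in> sets P" and to_hist: "A \<in> sets (obs_filtration X t) \<Longrightarrow> A \<in> sets (hist t)" for A t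
    using obs_subalgebra[of t] obs_hist[of "\<lambda>\<omega>. \<omega> \<in> A" t "count_space UNIV"] by (auto simp: subalgebra_def pred_def)
  note [measurable] = to_P[OF R_obs] to_P[OF E_obs] to_P[OF Q_obs] to_hist[OF R_obs]
  note [measurable] = latent_P
  have split: "indicator (Q t) \<omega> = indicator (E t) \<omega> + (indicator (R t) \<omega> :: ennreal)" for t \<omega>
    unfolding EQ by (auto simp: Q_def R_def split: split_indicator)
  have split_int: "(\<integral>\<^sup>+\<omega>. F \<omega> * indicator (Q t) \<omega> \<partial>P) = (\<integral>\<^sup>+\<omega>. F \<omega> * indicator (E t) \<omega> \<partial>P) + (\<integral>\<^sup>+\<omega>. F \<omega> * indicator (R t) \<omega> \<partial>P)"
    if [measurable]: "F \<in> borel_measurable P" for F t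
    by (simp add: split distrib_left nn_integral_add)
  let ?I = "\<lambda>F A. \<integral>\<^sup>+\<omega>. F \<omega> * indicator A \<omega> \<partial>P"
  have cp01: "0 \<le> ?cp t \<omega>" "?cp t \<omega> \<le> 1" for t \<omega> using link_range[of "Suc t" \<omega>] by (auto simp: change_prob_eq)
  have cp_hist [measurable]: "(\<lambda>\<omega>. ?cp t \<omega>) \<in> borel_measurable (hist t)" for t
  proof -
    note [measurable] = obs_hist[OF link_obs, of t] measurable_latent[of t t, simplified]
    show ?thesis unfolding change_prob_eq by measurable
  qed
  note [measurable] = cp_hist[THEN hist_P] pot_hist[THEN hist_P]
  \<comment> \<open>Expresses the compensator of \<open>pot\<close> through the latent state at the
    end of the step, which can be counted.\<close>
  have latent_cp: "?I (\<lambda>\<omega>. of_bool (latent (Suc t) \<omega>)) (R t) = ?I (\<lambda>\<omega>. ennreal (?cp t \<omega>)) (R t)" for t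
  proof (subst nn_integral_step_weighted)
    show "(\<lambda>\<omega>. of_bool (latent (Suc t) \<omega>)) \<in> borel_measurable (hist (Suc t))"
      using measurable_latent[of "Suc t" "Suc t"] by measurable
    have x: "X (Suc t) \<omega> \<in> {1..K}" for \<omega> by (rule X_range) simp
    show "(\<integral>\<^sup>+\<omega>. (ennreal (?cp t \<omega>) * next_value (\<lambda>\<omega>. of_bool (latent (Suc t) \<omega>)) t \<omega> True +
        ennreal (1 - ?cp t \<omega>) * next_value (\<lambda>\<omega>. of_bool (latent (Suc t) \<omega>)) t \<omega> False) * indicator (R t) \<omega> \<partial>P) = ?I (\<lambda>\<omega>. ennreal (?cp t \<omega>)) (R t)"
      by (simp add: next_value_def nn_integral_g[OF x])
  qed (rule to_hist[OF R_obs])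
  have pot_dec: "?I (pot (Suc t)) (Q (Suc t)) + 0 \<le> ?I (pot t) (R t) + ennreal lam * ?I (\<lambda>\<omega>. of_bool (latent (Suc t) \<omega>)) (R t)" for t
  proof -
    have "?I (pot (Suc t)) (R t) \<le> (\<integral>\<^sup>+\<omega>. (pot t \<omega> + ennreal (lam * ?cp t \<omega>)) * indicator (R t) \<omega> \<partial>P)"
      unfolding nn_integral_step_weighted[OF pot_hist to_hist[OF R_obs]]
      by (intro nn_integral_mono mult_right_mono pot_step) auto
    also have "\<dots> = ?I (pot t) (R t) + (\<integral>\<^sup>+\<omega>. ennreal lam * (ennreal (?cp t \<omega>) * indicator (R t) \<omega>) \<partial>P)"
      using lam cp01 by (subst nn_integral_add[symmetric]) (auto simp: distrib_right ennreal_mult mult.assoc)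
    also have "(\<integral>\<^sup>+\<omega>. ennreal lam * (ennreal (?cp t \<omega>) * indicator (R t) \<omega>) \<partial>P) = ennreal lam * ?I (\<lambda>\<omega>. ennreal (?cp t \<omega>)) (R t)"
      by (rule nn_integral_cmult) measurable
    finally show ?thesis unfolding Q_Suc latent_cp by simp
  qed
  let ?W = "\<lambda>t \<omega>. min_time (state t \<omega>) * of_bool (\<not> latent t \<omega>)"
  have min_fin: "min_time s \<le> ennreal (w\<^sub>0 + \<kappa>)" if "s \<in> states \<kappa> K" for s
    using min_time_compare[OF that s0] w by (simp add: ennreal_of_nat_eq_real_of_nat ennreal_plus add.commute)
  have Wh: "(\<lambda>\<omega>. ?W t \<omega>) \<in> borel_measurable (hist t)" for t
  proof -
    have [measurable]: "(\<lambda>\<omega>. min_time (state t \<omega>)) \<in> borel_measurable (hist t)" by (rule measurable_compose[OF state_hist]) simp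
    show ?thesis using measurable_latent[of t t] by measurable
  qed
  note [measurable] = Wh[THEN hist_P]
  have W_inc: "?I (?W t) (R t) \<le> ?I (?W (Suc t)) (Q (Suc t)) + ?I (\<lambda>\<omega>. of_bool (\<not> latent t \<omega>)) (R t)" for t
  proof -
    have nv: "next_value (?W (Suc t)) t \<omega> False = min_time (state (Suc t) \<omega>)" "next_value (?W (Suc t)) t \<omega> True = 0" for \<omega>
    proof -
      have x: "X (Suc t) \<omega> \<in> {1..K}" by (rule X_range) simp
      have fx: "f (X (Suc t) \<omega>) \<in> borel_measurable \<mu>" by (rule borel_imp_\<mu>[OF f_measurable[OF x]])
      show "next_value (?W (Suc t)) t \<omega> False = min_time (state (Suc t) \<omega>)"
        unfolding next_value_def using nn_integral_f[OF x] fx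
        by (simp add: state_Suc state_upd X_upd nn_integral_cmult)
    qed (simp add: next_value_def)
    have "?I (?W t) (R t) \<le> (\<integral>\<^sup>+\<omega>. (ennreal (1 - ?cp t \<omega>) * min_time (state (Suc t) \<omega>)) * indicator (R t) \<omega> + of_bool (\<not> latent t \<omega>) * indicator (R t) \<omega> \<partial>P)"
    proof (intro nn_integral_mono)
      fix \<omega>
      have "?W t \<omega> * indicator (R t) \<omega> \<le> (ennreal (1 - ?cp t \<omega>) * min_time (state (Suc t) \<omega>) + of_bool (\<not> latent t \<omega>)) * indicator (R t) \<omega>"
        by (intro mult_right_mono min_time_process_step le_less_trans[OF min_fin]) auto
      then show "?W t \<omega> * indicator (R t) \<omega> \<le> (ennreal (1 - ?cp t \<omega>) * min_time (state (Suc t) \<omega>)) * indicator (R t) \<omega> + of_bool (\<not> latent t \<omega>) * indicator (R t) \<omega>"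
        by (simp only: distrib_right)
    qed
    also have "\<dots> = (\<integral>\<^sup>+\<omega>. (ennreal (1 - ?cp t \<omega>) * min_time (state (Suc t) \<omega>)) * indicator (R t) \<omega> \<partial>P) + ?I (\<lambda>\<omega>. of_bool (\<not> latent t \<omega>)) (R t)"
    proof (rule nn_integral_add)
      have [measurable]: "(\<lambda>\<omega>. min_time (state (Suc t) \<omega>)) \<in> borel_measurable P"
        by (rule hist_P[OF measurable_compose[OF state_hist]]) simp
      show "(\<lambda>\<omega>. (ennreal (1 - ?cp t \<omega>) * min_time (state (Suc t) \<omega>)) * indicator (R t) \<omega>) \<in> borel_measurable P" by measurable
    qed measurable
    also have "(\<integral>\<^sup>+\<omega>. (ennreal (1 - ?cp t \<omega>) * min_time (state (Suc t) \<omega>)) * indicator (R t) \<omega> \<partial>P) = ?I (?W (Suc t)) (Q (Suc t))"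
      unfolding Q_Suc nn_integral_step_weighted[OF Wh to_hist[OF R_obs]] nv by simp
    finally show ?thesis .
  qed
  have sumR: "expected_time P T = (\<Sum>t. emeasure P (R t))"
    unfolding R_def by (rule expected_time_eq[OF T])
  define e where "e = enn2real (expected_time P T)"
  have e: "expected_time P T = ennreal e" "0 \<le> e"
    unfolding e_def using False by (simp_all add: less_top ennreal_enn2real)
  \<comment> \<open>A finite mean makes a late horizon improbable. Its probability is taken at most
    \<alpha>, and together with the false alarms this gives 2 \<alpha>.\<close>
  obtain n where n: "emeasure P (Q n) \<le> ennreal \<alpha>"
  proof -
    have "\<exists>t. emeasure P (R t) \<le> ennreal \<alpha>"
    proof (rule ccontr)
      assume "\<not> ?thesis"
      then have *: "ennreal \<alpha> \<le> emeasure P (R t)" for t by (simp add: not_le less_imp_le)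
      have "real N * \<alpha> \<le> e" for N :: nat
      proof -
        have "ennreal (real N * \<alpha>) = (\<Sum>t<N. ennreal \<alpha>)" using \<alpha> by (simp add: ennreal_mult ennreal_of_nat_eq_real_of_nat)
        also have "\<dots> \<le> (\<Sum>t<N. emeasure P (R t))" by (intro sum_mono *)
        also have "\<dots> \<le> (\<Sum>t. emeasure P (R t))" by (intro sum_le_suminf) auto
        finally show ?thesis using e by (simp add: sumR[symmetric])
      qed
      moreover obtain N :: nat where "e / \<alpha> < real N" using reals_Archimedean2 by blast
      then have "e < real N * \<alpha>" using \<alpha> by (simp add: divide_less_eq)
      ultimately show False by (simp add: not_le[symmetric])
    qed
    then show thesis using that Q_Suc by metis
  qed
  let ?L = "\<lambda>t. {\<omega>. \<not> latent t \<omega>}"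
  note L [measurable] = not_latent_sets
  have early: "(\<Sum>t<n. emeasure P (E t \<inter> ?L t)) + emeasure P (Q n \<inter> ?L n) \<le> ennreal (2 * \<alpha>)"
  proof -
    have "(\<Sum>t<n. emeasure P (E t \<inter> ?L t)) = emeasure P (\<Union>t\<in>{..<n}. E t \<inter> ?L t)"
      by (rule sum_emeasure) (auto simp: disjoint_family_on_def E_def intro!: sets.Int to_P[OF E_obs, unfolded E_def] L)
    also have "\<dots> \<le> emeasure P {\<omega>. T \<omega> < change_point \<omega>}"
    proof (rule emeasure_mono_AE)
      show "AE \<omega> in P. \<omega> \<in> (\<Union>t\<in>{..<n}. E t \<inter> ?L t) \<longrightarrow> \<omega> \<in> {\<omega>. T \<omega> < change_point \<omega>}"
        using AE_less_change_point by eventually_elim (auto simp: E_def)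
    qed (rule early_stop_sets[OF T])
    also have "\<dots> \<le> ennreal \<alpha>" using err unfolding P.emeasure_eq_measure by (rule ennreal_leI)
    finally have "(\<Sum>t<n. emeasure P (E t \<inter> ?L t)) + emeasure P (Q n \<inter> ?L n) \<le> ennreal \<alpha> + emeasure P (Q n)"
      by (intro add_mono emeasure_mono) (auto intro: to_P[OF Q_obs])
    also have "\<dots> \<le> ennreal \<alpha> + ennreal \<alpha>" by (intro add_left_mono n)
    also have "\<dots> = ennreal (2 * \<alpha>)" using \<alpha> by (simp add: ennreal_plus[symmetric] del: ennreal_plus)
    finally show ?thesis .
  qed
  have total: "(\<Sum>t<m. emeasure P (E t)) + emeasure P (Q m) = 1" for m
  proof (induction m)
    case (Suc m)
    have "emeasure P (Q m) = emeasure P (E m) + emeasure P (R m)"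
      using split_int[of "\<lambda>_. 1" m] by (simp add: to_P[OF E_obs] to_P[OF Q_obs] to_P[OF R_obs])
    then show ?case using Suc by (simp add: Q_Suc add_ac)
  qed (use P.emeasure_space_1 in \<open>simp add: Q_0\<close>)
  let ?l = "ln (1 / ?\<eta>)"
  have l0: "0 < ?l" using \<alpha> by (simp add: ln_gt_zero)
  have pot_ge: "ennreal (?l + 1) * emeasure P A \<le> ?I (pot t) A + ennreal (1 / ?\<eta>) * emeasure P (A \<inter> ?L t)"
    if A: "A \<in> sets (obs_filtration X t)" for A t
  proof -
    note [measurable] = to_P[OF A] odds_obs[THEN obs_P, of t]
    have "ennreal (?l + 1) \<le> pot t \<omega> + ennreal (1 / ?\<eta>) * ennreal (1 / (1 + odds t \<omega>))" for \<omega>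
    proof -
      let ?u = "1 / (1 + odds t \<omega>)"
      have u: "0 < 1 + odds t \<omega>" using odds_nonneg[of t \<omega>] by simp
      have "ln (?u / ?\<eta>) \<le> ?u / ?\<eta> - 1" using u \<alpha> by (intro ln_le_minus_one) auto
      moreover have "ln (?u / ?\<eta>) = ?l - ln (1 + odds t \<omega>)" using u \<alpha> by (simp add: ln_div ln_mult)
      ultimately have "?l + 1 \<le> ln (1 + odds t \<omega>) + ?u / ?\<eta>" by linarith
      then have "?l + 1 \<le> ln (1 + odds t \<omega>) + 1 / ?\<eta> * ?u" by (simp add: mult.commute)
      moreover have "0 \<le> (if latent t \<omega> then h (state t \<omega>) else 1 + \<kappa> * lam)"
        using h_range[OF state_states] lam by simp
      ultimately have "ennreal (?l + 1) \<le> ennreal (ln (1 + odds t \<omega>) + (if latent t \<omega> then h (state t \<omega>) else 1 + \<kappa> * lam) + 1 / ?\<eta> * ?u)"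
        by (intro ennreal_leI) linarith
      also have "\<dots> = pot t \<omega> + ennreal (1 / ?\<eta>) * ennreal ?u"
        unfolding pot_def using odds_nonneg[of t \<omega>] h_range[OF state_states[of t \<omega>]] lam \<alpha>
        by (subst ennreal_plus) (auto simp: ennreal_mult[symmetric])
      finally show ?thesis .
    qed
    then have "(\<integral>\<^sup>+\<omega>. ennreal (?l + 1) * indicator A \<omega> \<partial>P) \<le> (\<integral>\<^sup>+\<omega>. (pot t \<omega> + ennreal (1 / ?\<eta>) * ennreal (1 / (1 + odds t \<omega>))) * indicator A \<omega> \<partial>P)"
      by (intro nn_integral_mono mult_right_mono) auto
    also have "\<dots> = ?I (pot t) A + ennreal (1 / ?\<eta>) * (\<integral>\<^sup>+\<omega>\<in>A. ennreal (1 / (1 + odds t \<omega>)) \<partial>P)"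
      by (simp add: distrib_right nn_integral_add nn_integral_cmult mult.assoc)
    also have "(\<integral>\<^sup>+\<omega>\<in>A. ennreal (1 / (1 + odds t \<omega>)) \<partial>P) = (\<integral>\<^sup>+\<omega>\<in>A. of_bool (\<not> latent t \<omega>) \<partial>P)"
      by (rule nn_integral_latent_obs(2)[OF A, symmetric])
    also have "\<dots> = (\<integral>\<^sup>+\<omega>. indicator (A \<inter> ?L t) \<omega> \<partial>P)" by (intro nn_integral_cong) (auto split: split_indicator)
    also have "\<dots> = emeasure P (A \<inter> ?L t)" by (intro nn_integral_indicator sets.Int to_P[OF A] L)
    finally show ?thesis using nn_integral_cmult_indicator[OF to_P[OF A]] by simp
  qed
  have pots: "ennreal ?l \<le> (\<Sum>t<n. ?I (pot t) (E t)) + ?I (pot n) (Q n)"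
  proof -
    have "ennreal (?l + 1) = ennreal (?l + 1) * ((\<Sum>t<n. emeasure P (E t)) + emeasure P (Q n))" by (simp add: total)
    also have "\<dots> = (\<Sum>t<n. ennreal (?l + 1) * emeasure P (E t)) + ennreal (?l + 1) * emeasure P (Q n)"
      by (simp add: distrib_left sum_distrib_left)
    also have "\<dots> \<le> (\<Sum>t<n. ?I (pot t) (E t) + ennreal (1 / ?\<eta>) * emeasure P (E t \<inter> ?L t)) +
        (?I (pot n) (Q n) + ennreal (1 / ?\<eta>) * emeasure P (Q n \<inter> ?L n))"
      by (intro add_mono sum_mono pot_ge E_obs Q_obs)
    also have "\<dots> = ((\<Sum>t<n. ?I (pot t) (E t)) + ?I (pot n) (Q n)) +
       ennreal (1 / ?\<eta>) * ((\<Sum>t<n. emeasure P (E t \<inter> ?L t)) + emeasure P (Q n \<inter> ?L n))"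
      by (simp add: sum.distrib distrib_left sum_distrib_left add_ac)
    also have "\<dots> \<le> ((\<Sum>t<n. ?I (pot t) (E t)) + ?I (pot n) (Q n)) + ennreal (1 / ?\<eta>) * ennreal (2 * \<alpha>)"
      by (intro add_left_mono mult_left_mono early) simp
    also have "ennreal (1 / ?\<eta>) * ennreal (2 * \<alpha>) = 1" using \<alpha> by (subst ennreal_mult[symmetric]) auto
    finally have "1 + ennreal ?l \<le> 1 + ((\<Sum>t<n. ?I (pot t) (E t)) + ?I (pot n) (Q n))"
      using l0 by (simp add: add.commute)
    then show ?thesis by (simp add: ennreal_add_left_cancel_le)
  qed
  define SL where "SL = (\<Sum>t<n. ?I (\<lambda>\<omega>. of_bool (latent (Suc t) \<omega>)) (R t))"
  define SN where "SN = (\<Sum>t<n. ?I (\<lambda>\<omega>. of_bool (\<not> latent t \<omega>)) (R t))"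
  define V0 where "V0 = ln (1 / (1 - \<pi>\<^sub>0)) + 1 + \<kappa> * lam"
  have V0: "0 \<le> V0" using \<pi>0 lam by (simp add: V0_def ln_ge_zero)
  have I: "ennreal ?l \<le> ennreal V0 + ennreal lam * SL"
  proof -
    have "(\<Sum>t<n. ?I (pot t) (E t)) + ?I (pot n) (Q n) + (\<Sum>t<n. 0) \<le> ?I (pot 0) (Q 0) + (\<Sum>t<n. ennreal lam * ?I (\<lambda>\<omega>. of_bool (latent (Suc t) \<omega>)) (R t))"
    proof (rule stopped_sum_le[where a="\<lambda>t. ?I (pot t) (R t)" and b="\<lambda>t. ?I (pot t) (E t)" and c="\<lambda>t. ?I (pot t) (Q t)" and C="\<lambda>_. 0"])
      show "?I (pot t) (Q t) = ?I (pot t) (E t) + ?I (pot t) (R t)" for t by (rule split_int) measurable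
    qed (rule pot_dec)
    also have "?I (pot 0) (Q 0) \<le> ennreal V0" using pot_initial by (simp add: Q_0 V0_def)
    finally show ?thesis using pots by (auto simp: SL_def sum_distrib_left intro: order_trans)
  qed
  have W_le: "?I (?W t) A \<le> ennreal (w\<^sub>0 + \<kappa>) * emeasure P (A \<inter> ?L t)" if A: "A \<in> sets P" for A t
  proof -
    have "?I (?W t) A \<le> (\<integral>\<^sup>+\<omega>. ennreal (w\<^sub>0 + \<kappa>) * indicator (A \<inter> ?L t) \<omega> \<partial>P)"
      using min_fin[OF state_states] by (intro nn_integral_mono) (auto split: split_indicator)
    also have "\<dots> = ennreal (w\<^sub>0 + \<kappa>) * emeasure P (A \<inter> ?L t)" by (intro nn_integral_cmult_indicator sets.Int A L)
    finally show ?thesis .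
  qed
  \<comment> \<open>Of the initial value only the part left at a stop before the change, or at the
    horizon, is lost: at most \<open>w\<^sub>0 + \<kappa>\<close> with probability 2
    \<alpha>.\<close>
  have II: "ennreal ((1 - \<pi>\<^sub>0) * w\<^sub>0) \<le> ennreal (w\<^sub>0 + \<kappa>) * ennreal (2 * \<alpha>) + SN"
  proof -
    have "ennreal ((1 - \<pi>\<^sub>0) * w\<^sub>0) = ?I (?W 0) (Q 0)"
      using nn_integral_initial[of "\<lambda>l. ennreal w\<^sub>0 * of_bool (\<not> l)"] \<pi>0 w
      by (simp add: Q_0 ennreal_mult memory_link_def)
    also have "\<dots> \<le> (\<Sum>t<n. ?I (?W t) (E t)) + ?I (?W n) (Q n) + SN"
      unfolding SN_def
    proof (rule stopped_sum_ge[where a="\<lambda>t. ?I (?W t) (R t)" and b="\<lambda>t. ?I (?W t) (E t)" and c="\<lambda>t. ?I (?W t) (Q t)"])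
      show "?I (?W t) (Q t) = ?I (?W t) (E t) + ?I (?W t) (R t)" for t by (rule split_int) measurable
    qed (rule W_inc)
    also have "\<dots> \<le> (\<Sum>t<n. ennreal (w\<^sub>0 + \<kappa>) * emeasure P (E t \<inter> ?L t)) + ennreal (w\<^sub>0 + \<kappa>) * emeasure P (Q n \<inter> ?L n) + SN"
      by (intro add_right_mono add_mono sum_mono W_le to_P[OF E_obs] to_P[OF Q_obs])
    also have "\<dots> = ennreal (w\<^sub>0 + \<kappa>) * ((\<Sum>t<n. emeasure P (E t \<inter> ?L t)) + emeasure P (Q n \<inter> ?L n)) + SN"
      by (simp add: distrib_left sum_distrib_left)
    also have "\<dots> \<le> ennreal (w\<^sub>0 + \<kappa>) * ennreal (2 * \<alpha>) + SN"
      by (intro add_right_mono mult_left_mono early) simp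
    finally show ?thesis .
  qed
  \<comment> \<open>The potential counts the steps ending with L = 1, the optimal mean time those
    beginning with L = 0. Only the step at which the change happens is counted twice, which costs at
    most 1.\<close>
  have III: "SL + SN \<le> ennreal (e + 1)"
  proof -
    let ?lr = "\<lambda>t. ?I (\<lambda>\<omega>. of_bool (latent t \<omega>)) (R t)" and ?nr = "\<lambda>t. ?I (\<lambda>\<omega>. of_bool (\<not> latent t \<omega>)) (R t)"
    have "?I (\<lambda>\<omega>. of_bool (latent (Suc t) \<omega>)) (R t) \<le> emeasure P (E (Suc t)) + ?lr (Suc t)" for t
    proof -
      have "?I (\<lambda>\<omega>. of_bool (latent (Suc t) \<omega>)) (R t) = ?I (\<lambda>\<omega>. of_bool (latent (Suc t) \<omega>)) (E (Suc t)) + ?lr (Suc t)"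
        unfolding Q_Suc[symmetric, of t] by (rule split_int) measurable
      also have "?I (\<lambda>\<omega>. of_bool (latent (Suc t) \<omega>)) (E (Suc t)) \<le> (\<integral>\<^sup>+\<omega>. indicator (E (Suc t)) \<omega> \<partial>P)"
        by (intro nn_integral_mono) (auto split: split_indicator)
      also have "\<dots> = emeasure P (E (Suc t))" by (intro nn_integral_indicator to_P[OF E_obs])
      finally show ?thesis by simp
    qed
    then have "SL \<le> (\<Sum>t<n. emeasure P (E (Suc t))) + (\<Sum>t<n. ?lr (Suc t))"
      unfolding SL_def sum.distrib[symmetric] by (intro sum_mono)
    also have "(\<Sum>t<n. emeasure P (E (Suc t))) \<le> 1"
    proof -
      have "(\<Sum>t<n. emeasure P (E (Suc t))) \<le> (\<Sum>t<Suc n. emeasure P (E t)) + emeasure P (Q (Suc n))"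
        unfolding sum.lessThan_Suc_shift by (simp add: add.assoc add_increasing add_increasing2)
      also have "\<dots> = 1" by (rule total)
      finally show ?thesis .
    qed
    also have "(\<Sum>t<n. ?lr (Suc t)) \<le> (\<Sum>t<Suc n. ?lr t)"
      unfolding sum.lessThan_Suc_shift by (simp add: add_increasing)
    finally have SL: "SL \<le> 1 + (\<Sum>t<Suc n. ?lr t)" by (simp add: add_mono)
    have SN: "SN \<le> (\<Sum>t<Suc n. ?nr t)" unfolding SN_def by (simp add: add_increasing2)
    have "?lr t + ?nr t = emeasure P (R t)" for t
    proof -
      have "?lr t + ?nr t = (\<integral>\<^sup>+\<omega>. of_bool (latent t \<omega>) * indicator (R t) \<omega> + of_bool (\<not> latent t \<omega>) * indicator (R t) \<omega> \<partial>P)"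
        by (rule nn_integral_add[symmetric]) measurable
      also have "\<dots> = (\<integral>\<^sup>+\<omega>. indicator (R t) \<omega> \<partial>P)" by (intro nn_integral_cong) auto
      also have "\<dots> = emeasure P (R t)" by (intro nn_integral_indicator to_P[OF R_obs])
      finally show ?thesis .
    qed
    then have "(\<Sum>t<Suc n. ?lr t) + (\<Sum>t<Suc n. ?nr t) = (\<Sum>t<Suc n. emeasure P (R t))"
      by (simp only: sum.distrib[symmetric])
    also have "\<dots> \<le> ennreal e" unfolding e(1)[symmetric] sumR by (intro sum_le_suminf) auto
    finally have "1 + ((\<Sum>t<Suc n. ?lr t) + (\<Sum>t<Suc n. ?nr t)) \<le> 1 + ennreal e" by (rule add_left_mono)
    moreover have "SL + SN \<le> 1 + ((\<Sum>t<Suc n. ?lr t) + (\<Sum>t<Suc n. ?nr t))"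
      using add_mono[OF SL SN] by (simp only: add.assoc)
    ultimately show ?thesis using e(2) by (simp add: add.commute order_trans)
  qed
  have "SL + SN < \<top>" using III by (rule le_less_trans) simp
  then obtain sl sn where s: "SL = ennreal sl" "SN = ennreal sn" "0 \<le> sl" "0 \<le> sn"
    by (cases SL; cases SN) auto
  have "?l \<le> V0 + lam * sl"
    using I lam V0 s by (simp add: ennreal_mult[symmetric] ennreal_plus[symmetric] del: ennreal_plus)
  then have 1: "(?l - V0) / lam \<le> sl" using lam by (simp add: divide_le_eq mult.commute)
  have 2: "(1 - \<pi>\<^sub>0) * w\<^sub>0 \<le> (w\<^sub>0 + \<kappa>) * (2 * \<alpha>) + sn"
    using II w(2) \<alpha> s by (simp add: ennreal_mult[symmetric] ennreal_plus[symmetric] del: ennreal_plus)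
  have 3: "sl + sn \<le> e + 1" using III s e(2) by (simp add: ennreal_plus[symmetric] del: ennreal_plus)
  show ?thesis
    unfolding e(1) using 1 2 3 by (intro ennreal_leI) (simp add: V0_def algebra_simps)
qed simp

end

end

section \<open>The upper bound\<close>

text \<open>The count in \<open>Det\<close> never exceeds the time, so the recent products do not
  reach time 0. The ratio at time 0 can therefore be redefined.\<close>

lemma (in staged_rule) stage_cong:
  assumes "\<And>t. \<Gamma> t = \<Gamma>' t" "\<And>t. 1 \<le> t \<Longrightarrow> \<Lambda> t = \<Lambda>' t"
  shows "stage \<Gamma> \<Lambda> t = stage \<Gamma>' \<Lambda>' t \<and> (\<forall>n. stage \<Gamma> \<Lambda> t = Det n \<longrightarrow> n \<le> t)"
proof (induction t)
  case 0
  then show ?case using assms(1) by (auto simp: enter_def)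
next
  case (Suc t)
  show ?case
  proof (cases "stage \<Gamma> \<Lambda> t")
    case (Det n)
    then have n: "n \<le> t" using Suc by simp
    have "recent_lr \<Lambda> (Suc t) (Suc n) = recent_lr \<Lambda>' (Suc t) (Suc n)"
      unfolding recent_lr_def by (intro prod.cong assms(2)) (use n in auto)
    moreover have "stage \<Gamma> \<Lambda> (Suc t) = stage_step (Det n) (\<Gamma>' (Suc t)) (recent_lr \<Lambda> (Suc t))"
      using Det assms(1)[of "Suc t"] by simp
    moreover have "stage \<Gamma>' \<Lambda>' t = Det n" using Suc Det by simp
    ultimately show ?thesis using n by (auto simp: enter_def)
  qed (use Suc in \<open>auto simp: enter_def assms(1)\<close>)
qed

lemma truncated_climb:
  fixes l w :: "'a \<Rightarrow> real"
  assumes trunc: "\<And>B. m \<le> B \<Longrightarrow> (\<integral>\<^sup>+y. ennreal (B - min (l y) m) * ennreal (w y) \<partial>\<mu>) \<le> ennreal (B - \<delta>)"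
    and w: "(\<integral>\<^sup>+y. ennreal (w y) \<partial>\<mu>) = 1" and [measurable]: "l \<in> borel_measurable \<mu>" "w \<in> borel_measurable \<mu>"
    and E: "m \<le> E" and k: "0 \<le> k" "0 \<le> c"
  shows "(\<integral>\<^sup>+y. ennreal (max 0 (E - l y) * k + c) * ennreal (w y) \<partial>\<mu>) \<le> ennreal ((E - \<delta>) * k + c)" and "\<delta> \<le> m"
proof -
  show dm: "\<delta> \<le> m"
  proof (rule ccontr)
    assume "\<not> \<delta> \<le> m"
    then have "m \<le> \<delta>" by simp
    have "(\<integral>\<^sup>+y. ennreal (\<delta> - m) * ennreal (w y) \<partial>\<mu>) \<le> (\<integral>\<^sup>+y. ennreal (\<delta> - min (l y) m) * ennreal (w y) \<partial>\<mu>)"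
      by (intro nn_integral_mono mult_right_mono ennreal_leI) auto
    also have "\<dots> \<le> ennreal (\<delta> - \<delta>)" by (rule trunc) fact
    finally have "ennreal (\<delta> - m) \<le> 0" using w by (simp add: nn_integral_cmult)
    then show False using \<open>\<not> \<delta> \<le> m\<close> by simp
  qed
  have "(\<integral>\<^sup>+y. ennreal (max 0 (E - l y) * k + c) * ennreal (w y) \<partial>\<mu>) \<le>
     (\<integral>\<^sup>+y. ennreal k * (ennreal (E - min (l y) m) * ennreal (w y)) + ennreal c * ennreal (w y) \<partial>\<mu>)"
  proof (rule nn_integral_mono)
    fix y
    have "max 0 (E - l y) * k + c \<le> (E - min (l y) m) * k + c" using E k by (intro add_right_mono mult_right_mono) auto
    then have "ennreal (max 0 (E - l y) * k + c) \<le> ennreal ((E - min (l y) m) * k + c)" by (rule ennreal_leI)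
    also have "\<dots> = ennreal k * ennreal (E - min (l y) m) + ennreal c"
      using E k by (subst ennreal_plus) (auto simp: ennreal_mult mult.commute min_le_iff_disj)
    finally have "ennreal (max 0 (E - l y) * k + c) * ennreal (w y) \<le> (ennreal k * ennreal (E - min (l y) m) + ennreal c) * ennreal (w y)"
      by (rule mult_right_mono) simp
    then show "ennreal (max 0 (E - l y) * k + c) * ennreal (w y) \<le> ennreal k * (ennreal (E - min (l y) m) * ennreal (w y)) + ennreal c * ennreal (w y)"
      by (simp add: distrib_right mult.assoc)
  qed
  also have "\<dots> = ennreal k * (\<integral>\<^sup>+y. ennreal (E - min (l y) m) * ennreal (w y) \<partial>\<mu>) + ennreal c"
    using w by (simp add: nn_integral_add nn_integral_cmult)
  also have "\<dots> \<le> ennreal k * ennreal (E - \<delta>) + ennreal c" by (intro add_right_mono mult_left_mono trunc E) simp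
  also have "\<dots> = ennreal ((E - \<delta>) * k + c)"
    using dm E k by (subst ennreal_plus) (auto simp: ennreal_mult mult.commute)
  finally show "(\<integral>\<^sup>+y. ennreal (max 0 (E - l y) * k + c) * ennreal (w y) \<partial>\<mu>) \<le> ennreal ((E - \<delta>) * k + c)" .
qed

lemma ln_odds_ge: "0 < G \<Longrightarrow> 0 \<le> q \<Longrightarrow> q < 1 \<Longrightarrow> ln G + survival_rate q \<le> ln ((G + q) / (1 - q))"
  by (simp add: survival_rate_def ln_divide_pos)

lemma survival_rate_nonneg: "0 \<le> survival_rate q" by (simp add: survival_rate_def)

text \<open>The constants: \<open>B1\<close>, \<open>B2\<close>, \<open>dd\<close> are the thresholds, \<open>M\<close> truncates the increments of the
  log-likelihood ratio, \<open>k1\<close>, \<open>k2\<close>, \<open>k'\<close> are reciprocals of (slightly reduced) drifts, and \<open>\<phi>1\<close>, \<open>\<phi>2\<close>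
  correct for the drift being attained only on average over a block. The constants \<open>c0\<close>, \<dots>, \<open>c3\<close> and \<open>R\<close>
  bound the expected remaining time in the various situations; \<open>R\<close> is the price of a restart.\<close>

locale two_stage = change_model K \<kappa> \<mu> f g \<Psi> s\<^sub>0 \<pi>\<^sub>0 X + staged_rule z\<^sub>0 \<Xi>\<^sub>1 \<Xi>\<^sub>2 "ereal B1" "ereal B2" "ereal dd"
  for K \<kappa> and \<mu> and f g :: "nat \<Rightarrow> 'y::polish_space \<Rightarrow> real" and \<Psi> s\<^sub>0 \<pi>\<^sub>0 X z\<^sub>0 \<Xi>\<^sub>1 \<Xi>\<^sub>2 B1 B2 dd +
  fixes p M Om k1 k2 k' C\<phi> R \<Theta> \<epsilon> \<delta> D1 D2 :: real and \<phi>1 \<phi>2 :: "nat \<Rightarrow> nat list \<Rightarrow> real"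
  assumes B1: "1 \<le> B1" and dd: "1 < dd"
    and p: "0 < p" "p \<le> 1" "\<And>x s. x \<in> {1..K} \<Longrightarrow> s \<in> states \<kappa> K \<Longrightarrow> \<Psi> x s \<le> p"
    and Om: "\<And>x s. x \<in> {1..K} \<Longrightarrow> s \<in> states \<kappa> K \<Longrightarrow> survival_rate (\<Psi> x s) \<le> Om"
    and M: "0 \<le> M" "\<And>x B. x \<in> {1..K} \<Longrightarrow> M \<le> B \<Longrightarrow> (\<integral>\<^sup>+y. ennreal (B - min (ln (g x y / f x y)) M) * ennreal (g x y) \<partial>\<mu>) \<le> ennreal (B - (I x - \<epsilon>))"
      "\<And>x B. x \<in> {1..K} \<Longrightarrow> M \<le> B \<Longrightarrow> (\<integral>\<^sup>+y. ennreal (B - min (ln (f x y / g x y)) M) * ennreal (f x y) \<partial>\<mu>) \<le> ennreal (B - (J x - \<epsilon>))"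
    and \<epsilon>I: "\<And>x. x \<in> {1..K} \<Longrightarrow> \<epsilon> \<le> I x" and \<delta>J: "\<And>x. x \<in> {1..K} \<Longrightarrow> \<delta> \<le> J x - \<epsilon>"
    and k1: "0 < k1" "k1 * (D1 - \<epsilon>) = 1" and k2: "0 < k2" "k2 * (D2 - \<epsilon>) = 1" and k': "0 < k'" "k' * \<delta> = 1"
    and y1: "\<And>n. acc_treatment n \<in> {1..K}" and y2: "\<And>n. det_treatment n \<in> {1..K}"
    and \<phi>1: "\<And>n s. s \<in> states \<kappa> K \<Longrightarrow> 0 \<le> \<phi>1 n s \<and> \<phi>1 n s \<le> C\<phi>"
      "\<And>n s. s \<in> states \<kappa> K \<Longrightarrow> D1 - reward I (acc_treatment n) s + \<phi>1 (Suc n) (shift \<kappa> (acc_treatment n) s) \<le> \<phi>1 n s"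
    and \<phi>2: "\<And>n s. s \<in> states \<kappa> K \<Longrightarrow> 0 \<le> \<phi>2 n s \<and> \<phi>2 n s \<le> C\<phi>"
      "\<And>n s. s \<in> states \<kappa> K \<Longrightarrow> D2 - reward I (det_treatment n) s + \<phi>2 (Suc n) (shift \<kappa> (det_treatment n) s) \<le> \<phi>2 n s"
    and \<Theta>: "0 \<le> \<Theta>" "\<And>s. s \<in> states \<kappa> K \<Longrightarrow> mean_time s (\<lambda>i. acc_treatment (length z\<^sub>0 + i)) \<le> ennreal \<Theta>"
begin

section \<open>Constants, stage process and Lyapunov function\<close>

definition "a1 = ln B1"
definition "\<beta> = ln B2"
definition "e = ln dd"
definition "N0 = M + Om + C\<phi>"
definition "c3 = (\<beta> + e + N0) * k2"
text \<open>Value of a fresh detection stage before the change: the mean time until the likelihood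
  ratio sends it back, \<open>c3\<close> in case the change occurs meanwhile, and one
  restart.\<close>

definition "C00 = k' * (e + M) + c3 + R"
text \<open>On entry into detection the posterior probability of no change is at most 1 / (1 +
  \<open>B1\<close>); this is the average price of a false start.\<close>

definition "c0 = C00 / (1 + B1)"
definition "Ud = (\<beta> - a1 + N0) * k2 + R / dd"
definition "c1 = c0 + Ud"
text \<open>The term ln (1 / p) accounts for the smallness of the odds just after the
  change.\<close>

definition "c2 = (a1 + N0 + ln (1 / p)) * k1 + c1"

definition \<theta> :: "nat \<Rightarrow> nat list \<Rightarrow> ennreal" where
  "\<theta> n s = mean_time s (\<lambda>i. acc_treatment (n + i))"

text \<open>There is no treatment at time 0 and nothing is known about \<open>X 0\<close>, so the
  ratio there is fixed to 1 to be measurable.\<close>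

definition lr1 :: "nat \<Rightarrow> 'y path \<Rightarrow> real" where
  "lr1 t \<omega> = (if t = 0 then 1 else lr t \<omega>)"

definition st :: "nat \<Rightarrow> 'y path \<Rightarrow> stage" where
  "st t \<omega> = stage (\<lambda>t. ereal (odds t \<omega>)) (\<lambda>t. lr1 t \<omega>) t"

definition Z :: "nat \<Rightarrow> nat \<Rightarrow> 'y path \<Rightarrow> real" where
  "Z t n \<omega> = recent_lr (\<lambda>t. lr1 t \<omega>) t n"

text \<open>The Lyapunov function of the upper bound: \<open>val \<sigma> t\<close> dominates the expected remaining time of a
  procedure that is in stage \<open>\<sigma>\<close> at time \<open>t\<close>.\<close>

fun val :: "stage \<Rightarrow> nat \<Rightarrow> 'y path \<Rightarrow> ennreal" where
  "val (Acc n) t \<omega> = (if latent t \<omega> then ennreal (max 0 (a1 + M + Om - ln (odds t \<omega>) + \<phi>1 n (state t \<omega>)) * k1 + c1)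
     else \<theta> n (state t \<omega>) * ennreal (1 + p * k1) + ennreal c2)"
| "val (Det n) t \<omega> = (if latent t \<omega> then ennreal (max 0 (\<beta> + M + Om - ln (odds t \<omega>) + \<phi>2 n (state t \<omega>)) * k2) + ennreal (R / dd / Z t n \<omega>)
     else ennreal (max 0 (ln (Z t n \<omega>) + e + M) * k' + (c3 + R)))"
| "val Stop t \<omega> = 0"

fun advance :: "stage \<Rightarrow> stage" where
  "advance (Acc n) = Acc (Suc n)" | "advance (Det n) = Det (Suc n)" | "advance Stop = Stop"

lemma B2: "1 \<le> B2" using B1 b1_le_b2 by simp

lemma Z_0 [simp]: "Z t 0 \<omega> = 1" by (simp add: Z_def recent_lr_def)

lemma Z_Suc: "Z (Suc t) (Suc n) \<omega> = lr (Suc t) \<omega> * Z t n \<omega>"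
  unfolding Z_def recent_lr_def prod.lessThan_Suc_shift by (simp add: lr1_def)

lemma lr1_obs: "lr1 t \<in> borel_measurable (obs_filtration X t)"
  by (cases "t = 0") (simp_all add: lr1_def[abs_def] lr_obs)

lemma Z_obs: "Z t n \<in> borel_measurable (obs_filtration X t)"
proof -
  have [measurable]: "lr1 (t - i) \<in> borel_measurable (obs_filtration X t)" for i
    by (rule obs_mono[OF lr1_obs]) simp
  show ?thesis unfolding Z_def recent_lr_def by measurable
qed

lemma st_0: "st 0 \<omega> = enter 0 (ereal (odds 0 \<omega>))" by (simp add: st_def)

lemma st_Suc: "st (Suc t) \<omega> = stage_step (st t \<omega>) (ereal (odds (Suc t) \<omega>)) (\<lambda>n. Z (Suc t) n \<omega>)"
  by (simp add: st_def Z_def)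

lemma st_obs: "st t \<in> measurable (obs_filtration X t) (count_space UNIV)"
proof (induction t)
  case 0
  note [measurable] = odds_obs[of 0]
  show ?case unfolding st_0 enter_def by measurable
next
  case (Suc t)
  note [measurable] = odds_obs[of "Suc t"] Z_obs[of "Suc t"]
  have 1: "(\<lambda>\<omega>. stage_step \<sigma> (ereal (odds (Suc t) \<omega>)) (\<lambda>n. Z (Suc t) n \<omega>)) \<in> measurable (obs_filtration X (Suc t)) (count_space UNIV)" for \<sigma>
    by (cases \<sigma>; simp only: stage_step.simps enter_def; measurable)
  have 2: "st t \<in> measurable (obs_filtration X (Suc t)) (count_space UNIV)" by (rule obs_mono[OF Suc]) simp
  show ?case unfolding st_Suc by (rule measurable_compose_countable[OF 1 2])
qed

lemma val_hist: "val \<sigma> t \<in> borel_measurable (hist t)"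
proof -
  note [measurable] = obs_hist[OF odds_obs, of t] obs_hist[OF Z_obs, of t] measurable_latent[of t t, simplified]
  have [measurable]: "(\<lambda>\<omega>. \<phi>1 n (state t \<omega>)) \<in> borel_measurable (hist t)" "(\<lambda>\<omega>. \<phi>2 n (state t \<omega>)) \<in> borel_measurable (hist t)"
    "(\<lambda>\<omega>. \<theta> n (state t \<omega>)) \<in> borel_measurable (hist t)" for n
    by (rule measurable_compose[OF state_hist], simp)+
  have "(\<lambda>\<omega>. val \<sigma> t \<omega>) \<in> borel_measurable (hist t)"
    by (cases \<sigma>; simp only: val.simps; measurable)
  then show ?thesis .
qed

definition U :: "nat \<Rightarrow> 'y path \<Rightarrow> ennreal" where "U t \<omega> = val (st t \<omega>) t \<omega>"
text \<open>Value at t + 1 if the stage merely advances. It separates the probabilistic drift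
  (\<open>Pre\<close> against the old value) from the effect of a stage change (new value against
  \<open>Pre\<close>).\<close>

definition Pre :: "nat \<Rightarrow> 'y path \<Rightarrow> ennreal" where "Pre t \<omega> = val (advance (st t \<omega>)) (Suc t) \<omega>"

lemma U_hist: "U t \<in> borel_measurable (hist t)"
  unfolding U_def by (rule measurable_compose_countable[OF val_hist obs_hist[OF st_obs]])

lemma Pre_hist: "Pre t \<in> borel_measurable (hist (Suc t))"
  unfolding Pre_def
  by (rule measurable_compose_countable[OF val_hist measurable_hist_mono[OF obs_hist[OF st_obs]]]) simp

lemma odds_Suc_ge: "odds t \<omega> * lr (Suc t) \<omega> \<le> odds (Suc t) \<omega>"
proof -
  have q: "0 \<le> link (Suc t) \<omega>" "link (Suc t) \<omega> < 1" using link_range by auto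
  have "odds t \<omega> \<le> (odds t \<omega> + link (Suc t) \<omega>) / (1 - link (Suc t) \<omega>)"
    using q odds_nonneg[of t \<omega>] by (simp add: pos_le_divide_eq right_diff_distrib add_increasing2)
  from mult_right_mono[OF this lr_nonneg[of "Suc t" \<omega>]] show ?thesis by simp
qed

lemma enter_cases:
  "enter n (ereal G) = Det m \<Longrightarrow> m = 0 \<and> B1 \<le> G \<and> G < B2" "enter n (ereal G) = Acc m \<Longrightarrow> m = n \<and> G < B1"
  using b1_le_b2 by (auto simp: enter_def split: if_splits)

text \<open>On entry into detection the product is 1 and the odds are at least \<open>B1\<close>;
  each step multiplies the odds by at least the likelihood ratio. So the odds stay controlled by the
  product even if the change occurs during detection.\<close>

lemma st_invariant:
  assumes lr: "\<And>t. 0 < lr (Suc t) \<omega>"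
  shows "(st t \<omega> = Acc n \<longrightarrow> odds t \<omega> < B1) \<and>
    (st t \<omega> = Det n \<longrightarrow> n \<le> t \<and> odds t \<omega> < B2 \<and> B1 * Z t n \<omega> \<le> odds t \<omega> \<and> 1 / dd < Z t n \<omega>)"
proof (induction t arbitrary: n)
  case 0
  show ?case using enter_cases[of 0 "odds 0 \<omega>"] dd by (auto simp: st_0)
next
  case (Suc t)
  have ent: "(enter m (ereal (odds (Suc t) \<omega>)) = Acc n \<longrightarrow> odds (Suc t) \<omega> < B1) \<and>
    (enter m (ereal (odds (Suc t) \<omega>)) = Det n \<longrightarrow> n \<le> Suc t \<and> odds (Suc t) \<omega> < B2 \<and> B1 * Z (Suc t) n \<omega> \<le> odds (Suc t) \<omega> \<and> 1 / dd < Z (Suc t) n \<omega>)" for m n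
    using enter_cases[of m "odds (Suc t) \<omega>"] dd by auto
  show ?case
  proof (cases "st t \<omega>")
    case (Acc m)
    then show ?thesis using ent[of "Suc m" n] by (simp add: st_Suc)
  next
    case (Det m)
    then have IH: "m \<le> t" "B1 * Z t m \<omega> \<le> odds t \<omega>" using Suc[of m] by auto
    show ?thesis
    proof (cases "B2 \<le> odds (Suc t) \<omega> \<or> Z (Suc t) (Suc m) \<omega> \<le> 1 / dd")
      case True
      then show ?thesis using ent[of "length z\<^sub>0" n] Det dd by (auto simp: st_Suc one_ereal_def)
    next
      case False
      then have s: "st (Suc t) \<omega> = Det (Suc m)" using Det dd by (simp add: st_Suc one_ereal_def)
      have "B1 * Z (Suc t) (Suc m) \<omega> = (B1 * Z t m \<omega>) * lr (Suc t) \<omega>" by (simp add: Z_Suc)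
      also have "\<dots> \<le> odds t \<omega> * lr (Suc t) \<omega>" using IH lr by (intro mult_right_mono) (auto intro: less_imp_le)
      also note odds_Suc_ge
      finally show ?thesis using s IH(1) False by auto
    qed
  qed (simp add: st_Suc)
qed

lemma c_nonneg: assumes "0 \<le> R"
  shows "0 \<le> a1" "a1 \<le> \<beta>" "0 < e" "0 \<le> Om" "0 \<le> C\<phi>" "0 \<le> N0" "0 \<le> c3" "0 \<le> C00" "0 \<le> c0" "0 \<le> Ud" "0 \<le> c1" "c1 \<le> c2" "c0 \<le> c1"
proof -
  have x: "1 \<in> {1..K}" using K by simp
  show a: "0 \<le> a1" "a1 \<le> \<beta>" "0 < e" using B1 b1_le_b2 dd by (auto simp: a1_def \<beta>_def e_def)
  show o: "0 \<le> Om" using Om[OF x s0] survival_rate_nonneg[of "\<Psi> 1 s\<^sub>0"] by linarith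
  show C: "0 \<le> C\<phi>" using \<phi>1(1)[OF s0, of 0] by linarith
  show N: "0 \<le> N0" using o C M(1) by (simp add: N0_def)
  show c3: "0 \<le> c3" using a N k2 by (simp add: c3_def)
  show C00: "0 \<le> C00" using c3 a M(1) k' assms by (simp add: C00_def)
  show c0: "0 \<le> c0" using C00 B1 by (simp add: c0_def)
  show Ud: "0 \<le> Ud" using a N k2 assms dd by (simp add: Ud_def)
  show "0 \<le> c1" using c0 Ud by (simp add: c1_def)
  have "0 \<le> ln (1 / p)" using p by (simp add: ln_ge_zero)
  then show "c1 \<le> c2" using a N k1 by (simp add: c2_def)
  show "c0 \<le> c1" using Ud by (simp add: c1_def)
qed

text \<open>C stands for the odds before the response and v for a lower bound of their logarithm, so
  that the remaining distance a - v is deterministic when the response is averaged.\<close>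

lemma climb:
  assumes x: "x \<in> {1..K}" and C: "0 < C" "v \<le> ln C" and a: "M \<le> a - v" and k: "0 \<le> k" "0 \<le> c"
  shows "(\<integral>\<^sup>+y. ennreal (max 0 (a - ln (C * (g x y / f x y))) * k + c) * ennreal (g x y) \<partial>\<mu>) \<le> ennreal ((a - v - (I x - \<epsilon>)) * k + c)"
proof -
  have [measurable]: "f x \<in> borel_measurable \<mu>" "g x \<in> borel_measurable \<mu>"
    using borel_imp_\<mu>[OF f_measurable[OF x]] borel_imp_\<mu>[OF g_measurable[OF x]] by auto
  have "(\<integral>\<^sup>+y. ennreal (max 0 (a - ln (C * (g x y / f x y))) * k + c) * ennreal (g x y) \<partial>\<mu>)
     \<le> (\<integral>\<^sup>+y. ennreal (max 0 ((a - v) - ln (g x y / f x y)) * k + c) * ennreal (g x y) \<partial>\<mu>)"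
  proof (rule nn_integral_mono_AE, use f_0_imp_g_0[OF x] in eventually_elim)
    fix y assume y: "f x y = 0 \<longrightarrow> g x y = 0"
    show "ennreal (max 0 (a - ln (C * (g x y / f x y))) * k + c) * ennreal (g x y) \<le> ennreal (max 0 ((a - v) - ln (g x y / f x y)) * k + c) * ennreal (g x y)"
    proof (cases "g x y = 0")
      case False
      then have "0 < g x y" "0 < f x y" using y f_nonneg[OF x, of y] g_nonneg[OF x, of y] by (auto simp: less_le)
      then have "ln (C * (g x y / f x y)) = ln C + ln (g x y / f x y)" using C by (intro ln_mult_pos) auto
      then have "max 0 (a - ln (C * (g x y / f x y))) * k + c \<le> max 0 ((a - v) - ln (g x y / f x y)) * k + c"
        using C k by (intro add_right_mono mult_right_mono) auto
      then show ?thesis by (intro mult_right_mono ennreal_leI) auto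
    qed simp
  qed
  also have "\<dots> \<le> ennreal ((a - v - (I x - \<epsilon>)) * k + c)"
    by (rule truncated_climb(1)[OF M(2)[OF x] nn_integral_g[OF x] _ _ a k]) measurable
  finally show ?thesis .
qed

section \<open>One-step inequalities, path by path\<close>

context
  fixes \<omega> :: "'y path" and t :: nat
  assumes good: "\<And>t. 0 < lr (Suc t) \<omega>" "latent t \<omega> \<Longrightarrow> 0 < odds t \<omega>" "X (Suc t) \<omega> = stage_treatment t (st t \<omega>)"
    and R0: "0 \<le> R"
begin

lemma upd_st: "st t ((\<omega>)(Suc t := z)) = st t \<omega>"
  by (rule hist_upd[OF obs_hist[OF st_obs]]) auto

lemma Z_upd: "n \<le> t \<Longrightarrow> Z (Suc t) (Suc n) ((\<omega>)(Suc t := (l, y))) = g (X (Suc t) \<omega>) y / f (X (Suc t) \<omega>) y * Z t n \<omega>"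
proof -
  assume n: "n \<le> t"
  have "Z t n ((\<omega>)(Suc t := (l, y))) = Z t n \<omega>" by (rule hist_upd[OF obs_hist[OF Z_obs]]) auto
  then show ?thesis by (simp add: Z_Suc lr_Suc_upd)
qed

lemma state_Suc_upd: "state (Suc t) ((\<omega>)(Suc t := z)) = shift \<kappa> (X (Suc t) \<omega>) (state t \<omega>)"
  by (simp add: state_Suc state_upd X_upd)

text \<open>Truncated information, survival rate and corrector add up to a gain of at least D1 -
  \<epsilon>, and \<open>k1\<close> is its reciprocal: one step gains one unit of time.\<close>

lemma Pre_step_Acc_latent:
  assumes st: "st t \<omega> = Acc n" and L: "latent t \<omega>"
  shows "next_value (Pre t) t \<omega> True + 1 \<le> U t \<omega>"
proof -
  define x s q G where "x = X (Suc t) \<omega>" and "s = state t \<omega>" and "q = link (Suc t) \<omega>" and "G = odds t \<omega>"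
  have x: "x \<in> {1..K}" "x = acc_treatment n" using X_range[of "Suc t" \<omega>] good(3) st by (auto simp: x_def)
  have s: "s \<in> states \<kappa> K" unfolding s_def by (rule state_states)
  have q: "0 \<le> q" "q < 1" using link_range by (auto simp: q_def)
  have q\<Psi>: "q = \<Psi> x s" by (simp add: q_def x_def s_def link_Suc)
  have G: "0 < G" "G < B1" using good(2)[OF L] st_invariant[OF good(1), of t n] st by (auto simp: G_def)
  have lG: "ln G < a1" using G by (simp add: a1_def)
  let ?s' = "shift \<kappa> x s"
  have \<phi>': "0 \<le> \<phi>1 (Suc n) ?s'" using \<phi>1(1)[OF shift_states[OF x(1) s]] by simp
  have \<phi>d: "\<phi>1 (Suc n) ?s' - survival_rate q - I x \<le> \<phi>1 n s - D1" using \<phi>1(2)[OF s, of n] by (simp add: x(2)[symmetric] reward_def q\<Psi>)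
  have oq: "survival_rate q \<le> Om" unfolding q\<Psi> by (rule Om[OF x(1) s])
  have nv: "next_value (Pre t) t \<omega> True = (\<integral>\<^sup>+y. ennreal (max 0 ((a1 + M + Om + \<phi>1 (Suc n) ?s') - ln ((G + q) / (1 - q) * (g x y / f x y))) * k1 + c1) * ennreal (g x y) \<partial>\<mu>)"
    unfolding next_value_def Pre_def upd_st st advance.simps val.simps state_Suc_upd odds_Suc_upd
    by (simp add: x_def s_def q_def G_def algebra_simps)
  have "next_value (Pre t) t \<omega> True \<le> ennreal (((a1 + M + Om + \<phi>1 (Suc n) ?s') - (ln G + survival_rate q) - (I x - \<epsilon>)) * k1 + c1)"
    unfolding nv
    by (rule climb[OF x(1)]) (use G q lG oq \<phi>' k1 c_nonneg[OF R0] ln_odds_ge[OF G(1) q] in auto)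
  also have "\<dots> \<le> ennreal ((a1 + M + Om - ln G + \<phi>1 n s) * k1 + c1 - 1)"
  proof (rule ennreal_leI)
    have "((a1 + M + Om + \<phi>1 (Suc n) ?s') - (ln G + survival_rate q) - (I x - \<epsilon>)) * k1 \<le> ((a1 + M + Om - ln G + \<phi>1 n s) - (D1 - \<epsilon>)) * k1"
      using \<phi>d k1 by (intro mult_right_mono) auto
    also have "\<dots> = (a1 + M + Om - ln G + \<phi>1 n s) * k1 - 1" using k1(2) by (simp add: algebra_simps)
    finally show "((a1 + M + Om + \<phi>1 (Suc n) ?s') - (ln G + survival_rate q) - (I x - \<epsilon>)) * k1 + c1 \<le> (a1 + M + Om - ln G + \<phi>1 n s) * k1 + c1 - 1" by simp
  qed
  finally have "next_value (Pre t) t \<omega> True + 1 \<le> ennreal ((a1 + M + Om - ln G + \<phi>1 n s) * k1 + c1 - 1) + 1" by (rule add_right_mono)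
  also have "\<dots> \<le> ennreal (max 0 (a1 + M + Om - ln G + \<phi>1 n s) * k1 + c1)"
  proof -
    have "0 \<le> a1 + M + Om - ln G + \<phi>1 n s" using lG \<phi>1(1)[OF s, of n] M(1) c_nonneg[OF R0] by linarith
    \<comment> \<open>Subtraction inside \<open>ennreal\<close> is cut off at 0; the removed 1 is
      recovered only if the value is at least 1.\<close>
    moreover have "1 \<le> (a1 + M + Om - ln G + \<phi>1 n s) * k1"
    proof -
      have "I x - \<epsilon> \<le> M"
        using truncated_climb(2)[OF M(2)[OF x(1)] nn_integral_g[OF x(1)], of M 1 0]
          borel_imp_\<mu>[OF f_measurable[OF x(1)]] borel_imp_\<mu>[OF g_measurable[OF x(1)]] by simp
      then have "D1 - \<epsilon> \<le> a1 + M + Om - ln G + \<phi>1 n s" using \<phi>d \<phi>' oq lG by linarith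
      then have "(D1 - \<epsilon>) * k1 \<le> (a1 + M + Om - ln G + \<phi>1 n s) * k1" using k1 by (intro mult_right_mono) auto
      then show ?thesis using k1 by (simp add: mult.commute)
    qed
    ultimately show ?thesis using c_nonneg[OF R0] by (simp add: ennreal_1[symmetric] ennreal_plus[symmetric] del: ennreal_1 ennreal_plus)
  qed
  also have "\<dots> = U t \<omega>" using st L by (simp add: U_def G_def s_def)
  finally show ?thesis .
qed

text \<open>If the change happens now, the odds before the response are at least q, and the distance
  to the threshold contains - ln q, unbounded for small q. Weighted with q it is at most q ln (1 /
  p) + p: the first part belongs to \<open>c2\<close>, the second costs p * k1 per step, whence the
  factor 1 + p * k1 on the mean time to the change.\<close>

lemma Pre_step_Acc_not_latent:
  assumes st: "st t \<omega> = Acc n" and L: "\<not> latent t \<omega>"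
  shows "ennreal (link (Suc t) \<omega>) * next_value (Pre t) t \<omega> True + ennreal (1 - link (Suc t) \<omega>) * next_value (Pre t) t \<omega> False + 1 \<le> U t \<omega>"
proof -
  define x s q G where "x = X (Suc t) \<omega>" and "s = state t \<omega>" and "q = link (Suc t) \<omega>" and "G = odds t \<omega>"
  have x: "x \<in> {1..K}" "x = acc_treatment n" using X_range[of "Suc t" \<omega>] good(3) st by (auto simp: x_def)
  have s: "s \<in> states \<kappa> K" unfolding s_def by (rule state_states)
  have q: "0 \<le> q" "q < 1" using link_range by (auto simp: q_def)
  have q\<Psi>: "q = \<Psi> x s" by (simp add: q_def x_def s_def link_Suc)
  have G: "0 \<le> G" using odds_nonneg by (simp add: G_def)
  note cn = c_nonneg[OF R0]
  let ?s' = "shift \<kappa> x s"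
  have s': "?s' \<in> states \<kappa> K" by (rule shift_states[OF x(1) s])
  have \<phi>': "0 \<le> \<phi>1 (Suc n) ?s'" "\<phi>1 (Suc n) ?s' \<le> C\<phi>" using \<phi>1(1)[OF s'] by auto
  have oq: "0 \<le> survival_rate q" "survival_rate q \<le> Om" unfolding q\<Psi> using Om[OF x(1) s] survival_rate_nonneg by auto
  have T: "ennreal q * next_value (Pre t) t \<omega> True \<le> ennreal (q * c2 + p * k1)"
  proof (cases "q = 0")
    case False
    then have q0: "0 < q" using q by simp
    have nv: "next_value (Pre t) t \<omega> True = (\<integral>\<^sup>+y. ennreal (max 0 ((a1 + M + Om + \<phi>1 (Suc n) ?s') - ln ((G + q) / (1 - q) * (g x y / f x y))) * k1 + c1) * ennreal (g x y) \<partial>\<mu>)"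
      unfolding next_value_def Pre_def upd_st st advance.simps val.simps state_Suc_upd odds_Suc_upd
      by (simp add: x_def s_def q_def G_def algebra_simps)
    have "q * (1 - q) \<le> q" using q by (simp add: mult_left_le)
    then have "q * (1 - q) \<le> G + q" using G by linarith
    moreover have "0 < 1 - q" using q by simp
    ultimately have qG: "q \<le> (G + q) / (1 - q)" by (simp only: pos_le_divide_eq)
    have C: "0 < (G + q) / (1 - q)" by (rule less_le_trans[OF q0 qG])
    have lnC: "ln q \<le> ln ((G + q) / (1 - q))" using q0 C qG by (simp only: ln_le_cancel_iff)
    have lq: "ln q \<le> 0" using q q0 by simp
    have Mle: "M \<le> (a1 + M + Om + \<phi>1 (Suc n) ?s') - ln q" using lq \<phi>' cn by linarith
    have "next_value (Pre t) t \<omega> True \<le> ennreal (((a1 + M + Om + \<phi>1 (Suc n) ?s') - ln q - (I x - \<epsilon>)) * k1 + c1)"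
      unfolding nv by (rule climb[OF x(1) C lnC Mle]) (use k1 cn in auto)
    also have "\<dots> \<le> ennreal ((a1 + N0 - ln q) * k1 + c1)"
      using \<phi>' \<epsilon>I[OF x(1)] k1 by (intro ennreal_leI add_right_mono mult_right_mono) (auto simp: N0_def)
    finally have "ennreal q * next_value (Pre t) t \<omega> True \<le> ennreal q * ennreal ((a1 + N0 - ln q) * k1 + c1)"
      by (rule mult_left_mono) simp
    also have "\<dots> = ennreal (q * ((a1 + N0 - ln q) * k1 + c1))"
      using q cn k1 lq by (intro ennreal_mult[symmetric]) (auto intro!: add_nonneg_nonneg mult_nonneg_nonneg)
    also have "\<dots> \<le> ennreal (q * c2 + p * k1)"
    proof (rule ennreal_leI)
      \<comment> \<open>Tangent bound for the logarithm, giving q ln (p / q) \<le> p.\<close>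
      have "ln (p / q) \<le> p / q - 1" using p q0 by (intro ln_le_minus_one) auto
      then have "q * ln (p / q) \<le> q * (p / q - 1)" using q by (intro mult_left_mono)
      also have "\<dots> \<le> p" using q0 by (simp add: right_diff_distrib)
      finally have "q * (ln (p / q)) * k1 \<le> p * k1" using k1 by (intro mult_right_mono) auto
      moreover have "ln (p / q) = - ln q - ln (1 / p)" using p q0 by (simp add: ln_divide_pos)
      ultimately have "q * (- ln q - ln (1 / p)) * k1 \<le> p * k1" by simp
      then show "q * ((a1 + N0 - ln q) * k1 + c1) \<le> q * c2 + p * k1" by (simp add: c2_def algebra_simps)
    qed
    finally show ?thesis .
  qed simp
  have F: "next_value (Pre t) t \<omega> False = \<theta> (Suc n) ?s' * ennreal (1 + p * k1) + ennreal c2"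
    unfolding next_value_def Pre_def upd_st st advance.simps val.simps state_Suc_upd
    using nn_integral_f[OF x(1)] borel_imp_\<mu>[OF f_measurable[OF x(1)]] by (simp add: x_def[symmetric] s_def[symmetric] nn_integral_cmult)
  have \<theta>: "\<theta> n s = 1 + ennreal (1 - q) * \<theta> (Suc n) ?s'"
    unfolding \<theta>_def using mean_time_step[OF s, of "\<lambda>i. acc_treatment (n + i)"] y1 by (simp add: treatments_def x(2)[symmetric] q\<Psi>)
  have c2: "0 \<le> c2" using cn by linarith
  have "ennreal q * next_value (Pre t) t \<omega> True + ennreal (1 - q) * next_value (Pre t) t \<omega> False + 1
     \<le> ennreal (q * c2 + p * k1) + ennreal (1 - q) * (\<theta> (Suc n) ?s' * ennreal (1 + p * k1) + ennreal c2) + 1"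
    unfolding F by (intro add_right_mono T)
  also have "\<dots> = (ennreal (q * c2 + p * k1) + ennreal ((1 - q) * c2) + 1) + ennreal (1 - q) * \<theta> (Suc n) ?s' * ennreal (1 + p * k1)"
    using q c2 by (simp add: distrib_left ennreal_mult' mult.assoc add_ac)
  also have "ennreal (q * c2 + p * k1) + ennreal ((1 - q) * c2) + 1 = ennreal (1 + p * k1) + ennreal c2"
    using q c2 p k1 by (simp add: ennreal_1[symmetric] ennreal_plus[symmetric] del: ennreal_1 ennreal_plus) (simp add: algebra_simps)
  also have "ennreal (1 + p * k1) + ennreal c2 + ennreal (1 - q) * \<theta> (Suc n) ?s' * ennreal (1 + p * k1) = \<theta> n s * ennreal (1 + p * k1) + ennreal c2"
    unfolding \<theta> by (simp add: distrib_right add_ac)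
  also have "\<dots> = U t \<omega>" using st L by (simp add: U_def s_def)
  finally show ?thesis by (simp add: q_def)
qed

text \<open>After the change the odds climb as in acceleration, while R / (dd Z) insures against a
  false return: the inverse likelihood ratio has mean at most 1. Before the change ln Z falls by at
  least \<delta> per step. If the change occurs during the stage, the odds still exceed B1 / dd, so
  \<open>c3\<close> covers the rest.\<close>

lemma Pre_step_Det:
  assumes st: "st t \<omega> = Det n"
  shows "ennreal (change_prob (memory_link \<kappa> \<Psi> s\<^sub>0 \<pi>\<^sub>0) X (Suc t) \<omega>) * next_value (Pre t) t \<omega> True
    + ennreal (1 - change_prob (memory_link \<kappa> \<Psi> s\<^sub>0 \<pi>\<^sub>0) X (Suc t) \<omega>) * next_value (Pre t) t \<omega> False + 1 \<le> U t \<omega>"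
proof -
  define x s q G z where "x = X (Suc t) \<omega>" and "s = state t \<omega>" and "q = link (Suc t) \<omega>" and "G = odds t \<omega>" and "z = Z t n \<omega>"
  have x: "x \<in> {1..K}" "x = det_treatment n" using X_range[of "Suc t" \<omega>] good(3) st by (auto simp: x_def)
  have s: "s \<in> states \<kappa> K" unfolding s_def by (rule state_states)
  have q: "0 \<le> q" "q < 1" using link_range by (auto simp: q_def)
  have q\<Psi>: "q = \<Psi> x s" by (simp add: q_def x_def s_def link_Suc)
  have inv: "n \<le> t" "G < B2" "B1 * z \<le> G" "1 / dd < z"
    using st_invariant[OF good(1), of t n] st by (auto simp: G_def z_def)
  have z0: "0 < z" using inv(4) dd by (smt (verit) divide_pos_pos)
  have G0: "0 < G" using inv(3) z0 B1 by (smt (verit) mult_pos_pos)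
  have lz: "a1 + ln z \<le> ln G" 
  proof -
    have "ln (B1 * z) \<le> ln G" using inv(3) z0 B1 G0 by (subst ln_le_cancel_iff) auto
    then show ?thesis using B1 z0 by (simp add: a1_def ln_mult)
  qed
  have ez: "0 < ln z + e"
  proof -
    have "ln (1 / dd) < ln z" using inv(4) z0 dd by (subst ln_less_cancel_iff) auto
    then show ?thesis using dd by (simp add: e_def ln_divide_pos)
  qed
  have lG: "ln G < \<beta>" using inv(2) G0 by (simp add: \<beta>_def)
  note cn = c_nonneg[OF R0]
  have [measurable]: "f x \<in> borel_measurable \<mu>" "g x \<in> borel_measurable \<mu>"
    using borel_imp_\<mu>[OF f_measurable[OF x(1)]] borel_imp_\<mu>[OF g_measurable[OF x(1)]] by auto
  let ?s' = "shift \<kappa> x s"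
  have s': "?s' \<in> states \<kappa> K" by (rule shift_states[OF x(1) s])
  have \<phi>': "0 \<le> \<phi>2 (Suc n) ?s'" "\<phi>2 (Suc n) ?s' \<le> C\<phi>" using \<phi>2(1)[OF s'] by auto
  have \<phi>d: "\<phi>2 (Suc n) ?s' - survival_rate q - I x \<le> \<phi>2 n s - D2" using \<phi>2(2)[OF s, of n] by (simp add: x(2)[symmetric] reward_def q\<Psi>)
  have oq: "0 \<le> survival_rate q" "survival_rate q \<le> Om" unfolding q\<Psi> using Om[OF x(1) s] survival_rate_nonneg by auto
  have T: "next_value (Pre t) t \<omega> True \<le> (\<integral>\<^sup>+y. ennreal (max 0 ((\<beta> + M + Om + \<phi>2 (Suc n) ?s') - ln ((G + q) / (1 - q) * (g x y / f x y))) * k2 + 0) * ennreal (g x y) \<partial>\<mu>) + ennreal (R / dd / z)"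
  proof -
    have "next_value (Pre t) t \<omega> True = (\<integral>\<^sup>+y. ennreal (max 0 ((\<beta> + M + Om + \<phi>2 (Suc n) ?s') - ln ((G + q) / (1 - q) * (g x y / f x y))) * k2 + 0) * ennreal (g x y)
        + ennreal (R / dd / (g x y / f x y * z)) * ennreal (g x y) \<partial>\<mu>)"
      unfolding next_value_def Pre_def upd_st st advance.simps val.simps state_Suc_upd odds_Suc_upd Z_upd[OF inv(1)]
      by (simp add: x_def s_def q_def G_def z_def algebra_simps)
    also have "\<dots> = (\<integral>\<^sup>+y. ennreal (max 0 ((\<beta> + M + Om + \<phi>2 (Suc n) ?s') - ln ((G + q) / (1 - q) * (g x y / f x y))) * k2 + 0) * ennreal (g x y) \<partial>\<mu>)
        + (\<integral>\<^sup>+y. ennreal (R / dd / (g x y / f x y * z)) * ennreal (g x y) \<partial>\<mu>)"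
      by (rule nn_integral_add) measurable
    also have "(\<integral>\<^sup>+y. ennreal (R / dd / (g x y / f x y * z)) * ennreal (g x y) \<partial>\<mu>) = (\<integral>\<^sup>+y. ennreal (R / dd / z) * (ennreal (f x y / g x y) * ennreal (g x y)) \<partial>\<mu>)"
    proof (rule nn_integral_cong)
      fix y
      have "R / dd / (g x y / f x y * z) = (R / dd / z) * (f x y / g x y)" by (simp add: divide_simps)
      then have "ennreal (R / dd / (g x y / f x y * z)) = ennreal (R / dd / z) * ennreal (f x y / g x y)"
        by (simp only:, intro ennreal_mult) (use R0 dd z0 f_nonneg[OF x(1), of y] g_nonneg[OF x(1), of y] in auto)
      then show "ennreal (R / dd / (g x y / f x y * z)) * ennreal (g x y) = ennreal (R / dd / z) * (ennreal (f x y / g x y) * ennreal (g x y))"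
        by (simp only: mult.assoc)
    qed
    also have "\<dots> = ennreal (R / dd / z) * (\<integral>\<^sup>+y. ennreal (f x y / g x y) * ennreal (g x y) \<partial>\<mu>)" by (rule nn_integral_cmult) measurable
    also have "\<dots> \<le> ennreal (R / dd / z) * 1"
      by (intro mult_left_mono density_pair.nn_integral_likelihood_ratio_le[OF gf[OF x(1)]]) simp
    finally show ?thesis by (simp add: add_left_mono)
  qed
  show ?thesis
  proof (cases "latent t \<omega>")
    case L: True
    have "next_value (Pre t) t \<omega> True \<le> ennreal (((\<beta> + M + Om + \<phi>2 (Suc n) ?s') - (ln G + survival_rate q) - (I x - \<epsilon>)) * k2 + 0) + ennreal (R / dd / z)"
      by (rule order_trans[OF T], intro add_right_mono climb[OF x(1)]) (use G0 q lG oq \<phi>' k2 cn ln_odds_ge[OF G0 q] in auto)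
    also have "\<dots> \<le> ennreal ((\<beta> + M + Om - ln G + \<phi>2 n s) * k2 - 1) + ennreal (R / dd / z)"
    proof (intro add_right_mono ennreal_leI)
      have "((\<beta> + M + Om + \<phi>2 (Suc n) ?s') - (ln G + survival_rate q) - (I x - \<epsilon>)) * k2 \<le> ((\<beta> + M + Om - ln G + \<phi>2 n s) - (D2 - \<epsilon>)) * k2"
        using \<phi>d k2 by (intro mult_right_mono) auto
      also have "\<dots> = (\<beta> + M + Om - ln G + \<phi>2 n s) * k2 - 1" using k2(2) by (simp add: algebra_simps)
      finally show "((\<beta> + M + Om + \<phi>2 (Suc n) ?s') - (ln G + survival_rate q) - (I x - \<epsilon>)) * k2 + 0 \<le> (\<beta> + M + Om - ln G + \<phi>2 n s) * k2 - 1" by simp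
    qed
    finally have "next_value (Pre t) t \<omega> True + 1 \<le> (ennreal ((\<beta> + M + Om - ln G + \<phi>2 n s) * k2 - 1) + ennreal (R / dd / z)) + 1" by (rule add_right_mono)
    also have "\<dots> = (ennreal ((\<beta> + M + Om - ln G + \<phi>2 n s) * k2 - 1) + 1) + ennreal (R / dd / z)" by (simp add: add_ac)
    also have "ennreal ((\<beta> + M + Om - ln G + \<phi>2 n s) * k2 - 1) + 1 \<le> ennreal (max 0 (\<beta> + M + Om - ln G + \<phi>2 n s) * k2)"
    proof -
      have "0 \<le> \<beta> + M + Om - ln G + \<phi>2 n s" using lG \<phi>2(1)[OF s, of n] M(1) cn by linarith
      moreover have "1 \<le> (\<beta> + M + Om - ln G + \<phi>2 n s) * k2"
      proof -
        have "I x - \<epsilon> \<le> M"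
          using truncated_climb(2)[OF M(2)[OF x(1)] nn_integral_g[OF x(1)], of M 1 0] by simp
        then have "D2 - \<epsilon> \<le> \<beta> + M + Om - ln G + \<phi>2 n s" using \<phi>d \<phi>' oq lG by linarith
        then have "(D2 - \<epsilon>) * k2 \<le> (\<beta> + M + Om - ln G + \<phi>2 n s) * k2" using k2 by (intro mult_right_mono) auto
        then show ?thesis using k2 by (simp add: mult.commute)
      qed
      ultimately show ?thesis by (simp add: ennreal_1[symmetric] ennreal_plus[symmetric] del: ennreal_1 ennreal_plus)
    qed
    finally have "next_value (Pre t) t \<omega> True + 1 \<le> U t \<omega>" using st L by (simp add: U_def G_def s_def z_def add_right_mono)
    then show ?thesis using L by (simp add: change_prob_eq)
  next
    case L: False
    \<comment> \<open>Within the stage Z exceeds 1 / dd, so the insurance is worth at most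
      R.\<close>
    have zi: "R / dd / z \<le> R"
    proof -
      have "1 \<le> dd * z" using inv(4) dd by (simp add: divide_less_eq mult.commute)
      then have "R / (dd * z) \<le> R / 1" using R0 by (intro divide_left_mono) auto
      then show ?thesis by simp
    qed
    have "next_value (Pre t) t \<omega> True \<le> ennreal (((\<beta> + M + Om + \<phi>2 (Suc n) ?s') - (a1 + ln z) - (I x - \<epsilon>)) * k2 + 0) + ennreal (R / dd / z)"
      by (rule order_trans[OF T], intro add_right_mono climb[OF x(1)])
        (use G0 q lG oq lz \<phi>' k2 cn ln_odds_ge[OF G0 q] in auto)
    also have "\<dots> \<le> ennreal c3 + ennreal R"
    proof (intro add_mono ennreal_leI zi)
      show "((\<beta> + M + Om + \<phi>2 (Suc n) ?s') - (a1 + ln z) - (I x - \<epsilon>)) * k2 + 0 \<le> c3"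
        unfolding c3_def add_0_right
        by (intro mult_right_mono) (use \<phi>' ez cn(1) \<epsilon>I[OF x(1)] k2 in \<open>auto simp: N0_def\<close>)
    qed
    finally have T': "next_value (Pre t) t \<omega> True \<le> ennreal (c3 + R)" using cn R0 by simp
    define E where "E = ln z + e + M"
    have EM: "M \<le> E" using ez by (simp add: E_def)
    have F: "next_value (Pre t) t \<omega> False \<le> ennreal ((E - (J x - \<epsilon>)) * k' + (c3 + R))"
    proof -
      have "next_value (Pre t) t \<omega> False = (\<integral>\<^sup>+y. ennreal (max 0 (ln (g x y / f x y * z) + e + M) * k' + (c3 + R)) * ennreal (f x y) \<partial>\<mu>)"
        unfolding next_value_def Pre_def upd_st st advance.simps val.simps state_Suc_upd odds_Suc_upd Z_upd[OF inv(1)]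
        by (simp add: x_def z_def)
      also have "\<dots> \<le> (\<integral>\<^sup>+y. ennreal (max 0 (E - ln (f x y / g x y)) * k' + (c3 + R)) * ennreal (f x y) \<partial>\<mu>)"
      proof (rule nn_integral_mono_AE, use g_0_imp_f_0[OF x(1)] in eventually_elim)
        fix y assume y: "g x y = 0 \<longrightarrow> f x y = 0"
        show "ennreal (max 0 (ln (g x y / f x y * z) + e + M) * k' + (c3 + R)) * ennreal (f x y) \<le> ennreal (max 0 (E - ln (f x y / g x y)) * k' + (c3 + R)) * ennreal (f x y)"
        proof (cases "f x y = 0")
          case False
          then have "0 < g x y" "0 < f x y" using y f_nonneg[OF x(1), of y] g_nonneg[OF x(1), of y] by (auto simp: less_le)
          then have "ln (g x y / f x y * z) = ln z - ln (f x y / g x y)" using z0 by (simp add: ln_mult ln_div)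
          then have "ln (g x y / f x y * z) + e + M = E - ln (f x y / g x y)" by (simp add: E_def)
          then show ?thesis by (simp only: order_refl)
        qed simp
      qed
      also have "\<dots> \<le> ennreal ((E - (J x - \<epsilon>)) * k' + (c3 + R))"
        by (rule truncated_climb(1)[OF M(3)[OF x(1)] nn_integral_f[OF x(1)] _ _ EM]) (use k' cn R0 in auto)
      finally show ?thesis .
    qed
    have Jm: "J x - \<epsilon> \<le> M"
      using truncated_climb(2)[OF M(3)[OF x(1)] nn_integral_f[OF x(1)], of M 1 0] by simp
    have F': "next_value (Pre t) t \<omega> False \<le> ennreal (E * k' - 1 + (c3 + R))"
    proof (rule order_trans[OF F], rule ennreal_leI)
      have "(E - (J x - \<epsilon>)) * k' \<le> (E - \<delta>) * k'" using \<delta>J[OF x(1)] k' by (intro mult_right_mono) auto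
      also have "\<dots> = E * k' - 1" using k'(2) by (simp add: algebra_simps)
      finally show "(E - (J x - \<epsilon>)) * k' + (c3 + R) \<le> E * k' - 1 + (c3 + R)" by simp
    qed
    have E1: "1 \<le> E * k'"
    proof -
      have "\<delta> \<le> E" using \<delta>J[OF x(1)] Jm EM by linarith
      then have "\<delta> * k' \<le> E * k'" using k' by (intro mult_right_mono) auto
      then show ?thesis using k'(2) by (simp only: mult.commute[of \<delta>])
    qed
    have c3R: "0 \<le> c3 + R" using cn R0 by simp
    have "ennreal q * next_value (Pre t) t \<omega> True + ennreal (1 - q) * next_value (Pre t) t \<omega> False + 1
      \<le> ennreal q * ennreal (c3 + R) + ennreal (1 - q) * ennreal (E * k' - 1 + (c3 + R)) + 1"
      by (intro add_mono mult_left_mono T' F') auto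
    also have "\<dots> = ennreal (q * (c3 + R) + (1 - q) * (E * k' - 1 + (c3 + R)) + 1)"
      using q c3R E1 by (simp add: ennreal_mult ennreal_plus)
    also have "\<dots> \<le> ennreal (max 0 E * k' + (c3 + R))"
    proof (rule ennreal_leI)
      have "0 \<le> q * (E * k' - 1)" using q E1 by simp
      moreover have "E * k' \<le> max 0 E * k'" using k' by (intro mult_right_mono) auto
      ultimately show "q * (c3 + R) + (1 - q) * (E * k' - 1 + (c3 + R)) + 1 \<le> max 0 E * k' + (c3 + R)"
        by (simp add: algebra_simps)
    qed
    also have "\<dots> = U t \<omega>" using st L by (simp add: U_def z_def E_def)
    finally show ?thesis using L by (simp add: change_prob_eq q_def)
  qed
qed

lemma Pre_step: "ennreal (change_prob (memory_link \<kappa> \<Psi> s\<^sub>0 \<pi>\<^sub>0) X (Suc t) \<omega>) * next_value (Pre t) t \<omega> True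
    + ennreal (1 - change_prob (memory_link \<kappa> \<Psi> s\<^sub>0 \<pi>\<^sub>0) X (Suc t) \<omega>) * next_value (Pre t) t \<omega> False + of_bool (st t \<omega> \<noteq> Stop) \<le> U t \<omega>"
proof (cases "st t \<omega>")
  case (Acc n)
  then show ?thesis
    using Pre_step_Acc_latent[OF Acc] Pre_step_Acc_not_latent[OF Acc] by (cases "latent t \<omega>") (simp_all add: change_prob_eq)
next
  case (Det n)
  then show ?thesis using Pre_step_Det[OF Det] by simp
next
  case Stop
  then have "next_value (Pre t) t \<omega> l = 0" for l by (simp add: next_value_def Pre_def upd_st)
  then show ?thesis using Stop by simp
qed

end

end

lemma (in regular_model) next_value_hist:
  assumes F: "F \<in> borel_measurable (hist (Suc t))"
  shows "(\<lambda>\<omega>. next_value F t \<omega> l) \<in> borel_measurable (hist t)"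
proof -
  let ?h = "if l then g else f"
  let ?u = "\<lambda>z. (fst z)(Suc t := (l, snd z))"
  have "?u \<in> measurable (hist t \<Otimes>\<^sub>M (borel :: 'a measure)) (hist (Suc t))"
  proof (rule measurable_into_hist)
    fix i assume "i \<le> Suc t"
    show "(\<lambda>z. ?u z i) \<in> measurable (hist t \<Otimes>\<^sub>M (borel :: 'a measure)) step_space"
    proof (cases "i = Suc t")
      case False
      then have "(\<lambda>\<omega>. \<omega> i) \<in> measurable (hist t) step_space" using \<open>i \<le> Suc t\<close> by (intro measurable_hist_coord) simp
      from measurable_compose[OF measurable_fst this] show ?thesis using False by simp
    qed (simp add: step_space_def)
  qed
  from measurable_compose[OF this F] have "(\<lambda>z. F (?u z)) \<in> borel_measurable (hist t \<Otimes>\<^sub>M (borel :: 'a measure))" .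
  moreover have "sets (hist t \<Otimes>\<^sub>M \<mu>) = sets (hist t \<Otimes>\<^sub>M (borel :: 'a measure))"
    by (rule sets_pair_measure_cong) (auto simp: sets_\<mu>)
  ultimately have [measurable]: "(\<lambda>z. F (?u z)) \<in> borel_measurable (hist t \<Otimes>\<^sub>M \<mu>)"
    using measurable_cong_sets by blast
  have 1: "(\<lambda>\<omega>. (if x \<in> {1..K} then \<integral>\<^sup>+y. F ((\<omega>)(Suc t := (l, y))) * ennreal (?h x y) \<partial>\<mu> else 0)) \<in> borel_measurable (hist t)" for x
  proof (cases "x \<in> {1..K}")
    case True
    have [measurable]: "?h x \<in> borel_measurable \<mu>"
      using True borel_imp_\<mu>[OF f_measurable] borel_imp_\<mu>[OF g_measurable] by simp
    have "(\<lambda>z. F (?u z) * ennreal (?h x (snd z))) \<in> borel_measurable (hist t \<Otimes>\<^sub>M \<mu>)" by measurable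
    then have "(\<lambda>\<omega>. \<integral>\<^sup>+y. F ((\<omega>)(Suc t := (l, y))) * ennreal (?h x y) \<partial>\<mu>) \<in> borel_measurable (hist t)"
      by (intro \<mu>.borel_measurable_nn_integral) (simp add: split_beta')
    then show ?thesis using True by simp
  next
    case False
    then show ?thesis by (simp only: if_False) simp
  qed
  have 2: "X (Suc t) \<in> measurable (hist t) (count_space UNIV)" by (rule X_hist) auto
  have "(\<lambda>\<omega>. (if X (Suc t) \<omega> \<in> {1..K} then \<integral>\<^sup>+y. F ((\<omega>)(Suc t := (l, y))) * ennreal (?h (X (Suc t) \<omega>) y) \<partial>\<mu> else 0)) \<in> borel_measurable (hist t)"
    by (rule measurable_compose_countable[OF 1 2])
  then show ?thesis using X_range[of "Suc t"] by (simp add: next_value_def)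
qed

section \<open>The effect of stage transitions\<close>

context two_stage
begin

lemma ln_odds_Det:
  assumes lr: "\<And>t. 0 < lr (Suc t) \<omega>" and st: "st t \<omega> = Det n"
  shows "0 < Z (Suc t) (Suc n) \<omega>" "0 < odds (Suc t) \<omega>" "a1 + ln (Z (Suc t) (Suc n) \<omega>) \<le> ln (odds (Suc t) \<omega>)"
proof -
  have inv: "B1 * Z t n \<omega> \<le> odds t \<omega>" "1 / dd < Z t n \<omega>" using st_invariant[OF lr, of t n] st by auto
  have "0 < 1 / dd" using dd by simp
  then have z: "0 < Z t n \<omega>" using inv(2) by linarith
  then show Zp: "0 < Z (Suc t) (Suc n) \<omega>" using lr[of t] by (simp add: Z_Suc)
  have "B1 * Z (Suc t) (Suc n) \<omega> = (B1 * Z t n \<omega>) * lr (Suc t) \<omega>" by (simp add: Z_Suc)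
  also have "\<dots> \<le> odds t \<omega> * lr (Suc t) \<omega>" using inv lr[of t] by (intro mult_right_mono) auto
  also note odds_Suc_ge
  finally have le: "B1 * Z (Suc t) (Suc n) \<omega> \<le> odds (Suc t) \<omega>" .
  have BZ: "0 < B1 * Z (Suc t) (Suc n) \<omega>" using Zp B1 by simp
  then show G: "0 < odds (Suc t) \<omega>" using le by linarith
  have "ln (B1 * Z (Suc t) (Suc n) \<omega>) \<le> ln (odds (Suc t) \<omega>)" using le BZ G by (simp only: ln_le_cancel_iff)
  then show "a1 + ln (Z (Suc t) (Suc n) \<omega>) \<le> ln (odds (Suc t) \<omega>)" using Zp B1 by (simp add: a1_def ln_mult_pos del: odds.simps)
qed

context
  assumes R: "0 \<le> R" "\<Theta> * (1 + p * k1) + c2 \<le> R" "(N0 + e + 1) * k1 + c1 \<le> R"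
begin

text \<open>y = 1 / (dd z) measures how far the product has fallen below 1 / dd. The fall lengthens
  the climb after the restart by ln y, whereas the insurance is multiplied by y, and ln y \<le> y -
  1.\<close>

lemma restart_le:
  assumes "0 < z" "z \<le> 1 / dd"
  shows "(N0 - ln z) * k1 + c1 \<le> R / dd / z" "R \<le> R / dd / z"
proof -
  define y where "y = 1 / (dd * z)"
  have dz: "0 < dd * z" "dd * z \<le> 1" using assms dd by (auto simp: pos_le_divide_eq mult.commute)
  have y: "1 \<le> y" using dz by (simp add: y_def)
  have ly: "ln y = - ln z - e" using assms dd by (simp add: y_def e_def ln_divide_pos ln_mult_pos)
  have Ry: "R / dd / z = R * y" by (simp add: y_def)
  have "R * 1 \<le> R * y" using y R(1) by (intro mult_left_mono) auto
  then show "R \<le> R / dd / z" by (simp only: Ry mult_1_right)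
  have "ln y \<le> y - 1" using y by (intro ln_le_minus_one) auto
  then have "(N0 - ln z) * k1 + c1 \<le> (N0 + e + (y - 1)) * k1 + c1"
    using ly k1 by (intro add_right_mono mult_right_mono) auto
  also have "\<dots> \<le> (N0 + e + 1) * k1 + c1 + ((y - 1) * (N0 + e + 1) * k1 + (y - 1) * c1)"
  proof -
    have n: "0 \<le> y - 1" "0 \<le> N0 + e" "0 \<le> c1" "0 \<le> k1" using y c_nonneg[OF R(1)] k1 by auto
    have "0 \<le> (y - 1) * (N0 + e) * k1" "0 \<le> (y - 1) * c1"
      by (rule mult_nonneg_nonneg[OF mult_nonneg_nonneg[OF n(1,2)] n(4)], rule mult_nonneg_nonneg[OF n(1,3)])
    with n(4)
    show ?thesis by (simp add: algebra_simps)
  qed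
  also have "\<dots> = ((N0 + e + 1) * k1 + c1) * y" by (simp add: algebra_simps)
  also have "\<dots> \<le> R * y" using R(3) y by (intro mult_right_mono) auto
  finally show "(N0 - ln z) * k1 + c1 \<le> R / dd / z" by (simp only: Ry)
qed

lemma Acc_value_le:
  assumes "s \<in> states \<kappa> K" "- l \<le> v" "0 \<le> v"
  shows "max 0 (a1 + M + Om - l + \<phi>1 n s) * k1 + c1 \<le> (a1 + N0 + v) * k1 + c1"
  using assms \<phi>1(1)[OF assms(1), of n] c_nonneg[OF R(1)] k1
  by (intro add_right_mono mult_right_mono) (auto simp: N0_def max_def)

context
  fixes \<omega> :: "'y path"
  assumes good: "\<And>t. 0 < lr (Suc t) \<omega>"
begin

text \<open>Continuing and stopping are immediate. The substance is a return to acceleration: after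
  the change it is paid by the insurance, before the change by the R contained in the value.\<close>

lemma transition_le:
  assumes ne: "st (Suc t) \<omega> \<noteq> Det 0" shows "U (Suc t) \<omega> \<le> Pre t \<omega>"
proof (cases "st t \<omega>")
  case (Acc n)
  then have "st (Suc t) \<omega> = Stop \<or> st (Suc t) \<omega> = Acc (Suc n)" using ne by (auto simp: st_Suc enter_def split: if_splits)
  then show ?thesis using Acc by (auto simp: U_def Pre_def simp del: val.simps(1,2))
next
  case Stop
  then show ?thesis by (simp add: U_def st_Suc)
next
  case (Det n)
  note z = ln_odds_Det[OF good Det]
  consider "st (Suc t) \<omega> = Stop" | "st (Suc t) \<omega> = Det (Suc n)" | "st (Suc t) \<omega> = Acc (length z\<^sub>0)" "Z (Suc t) (Suc n) \<omega> \<le> 1 / dd"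
    using ne Det dd by (auto simp: st_Suc enter_def one_ereal_def split: if_splits)
  then show ?thesis
  proof cases
    case 3
    note r = restart_le[OF z(1) 3(2)]
    have s: "state (Suc t) \<omega> \<in> states \<kappa> K" by (rule state_states)
    show ?thesis
    proof (cases "latent (Suc t) \<omega>")
      case True
      have "0 \<le> N0 - ln (Z (Suc t) (Suc n) \<omega>)"
      proof -
        have "ln (Z (Suc t) (Suc n) \<omega>) \<le> ln 1" using z(1) 3(2) dd by (subst ln_le_cancel_iff) (auto intro: order_trans)
        then show ?thesis using c_nonneg[OF R(1)] by simp
      qed
      then have "max 0 (a1 + M + Om - ln (odds (Suc t) \<omega>) + \<phi>1 (length z\<^sub>0) (state (Suc t) \<omega>)) * k1 + c1 \<le> (N0 - ln (Z (Suc t) (Suc n) \<omega>)) * k1 + c1"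
        using z(3) \<phi>1(1)[OF s, of "length z\<^sub>0"] k1 by (intro add_right_mono mult_right_mono) (auto simp: N0_def)
      also note r(1)
      finally have "U (Suc t) \<omega> \<le> ennreal (R / dd / Z (Suc t) (Suc n) \<omega>)"
        using True 3 by (simp add: U_def ennreal_leI del: odds.simps)
      also have "\<dots> \<le> Pre t \<omega>" using True Det by (simp add: Pre_def del: odds.simps)
      finally show ?thesis .
    next
      case False
      have "U (Suc t) \<omega> = \<theta> (length z\<^sub>0) (state (Suc t) \<omega>) * ennreal (1 + p * k1) + ennreal c2" using False 3 by (simp add: U_def)
      also have "\<dots> \<le> ennreal \<Theta> * ennreal (1 + p * k1) + ennreal c2"
        unfolding \<theta>_def by (intro add_right_mono mult_right_mono \<Theta> s) simp
      also have "\<dots> = ennreal (\<Theta> * (1 + p * k1) + c2)"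
      proof -
        have "0 \<le> c2" "0 \<le> p * k1" using c_nonneg[OF R(1)] p k1 by auto
        then show ?thesis using \<Theta>(1) by (simp add: ennreal_mult)
      qed
      also have "\<dots> \<le> ennreal (max 0 (ln (Z (Suc t) (Suc n) \<omega>) + e + M) * k' + (c3 + R))"
      proof (rule ennreal_leI)
        have "0 \<le> max 0 (ln (Z (Suc t) (Suc n) \<omega>) + e + M) * k'" using k' by simp
        then show "\<Theta> * (1 + p * k1) + c2 \<le> max 0 (ln (Z (Suc t) (Suc n) \<omega>) + e + M) * k' + (c3 + R)"
          using R(2) c_nonneg[OF R(1)] by linarith
      qed
      also have "\<dots> = Pre t \<omega>" using False Det by (simp add: Pre_def)
      finally show ?thesis .
    qed
  qed (use Det in \<open>auto simp: U_def Pre_def simp del: val.simps(1,2)\<close>)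
qed

text \<open>At a fresh entry after the change the value has a surplus of \<open>c0\<close>; before
  the change it may rise, by less than \<open>C00\<close>. The two cases are balanced only in the
  mean.\<close>

lemma transition_Det:
  assumes eq: "st (Suc t) \<omega> = Det 0"
  shows "B1 \<le> odds (Suc t) \<omega>"
    and "latent (Suc t) \<omega> \<Longrightarrow> U (Suc t) \<omega> \<le> ennreal Ud \<and> ennreal c1 \<le> Pre t \<omega>"
    and "\<not> latent (Suc t) \<omega> \<Longrightarrow> U (Suc t) \<omega> \<le> ennreal C00 \<and> ennreal c0 \<le> Pre t \<omega>"
proof -
  have cs: "(\<exists>n. st t \<omega> = Acc n) \<or> (\<exists>n. st t \<omega> = Det n \<and> Z (Suc t) (Suc n) \<omega> \<le> 1 / dd)"
    using eq dd by (cases "st t \<omega>") (auto simp: st_Suc enter_def one_ereal_def split: if_splits)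
  show B: "B1 \<le> odds (Suc t) \<omega>"
    using eq by (cases "st t \<omega>") (auto simp: st_Suc enter_def split: if_splits simp del: odds.simps)
  have s: "state (Suc t) \<omega> \<in> states \<kappa> K" by (rule state_states)
  note cn = c_nonneg[OF R(1)]
  have c1R: "c1 \<le> R" using R(3) cn k1 by (smt (verit) mult_nonneg_nonneg)
  {
    assume L: "latent (Suc t) \<omega>"
    have "a1 \<le> ln (odds (Suc t) \<omega>)" using B B1 unfolding a1_def by (subst ln_le_cancel_iff) auto
    then have "max 0 (\<beta> + M + Om - ln (odds (Suc t) \<omega>) + \<phi>2 0 (state (Suc t) \<omega>)) * k2 \<le> (\<beta> - a1 + N0) * k2"
      using \<phi>2(1)[OF s, of 0] k2 cn by (intro mult_right_mono) (auto simp: N0_def)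
    then have "U (Suc t) \<omega> \<le> ennreal ((\<beta> - a1 + N0) * k2) + ennreal (R / dd)"
      using L eq by (simp add: U_def ennreal_leI add_right_mono del: odds.simps)
    also have "\<dots> = ennreal Ud" using cn k2 R(1) dd by (simp add: Ud_def ennreal_plus)
    finally have 1: "U (Suc t) \<omega> \<le> ennreal Ud" .
    have 2: "ennreal c1 \<le> Pre t \<omega>" using cs
    proof (elim disjE exE conjE)
      fix n assume "st t \<omega> = Acc n"
      then show ?thesis using L k1 by (simp add: Pre_def ennreal_leI del: odds.simps)
    next
      fix n assume D: "st t \<omega> = Det n" "Z (Suc t) (Suc n) \<omega> \<le> 1 / dd"
      have "c1 \<le> R / dd / Z (Suc t) (Suc n) \<omega>" using restart_le(2)[OF ln_odds_Det(1)[OF good D(1)] D(2)] c1R by linarith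
      then have "ennreal c1 \<le> ennreal (R / dd / Z (Suc t) (Suc n) \<omega>)" by (rule ennreal_leI)
      also have "\<dots> \<le> Pre t \<omega>" using L D by (simp add: Pre_def del: odds.simps)
      finally show ?thesis .
    qed
    from 1 2 show "U (Suc t) \<omega> \<le> ennreal Ud \<and> ennreal c1 \<le> Pre t \<omega>" ..
  }
  {
    assume L: "\<not> latent (Suc t) \<omega>"
    have "max 0 (e + M) * k' + (c3 + R) = C00" using cn M(1) by (simp add: C00_def)
    then have 1: "U (Suc t) \<omega> \<le> ennreal C00" using L eq by (simp add: U_def)
    have 2: "ennreal c0 \<le> Pre t \<omega>" using cs
    proof (elim disjE exE conjE)
      fix n assume "st t \<omega> = Acc n"
      then have "Pre t \<omega> = \<theta> (Suc n) (state (Suc t) \<omega>) * ennreal (1 + p * k1) + ennreal c2" using L by (simp add: Pre_def)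
      moreover have "ennreal c0 \<le> ennreal c2" using cn by (intro ennreal_leI) linarith
      ultimately show ?thesis by (simp add: add_increasing)
    next
      fix n assume D: "st t \<omega> = Det n"
      have "0 \<le> max 0 (ln (Z (Suc t) (Suc n) \<omega>) + e + M) * k'" using k' by simp
      then have "c0 \<le> max 0 (ln (Z (Suc t) (Suc n) \<omega>) + e + M) * k' + (c3 + R)" using cn c1R by linarith
      then show ?thesis using L D by (simp add: Pre_def ennreal_leI)
    qed
    from 1 2 show "U (Suc t) \<omega> \<le> ennreal C00 \<and> ennreal c0 \<le> Pre t \<omega>" ..
  }
qed

end

text \<open>Entering detection is an observable event F with odds at least \<open>B1\<close>. The
  loss \<open>C00\<close> on F without a change is thus at most \<open>c0\<close> times the
  probability of F, which is the surplus collected on all of F.\<close>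

lemma integral_transition: "(\<integral>\<^sup>+\<omega>. U (Suc t) \<omega> \<partial>P) \<le> (\<integral>\<^sup>+\<omega>. Pre t \<omega> \<partial>P)"
proof -
  note cn = c_nonneg[OF R(1)]
  define F where "F = {\<omega>. st (Suc t) \<omega> = Det 0 \<and> B1 \<le> odds (Suc t) \<omega>}"
  have F_obs: "F \<in> sets (obs_filtration X (Suc t))"
  proof -
    note [measurable] = st_obs[of "Suc t"] odds_obs[of "Suc t"]
    have "F = {\<omega> \<in> space (obs_filtration X (Suc t)). st (Suc t) \<omega> = Det 0 \<and> B1 \<le> odds (Suc t) \<omega>}" by (simp add: F_def)
    also have "\<dots> \<in> sets (obs_filtration X (Suc t))" by measurable
    finally show ?thesis .
  qed
  have FP [measurable]: "F \<in> sets P" using F_obs obs_subalgebra[of "Suc t"] by (auto simp: subalgebra_def)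
  let ?N = "{\<omega>. \<not> latent (Suc t) \<omega>}"
  have N [measurable]: "?N \<in> sets P"
  proof -
    note [measurable] = latent_P
    have "{\<omega> \<in> space P. \<not> latent (Suc t) \<omega>} \<in> sets P" by measurable
    then show ?thesis by simp
  qed
  note [measurable] = hist_P[OF U_hist] hist_P[OF Pre_hist]
  \<comment> \<open>In the case without a change, \<open>C00\<close> pays for the new value and
    \<open>Pre\<close> itself for the added \<open>c0\<close>.\<close>
  have ae: "AE \<omega> in P. U (Suc t) \<omega> + (ennreal c0 * indicator F \<omega>) \<le> Pre t \<omega> + ennreal C00 * indicator (F \<inter> ?N) \<omega>"
    using AE_lr_pos
  proof eventually_elim
    case (elim \<omega>)
    then have good: "0 < lr (Suc t) \<omega>" for t by blast
    show ?case
    proof (cases "st (Suc t) \<omega> = Det 0")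
      case False
      then show ?thesis using transition_le[OF good False] by (simp add: F_def)
    next
      case D: True
      note tr = transition_Det[OF good D]
      have F: "\<omega> \<in> F" using D tr(1) by (simp add: F_def)
      show ?thesis
      proof (cases "latent (Suc t) \<omega>")
        case True
        have "U (Suc t) \<omega> + ennreal c0 \<le> ennreal Ud + ennreal c0" using tr(2)[OF True] by (intro add_right_mono) simp
        also have "\<dots> = ennreal c1" using cn by (simp add: c1_def ennreal_plus add.commute)
        also have "\<dots> \<le> Pre t \<omega>" using tr(2)[OF True] by simp
        finally show ?thesis using F True by simp
      next
        case False
        have "U (Suc t) \<omega> + ennreal c0 \<le> ennreal C00 + Pre t \<omega>" using tr(3)[OF False] by (intro add_mono) simp_all
        then show ?thesis using F False by (simp add: add.commute)
      qed
    qed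
  qed
  have le: "ennreal C00 * emeasure P (F \<inter> ?N) \<le> ennreal c0 * emeasure P F"
  proof -
    have "emeasure P (F \<inter> ?N) \<le> ennreal (1 / (1 + B1)) * emeasure P F"
      by (rule prob_not_latent_le[OF F_obs]) (use B1 in \<open>auto simp: F_def\<close>)
    then have "ennreal C00 * emeasure P (F \<inter> ?N) \<le> ennreal C00 * (ennreal (1 / (1 + B1)) * emeasure P F)"
      by (rule mult_left_mono) simp
    also have "\<dots> = ennreal c0 * emeasure P F"
      using cn B1 by (simp add: c0_def ennreal_mult[symmetric] mult.assoc[symmetric])
    finally show ?thesis .
  qed
  have "(\<integral>\<^sup>+\<omega>. U (Suc t) \<omega> \<partial>P) + ennreal c0 * emeasure P F = (\<integral>\<^sup>+\<omega>. U (Suc t) \<omega> + ennreal c0 * indicator F \<omega> \<partial>P)"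
    by (subst nn_integral_add) (auto simp: nn_integral_cmult_indicator)
  also have "\<dots> \<le> (\<integral>\<^sup>+\<omega>. Pre t \<omega> + ennreal C00 * indicator (F \<inter> ?N) \<omega> \<partial>P)" by (rule nn_integral_mono_AE[OF ae])
  also have "\<dots> = (\<integral>\<^sup>+\<omega>. Pre t \<omega> \<partial>P) + ennreal C00 * emeasure P (F \<inter> ?N)"
    by (subst nn_integral_add) (auto simp: nn_integral_cmult_indicator)
  also have "\<dots> \<le> (\<integral>\<^sup>+\<omega>. Pre t \<omega> \<partial>P) + ennreal c0 * emeasure P F" by (intro add_left_mono le)
  finally have "ennreal c0 * emeasure P F + (\<integral>\<^sup>+\<omega>. U (Suc t) \<omega> \<partial>P) \<le> ennreal c0 * emeasure P F + (\<integral>\<^sup>+\<omega>. Pre t \<omega> \<partial>P)"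
    by (simp add: add.commute)
  moreover have "ennreal c0 * emeasure P F \<noteq> \<top>" by (simp add: ennreal_mult_eq_top_iff P.emeasure_finite)
  ultimately show ?thesis by (simp add: ennreal_add_left_cancel_le)
qed

text \<open>Each step before stopping lowers the mean of the Lyapunov function by the probability of
  running, so the mean duration is at most its mean at time 0.\<close>

theorem upper_bound:
  assumes T: "obs_stopping_time X T" and le: "AE \<omega> in P. \<forall>t. T \<omega> \<le> enat t \<longleftrightarrow> st t \<omega> = Stop"
    and tr: "AE \<omega> in P. \<forall>t. X (Suc t) \<omega> = stage_treatment t (st t \<omega>)"
    and G0: "\<pi>\<^sub>0 / (1 - \<pi>\<^sub>0) < B1" and w: "mean_time s\<^sub>0 acc_treatment = ennreal w\<^sub>0" "0 \<le> w\<^sub>0"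
  shows "expected_time P T \<le> ennreal ((1 - \<pi>\<^sub>0) * w\<^sub>0 * (1 + p * k1) + c2 + k1)"
proof -
  note cn = c_nonneg[OF R(1)]
  have stP [measurable]: "st t \<in> measurable P (count_space UNIV)" for t by (rule obs_P[OF st_obs])
  have run: "emeasure P {\<omega>. enat t < T \<omega>} = (\<integral>\<^sup>+\<omega>. of_bool (st t \<omega> \<noteq> Stop) \<partial>P)" for t
  proof -
    have "space P - {\<omega>. T \<omega> \<le> enat t} \<in> sets P" by (intro sets.compl_sets stopping_time_sets[OF T])
    moreover have "space P - {\<omega>. T \<omega> \<le> enat t} = {\<omega>. enat t < T \<omega>}" by auto
    ultimately have "emeasure P {\<omega>. enat t < T \<omega>} = (\<integral>\<^sup>+\<omega>. indicator {\<omega>. enat t < T \<omega>} \<omega> \<partial>P)" by simp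
    also have "\<dots> = (\<integral>\<^sup>+\<omega>. of_bool (st t \<omega> \<noteq> Stop) \<partial>P)"
      by (rule nn_integral_cong_AE, use le in eventually_elim) (auto simp: not_le[symmetric] split: split_indicator)
    finally show ?thesis .
  qed
  have step: "(\<integral>\<^sup>+\<omega>. U (Suc t) \<omega> \<partial>P) + (\<integral>\<^sup>+\<omega>. of_bool (st t \<omega> \<noteq> Stop) \<partial>P) \<le> (\<integral>\<^sup>+\<omega>. U t \<omega> \<partial>P)" for t
  proof -
    let ?cp = "\<lambda>\<omega>. change_prob (memory_link \<kappa> \<Psi> s\<^sub>0 \<pi>\<^sub>0) X (Suc t) \<omega>"
    let ?S = "\<lambda>\<omega>. ennreal (?cp \<omega>) * next_value (Pre t) t \<omega> True + ennreal (1 - ?cp \<omega>) * next_value (Pre t) t \<omega> False"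
    have [measurable]: "?cp \<in> borel_measurable P"
    proof -
      note [measurable] = obs_P[OF link_obs, of t] latent_P
      show ?thesis unfolding change_prob_eq by measurable
    qed
    note [measurable] = hist_P[OF next_value_hist[OF Pre_hist]]
    have "(\<integral>\<^sup>+\<omega>. U (Suc t) \<omega> \<partial>P) \<le> (\<integral>\<^sup>+\<omega>. ?S \<omega> \<partial>P)"
      using integral_transition[of t] by (simp only: nn_integral_step[OF Pre_hist])
    then have "(\<integral>\<^sup>+\<omega>. U (Suc t) \<omega> \<partial>P) + (\<integral>\<^sup>+\<omega>. of_bool (st t \<omega> \<noteq> Stop) \<partial>P) \<le> (\<integral>\<^sup>+\<omega>. ?S \<omega> \<partial>P) + (\<integral>\<^sup>+\<omega>. of_bool (st t \<omega> \<noteq> Stop) \<partial>P)"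
      by (rule add_right_mono)
    also have "\<dots> \<le> (\<integral>\<^sup>+\<omega>. ?S \<omega> + of_bool (st t \<omega> \<noteq> Stop) \<partial>P)"
      by (subst nn_integral_add) measurable
    also have "\<dots> \<le> (\<integral>\<^sup>+\<omega>. U t \<omega> \<partial>P)"
    proof (rule nn_integral_mono_AE)
      show "AE \<omega> in P. ?S \<omega> + of_bool (st t \<omega> \<noteq> Stop) \<le> U t \<omega>"
        using AE_lr_pos AE_latent_odds_pos tr
      proof eventually_elim
        case (elim \<omega>)
        then show ?case by (intro Pre_step R(1)) blast+
      qed
    qed
    finally show ?thesis .
  qed
  have sums: "(\<integral>\<^sup>+\<omega>. U n \<omega> \<partial>P) + (\<Sum>t<n. \<integral>\<^sup>+\<omega>. of_bool (st t \<omega> \<noteq> Stop) \<partial>P) \<le> (\<integral>\<^sup>+\<omega>. U 0 \<omega> \<partial>P)" for n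
  proof (induction n)
    case (Suc n)
    have "(\<integral>\<^sup>+\<omega>. U (Suc n) \<omega> \<partial>P) + (\<Sum>t<Suc n. \<integral>\<^sup>+\<omega>. of_bool (st t \<omega> \<noteq> Stop) \<partial>P) =
      ((\<integral>\<^sup>+\<omega>. U (Suc n) \<omega> \<partial>P) + (\<integral>\<^sup>+\<omega>. of_bool (st n \<omega> \<noteq> Stop) \<partial>P)) + (\<Sum>t<n. \<integral>\<^sup>+\<omega>. of_bool (st t \<omega> \<noteq> Stop) \<partial>P)" by (simp add: add_ac)
    also have "\<dots> \<le> (\<integral>\<^sup>+\<omega>. U n \<omega> \<partial>P) + (\<Sum>t<n. \<integral>\<^sup>+\<omega>. of_bool (st t \<omega> \<noteq> Stop) \<partial>P)" by (intro add_right_mono step)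
    also note Suc
    finally show ?case .
  qed simp
  have "expected_time P T = (\<Sum>t. \<integral>\<^sup>+\<omega>. of_bool (st t \<omega> \<noteq> Stop) \<partial>P)" unfolding expected_time_eq[OF T] run ..
  also have "\<dots> \<le> (\<integral>\<^sup>+\<omega>. U 0 \<omega> \<partial>P)"
  proof (rule suminf_le_const)
    show "(\<Sum>t<n. \<integral>\<^sup>+\<omega>. of_bool (st t \<omega> \<noteq> Stop) \<partial>P) \<le> (\<integral>\<^sup>+\<omega>. U 0 \<omega> \<partial>P)" for n
      by (rule order_trans[OF _ sums[of n]]) (simp add: add_increasing)
  qed simp
  also have "\<dots> \<le> ennreal ((1 - \<pi>\<^sub>0) * w\<^sub>0 * (1 + p * k1) + c2 + k1)"
  proof -
    have G0': "odds 0 \<omega> = \<pi>\<^sub>0 / (1 - \<pi>\<^sub>0)" for \<omega> by (simp add: memory_link_def)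
    \<comment> \<open>The prior odds lie below \<open>B1\<close>, so the rule starts at the
      beginning of the initial sequence.\<close>
    have "st 0 \<omega> = Acc 0" for \<omega> using G0 b1_le_b2 by (simp add: st_0 enter_def memory_link_def not_le[symmetric])
    then have U0: "U 0 \<omega> = (if latent 0 \<omega> then ennreal (max 0 (a1 + M + Om - ln (\<pi>\<^sub>0 / (1 - \<pi>\<^sub>0)) + \<phi>1 0 s\<^sub>0) * k1 + c1)
        else ennreal w\<^sub>0 * ennreal (1 + p * k1) + ennreal c2)" for \<omega>
      using w(1) by (simp add: U_def \<theta>_def memory_link_def)
    have "(\<integral>\<^sup>+\<omega>. U 0 \<omega> \<partial>P) = ennreal \<pi>\<^sub>0 * ennreal (max 0 (a1 + M + Om - ln (\<pi>\<^sub>0 / (1 - \<pi>\<^sub>0)) + \<phi>1 0 s\<^sub>0) * k1 + c1)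
       + ennreal (1 - \<pi>\<^sub>0) * (ennreal w\<^sub>0 * ennreal (1 + p * k1) + ennreal c2)"
      unfolding U0 using nn_integral_initial[of "\<lambda>l. if l then ennreal (max 0 (a1 + M + Om - ln (\<pi>\<^sub>0 / (1 - \<pi>\<^sub>0)) + \<phi>1 0 s\<^sub>0) * k1 + c1)
        else ennreal w\<^sub>0 * ennreal (1 + p * k1) + ennreal c2"] by (simp add: memory_link_def)
    also have "ennreal \<pi>\<^sub>0 * ennreal (max 0 (a1 + M + Om - ln (\<pi>\<^sub>0 / (1 - \<pi>\<^sub>0)) + \<phi>1 0 s\<^sub>0) * k1 + c1) \<le> ennreal (\<pi>\<^sub>0 * c2 + k1)"
    \<comment> \<open>A change present at time 0 starts with odds at least
      \<open>\<pi>\<^sub>0\<close>. Since - x ln x \<le> 1, the weighted logarithmic distance costs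
      at most \<open>k1\<close> beyond \<open>c2\<close>.\<close>
    proof (cases "\<pi>\<^sub>0 = 0")
      case False
      then have p0: "0 < \<pi>\<^sub>0" using \<pi>0 by simp
      have l: "- ln (\<pi>\<^sub>0 / (1 - \<pi>\<^sub>0)) \<le> - ln \<pi>\<^sub>0" "0 \<le> - ln \<pi>\<^sub>0"
      proof -
        have "ln (1 - \<pi>\<^sub>0) \<le> 0" using p0 \<pi>0 by simp
        then show "- ln (\<pi>\<^sub>0 / (1 - \<pi>\<^sub>0)) \<le> - ln \<pi>\<^sub>0" using p0 \<pi>0 by (simp add: ln_divide_pos)
        show "0 \<le> - ln \<pi>\<^sub>0" using p0 \<pi>0 by simp
      qed
      have "\<pi>\<^sub>0 * (max 0 (a1 + M + Om - ln (\<pi>\<^sub>0 / (1 - \<pi>\<^sub>0)) + \<phi>1 0 s\<^sub>0) * k1 + c1) \<le> \<pi>\<^sub>0 * ((a1 + N0 - ln \<pi>\<^sub>0) * k1 + c1)"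
        using Acc_value_le[OF s0 l, of 0] \<pi>0 by (intro mult_left_mono) auto
      also have "\<dots> = \<pi>\<^sub>0 * ((a1 + N0) * k1 + c1) + (- \<pi>\<^sub>0 * ln \<pi>\<^sub>0) * k1" by (simp add: algebra_simps)
      also have "\<dots> \<le> \<pi>\<^sub>0 * c2 + 1 * k1"
      proof (intro add_mono mult_left_mono mult_right_mono)
        have "0 \<le> ln (1 / p) * k1" using p k1 by (simp add: ln_ge_zero)
        then show "(a1 + N0) * k1 + c1 \<le> c2" by (simp add: c2_def distrib_right)
        show "- \<pi>\<^sub>0 * ln \<pi>\<^sub>0 \<le> 1" using minus_x_ln_le[OF \<pi>0(1)] \<pi>0 by linarith
      qed (use k1 \<pi>0 in auto)
      finally show ?thesis
        using \<pi>0 cn k1 by (subst ennreal_mult[symmetric]) (auto intro!: ennreal_leI simp del: ennreal_plus)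
    qed simp
    also have "ennreal (\<pi>\<^sub>0 * c2 + k1) + ennreal (1 - \<pi>\<^sub>0) * (ennreal w\<^sub>0 * ennreal (1 + p * k1) + ennreal c2) =
      ennreal ((1 - \<pi>\<^sub>0) * w\<^sub>0 * (1 + p * k1) + c2 + k1)"
    proof -
      have "0 \<le> c2" "0 \<le> p * k1" using cn p k1 by auto
      then have "ennreal (\<pi>\<^sub>0 * c2 + k1) + ennreal (1 - \<pi>\<^sub>0) * (ennreal w\<^sub>0 * ennreal (1 + p * k1) + ennreal c2) =
         ennreal ((\<pi>\<^sub>0 * c2 + k1) + (1 - \<pi>\<^sub>0) * (w\<^sub>0 * (1 + p * k1) + c2))"
        using \<pi>0 k1 w(2) by (simp add: ennreal_mult[symmetric] ennreal_plus[symmetric] del: ennreal_plus)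
      also have "(\<pi>\<^sub>0 * c2 + k1) + (1 - \<pi>\<^sub>0) * (w\<^sub>0 * (1 + p * k1) + c2) = (1 - \<pi>\<^sub>0) * w\<^sub>0 * (1 + p * k1) + c2 + k1" by (simp add: algebra_simps)
      finally show ?thesis .
    qed
    finally show ?thesis by (simp add: add_right_mono)
  qed
  finally show ?thesis .
qed

end

end

section \<open>The proposed procedure\<close>

text \<open>Adaptedness of treatments and stopping time is not assumed here but derived from the
  specification of the procedure.\<close>

locale procedure_setup = densities K \<mu> f g + staged_rule z\<^sub>0 \<Xi>\<^sub>1 \<Xi>\<^sub>2 b1 b2 d
  for K \<mu> and f g :: "nat \<Rightarrow> 'y::polish_space \<Rightarrow> real" and z\<^sub>0 \<Xi>\<^sub>1 \<Xi>\<^sub>2 b1 b2 d +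
  fixes \<pi> :: "nat list \<Rightarrow> real" and X :: "nat \<Rightarrow> 'y path \<Rightarrow> nat" and T :: "'y path \<Rightarrow> enat"
  assumes blocks: "\<Xi>\<^sub>1 \<noteq> []" "\<Xi>\<^sub>2 \<noteq> []" "set z\<^sub>0 \<subseteq> {1..K}" "set \<Xi>\<^sub>1 \<subseteq> {1..K}" "set \<Xi>\<^sub>2 \<subseteq> {1..K}"
    and procedure: "proposed_procedure \<mu> f g \<pi> z\<^sub>0 \<Xi>\<^sub>1 \<Xi>\<^sub>2 b1 b2 d X T"
begin

lemma acc_treatment_range: "acc_treatment n \<in> {1..K}"
proof (cases "n < length z\<^sub>0")
  case True
  then show ?thesis using subsetD[OF blocks(3) nth_mem[OF True]] by (simp add: acc_treatment_def)
next
  case False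
  then show ?thesis using cyc_range[OF blocks(1,4), of "int (Suc n) - int (length z\<^sub>0)"] by (simp add: acc_treatment_def)
qed

lemma det_treatment_range: "det_treatment n \<in> {1..K}"
  unfolding det_treatment_def by (rule cyc_range[OF blocks(2,5)])

lemma stage_treatment_range: "stage_treatment t \<sigma> \<in> {1..K}"
  by (cases \<sigma>; simp only: stage_treatment.simps acc_treatment_range det_treatment_range cyc_range[OF blocks(1,4)])

definition ratio :: "nat \<Rightarrow> 'y path \<Rightarrow> real" where
  "ratio t \<omega> = (if t = 0 then 1 else g (X t \<omega>) (response t \<omega>) / f (X t \<omega>) (response t \<omega>))"

lemma procedure_stages:
  obtains \<Gamma> where "posterior_odds (path_law \<mu> f g \<pi> X) X \<Gamma>"
    "\<And>t \<omega>. X (Suc t) \<omega> = stage_treatment t (stage (\<lambda>t. \<Gamma> t \<omega>) (\<lambda>t. ratio t \<omega>) t)"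
    "\<And>t \<omega>. T \<omega> \<le> enat t \<longleftrightarrow> stage (\<lambda>t. \<Gamma> t \<omega>) (\<lambda>t. ratio t \<omega>) t = Stop"
    "\<And>t \<omega>. T \<omega> = enat t \<Longrightarrow> b2 \<le> \<Gamma> t \<omega>"
proof -
  obtain \<Gamma> \<Lambda> S where G: "posterior_odds (path_law \<mu> f g \<pi> X) X \<Gamma>"
    and \<Lambda>: "\<And>t \<omega>. \<Lambda> t \<omega> = g (X t \<omega>) (response t \<omega>) / f (X t \<omega>) (response t \<omega>)"
    and S: "\<And>n \<omega>. S n \<omega> = switch_time (\<lambda>t. \<Gamma> t \<omega>) (\<lambda>t. \<Lambda> t \<omega>) b1 b2 d n"
    and X: "\<And>t \<omega>. 1 \<le> t \<Longrightarrow> X t \<omega> = treatment z\<^sub>0 \<Xi>\<^sub>1 \<Xi>\<^sub>2 (\<lambda>n. S n \<omega>) t"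
    and T: "\<And>\<omega>. T \<omega> = procedure_time (\<lambda>t. \<Gamma> t \<omega>) b2 (\<lambda>n. S n \<omega>)"
    using procedure unfolding proposed_procedure_def by blast
  have eq: "stage (\<lambda>t. \<Gamma> t \<omega>) (\<lambda>t. \<Lambda> t \<omega>) t = stage (\<lambda>t. \<Gamma> t \<omega>) (\<lambda>t. ratio t \<omega>) t" for t \<omega>
    using stage_cong[of "\<lambda>t. \<Gamma> t \<omega>" "\<lambda>t. \<Gamma> t \<omega>" "\<lambda>t. \<Lambda> t \<omega>" "\<lambda>t. ratio t \<omega>" t] by (simp add: \<Lambda> ratio_def)
  show thesis
  proof (rule that[OF G])
    show "X (Suc t) \<omega> = stage_treatment t (stage (\<lambda>t. \<Gamma> t \<omega>) (\<lambda>t. ratio t \<omega>) t)" for t \<omega>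
      unfolding eq[symmetric] X[of "Suc t" \<omega>, simplified] by (rule treatment_eq[OF S])
    show "T \<omega> \<le> enat t \<longleftrightarrow> stage (\<lambda>t. \<Gamma> t \<omega>) (\<lambda>t. ratio t \<omega>) t = Stop" for t \<omega>
      unfolding eq[symmetric] T by (rule procedure_time_le_iff[OF S])
    show "b2 \<le> \<Gamma> t \<omega>" if "T \<omega> = enat t" for t \<omega>
      using procedure_time_odds[OF S, of \<omega> t] that by (simp add: T)
  qed
qed

lemma X_range': "X (Suc t) \<omega> \<in> {1..K}"
  by (rule procedure_stages) (simp only: stage_treatment_range)

lemma ratio_measurable: "ratio t \<in> borel_measurable (obs_filtration X t)"
proof (cases t)
  case (Suc n)
  have Y [measurable]: "response t \<in> borel_measurable (obs_filtration X t)"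
    by (rule measurable_response_obs) (use Suc in auto)
  have 1: "(\<lambda>\<omega>. (if x \<in> {1..K} then g x (response t \<omega>) / f x (response t \<omega>) else 0)) \<in> borel_measurable (obs_filtration X t)" for x
  proof (cases "x \<in> {1..K}")
    case True
    have [measurable]: "(\<lambda>\<omega>. g x (response t \<omega>)) \<in> borel_measurable (obs_filtration X t)" "(\<lambda>\<omega>. f x (response t \<omega>)) \<in> borel_measurable (obs_filtration X t)"
      using measurable_compose[OF Y f_measurable[OF True]] measurable_compose[OF Y g_measurable[OF True]] by auto
    show ?thesis using True by simp
  next
    case False
    then show ?thesis by (simp only: if_False) simp
  qed
  have 2: "X t \<in> measurable (obs_filtration X t) (count_space UNIV)"
    by (rule measurable_treatment_obs) (use Suc in auto)
  have "(\<lambda>\<omega>. (if X t \<omega> \<in> {1..K} then g (X t \<omega>) (response t \<omega>) / f (X t \<omega>) (response t \<omega>) else 0)) \<in> borel_measurable (obs_filtration X t)"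
    by (rule measurable_compose_countable[OF 1 2])
  then show ?thesis using Suc X_range'[of n] by (simp add: ratio_def[abs_def])
qed (simp add: ratio_def[abs_def])

lemma stage_measurable:
  assumes "posterior_odds (path_law \<mu> f g \<pi> X) X \<Gamma>"
  shows "(\<lambda>\<omega>. stage (\<lambda>t. \<Gamma> t \<omega>) (\<lambda>t. ratio t \<omega>) t) \<in> measurable (obs_filtration X t) (count_space UNIV)"
proof (induction t)
  have \<Gamma>: "\<Gamma> t \<in> borel_measurable (obs_filtration X t)" for t using assms by (simp add: posterior_odds_def)
  {
    case 0
    note [measurable] = \<Gamma>[of 0]
    show ?case unfolding stage.simps enter_def by measurable
  next
    case (Suc t)
    note [measurable] = \<Gamma>[of "Suc t"]
    have [measurable]: "(\<lambda>\<omega>. recent_lr (\<lambda>t. ratio t \<omega>) (Suc t) n) \<in> borel_measurable (obs_filtration X (Suc t))" for n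
    proof -
      have [measurable]: "ratio (Suc t - i) \<in> borel_measurable (obs_filtration X (Suc t))" for i
        by (rule obs_mono[OF ratio_measurable]) simp
      show ?thesis unfolding recent_lr_def by measurable
    qed
    have 1: "(\<lambda>\<omega>. stage_step \<sigma> (\<Gamma> (Suc t) \<omega>) (recent_lr (\<lambda>t. ratio t \<omega>) (Suc t))) \<in> measurable (obs_filtration X (Suc t)) (count_space UNIV)" for \<sigma>
      by (cases \<sigma>; simp only: stage_step.simps enter_def; measurable)
    have 2: "(\<lambda>\<omega>. stage (\<lambda>t. \<Gamma> t \<omega>) (\<lambda>t. ratio t \<omega>) t) \<in> measurable (obs_filtration X (Suc t)) (count_space UNIV)"
      by (rule obs_mono[OF Suc]) simp
    show ?case unfolding stage.simps by (rule measurable_compose_countable[OF 1 2])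
  }
qed

text \<open>Not circular: \<open>posterior_odds\<close> already includes measurability of the odds
  at time n in the filtration of the observed treatments, and the treatment at n + 1 is a function
  of the stage at n.\<close>

lemma adapted_assignment: "assignment_rule K X"
  unfolding assignment_rule_def
proof (intro allI impI)
  fix t :: nat assume "1 \<le> t"
  then obtain n where t: "t = Suc n" by (cases t) auto
  obtain \<Gamma> where G: "posterior_odds (path_law \<mu> f g \<pi> X) X \<Gamma>"
    "\<And>t \<omega>. X (Suc t) \<omega> = stage_treatment t (stage (\<lambda>t. \<Gamma> t \<omega>) (\<lambda>t. ratio t \<omega>) t)" by (rule procedure_stages) blast
  have "(\<lambda>\<omega>. stage_treatment n (stage (\<lambda>t. \<Gamma> t \<omega>) (\<lambda>t. ratio t \<omega>) n)) \<in> measurable (obs_filtration X n) (count_space {1..K})"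
    by (rule measurable_compose[OF stage_measurable[OF G(1)]]) (use stage_treatment_range in simp)
  moreover have "X t = (\<lambda>\<omega>. stage_treatment n (stage (\<lambda>t. \<Gamma> t \<omega>) (\<lambda>t. ratio t \<omega>) n))" using G(2)[of n] t by auto
  ultimately show "X t \<in> measurable (obs_filtration X (t - 1)) (count_space {1..K})" using t by simp
qed

lemma adapted_stopping: "obs_stopping_time X T"
  unfolding obs_stopping_time_def
proof
  fix t
  obtain \<Gamma> where G: "posterior_odds (path_law \<mu> f g \<pi> X) X \<Gamma>"
    "\<And>t \<omega>. T \<omega> \<le> enat t \<longleftrightarrow> stage (\<lambda>t. \<Gamma> t \<omega>) (\<lambda>t. ratio t \<omega>) t = Stop" by (rule procedure_stages) blast
  note [measurable] = stage_measurable[OF G(1), of t]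
  have "{\<omega> \<in> space (obs_filtration X t). stage (\<lambda>t. \<Gamma> t \<omega>) (\<lambda>t. ratio t \<omega>) t = Stop} \<in> sets (obs_filtration X t)" by measurable
  then show "{\<omega>. T \<omega> \<le> enat t} \<in> sets (obs_filtration X t)" by (simp add: G(2))
qed

end

locale proposed_setup = informative_densities K \<mu> f g + memory_model K \<kappa> \<Psi>
  for K \<kappa> and \<mu> and f g :: "nat \<Rightarrow> 'y::polish_space \<Rightarrow> real" and \<Psi> +
  fixes s\<^sub>0 :: "nat list" and \<pi>\<^sub>0 \<alpha> :: real and \<upsilon> \<upsilon>' :: "nat list \<Rightarrow> nat" and lam :: real and h :: "nat list \<Rightarrow> real"
    and A b1 b2 d :: ereal and X :: "nat \<Rightarrow> 'y path \<Rightarrow> nat" and T :: "'y path \<Rightarrow> enat"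
  assumes s0: "s\<^sub>0 \<in> states \<kappa> K" and \<pi>0: "0 \<le> \<pi>\<^sub>0" "\<pi>\<^sub>0 < 1" and \<alpha>: "0 < \<alpha>" "\<alpha> < 1"
    and \<upsilon>_min: "\<And>s. s \<in> states \<kappa> K \<Longrightarrow>
        is_arg_min (\<lambda>x. ereal (1 - \<Psi> x s) * (1 + mean_change_value \<kappa> K \<Psi> (shift \<kappa> x s))) (\<lambda>x. x \<in> {1..K}) (\<upsilon> s)"
    and bellman: "\<And>s. s \<in> states \<kappa> K \<Longrightarrow> lam + h s = (MAX x\<in>{1..K}. reward I x s + h (shift \<kappa> x s))"
    and \<upsilon>'_max: "\<And>s. s \<in> states \<kappa> K \<Longrightarrow> is_arg_max (\<lambda>x. reward I x s + h (shift \<kappa> x s)) (\<lambda>x. x \<in> {1..K}) (\<upsilon>' s)"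
    and A: "A = worst_mean_change K (memory_link \<kappa> \<Psi> s\<^sub>0 \<pi>\<^sub>0) (policy_block \<kappa> \<upsilon> s\<^sub>0) + ereal (ln ((1 - \<alpha>) / \<alpha>) / drift I (policy_block \<kappa> \<upsilon>' s\<^sub>0))"
    and b2: "b2 = ereal ((1 - \<alpha>) / \<alpha>)"
    and b1: "b1 = (if drift I (policy_block \<kappa> \<upsilon> s\<^sub>0) = drift I (policy_block \<kappa> \<upsilon>' s\<^sub>0) then b2
        else min b2 (A / ereal (1 / drift I (policy_block \<kappa> \<upsilon> s\<^sub>0) - 1 / drift I (policy_block \<kappa> \<upsilon>' s\<^sub>0)) - 1))"
    and d: "d = b1 * (A / ereal (1 / drift I (policy_block \<kappa> \<upsilon>' s\<^sub>0) + 1 / block_average J (policy_block \<kappa> \<upsilon>' s\<^sub>0)))"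
    and procedure: "proposed_procedure \<mu> f g (memory_link \<kappa> \<Psi> s\<^sub>0 \<pi>\<^sub>0) (policy_prefix \<kappa> \<upsilon> s\<^sub>0) (policy_block \<kappa> \<upsilon> s\<^sub>0)
        (policy_block \<kappa> \<upsilon>' s\<^sub>0) b1 b2 d X T"
begin

sublocale acc: stationary_policy K \<kappa> \<Psi> \<upsilon> s\<^sub>0
  using arg_min_imp(1)[OF _ \<upsilon>_min] s0 by unfold_locales auto

sublocale det: stationary_policy K \<kappa> \<Psi> \<upsilon>' s\<^sub>0
  using \<upsilon>'_max s0 by unfold_locales (auto simp: is_arg_max_def)

sublocale procedure_setup K \<mu> f g acc.lead_in acc.block det.block b1 b2 d "memory_link \<kappa> \<Psi> s\<^sub>0 \<pi>\<^sub>0" X T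
  using acc.block_nonempty det.block_nonempty acc.lead_in_range acc.block_range det.block_range procedure
  by unfold_locales (auto simp: b1)

sublocale change_model K \<kappa> \<mu> f g \<Psi> s\<^sub>0 \<pi>\<^sub>0 X
  using s0 \<pi>0 adapted_assignment by unfold_locales auto

definition "Q t \<omega> = stage (\<lambda>t. ereal (odds t \<omega>)) (\<lambda>t. if t = 0 then 1 else lr t \<omega>) t"

text \<open>The procedure is driven by some version of the posterior odds, so its description
  through the recursion \<open>odds\<close> holds only almost surely.\<close>

lemma procedure_AE:
  "AE \<omega> in P. (\<forall>t. X (Suc t) \<omega> = stage_treatment t (Q t \<omega>)) \<and> (\<forall>t. T \<omega> \<le> enat t \<longleftrightarrow> Q t \<omega> = Stop)
     \<and> (\<forall>t. T \<omega> = enat t \<longrightarrow> (1 - \<alpha>) / \<alpha> \<le> odds t \<omega>)"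
proof -
  obtain \<Gamma> where G: "posterior_odds P X \<Gamma>"
    "\<And>t \<omega>. X (Suc t) \<omega> = stage_treatment t (stage (\<lambda>t. \<Gamma> t \<omega>) (\<lambda>t. ratio t \<omega>) t)"
    "\<And>t \<omega>. T \<omega> \<le> enat t \<longleftrightarrow> stage (\<lambda>t. \<Gamma> t \<omega>) (\<lambda>t. ratio t \<omega>) t = Stop"
    "\<And>t \<omega>. T \<omega> = enat t \<Longrightarrow> b2 \<le> \<Gamma> t \<omega>" by (rule procedure_stages) blast
  show ?thesis
    using posterior_odds_eq[OF G(1)]
  proof eventually_elim
    case (elim \<omega>)
    have "(\<lambda>t. \<Gamma> t \<omega>) = (\<lambda>t. ereal (odds t \<omega>))" using elim by blast
    moreover have "(\<lambda>t. ratio t \<omega>) = (\<lambda>t. if t = 0 then 1 else lr t \<omega>)" by (auto simp: ratio_def lr_def)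
    ultimately have st: "stage (\<lambda>t. \<Gamma> t \<omega>) (\<lambda>t. ratio t \<omega>) t = Q t \<omega>" for t by (simp add: Q_def)
    show ?case
    proof (intro conjI allI impI)
      fix t
      show "X (Suc t) \<omega> = stage_treatment t (Q t \<omega>)" by (subst st[symmetric]) (rule G(2))
      show "T \<omega> \<le> enat t \<longleftrightarrow> Q t \<omega> = Stop" by (subst st[symmetric]) (rule G(3))
      assume "T \<omega> = enat t"
      from G(4)[OF this] elim show "(1 - \<alpha>) / \<alpha> \<le> odds t \<omega>" by (simp add: b2 del: odds.simps)
    qed
  qed
qed

theorem admissible: "(X, T) \<in> admissible K \<mu> f g (memory_link \<kappa> \<Psi> s\<^sub>0 \<pi>\<^sub>0) \<alpha>"
proof -
  have "measure P {\<omega>. T \<omega> < change_point \<omega>} \<le> \<alpha>"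
    by (rule false_alarm_le[OF adapted_stopping \<alpha>]) (use procedure_AE in \<open>auto elim!: eventually_mono\<close>)
  then show ?thesis using adapted_assignment adapted_stopping by (simp add: admissible_def)
qed

end

lemma memory_link_Nil: "memory_link \<kappa> \<Psi> s\<^sub>0 \<pi>\<^sub>0 [] = \<pi>\<^sub>0"
  by (simp add: memory_link_def)

text \<open>The change fails to occur with probability \<open>1 - \<pi>\<^sub>0\<close>, and every admissible procedure must then
  run forever with probability at least \<open>1 - \<pi>\<^sub>0 - \<alpha>\<close>.\<close>

lemma (in change_model) expected_time_infinite:
  assumes T: "obs_stopping_time X T" and err: "measure P {\<omega>. T \<omega> < change_point \<omega>} \<le> \<alpha>"
    and \<Psi>0: "\<And>x s. x \<in> {1..K} \<Longrightarrow> s \<in> states \<kappa> K \<Longrightarrow> \<Psi> x s = 0" and \<alpha>: "0 \<le> \<alpha>" "\<alpha> < 1 - \<pi>\<^sub>0"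
  shows "expected_time P T = \<top>"
proof -
  note L = not_latent_sets
  have R: "{\<omega>. enat t < T \<omega>} \<in> sets P" for t
  proof -
    have "space P - {\<omega>. T \<omega> \<le> enat t} \<in> sets P" by (intro sets.compl_sets stopping_time_sets[OF T])
    moreover have "space P - {\<omega>. T \<omega> \<le> enat t} = {\<omega>. enat t < T \<omega>}" by auto
    ultimately show ?thesis by simp
  qed
  have nL: "(\<integral>\<^sup>+\<omega>. of_bool (\<not> latent t \<omega>) \<partial>P) = ennreal (1 - \<pi>\<^sub>0)" for t
  proof (induction t)
    case 0
    show ?case using nn_integral_initial[of "\<lambda>l. of_bool (\<not> l)"] by (simp add: memory_link_Nil)
  next
    case (Suc t)
    have [measurable]: "latent (Suc t) \<in> measurable (hist (Suc t)) (count_space UNIV)" by (rule measurable_latent) simp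
    have x: "X (Suc t) \<omega> \<in> {1..K}" for \<omega> by (rule X_range) simp
    have "(\<integral>\<^sup>+\<omega>. of_bool (\<not> latent (Suc t) \<omega>) \<partial>P) = (\<integral>\<^sup>+\<omega>. ennreal (1 - change_prob (memory_link \<kappa> \<Psi> s\<^sub>0 \<pi>\<^sub>0) X (Suc t) \<omega>) \<partial>P)"
      by (subst nn_integral_step[of _ t]) (auto simp: next_value_def nn_integral_f[OF x])
    also have "\<dots> = (\<integral>\<^sup>+\<omega>. of_bool (\<not> latent t \<omega>) \<partial>P)"
      using \<Psi>0[OF x state_states] by (intro nn_integral_cong) (auto simp: change_prob_eq link_Suc)
    finally show ?case using Suc by simp
  qed
  have "ennreal (1 - \<pi>\<^sub>0 - \<alpha>) \<le> emeasure P {\<omega>. enat t < T \<omega>}" for t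
  proof -
    define E where "E = {\<omega>. T \<omega> \<le> enat t} \<inter> {\<omega>. \<not> latent t \<omega>}"
    have ES: "E \<in> sets P" unfolding E_def by (intro sets.Int stopping_time_sets[OF T] L)
    have "ennreal (1 - \<pi>\<^sub>0) = emeasure P {\<omega>. \<not> latent t \<omega>}"
      unfolding nL[of t, symmetric] nn_integral_indicator[OF L, symmetric] by (intro nn_integral_cong) (auto split: split_indicator)
    also have "\<dots> \<le> emeasure P ({\<omega>. enat t < T \<omega>} \<union> E)"
      using R ES by (intro emeasure_mono) (auto simp: E_def)
    also have "\<dots> \<le> emeasure P {\<omega>. enat t < T \<omega>} + emeasure P E" by (intro emeasure_subadditive R ES)
    also have "emeasure P E \<le> emeasure P {\<omega>. T \<omega> < change_point \<omega>}"
    proof (rule emeasure_mono_AE)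
      show "AE \<omega> in P. \<omega> \<in> E \<longrightarrow> \<omega> \<in> {\<omega>. T \<omega> < change_point \<omega>}"
        using AE_less_change_point by eventually_elim (auto simp: E_def intro: le_less_trans)
    qed (rule early_stop_sets[OF T])
    also have "\<dots> \<le> ennreal \<alpha>" using err unfolding P.emeasure_eq_measure by (rule ennreal_leI)
    finally have "ennreal (1 - \<pi>\<^sub>0) \<le> emeasure P {\<omega>. enat t < T \<omega>} + ennreal \<alpha>" by (simp add: add_left_mono)
    then have "ennreal (1 - \<pi>\<^sub>0) - ennreal \<alpha> \<le> emeasure P {\<omega>. enat t < T \<omega>}"
      by (simp add: ennreal_minus_le_iff add.commute)
    then show ?thesis using \<alpha> by (simp add: ennreal_minus)
  qed
  then have "(\<Sum>t. ennreal (1 - \<pi>\<^sub>0 - \<alpha>)) \<le> (\<Sum>t. emeasure P {\<omega>. enat t < T \<omega>})" by (intro suminf_le) auto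
  moreover have "(\<Sum>t::nat. ennreal (1 - \<pi>\<^sub>0 - \<alpha>)) = \<top>"
    using \<alpha> by (subst nn_integral_count_space_nat[symmetric]) (simp add: ennreal_mult_top)
  ultimately show ?thesis unfolding expected_time_eq[OF T] by (simp add: top_unique)
qed

lemma (in staged_rule) det_treatment_block: "det_treatment n = block_sequence \<Xi>\<^sub>2 n"
  by (simp add: det_treatment_def block_sequence_def)

lemma (in staged_rule) acc_treatment_block: "length z\<^sub>0 \<le> n \<Longrightarrow> acc_treatment n = block_sequence \<Xi>\<^sub>1 (n - length z\<^sub>0)"
  by (simp add: acc_treatment_def block_sequence_def Suc_diff_le of_nat_diff algebra_simps)

lemma ln_bound: "0 < (x::real) \<Longrightarrow> ln x \<le> x"
  using ln_le_minus_one[of x] by linarith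

context informative_densities
begin

definition "Imin = Min (I ` {1..K})"
definition "Imax = Max (I ` {1..K})"
definition "Jmin = Min (J ` {1..K})"

lemma I_bounds: "x \<in> {1..K} \<Longrightarrow> Imin \<le> I x" "x \<in> {1..K} \<Longrightarrow> I x \<le> Imax" "x \<in> {1..K} \<Longrightarrow> Jmin \<le> J x"
  by (simp_all add: Imin_def Imax_def Jmin_def)

lemma Imin_pos: "0 < Imin" and Jmin_pos: "0 < Jmin"
  using K I_pos J_pos by (auto simp: Imin_def Jmin_def)

end

section \<open>Quantities for a model whose change probabilities stay below 1 - c\<close>

locale bounded_setup = proposed_setup +
  fixes c :: real
  assumes c: "0 < c" "c < 1" and \<Psi>c: "\<And>x s. x \<in> {1..K} \<Longrightarrow> s \<in> states \<kappa> K \<Longrightarrow> \<Psi> x s \<le> 1 - c" and \<pi>0c: "\<pi>\<^sub>0 \<le> 1 - c"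
begin

definition "Om = - ln c"
definition "Rmax = Imax + Om"
abbreviation "D1 \<equiv> drift I acc.block"
abbreviation "D2 \<equiv> drift I det.block"
definition "\<beta> = ln ((1 - \<alpha>) / \<alpha>)"

lemma Om: "x \<in> {1..K} \<Longrightarrow> s \<in> states \<kappa> K \<Longrightarrow> survival_rate (\<Psi> x s) \<le> Om" and Om_nonneg: "0 \<le> Om"
proof -
  show "0 \<le> Om" using c by (simp add: Om_def)
  assume x: "x \<in> {1..K}" and s: "s \<in> states \<kappa> K"
  have "ln c \<le> ln (1 - \<Psi> x s)" using \<Psi>c[OF x s] c by (subst ln_le_cancel_iff) auto
  moreover have "ln (1 - \<Psi> x s) \<le> 0" using \<Psi>[OF x s] by simp
  ultimately show "survival_rate (\<Psi> x s) \<le> Om" by (simp add: survival_rate_def Om_def)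
qed

lemma reward_le: "x \<in> {1..K} \<Longrightarrow> s \<in> states \<kappa> K \<Longrightarrow> reward I x s \<le> Rmax"
  using Om I_bounds(2) by (simp add: reward_def Rmax_def add_mono)

lemma drift_range: "Imin \<le> D1" "D1 \<le> Rmax" "Imin \<le> D2" "D2 \<le> Rmax"
  using drift_bounds[OF acc.block_nonempty acc.block_range, of Imin I Rmax] drift_bounds[OF det.block_nonempty det.block_range, of Imin I Rmax]
    I_bounds(1) reward_le by auto

lemma bellman_le: "x \<in> {1..K} \<Longrightarrow> s \<in> states \<kappa> K \<Longrightarrow> reward I x s + h (shift \<kappa> x s) \<le> lam + h s"
  by (simp add: bellman)

lemma bellman_eq: "s \<in> states \<kappa> K \<Longrightarrow> reward I (\<upsilon>' s) s + h (shift \<kappa> (\<upsilon>' s) s) = lam + h s"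
proof -
  assume s: "s \<in> states \<kappa> K"
  have v: "\<upsilon>' s \<in> {1..K}" using \<upsilon>'_max[OF s] by (simp add: is_arg_max_linorder)
  have le: "reward I x s + h (shift \<kappa> x s) \<le> reward I (\<upsilon>' s) s + h (shift \<kappa> (\<upsilon>' s) s)" if "x \<in> {1..K}" for x
    using \<upsilon>'_max[OF s] that by (simp add: is_arg_max_linorder)
  have "(MAX x\<in>{1..K}. reward I x s + h (shift \<kappa> x s)) = reward I (\<upsilon>' s) s + h (shift \<kappa> (\<upsilon>' s) s)"
  proof (rule Max_eqI)
    show "reward I (\<upsilon>' s) s + h (shift \<kappa> (\<upsilon>' s) s) \<in> (\<lambda>x. reward I x s + h (shift \<kappa> x s)) ` {1..K}" using v by (rule imageI)
  qed (use le in auto)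
  then show ?thesis using bellman[OF s] by simp
qed

lemma lam_eq: "D2 = lam"
  by (rule det.drift_eq[OF bellman_eq])

lemma D1_le: "D1 \<le> lam"
  by (rule drift_le[OF _ acc.block_nonempty acc.block_range bellman_le]) (use s0 in auto)

lemma lam_range: "0 < lam" "Imin \<le> lam" "lam \<le> Rmax"
  using drift_range Imin_pos lam_eq by auto

lemma J_average: "Jmin \<le> block_average J det.block"
proof -
  have "real (length det.block) * Jmin \<le> (\<Sum>i<length det.block. J (det.block ! i))"
    by (rule order_trans[OF _ sum_bounded_below[of _ Jmin]]) (use I_bounds(3)[OF subsetD[OF det.block_range nth_mem]] in auto)
  then show ?thesis using det.block_nonempty by (simp add: block_average_def pos_le_divide_eq mult.commute)
qed

text \<open>The Bellman equation fixes h only up to a constant; this normalisation makes it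
  nonnegative, as the potential requires.\<close>

definition "hn s = h s - Min (h ` states \<kappa> K)"

lemma hn: "x \<in> {1..K} \<Longrightarrow> s \<in> states \<kappa> K \<Longrightarrow> reward I x s + hn (shift \<kappa> x s) \<le> lam + hn s"
  "s \<in> states \<kappa> K \<Longrightarrow> 0 \<le> hn s \<and> hn s \<le> \<kappa> * lam"
proof -
  show "x \<in> {1..K} \<Longrightarrow> s \<in> states \<kappa> K \<Longrightarrow> reward I x s + hn (shift \<kappa> x s) \<le> lam + hn s"
    using bellman_le by (simp add: hn_def)
  assume s: "s \<in> states \<kappa> K"
  have "Min (h ` states \<kappa> K) \<in> h ` states \<kappa> K" using finite_states s0 by (intro Min_in) auto
  then obtain s' where s': "s' \<in> states \<kappa> K" "Min (h ` states \<kappa> K) = h s'" by auto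
  have "h s \<le> h s' + \<kappa> * lam"
    by (rule value_span[OF bellman_le _ s'(1) s]) (use I_pos in \<open>auto intro: less_imp_le\<close>)
  moreover have "Min (h ` states \<kappa> K) \<le> h s" using finite_states s by (intro Min_le) auto
  ultimately show "0 \<le> hn s \<and> hn s \<le> \<kappa> * lam" using s' by (simp add: hn_def)
qed

definition "pmax = Max ((\<lambda>(x, s). \<Psi> x s) ` ({1..K} \<times> states \<kappa> K))"

lemma pmax: "x \<in> {1..K} \<Longrightarrow> s \<in> states \<kappa> K \<Longrightarrow> \<Psi> x s \<le> pmax"
  "\<exists>x\<in>{1..K}. \<exists>s\<in>states \<kappa> K. \<Psi> x s = pmax" "0 \<le> pmax" "pmax \<le> 1"
proof -
  let ?S = "(\<lambda>(x, s). \<Psi> x s) ` ({1..K} \<times> states \<kappa> K)"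
  have fin: "finite ?S" using finite_states by simp
  show le: "x \<in> {1..K} \<Longrightarrow> s \<in> states \<kappa> K \<Longrightarrow> \<Psi> x s \<le> pmax" for x s
    unfolding pmax_def by (intro Max_ge[OF fin]) auto
  have x: "1 \<in> {1..K}" using K by simp
  have "?S \<noteq> {}" using x s0 by blast
  then have "pmax \<in> ?S" unfolding pmax_def by (rule Max_in[OF fin])
  then show ex: "\<exists>x\<in>{1..K}. \<exists>s\<in>states \<kappa> K. \<Psi> x s = pmax" by fastforce
  show "0 \<le> pmax" using le[OF x s0] \<Psi>[OF x s0] by simp
  show "pmax \<le> 1" using ex \<Psi> by fastforce
qed

lemma arg_min_le: "s \<in> states \<kappa> K \<Longrightarrow> x \<in> {1..K} \<Longrightarrow>
    ennreal (1 - \<Psi> (\<upsilon> s) s) * min_time (shift \<kappa> (\<upsilon> s) s) \<le> ennreal (1 - \<Psi> x s) * min_time (shift \<kappa> x s)"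
  by (rule arg_min_imp(2)[OF _ \<upsilon>_min])

context
  assumes p: "0 < pmax"
begin

definition "w\<^sub>0 = enn2real (min_time s\<^sub>0)"

text \<open>The optimal mean time and the largest change probability are reciprocal up to the factor
  \<kappa> + 1. This replaces any lower bound on the change probabilities.\<close>

lemma w0: "min_time s\<^sub>0 = ennreal w\<^sub>0" "1 / pmax \<le> w\<^sub>0" "w\<^sub>0 * pmax \<le> \<kappa> + 1" "1 \<le> w\<^sub>0"
proof -
  obtain x' s' where x': "x' \<in> {1..K}" "s' \<in> states \<kappa> K" "\<Psi> x' s' = pmax" using pmax(2) by auto
  have le: "min_time s\<^sub>0 \<le> ennreal ((\<kappa> + 1) / pmax)" by (rule min_time_bound[OF s0 x'(1,2,3) p])
  then show eq: "min_time s\<^sub>0 = ennreal w\<^sub>0"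
    unfolding w\<^sub>0_def by (intro ennreal_enn2real[symmetric] le_less_trans[OF le]) simp
  have ge: "ennreal (1 / pmax) \<le> min_time s\<^sub>0" by (rule min_time_ge[OF s0 p pmax(1,4)])
  have nn: "0 \<le> w\<^sub>0" by (simp add: w\<^sub>0_def)
  show g: "1 / pmax \<le> w\<^sub>0" using ge nn by (simp add: eq)
  have "w\<^sub>0 \<le> (\<kappa> + 1) / pmax" using le p by (simp add: eq)
  then show "w\<^sub>0 * pmax \<le> \<kappa> + 1" using p by (simp add: pos_le_divide_eq)
  have "1 \<le> 1 / pmax" using p pmax(4) by simp
  then show "1 \<le> w\<^sub>0" using g by linarith
qed

lemma mean_time_acc: "mean_time s\<^sub>0 acc_treatment = ennreal w\<^sub>0"
proof -
  have eq: "acc_treatment = acc.plan" using acc.acc_treatment_plan by blast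
  have "mean_time s\<^sub>0 acc.plan \<le> min_time s\<^sub>0" using acc.plan_optimal[OF arg_min_le, of 0] by simp
  moreover have "min_time s\<^sub>0 \<le> mean_time s\<^sub>0 acc.plan" by (rule min_time_le[OF acc.plan_treatments])
  ultimately show ?thesis by (simp add: eq w0(1) antisym)
qed

text \<open>The worst-case mean time in the thresholds is finite, and it exceeds the optimal one by
  at most 2 \<kappa>.\<close>

lemma worst_mean:
  obtains l where "worst_mean_change K (memory_link \<kappa> \<Psi> s\<^sub>0 \<pi>\<^sub>0) acc.block = ereal l" "1 / pmax \<le> l" "l \<le> 2 * \<kappa> + w\<^sub>0"
    "\<And>s. s \<in> states \<kappa> K \<Longrightarrow> mean_time s (block_sequence acc.block) \<le> ennreal l"
proof -
  let ?W = "worst_mean_change K (memory_link \<kappa> \<Psi> s\<^sub>0 \<pi>\<^sub>0) acc.block"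
  have bt: "block_sequence acc.block \<in> treatments"
    unfolding treatments_def block_sequence_def using cyc_range[OF acc.block_nonempty acc.block_range] by simp
  have up: "?W \<le> enn2ereal (ennreal (2 * \<kappa> + w\<^sub>0))"
  proof (rule mean_time_block_le_worst(2)[OF s0 s0 acc.block_nonempty acc.block_range])
    fix s assume "s \<in> states \<kappa> K"
    from acc.mean_time_block_le[OF arg_min_le this] show "mean_time s (block_sequence acc.block) \<le> ennreal (2 * \<kappa> + w\<^sub>0)"
      using w0 by (simp add: w0(1) ennreal_of_nat_eq_real_of_nat ennreal_plus ennreal_mult)
  qed
  have lo: "enn2ereal (mean_time s (block_sequence acc.block)) \<le> ?W" if "s \<in> states \<kappa> K" for s
    by (rule mean_time_block_le_worst(1)[OF that s0 acc.block_nonempty acc.block_range])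
  have g: "enn2ereal (ennreal (1 / pmax)) \<le> ?W"
    using mean_time_ge_geometric[OF s0 bt p pmax(1,4)] lo[OF s0] by (auto simp: less_eq_ennreal.rep_eq intro: order_trans)
  have e: "enn2ereal (ennreal x) = ereal x" if "0 \<le> x" for x using that by simp
  have up': "?W \<le> ereal (2 * \<kappa> + w\<^sub>0)" using up e[of "2 * \<kappa> + w\<^sub>0"] w0 by simp
  obtain l where l: "?W = ereal l"
    using up g w0 p by (cases ?W) auto
  show thesis
  proof (rule that[OF l])
    show "1 / pmax \<le> l" using g p by (simp add: l)
    then have l0: "0 \<le> l" using p by (smt (verit) divide_nonneg_pos)
    show "l \<le> 2 * \<kappa> + w\<^sub>0" using up' by (simp add: l)
    show "mean_time s (block_sequence acc.block) \<le> ennreal l" if "s \<in> states \<kappa> K" for s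
      unfolding less_eq_ennreal.rep_eq using lo[OF that] l l0 by simp
  qed
qed

text \<open>The subtracted constant absorbs what does not grow: ln 2 from the level 2 \<alpha>, - ln
  c from the prior, multiples of \<kappa> from the spans of both value functions. Only the term 2
  \<alpha> \<open>w\<^sub>0\<close> depends on the mean time.\<close>

lemma optimal_time_ge:
  assumes \<alpha>2: "2 * \<alpha> < 1"
  shows "ennreal ((1 - \<pi>\<^sub>0) * w\<^sub>0 + \<beta> / lam - ((ln 2 - ln c + 1) / Imin + 3 * \<kappa> + 1) - 2 * \<alpha> * w\<^sub>0) \<le> optimal_time K \<mu> f g (memory_link \<kappa> \<Psi> s\<^sub>0 \<pi>\<^sub>0) \<alpha>"
  unfolding optimal_time_def
proof (rule INF_greatest, clarify)
  fix X' :: "nat \<Rightarrow> 'a path \<Rightarrow> nat" and T' assume "(X', T') \<in> Defs.admissible K \<mu> f g (memory_link \<kappa> \<Psi> s\<^sub>0 \<pi>\<^sub>0) \<alpha>"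
  then have X': "assignment_rule K X'" and T': "obs_stopping_time X' T'"
    and err: "measure (path_law \<mu> f g (memory_link \<kappa> \<Psi> s\<^sub>0 \<pi>\<^sub>0) X') {\<omega>. T' \<omega> < change_point \<omega>} \<le> \<alpha>"
    by (auto simp: admissible_def)
  interpret m: change_model K \<kappa> \<mu> f g \<Psi> s\<^sub>0 \<pi>\<^sub>0 X' using s0 \<pi>0 X' by unfold_locales auto
  have "(1 - \<pi>\<^sub>0) * w\<^sub>0 + \<beta> / lam - ((ln 2 - ln c + 1) / Imin + 3 * \<kappa> + 1) - 2 * \<alpha> * w\<^sub>0
    \<le> (1 - \<pi>\<^sub>0) * w\<^sub>0 + (ln (1 / (2 * \<alpha>)) - (ln (1 / (1 - \<pi>\<^sub>0)) + 1 + \<kappa> * lam)) / lam - 2 * \<alpha> * (w\<^sub>0 + \<kappa>) - 1"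
  proof -
    have "ln ((1 - \<alpha>) / \<alpha>) \<le> ln (1 / \<alpha>)" using \<alpha> by (subst ln_le_cancel_iff) (auto simp: divide_right_mono)
    then have 1: "\<beta> - ln 2 \<le> ln (1 / (2 * \<alpha>))" using \<alpha> by (simp add: \<beta>_def ln_divide_pos ln_mult_pos)
    have "ln (1 / (1 - \<pi>\<^sub>0)) \<le> ln (1 / c)" using c \<pi>0c \<pi>0 by (subst ln_le_cancel_iff) (auto intro!: divide_left_mono)
    then have 2: "ln (1 / (1 - \<pi>\<^sub>0)) \<le> - ln c" using c by (simp add: ln_divide_pos)
    have "\<beta> / lam - (ln 2 - ln c + 1) / lam - \<kappa> = (\<beta> - ln 2 - (- ln c + 1 + \<kappa> * lam)) / lam"
      using lam_range by (simp add: field_simps)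
    also have "\<dots> \<le> (ln (1 / (2 * \<alpha>)) - (ln (1 / (1 - \<pi>\<^sub>0)) + 1 + \<kappa> * lam)) / lam"
      using 1 2 lam_range by (intro divide_right_mono) auto
    finally have "\<beta> / lam - (ln 2 - ln c + 1) / lam - \<kappa> \<le> (ln (1 / (2 * \<alpha>)) - (ln (1 / (1 - \<pi>\<^sub>0)) + 1 + \<kappa> * lam)) / lam" .
    moreover have "(ln 2 - ln c + 1) / lam \<le> (ln 2 - ln c + 1) / Imin"
      using lam_range Imin_pos c by (intro divide_left_mono) (auto simp: add_nonneg_nonneg intro!: add_nonneg_nonneg)
    moreover have "2 * \<alpha> * real \<kappa> \<le> 1 * real \<kappa>" using \<alpha>2 by (intro mult_right_mono) auto
    ultimately show ?thesis by (simp add: algebra_simps)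
  qed
  then have "ennreal ((1 - \<pi>\<^sub>0) * w\<^sub>0 + \<beta> / lam - ((ln 2 - ln c + 1) / Imin + 3 * \<kappa> + 1) - 2 * \<alpha> * w\<^sub>0)
    \<le> ennreal ((1 - \<pi>\<^sub>0) * w\<^sub>0 + (ln (1 / (2 * \<alpha>)) - (ln (1 / (1 - \<pi>\<^sub>0)) + 1 + \<kappa> * lam)) / lam - 2 * \<alpha> * (w\<^sub>0 + \<kappa>) - 1)"
    by (rule ennreal_leI)
  also have "\<dots> \<le> expected_time (path_law \<mu> f g (memory_link \<kappa> \<Psi> s\<^sub>0 \<pi>\<^sub>0) X') T'"
    using w0 by (intro m.lower_bound[OF hn lam_range(1) T' \<alpha>(1) \<alpha>2 err]) auto
  finally show "ennreal ((1 - \<pi>\<^sub>0) * w\<^sub>0 + \<beta> / lam - ((ln 2 - ln c + 1) / Imin + 3 * \<kappa> + 1) - 2 * \<alpha> * w\<^sub>0) \<le> expected_time (path_law \<mu> f g (memory_link \<kappa> \<Psi> s\<^sub>0 \<pi>\<^sub>0) X') T'" .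
qed

end

text \<open>At most Rmax is lost in each step of the initial sequence, of the \<kappa> steps that
  fill the memory, and of one block; both lengths are at most K^\<kappa>.\<close>

definition "C\<phi> = real (2 * K ^ \<kappa> + \<kappa>) * Rmax"
definition "\<phi>1 n s = corrector I D1 s (\<lambda>i. acc_treatment (n + i))"
definition "\<phi>2 n s = corrector I D2 s (\<lambda>i. det_treatment (n + i))"

lemma Rmax_pos: "0 < Rmax" using drift_range Imin_pos by linarith

lemma deficits:
  assumes s: "s \<in> states \<kappa> K"
  shows "deficit I D1 s (\<lambda>i. acc_treatment (n + i)) k \<le> C\<phi>" "deficit I D2 s (\<lambda>i. det_treatment (n + i)) k \<le> C\<phi>"
proof -
  have I0: "x \<in> {1..K} \<Longrightarrow> 0 \<le> I x" for x using I_pos by (simp add: less_imp_le)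
  have 1: "deficit I D1 s (\<lambda>i. acc_treatment (n + i)) k \<le> real (length acc.lead_in + \<kappa> + length acc.block) * D1"
  proof (rule deficit_le[OF s acc.block_nonempty _ _ I0 acc.block_range, where a=n])
    show "(\<lambda>i. acc_treatment (n + i)) \<in> treatments" using acc_treatment_range by (simp add: treatments_def)
    show "acc_treatment (n + i) = block_sequence acc.block (n + (i - length acc.lead_in))" if "length acc.lead_in \<le> i" for i
      using that by (subst acc_treatment_block) auto
  qed
  have 2: "deficit I D2 s (\<lambda>i. det_treatment (n + i)) k \<le> real (0 + \<kappa> + length det.block) * D2"
  proof (rule deficit_le[OF s det.block_nonempty _ _ I0 det.block_range, where a=n])
    show "(\<lambda>i. det_treatment (n + i)) \<in> treatments" using det_treatment_range by (simp add: treatments_def)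
  qed (simp add: det_treatment_block)
  have "real (length acc.lead_in + \<kappa> + length acc.block) * D1 \<le> C\<phi>"
    unfolding C\<phi>_def using acc.length_bounds drift_range Imin_pos by (intro mult_mono of_nat_mono) auto
  with 1 show "deficit I D1 s (\<lambda>i. acc_treatment (n + i)) k \<le> C\<phi>" by (rule order_trans)
  have "real (0 + \<kappa> + length det.block) * D2 \<le> C\<phi>"
    unfolding C\<phi>_def using det.length_bounds drift_range Imin_pos by (intro mult_mono of_nat_mono) auto
  with 2 show "deficit I D2 s (\<lambda>i. det_treatment (n + i)) k \<le> C\<phi>" by (rule order_trans)
qed

lemma \<phi>_props:
  assumes s: "s \<in> states \<kappa> K"
  shows "0 \<le> \<phi>1 n s \<and> \<phi>1 n s \<le> C\<phi>" "0 \<le> \<phi>2 n s \<and> \<phi>2 n s \<le> C\<phi>"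
    "D1 - reward I (acc_treatment n) s + \<phi>1 (Suc n) (shift \<kappa> (acc_treatment n) s) \<le> \<phi>1 n s"
    "D2 - reward I (det_treatment n) s + \<phi>2 (Suc n) (shift \<kappa> (det_treatment n) s) \<le> \<phi>2 n s"
proof -
  have s1: "shift \<kappa> (acc_treatment (n + 0)) s \<in> states \<kappa> K" by (rule shift_states[OF acc_treatment_range s])
  have s2: "shift \<kappa> (det_treatment (n + 0)) s \<in> states \<kappa> K" by (rule shift_states[OF det_treatment_range s])
  have d1: "deficit I D1 (shift \<kappa> (acc_treatment (n + 0)) s) (\<lambda>i. acc_treatment (n + Suc i)) k \<le> C\<phi>" for k
    using deficits(1)[OF s1, of "Suc n" k] by simp
  have d2: "deficit I D2 (shift \<kappa> (det_treatment (n + 0)) s) (\<lambda>i. det_treatment (n + Suc i)) k \<le> C\<phi>" for k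
    using deficits(2)[OF s2, of "Suc n" k] by simp
  have c1: "0 \<le> corrector I D1 s (\<lambda>i. acc_treatment (n + i))" "corrector I D1 s (\<lambda>i. acc_treatment (n + i)) \<le> C\<phi>"
    "D1 - reward I (acc_treatment (n + 0)) s + corrector I D1 (shift \<kappa> (acc_treatment (n + 0)) s) (\<lambda>i. acc_treatment (n + Suc i))
      \<le> corrector I D1 s (\<lambda>i. acc_treatment (n + i))"
    by (rule corrector_props[where y="\<lambda>i. acc_treatment (n + i)" and C=C\<phi>]; rule deficits(1)[OF s] d1)+
  have c2: "0 \<le> corrector I D2 s (\<lambda>i. det_treatment (n + i))" "corrector I D2 s (\<lambda>i. det_treatment (n + i)) \<le> C\<phi>"
    "D2 - reward I (det_treatment (n + 0)) s + corrector I D2 (shift \<kappa> (det_treatment (n + 0)) s) (\<lambda>i. det_treatment (n + Suc i))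
      \<le> corrector I D2 s (\<lambda>i. det_treatment (n + i))"
    by (rule corrector_props[where y="\<lambda>i. det_treatment (n + i)" and C=C\<phi>]; rule deficits(2)[OF s] d2)+
  show "0 \<le> \<phi>1 n s \<and> \<phi>1 n s \<le> C\<phi>" "0 \<le> \<phi>2 n s \<and> \<phi>2 n s \<le> C\<phi>" using c1(1,2) c2(1,2) by (simp_all add: \<phi>1_def \<phi>2_def)
  show "D1 - reward I (acc_treatment n) s + \<phi>1 (Suc n) (shift \<kappa> (acc_treatment n) s) \<le> \<phi>1 n s" using c1(3) by (simp add: \<phi>1_def)
  show "D2 - reward I (det_treatment n) s + \<phi>2 (Suc n) (shift \<kappa> (det_treatment n) s) \<le> \<phi>2 n s" using c2(3) by (simp add: \<phi>2_def)
qed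

end

section \<open>Thresholds and constants\<close>

text \<open>Pure real arithmetic of the thresholds; \<open>q\<^sub>0\<close> stands for the
  denominator in d. The alternative \<open>B1_ge\<close> reflects the minimum in b1: either it
  equals b2, or it is given by the quotient, whose denominator is at most 1 / Imin.\<close>

locale threshold_bounds =
  fixes Imin Jmin Rmax M N0 \<epsilon> D1 lam \<beta> \<alpha> B1 p l q\<^sub>0 :: real
  assumes Imin: "0 < Imin" and Jmin: "0 < Jmin" and \<epsilon>: "0 < \<epsilon>" "2 * \<epsilon> \<le> Imin" and MN: "0 \<le> M" "0 \<le> N0"
    and D: "Imin \<le> D1" "D1 \<le> lam" "lam \<le> Rmax" and \<beta>: "0 \<le> \<beta>"
    and p: "0 < p" "p \<le> 1" "1 / p \<le> l" and \<alpha>: "0 < \<alpha>" "\<alpha> \<le> 1"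
    and q0: "1 / lam \<le> q\<^sub>0" "q\<^sub>0 \<le> 1 / Imin + 1 / Jmin"
    and B1: "10 \<le> B1" "8 * (1 / Imin + 1 / Jmin) \<le> B1" "B1 \<le> exp \<beta>" "(1 + B1) * (1 / D1 - 1 / lam) \<le> l + \<beta> / lam"
    and B1_ge: "1 / \<alpha> \<le> 1 + B1 \<or> Imin * (l + \<beta> / lam) \<le> 1 + B1"
begin

definition "Ar = l + \<beta> / lam"
definition "dd = B1 * (Ar / q\<^sub>0)"
definition "k = 2 / Imin"
definition "k' = 2 / Jmin"
definition "k1 = 1 / (D1 - \<epsilon>)"
definition "k2 = 1 / (lam - \<epsilon>)"
definition "Q = k' * (2 * Rmax + M) + (3 * Rmax + N0 + 1) * k + 1 + k"
text \<open>\<open>c2\<close> depends on R through C00 / (1 + B1) and R / dd. As B1 and dd are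
  large, these return only small fractions of R; one obtains \<open>c2\<close> \<le> 3 Q Ar and l (1
  + p k1) \<le> Q Ar, hence the factor 4.\<close>

definition "R = 4 * Q * Ar"
text \<open>Free of \<alpha>, \<beta>, p and l, hence uniform over the models.\<close>

definition "overhead n = n * k + 4 / Imin + 4 + 2 * N0 * k + 2 * k + 5 * Q * (1 + 1 / Imin) + Q"
definition "a1 = ln B1"
definition "e = ln dd"
definition "c3 = (\<beta> + e + N0) * k2"
definition "C00 = k' * (e + M) + c3 + R"
definition "c0 = C00 / (1 + B1)"
definition "c1 = c0 + ((\<beta> - a1 + N0) * k2 + R / dd)"
definition "c2 = (a1 + N0 + ln (1 / p)) * k1 + c1"

lemma pos: "0 < D1" "0 < lam" "0 < Rmax" "0 < k" "0 < k'" "0 < q\<^sub>0"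
proof -
  show "0 < D1" "0 < lam" "0 < Rmax" using Imin D by linarith+
  then have "0 < 1 / lam" by simp
  then show "0 < q\<^sub>0" using q0 by linarith
  show "0 < k" "0 < k'" using Imin Jmin by (simp_all add: k_def k'_def)
qed

lemma k12: "0 < k2" "k2 \<le> k1" "k1 \<le> k" "0 < k1" "k2 \<le> k"
proof -
  have "Imin / 2 \<le> D1 - \<epsilon>" using \<epsilon> D by linarith
  then have "1 / (D1 - \<epsilon>) \<le> 1 / (Imin / 2)" using Imin by (intro divide_left_mono) auto
  then show 1: "k1 \<le> k" by (simp add: k1_def k_def)
  show "0 < k2" "k2 \<le> k1" "0 < k1" using \<epsilon> D by (auto simp: k1_def k2_def intro!: divide_left_mono mult_pos_pos)
  then show "k2 \<le> k" using 1 by linarith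
qed

lemma l: "1 \<le> l" "1 \<le> Ar" "l \<le> Ar" "\<beta> \<le> Rmax * Ar"
proof -
  have "1 \<le> 1 / p" using p by simp
  then show 1: "1 \<le> l" using p by linarith
  have 2: "0 \<le> \<beta> / lam" using \<beta> pos by simp
  then show "1 \<le> Ar" "l \<le> Ar" using 1 by (simp_all add: Ar_def)
  have "\<beta> = lam * (Ar - l)" using pos by (simp add: Ar_def)
  also have "\<dots> \<le> Rmax * (Ar - l)" using D 2 by (intro mult_right_mono) (auto simp: Ar_def)
  also have "\<dots> \<le> Rmax * Ar" using 1 pos by (intro mult_left_mono) auto
  finally show "\<beta> \<le> Rmax * Ar" .
qed

lemma a1: "0 \<le> a1" "a1 \<le> \<beta>"
proof -
  show "0 \<le> a1" using B1 by (simp add: a1_def)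
  have "ln B1 \<le> ln (exp \<beta>)" using B1 by (subst ln_le_cancel_iff) auto
  then show "a1 \<le> \<beta>" by (simp add: a1_def)
qed

lemma dd: "8 \<le> dd" "1 < dd"
proof -
  have "8 * q\<^sub>0 \<le> B1" by (rule order_trans[OF mult_left_mono[OF q0(2)] B1(2)]) simp
  then have "8 * q\<^sub>0 * 1 \<le> B1 * Ar" using l pos B1 by (intro mult_mono) auto
  then show "8 \<le> dd" using pos by (simp add: dd_def pos_le_divide_eq)
  then show "1 < dd" by linarith
qed

lemma e: "0 \<le> e" "e \<le> 2 * Rmax * Ar"
proof -
  show "0 \<le> e" using dd by (simp add: e_def)
  have q: "1 / q\<^sub>0 \<le> Rmax"
  proof -
    have "1 / q\<^sub>0 \<le> 1 / (1 / lam)" using q0(1) pos by (intro divide_left_mono) auto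
    then show ?thesis using D by simp
  qed
  have "dd \<le> B1 * (Rmax * Ar)"
  proof -
    have "Ar * (1 / q\<^sub>0) \<le> Ar * Rmax" using q l by (intro mult_left_mono) auto
    then have "B1 * (Ar * (1 / q\<^sub>0)) \<le> B1 * (Ar * Rmax)" by (rule mult_left_mono) (use B1 in simp)
    then show ?thesis by (simp add: dd_def mult.commute)
  qed
  then have "e \<le> ln (B1 * (Rmax * Ar))" using dd by (simp add: e_def)
  also have "\<dots> = a1 + ln (Rmax * Ar)" using B1 pos l by (simp add: a1_def ln_mult_pos)
  also have "ln (Rmax * Ar) \<le> Rmax * Ar" using pos l by (intro ln_bound) (simp add: mult_pos_pos)
  finally show "e \<le> 2 * Rmax * Ar" using a1 l by linarith
qed

lemma Q_parts: "k' * (2 * Rmax + M) \<ge> 0" "(3 * Rmax + N0 + 1) * k \<ge> 0" "1 \<le> Q" "0 \<le> R"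
proof -
  show 1: "k' * (2 * Rmax + M) \<ge> 0" "(3 * Rmax + N0 + 1) * k \<ge> 0" using pos MN by (auto intro!: mult_nonneg_nonneg add_nonneg_nonneg)
  then show "1 \<le> Q" using pos unfolding Q_def by linarith
  then show "0 \<le> R" using l by (simp add: R_def)
qed

lemma le_Ar: "0 \<le> x \<Longrightarrow> x \<le> x * Ar"
  using mult_left_mono[of 1 Ar x] l by simp

lemma R_dd: "R / dd \<le> Q / 2" "0 \<le> R / dd"
proof -
  have "R / dd = 4 * Q * q\<^sub>0 / B1" using l by (simp add: R_def dd_def)
  also have "\<dots> \<le> Q / 2"
  proof -
    have "8 * q\<^sub>0 \<le> B1" by (rule order_trans[OF mult_left_mono[OF q0(2)] B1(2)]) simp
    then have "Q * (8 * q\<^sub>0) \<le> Q * B1" using Q_parts by (intro mult_left_mono) auto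
    then show ?thesis using B1 by (simp add: field_simps)
  qed
  finally show "R / dd \<le> Q / 2" .
  show "0 \<le> R / dd" using Q_parts dd by simp
qed

lemma C00: "C00 \<le> 5 * Q * Ar" "0 \<le> C00"
proof -
  have "c3 \<le> (3 * Rmax + N0) * Ar * k"
  proof -
    have "\<beta> + e + N0 \<le> (3 * Rmax + N0) * Ar" using l e le_Ar[OF MN(2)] by (simp add: algebra_simps)
    then show ?thesis unfolding c3_def using k12 l pos MN by (intro mult_mono) (auto intro!: mult_nonneg_nonneg)
  qed
  moreover have "k' * (e + M) \<le> k' * ((2 * Rmax + M) * Ar)"
    using e le_Ar[OF MN(1)] pos by (intro mult_left_mono) (auto simp: algebra_simps)
  moreover have "(k' * (2 * Rmax + M) + (3 * Rmax + N0) * k) * Ar \<le> Q * Ar"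
    using l pos by (intro mult_right_mono) (auto simp: Q_def algebra_simps)
  ultimately show "C00 \<le> 5 * Q * Ar" by (simp add: C00_def R_def algebra_simps)
  show "0 \<le> C00" unfolding C00_def c3_def using pos e MN \<beta> k12 Q_parts by (intro add_nonneg_nonneg mult_nonneg_nonneg) auto
qed

text \<open>The crude bound closes the choice of R. The final estimate needs the second: in both
  cases of \<open>B1_ge\<close> the quotient Ar / (1 + B1) is at most a constant plus \<alpha>
  Ar.\<close>

lemma c0: "c0 \<le> Q * Ar / 2" "c0 \<le> 5 * Q * (1 / Imin + \<alpha> * Ar)" "0 \<le> c0"
proof -
  have QA: "0 \<le> Q * Ar" using Q_parts l by simp
  have le: "c0 \<le> 5 * (Q * Ar) / (1 + B1)" using C00 B1 by (simp add: c0_def divide_right_mono)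
  also have "5 * (Q * Ar) / (1 + B1) \<le> 5 * (Q * Ar) / 10" using B1 QA by (intro divide_left_mono) auto
  finally show "c0 \<le> Q * Ar / 2" by (simp add: mult.commute)
  have "Ar / (1 + B1) \<le> 1 / Imin + \<alpha> * Ar"
  proof (cases "1 / \<alpha> \<le> 1 + B1")
    case True
    have "Ar / (1 + B1) \<le> Ar / (1 / \<alpha>)" using True \<alpha> l B1 by (intro divide_left_mono) auto
    then show ?thesis using Imin by (simp add: mult.commute add_increasing)
  next
    case False
    then have "Imin * Ar \<le> 1 + B1" using B1_ge by (simp add: Ar_def)
    then have "Ar / (1 + B1) \<le> 1 / Imin" using B1 Imin by (simp add: field_simps)
    moreover have "0 \<le> \<alpha> * Ar" using \<alpha> l by simp
    ultimately show ?thesis by linarith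
  qed
  then have "5 * Q * (Ar / (1 + B1)) \<le> 5 * Q * (1 / Imin + \<alpha> * Ar)" using Q_parts by (intro mult_left_mono) auto
  with le show "c0 \<le> 5 * Q * (1 / Imin + \<alpha> * Ar)" by simp
  show "0 \<le> c0" using C00 B1 by (simp add: c0_def)
qed

lemma ln_p: "0 \<le> ln (1 / p)" "ln (1 / p) \<le> ln Ar" "ln Ar \<le> Ar" "0 \<le> ln Ar"
proof -
  have "1 \<le> 1 / p" using p by simp
  then show "0 \<le> ln (1 / p)" by simp
  show "ln (1 / p) \<le> ln Ar" using p l by (subst ln_le_cancel_iff) auto
  show "ln Ar \<le> Ar" "0 \<le> ln Ar" using l by (auto intro: ln_bound)
qed

lemma c1: "c1 \<le> 2 * Q * Ar"
proof -
  have "(\<beta> - a1 + N0) * k2 \<le> (Rmax + N0) * Ar * k"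
  proof (intro mult_mono)
    show "\<beta> - a1 + N0 \<le> (Rmax + N0) * Ar" using l a1 le_Ar[OF MN(2)] by (simp add: algebra_simps)
  qed (use k12 l pos MN in auto)
  also have "\<dots> = ((Rmax + N0) * k) * Ar" by simp
  also have "\<dots> \<le> Q * Ar"
  proof (intro mult_right_mono)
    have "(Rmax + N0) * k \<le> (3 * Rmax + N0 + 1) * k" using pos by (intro mult_right_mono) auto
    then show "(Rmax + N0) * k \<le> Q" using Q_parts pos unfolding Q_def by linarith
  qed (use l in auto)
  finally have 1: "(\<beta> - a1 + N0) * k2 \<le> Q * Ar" .
  have "Q \<le> Q * Ar" using Q_parts by (intro le_Ar) simp
  then show ?thesis using 1 c0(1) R_dd(1) unfolding c1_def by linarith
qed

lemma Q_k: "0 \<le> x \<Longrightarrow> x \<le> (3 * Rmax + N0 + 1) * Ar \<Longrightarrow> x * k1 \<le> Q * Ar"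
proof -
  assume x: "0 \<le> x" "x \<le> (3 * Rmax + N0 + 1) * Ar"
  have "x * k1 \<le> (3 * Rmax + N0 + 1) * Ar * k" using x k12 l pos MN by (intro mult_mono) auto
  also have "\<dots> = ((3 * Rmax + N0 + 1) * k) * Ar" by simp
  also have "\<dots> \<le> Q * Ar" using l pos Q_parts by (intro mult_right_mono) (auto simp: Q_def)
  finally show "x * k1 \<le> Q * Ar" .
qed

lemma c2: "c2 \<le> 3 * Q * Ar"
proof -
  have 1: "a1 + N0 + ln (1 / p) \<le> (3 * Rmax + N0 + 1) * Ar"
  proof -
    have "0 \<le> Rmax * Ar" using pos l by simp
    then show ?thesis using a1 l ln_p le_Ar[OF MN(2)] unfolding distrib_right by linarith
  qed
  have "(a1 + N0 + ln (1 / p)) * k1 \<le> Q * Ar"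
    using a1 ln_p MN 1 by (intro Q_k) auto
  then show ?thesis using c1 unfolding c2_def by linarith
qed

lemma R_large: "l * (1 + p * k1) + c2 \<le> R" "(N0 + e + 1) * k1 + c1 \<le> R"
proof -
  have QA: "0 \<le> Q * Ar" using Q_parts l by simp
  have "p * k1 \<le> 1 * k" using p k12 by (intro mult_mono) auto
  then have "1 + p * k1 \<le> Q" using Q_parts unfolding Q_def by linarith
  then have "l * (1 + p * k1) \<le> Ar * Q" using l p k12 Q_parts by (intro mult_mono) (auto intro!: add_nonneg_nonneg)
  then show "l * (1 + p * k1) + c2 \<le> R" using c2 by (simp add: R_def mult.commute mult.left_commute)
  have 1: "N0 + e + 1 \<le> (3 * Rmax + N0 + 1) * Ar"
  proof -
    have "0 \<le> Rmax * Ar" using pos l by simp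
    then show ?thesis using e l le_Ar[OF MN(2)] unfolding distrib_right by linarith
  qed
  have "(N0 + e + 1) * k1 \<le> Q * Ar" using e MN 1 by (intro Q_k) auto
  then show "(N0 + e + 1) * k1 + c1 \<le> R" using c1 QA unfolding R_def by linarith
qed

text \<open>The price of climbing to B1 with the acceleration drift instead of the detection drift.
  With \<delta> = 1 / D1 - 1 / lam the choice of B1 gives B1 \<le> Ar / \<delta>, and \<delta> ln
  (Ar / \<delta>) is at most \<delta> ln Ar + 1. The factor 4 comes from D - \<epsilon> \<ge> D / 2
  for both drifts.\<close>

lemma threshold_gain: "a1 * (k1 - k2) \<le> 4 * (ln Ar / Imin + 1)"
proof -
  define \<delta> where "\<delta> = 1 / D1 - 1 / lam"
  have \<delta>: "0 \<le> \<delta>" "\<delta> \<le> 1 / Imin"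
  proof -
    show "0 \<le> \<delta>" using D pos by (simp add: \<delta>_def divide_left_mono)
    have "1 / D1 \<le> 1 / Imin" "0 \<le> 1 / lam" using D pos Imin by (auto intro!: divide_left_mono)
    then show "\<delta> \<le> 1 / Imin" unfolding \<delta>_def by linarith
  qed
  have "k1 - k2 \<le> 4 * \<delta>"
  proof -
    have D': "D1 / 2 \<le> D1 - \<epsilon>" "lam / 2 \<le> lam - \<epsilon>" using \<epsilon> D by linarith+
    have "k1 - k2 = (lam - D1) / ((D1 - \<epsilon>) * (lam - \<epsilon>))"
      using D' pos unfolding k1_def k2_def by (subst diff_frac_eq) auto
    also have "\<dots> \<le> (lam - D1) / ((D1 / 2) * (lam / 2))"
      using D' D pos by (intro divide_left_mono mult_mono mult_pos_pos) auto
    also have "\<dots> = 4 * ((lam - D1) / (D1 * lam))" by simp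
    also have "(lam - D1) / (D1 * lam) = \<delta>" using pos unfolding \<delta>_def by (subst diff_frac_eq) auto
    finally show ?thesis .
  qed
  then have "a1 * (k1 - k2) \<le> a1 * (4 * \<delta>)" by (rule mult_left_mono) (rule a1(1))
  also have "\<dots> = 4 * (\<delta> * a1)" by simp
  also have "\<delta> * a1 \<le> ln Ar / Imin + 1"
  proof (cases "\<delta> = 0")
    case False
    then have \<delta>0: "0 < \<delta>" using \<delta> by simp
    have "B1 \<le> Ar / \<delta>" using B1(4) \<delta>0 B1(1) unfolding Ar_def[symmetric] \<delta>_def[symmetric]
      by (simp add: pos_le_divide_eq algebra_simps)
    then have "a1 \<le> ln (Ar / \<delta>)" unfolding a1_def using B1 by (subst ln_le_cancel_iff) auto
    also have "\<dots> = ln Ar + ln (1 / \<delta>)" using \<delta>0 l by (simp add: ln_divide_pos)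
    also have "ln (1 / \<delta>) \<le> 1 / \<delta>" using \<delta>0 by (intro ln_bound) simp
    finally have "\<delta> * a1 \<le> \<delta> * (ln Ar + 1 / \<delta>)" using \<delta> by (intro mult_left_mono) auto
    also have "\<dots> = \<delta> * ln Ar + 1" using \<delta>0 by (simp add: distrib_left)
    also have "\<delta> * ln Ar \<le> 1 / Imin * ln Ar" using \<delta> ln_p by (intro mult_right_mono) auto
    finally show ?thesis by simp
  qed (use ln_p Imin in auto)
  finally show ?thesis by simp
qed

lemma overhead_nonneg: "0 \<le> n \<Longrightarrow> 0 \<le> overhead n"
  unfolding overhead_def using pos MN Imin Q_parts by (intro add_nonneg_nonneg mult_nonneg_nonneg) auto

text \<open>Only w and \<beta> k2 are of leading order. The correction w p k1 is bounded by the
  hypothesis on w p, and a1 k1 is compared with a1 k2 by \<open>threshold_gain\<close>.\<close>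

lemma estimate:
  assumes w: "0 \<le> w" "w * p \<le> K"
  shows "w * (1 + p * k1) + c2 + k1 \<le> w + \<beta> * k2
    + overhead K * (1 + ln Ar + \<alpha> * Ar)"
proof -
  define L where "L = 1 + ln Ar + \<alpha> * Ar"
  have L: "1 \<le> L" "ln Ar \<le> L" "\<alpha> * Ar \<le> L" "1 + ln Ar \<le> L" using ln_p \<alpha> l by (simp_all add: L_def)
  have le_L: "x \<le> x * L" if "0 \<le> x" for x using mult_left_mono[OF L(1) that] by simp
  have Q0: "0 \<le> Q" using Q_parts by simp
  have 1: "w * p * k1 \<le> K * k * L"
  proof -
    have wp: "0 \<le> w * p" using w p by simp
    then have K0: "0 \<le> K" using w by linarith
    have "w * p * k1 \<le> K * k" by (rule mult_mono) (use w k12 K0 in auto)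
    also have "\<dots> \<le> K * k * L" using K0 pos by (intro le_L) simp
    finally show ?thesis .
  qed
  have 2: "a1 * (k1 - k2) \<le> 4 / Imin * L + 4 * L"
  proof -
    have "4 * (ln Ar / Imin + 1) = 4 / Imin * ln Ar + 4" by simp
    also have "\<dots> \<le> 4 / Imin * L + 4 * L" using L Imin by (intro add_mono mult_left_mono) auto
    finally show ?thesis using threshold_gain by linarith
  qed
  have 3: "N0 * k1 \<le> N0 * k * L" "N0 * k2 \<le> N0 * k * L"
  proof -
    have "N0 * k1 \<le> N0 * k" "N0 * k2 \<le> N0 * k" using MN k12 by (auto intro!: mult_left_mono)
    then show "N0 * k1 \<le> N0 * k * L" "N0 * k2 \<le> N0 * k * L" using le_L[of "N0 * k"] MN pos by auto
  qed
  have 4: "ln (1 / p) * k1 + k1 \<le> k * L"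
  proof -
    have "ln (1 / p) * k1 + k1 = k1 * (1 + ln (1 / p))" by (simp add: algebra_simps)
    also have "\<dots> \<le> k * L" using ln_p L k12 pos by (intro mult_mono) auto
    finally show ?thesis .
  qed
  have 5: "c0 \<le> 5 * Q * (1 + 1 / Imin) * L"
  proof -
    have "1 / Imin + \<alpha> * Ar \<le> (1 + 1 / Imin) * L"
      using le_L[of "1 / Imin"] L Imin by (simp add: distrib_right)
    then have "5 * Q * (1 / Imin + \<alpha> * Ar) \<le> 5 * Q * ((1 + 1 / Imin) * L)" using Q0 by (intro mult_left_mono) auto
    then show ?thesis using c0(2) by (simp add: mult.assoc)
  qed
  have 6: "R / dd \<le> Q * L" using R_dd Q0 le_L[OF Q0] by linarith
  have 7: "0 \<le> k * L" using pos L by simp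
  have "w * (1 + p * k1) + c2 + k1 = w + \<beta> * k2 + (w * p * k1 + a1 * (k1 - k2) + N0 * k1 + N0 * k2 + (ln (1 / p) * k1 + k1) + c0 + R / dd)"
    by (simp add: c2_def c1_def algebra_simps)
  also have "\<dots> \<le> w + \<beta> * k2 + (K * k * L + (4 / Imin * L + 4 * L) + N0 * k * L + N0 * k * L + 2 * (k * L) + 5 * Q * (1 + 1 / Imin) * L + Q * L)"
    using 1 2 3 4 5 6 7 by linarith
  also have "\<dots> = w + \<beta> * k2 + (K * k + 4 / Imin + 4 + 2 * N0 * k + 2 * k + 5 * Q * (1 + 1 / Imin) + Q) * L"
    by (simp add: distrib_right)
  finally show ?thesis by (simp add: L_def overhead_def)
qed

end

section \<open>The actual thresholds and the resulting upper estimate\<close>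

context bounded_setup
begin

lemma exp_\<beta>: "exp \<beta> = (1 - \<alpha>) / \<alpha>" "1 + exp \<beta> = 1 / \<alpha>"
  using \<alpha> by (simp_all add: \<beta>_def field_simps)

text \<open>Finiteness of the worst-case mean time turns the extended real definitions into real
  ones. Equal drifts, where b1 = b2, are kept apart from the quotient.\<close>

lemma thresholds:
  assumes l: "worst_mean_change K (memory_link \<kappa> \<Psi> s\<^sub>0 \<pi>\<^sub>0) acc.block = ereal l" "0 \<le> l" and \<beta>: "0 \<le> \<beta>"
  obtains B1 where "b1 = ereal B1" "b2 = ereal (exp \<beta>)"
    "d = ereal (B1 * ((l + \<beta> / lam) / (1 / lam + 1 / block_average J det.block)))"
    "B1 \<le> exp \<beta>" "(1 + B1) * (1 / D1 - 1 / lam) \<le> l + \<beta> / lam"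
    "1 / \<alpha> \<le> 1 + B1 \<or> Imin * (l + \<beta> / lam) \<le> 1 + B1"
proof -
  define B1 where "B1 = (if D1 = lam then exp \<beta> else min (exp \<beta>) ((l + \<beta> / lam) / (1 / D1 - 1 / lam) - 1))"
  have A: "A = ereal (l + \<beta> / lam)" unfolding A l lam_eq \<beta>_def[symmetric] by simp
  have Ar: "0 \<le> l + \<beta> / lam" using l \<beta> lam_range by simp
  have b2: "b2 = ereal (exp \<beta>)" using b2 exp_\<beta> by simp
  have D1: "0 < D1" using drift_range Imin_pos by linarith
  have \<delta>: "0 < 1 / D1 - 1 / lam" "1 / D1 - 1 / lam \<le> 1 / Imin" if "D1 \<noteq> lam"
  proof -
    have "1 / lam < 1 / D1" using that D1_le D1 by (intro divide_strict_left_mono) auto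
    then show "0 < 1 / D1 - 1 / lam" by simp
    have "1 / D1 \<le> 1 / Imin" using drift_range Imin_pos by (intro divide_left_mono) auto
    moreover have "0 < 1 / lam" using lam_range by simp
    ultimately show "1 / D1 - 1 / lam \<le> 1 / Imin" by linarith
  qed
  have b1: "b1 = ereal B1"
  proof (cases "D1 = lam")
    case True
    then show ?thesis using b1 b2 lam_eq by (simp add: B1_def)
  next
    case False
    have "A / ereal (1 / D1 - 1 / lam) - 1 = ereal ((l + \<beta> / lam) / (1 / D1 - 1 / lam) - 1)"
      using \<delta>[OF False] False by (simp add: A one_ereal_def)
    then show ?thesis using False unfolding b1 lam_eq b2 B1_def by (simp add: ereal_min[symmetric] del: ereal_min)
  qed
  have J: "0 < 1 / lam + 1 / block_average J det.block"
    using J_average Jmin_pos lam_range by (intro add_pos_pos) auto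
  show thesis
  proof (rule that[OF b1 b2])
    show "d = ereal (B1 * ((l + \<beta> / lam) / (1 / lam + 1 / block_average J det.block)))"
      using J unfolding d lam_eq A b1 by simp
    show "B1 \<le> exp \<beta>" by (simp add: B1_def)
    show "(1 + B1) * (1 / D1 - 1 / lam) \<le> l + \<beta> / lam"
    proof (cases "D1 = lam")
      case False
      have "1 + B1 \<le> (l + \<beta> / lam) / (1 / D1 - 1 / lam)" using False by (simp add: B1_def)
      then show ?thesis using \<delta>[OF False] by (simp only: pos_le_divide_eq)
    qed (use Ar in simp)
    show "1 / \<alpha> \<le> 1 + B1 \<or> Imin * (l + \<beta> / lam) \<le> 1 + B1"
    proof (cases "B1 = exp \<beta>")
      case True
      then show ?thesis using exp_\<beta> by simp
    next
      case False
      then have D: "D1 \<noteq> lam" and eq: "1 + B1 = (l + \<beta> / lam) / (1 / D1 - 1 / lam)" by (auto simp: B1_def min_def split: if_splits)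
      have "Imin * (1 / D1 - 1 / lam) \<le> 1" using mult_left_mono[OF \<delta>(2)[OF D], of Imin] Imin_pos by simp
      then have "(l + \<beta> / lam) * (Imin * (1 / D1 - 1 / lam)) \<le> l + \<beta> / lam" using Ar mult_left_mono by fastforce
      then have "Imin * (l + \<beta> / lam) * (1 / D1 - 1 / lam) \<le> l + \<beta> / lam" by (simp add: mult.commute mult.left_commute)
      then have "Imin * (l + \<beta> / lam) \<le> 1 + B1" unfolding eq pos_le_divide_eq[OF \<delta>(1)[OF D]] .
      then show ?thesis ..
    qed
  qed
qed

lemma upper_estimate:
  assumes pp: "0 < pmax" and \<epsilon>: "0 < \<epsilon>" "2 * \<epsilon> \<le> Imin" "2 * \<epsilon> \<le> Jmin"
    and M: "0 \<le> M"
      "\<And>x B. x \<in> {1..K} \<Longrightarrow> M \<le> B \<Longrightarrow> (\<integral>\<^sup>+y. ennreal (B - min (ln (g x y / f x y)) M) * ennreal (g x y) \<partial>\<mu>) \<le> ennreal (B - (I x - \<epsilon>))"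
      "\<And>x B. x \<in> {1..K} \<Longrightarrow> M \<le> B \<Longrightarrow> (\<integral>\<^sup>+y. ennreal (B - min (ln (f x y / g x y)) M) * ennreal (f x y) \<partial>\<mu>) \<le> ennreal (B - (J x - \<epsilon>))"
    and large: "11 + 8 * (1 / Imin + 1 / Jmin) + 1 / c \<le> 1 / \<alpha>" "11 + 8 * (1 / Imin + 1 / Jmin) + 1 / c \<le> Imin * (\<beta> / Rmax)"
  shows "expected_time P T \<le> ennreal ((1 - \<pi>\<^sub>0) * w\<^sub>0 + \<beta> * (1 / (lam - \<epsilon>))
    + threshold_bounds.overhead Imin Jmin Rmax M (M + Om + C\<phi>) (\<kappa> + 1) * (1 + ln (2 * \<kappa> + w\<^sub>0 + \<beta> / Imin) + \<alpha> * (2 * \<kappa> + w\<^sub>0 + \<beta> / Imin)))"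
proof -
  let ?b = "11 + 8 * (1 / Imin + 1 / Jmin) + 1 / c"
  have q: "0 \<le> 8 * (1 / Imin + 1 / Jmin)" "0 < 1 / c" using Imin_pos Jmin_pos c by auto
  have "1 \<le> exp \<beta>" using large(1) exp_\<beta> q by linarith
  then have \<beta>: "0 \<le> \<beta>" by simp
  obtain l where l: "worst_mean_change K (memory_link \<kappa> \<Psi> s\<^sub>0 \<pi>\<^sub>0) acc.block = ereal l" "1 / pmax \<le> l" "l \<le> 2 * \<kappa> + w\<^sub>0"
    "\<And>s. s \<in> states \<kappa> K \<Longrightarrow> mean_time s (block_sequence acc.block) \<le> ennreal l" by (rule worst_mean[OF pp]) blast
  note w = w0[OF pp]
  have "0 \<le> 1 / pmax" using pp by simp
  then have l0: "0 \<le> l" using l(2) by linarith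
  obtain B1 where B1: "b1 = ereal B1" "b2 = ereal (exp \<beta>)"
    "d = ereal (B1 * ((l + \<beta> / lam) / (1 / lam + 1 / block_average J det.block)))"
    "B1 \<le> exp \<beta>" "(1 + B1) * (1 / D1 - 1 / lam) \<le> l + \<beta> / lam"
    "1 / \<alpha> \<le> 1 + B1 \<or> Imin * (l + \<beta> / lam) \<le> 1 + B1" by (rule thresholds[OF l(1) l0 \<beta>]) blast
  \<comment> \<open>The lower bound on B1 comes from small \<alpha> if b1 = b2, and from large
    \<beta> if the quotient is active.\<close>
  have B1_ge: "?b \<le> 1 + B1"
  proof (cases "1 / \<alpha> \<le> 1 + B1")
    case False
    have "Imin * (\<beta> / Rmax) \<le> Imin * (l + \<beta> / lam)"
    proof (intro mult_left_mono)
      have "\<beta> / Rmax \<le> \<beta> / lam" using lam_range \<beta> by (intro divide_left_mono) auto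
      then show "\<beta> / Rmax \<le> l + \<beta> / lam" using l0 by linarith
    qed (use Imin_pos in simp)
    then show ?thesis using B1(6) False large(2) by linarith
  qed (use large in linarith)
  interpret tb: threshold_bounds Imin Jmin Rmax M "M + Om + C\<phi>" \<epsilon> D1 lam \<beta> \<alpha> B1 pmax l "1 / lam + 1 / block_average J det.block"
  proof unfold_locales
    show "0 \<le> M + Om + C\<phi>" using M Om_nonneg Rmax_pos by (simp add: C\<phi>_def)
    have "1 / lam \<le> 1 / Imin" using lam_range Imin_pos by (intro divide_left_mono) auto
    moreover have "1 / block_average J det.block \<le> 1 / Jmin" using J_average Jmin_pos by (intro divide_left_mono) auto
    ultimately show "1 / lam + 1 / block_average J det.block \<le> 1 / Imin + 1 / Jmin" by linarith
    show "1 / lam \<le> 1 / lam + 1 / block_average J det.block" using J_average Jmin_pos by simp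
    show "10 \<le> B1" "8 * (1 / Imin + 1 / Jmin) \<le> B1" using B1_ge q by linarith+
  qed (use Imin_pos Jmin_pos \<epsilon> M drift_range D1_le lam_range \<beta> pp pmax(4) l \<alpha> B1 in auto)
  interpret ts: two_stage K \<kappa> \<mu> f g \<Psi> s\<^sub>0 \<pi>\<^sub>0 X acc.lead_in acc.block det.block B1 "exp \<beta>" tb.dd
    pmax M Om tb.k1 tb.k2 tb.k' C\<phi> tb.R l \<epsilon> "Jmin / 2" D1 D2 \<phi>1 \<phi>2
  proof unfold_locales
    show "1 \<le> B1" using tb.B1 by simp
    show "1 < tb.dd" by (rule tb.dd)
    show "\<epsilon> \<le> I x" if "x \<in> {1..K}" for x using I_bounds(1)[OF that] \<epsilon> by linarith
    show "Jmin / 2 \<le> J x - \<epsilon>" if "x \<in> {1..K}" for x using I_bounds(3)[OF that] \<epsilon> by linarith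
    show "tb.k1 * (D1 - \<epsilon>) = 1" "tb.k2 * (D2 - \<epsilon>) = 1"
      using tb.D \<epsilon> by (auto simp: tb.k1_def tb.k2_def lam_eq)
    show "tb.k' * (Jmin / 2) = 1" using Jmin_pos by (simp add: tb.k'_def)
    show "mean_time s (\<lambda>i. acc_treatment (length acc.lead_in + i)) \<le> ennreal l" if "s \<in> states \<kappa> K" for s
    proof -
      have "acc_treatment (length acc.lead_in + i) = block_sequence acc.block i" for i
        using acc_treatment_block[of "length acc.lead_in + i"] by simp
      then show ?thesis using l(4)[OF that] by simp
    qed
  qed (use B1(4) tb.k12 tb.pos pp pmax Om M l0 \<phi>_props acc_treatment_range det_treatment_range in auto)
  have d: "d = ereal tb.dd" using B1(3) by (simp add: tb.dd_def tb.Ar_def)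
  have defs: "ts.c2 = tb.c2" "ts.N0 = M + Om + C\<phi>" "ts.e = tb.e" "ts.c1 = tb.c1"
    unfolding ts.c2_def ts.c1_def ts.c0_def ts.C00_def ts.c3_def ts.Ud_def ts.a1_def ts.\<beta>_def ts.e_def ts.N0_def
      tb.c2_def tb.c1_def tb.c0_def tb.C00_def tb.c3_def tb.a1_def tb.e_def by simp_all
  have st: "ts.st t \<omega> = Q t \<omega>" for t \<omega>
  proof -
    have "(\<lambda>t. ts.lr1 t \<omega>) = (\<lambda>t. if t = 0 then 1 else lr t \<omega>)" by (auto simp: ts.lr1_def)
    then show ?thesis unfolding ts.st_def Q_def unfolding B1(1,2) d by simp
  qed
  have "expected_time P T \<le> ennreal ((1 - \<pi>\<^sub>0) * w\<^sub>0 * (1 + pmax * tb.k1) + ts.c2 + tb.k1)"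
  proof (rule ts.upper_bound)
    show "0 \<le> tb.R" by (rule tb.Q_parts)
    show "l * (1 + pmax * tb.k1) + ts.c2 \<le> tb.R" "(ts.N0 + ts.e + 1) * tb.k1 + ts.c1 \<le> tb.R"
      using tb.R_large by (simp_all add: defs)
    show "obs_stopping_time X T" by (rule adapted_stopping)
    show "AE \<omega> in P. \<forall>t. T \<omega> \<le> enat t \<longleftrightarrow> ts.st t \<omega> = Stop" unfolding st using procedure_AE by (auto elim!: eventually_mono)
    show "AE \<omega> in P. \<forall>t. X (Suc t) \<omega> = stage_treatment t (ts.st t \<omega>)" unfolding st using procedure_AE by (auto elim!: eventually_mono)
    have "\<pi>\<^sub>0 / (1 - \<pi>\<^sub>0) \<le> 1 / c" using \<pi>0 \<pi>0c c by (intro frac_le) auto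
    then show "\<pi>\<^sub>0 / (1 - \<pi>\<^sub>0) < B1" using B1_ge q by linarith
    show "mean_time s\<^sub>0 acc_treatment = ennreal w\<^sub>0" by (rule mean_time_acc[OF pp])
    show "0 \<le> w\<^sub>0" using w by simp
  qed
  also have "(1 - \<pi>\<^sub>0) * w\<^sub>0 * (1 + pmax * tb.k1) + ts.c2 + tb.k1
    \<le> (1 - \<pi>\<^sub>0) * w\<^sub>0 + \<beta> * tb.k2 + tb.overhead (\<kappa> + 1) * (1 + ln tb.Ar + \<alpha> * tb.Ar)"
    unfolding defs
  proof (rule tb.estimate)
    show "0 \<le> (1 - \<pi>\<^sub>0) * w\<^sub>0" using \<pi>0 w by simp
    have "(1 - \<pi>\<^sub>0) * (w\<^sub>0 * pmax) \<le> 1 * (w\<^sub>0 * pmax)" using \<pi>0 w pp by (intro mult_right_mono) auto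
    then show "(1 - \<pi>\<^sub>0) * w\<^sub>0 * pmax \<le> real (\<kappa> + 1)" using w(3) unfolding mult.assoc by (simp only: of_nat_add of_nat_1)
  qed
  also have "\<dots> \<le> (1 - \<pi>\<^sub>0) * w\<^sub>0 + \<beta> * tb.k2 + tb.overhead (\<kappa> + 1) * (1 + ln (2 * \<kappa> + w\<^sub>0 + \<beta> / Imin) + \<alpha> * (2 * \<kappa> + w\<^sub>0 + \<beta> / Imin))"
  proof (intro add_left_mono mult_left_mono)
    have "\<beta> / lam \<le> \<beta> / Imin" using lam_range Imin_pos \<beta> by (intro divide_left_mono) auto
    then have "tb.Ar \<le> 2 * \<kappa> + w\<^sub>0 + \<beta> / Imin" using l by (simp add: tb.Ar_def)
    moreover from this have "ln tb.Ar \<le> ln (2 * \<kappa> + w\<^sub>0 + \<beta> / Imin)" using tb.l by (subst ln_le_cancel_iff) auto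
    ultimately show "1 + ln tb.Ar + \<alpha> * tb.Ar \<le> 1 + ln (2 * \<kappa> + w\<^sub>0 + \<beta> / Imin) + \<alpha> * (2 * \<kappa> + w\<^sub>0 + \<beta> / Imin)"
      using \<alpha> by (intro add_mono mult_left_mono) auto
    show "0 \<le> tb.overhead (\<kappa> + 1)" by (rule tb.overhead_nonneg) simp
  qed
  finally show ?thesis by (simp add: ennreal_leI tb.k2_def)
qed

end

section \<open>Asymptotic optimality\<close>

text \<open>With S = q w + \<beta> / lam every error is made a fraction of \<eta> S: 1/4 for the
  reduced drift, 1/8 each for the logarithm, for the \<alpha> term, for C' and for 2 \<alpha> w.
  Large \<beta> forces S to be large, and w needs no upper bound since w \<le> S / c.\<close>

lemma ratio_estimate:
  fixes Imin Rmax c C C' \<eta> \<epsilon> n :: real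
  assumes Imin: "0 < Imin" and Rmax: "0 < Rmax" and c: "0 < c" and C: "0 < C" "0 \<le> C'" and \<eta>: "0 < \<eta>"
    and \<epsilon>: "0 < \<epsilon>" "2 * \<epsilon> \<le> Imin" "8 * \<epsilon> \<le> \<eta> * Imin" and n: "0 \<le> n"
  shows "\<exists>\<beta>\<^sub>0 \<alpha>\<^sub>0. 0 < \<alpha>\<^sub>0 \<and> (\<forall>\<alpha> \<beta> w lam q. 0 < \<alpha> \<longrightarrow> \<alpha> \<le> \<alpha>\<^sub>0 \<longrightarrow> \<beta>\<^sub>0 \<le> \<beta> \<longrightarrow> 1 \<le> w \<longrightarrow> Imin \<le> lam \<longrightarrow> lam \<le> Rmax \<longrightarrow> c \<le> q \<longrightarrow>
      q * w + \<beta> * (1 / (lam - \<epsilon>)) + C * (1 + ln (n + w + \<beta> / Imin) + \<alpha> * (n + w + \<beta> / Imin))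
        \<le> (1 + \<eta>) * (q * w + \<beta> / lam - C' - 2 * \<alpha> * w) \<and> 0 < q * w + \<beta> / lam - C' - 2 * \<alpha> * w)"
proof -
  \<comment> \<open>B bounds W / S; \<delta> is the slope at which ln W is traded for a multiple of
    S, b is the constant left over from this trade, and \<open>S\<^sub>0\<close> makes b and C'
    negligible.\<close>
  define B where "B = 1 / c + Rmax / Imin + n"
  define \<delta> where "\<delta> = \<eta> / (16 * C)"
  define b where "b = C * (1 + \<bar>ln B\<bar> + \<bar>ln (1 / \<delta>)\<bar>)"
  define S\<^sub>0 where "S\<^sub>0 = 1 + 16 / \<eta> * b + 8 / \<eta> * ((1 + \<eta>) * C')"
  define \<alpha>\<^sub>0 where "\<alpha>\<^sub>0 = min (\<eta> / (8 * B * C)) (\<eta> * c / (16 * (1 + \<eta>)))"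
  have B: "0 < B" unfolding B_def using c Rmax Imin n by (intro add_pos_nonneg add_pos_pos) auto
  have \<delta>: "0 < \<delta>" using \<eta> C by (simp add: \<delta>_def)
  have b: "0 \<le> b" unfolding b_def using C by (intro mult_nonneg_nonneg) auto
  show ?thesis
  proof (rule exI[of _ "Rmax * S\<^sub>0"], rule exI[of _ \<alpha>\<^sub>0], intro conjI allI impI)
    show "0 < \<alpha>\<^sub>0" using \<eta> B C c by (auto simp: \<alpha>\<^sub>0_def)
    fix \<alpha> \<beta> w lam q :: real
    assume \<alpha>: "0 < \<alpha>" "\<alpha> \<le> \<alpha>\<^sub>0" and \<beta>: "Rmax * S\<^sub>0 \<le> \<beta>" and w: "1 \<le> w" and lam: "Imin \<le> lam" "lam \<le> Rmax" and q: "c \<le> q"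
    define S where "S = q * w + \<beta> / lam"
    define W where "W = n + w + \<beta> / Imin"
    have C'\<eta>: "0 \<le> (1 + \<eta>) * C'" using \<eta> C by simp
    have S0: "1 \<le> S\<^sub>0" "16 / \<eta> * b \<le> S\<^sub>0" "8 / \<eta> * ((1 + \<eta>) * C') \<le> S\<^sub>0"
    proof -
      have "0 \<le> 16 / \<eta> * b" "0 \<le> 8 / \<eta> * ((1 + \<eta>) * C')" using \<eta> b C'\<eta> by (auto intro!: mult_nonneg_nonneg)
      then show "1 \<le> S\<^sub>0" "16 / \<eta> * b \<le> S\<^sub>0" "8 / \<eta> * ((1 + \<eta>) * C') \<le> S\<^sub>0" unfolding S\<^sub>0_def by linarith+
    qed
    have \<beta>0: "0 < \<beta>"
    proof -
      have "0 < Rmax * S\<^sub>0" using Rmax S0 by simp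
      then show ?thesis using \<beta> by linarith
    qed
    have lam0: "0 < lam" using lam Imin by linarith
    have qw: "c * w \<le> q * w" using q w by (intro mult_right_mono) auto
    have cw: "0 < c * w" using c w by simp
    have \<beta>lam: "0 \<le> \<beta> / lam" using \<beta>0 lam0 by simp
    have S: "S\<^sub>0 \<le> S" "w \<le> S / c" "\<beta> / Imin \<le> Rmax / Imin * S" "\<beta> / lam \<le> S"
    proof -
      have "S\<^sub>0 \<le> \<beta> / Rmax" using \<beta> Rmax by (simp add: pos_le_divide_eq mult.commute)
      also have "\<dots> \<le> \<beta> / lam" using lam lam0 \<beta>0 by (intro divide_left_mono) auto
      finally have "S\<^sub>0 \<le> \<beta> / lam" .
      then show "S\<^sub>0 \<le> S" using qw cw unfolding S_def by linarith
      have "c * w \<le> S" using qw \<beta>lam unfolding S_def by linarith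
      then show "w \<le> S / c" using c by (simp add: pos_le_divide_eq mult.commute)
      show 1: "\<beta> / lam \<le> S" using qw cw unfolding S_def by linarith
      have "\<beta> = lam * (\<beta> / lam)" using lam0 by simp
      also have "\<dots> \<le> Rmax * S" using lam lam0 1 \<beta>lam by (intro mult_mono) auto
      finally have "\<beta> / Imin \<le> Rmax * S / Imin" using Imin by (intro divide_right_mono) auto
      then show "\<beta> / Imin \<le> Rmax / Imin * S" by simp
    qed
    have S1: "1 \<le> S" using S S0 by linarith
    have W: "W \<le> B * S" "1 \<le> W"
    proof -
      have "n * 1 \<le> n * S" using n S1 by (intro mult_left_mono) auto
      then show "W \<le> B * S" using S unfolding W_def B_def by (simp add: distrib_right)
      have "0 \<le> \<beta> / Imin" using \<beta>0 Imin by simp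
      then show "1 \<le> W" using w n unfolding W_def by linarith
    qed
    have 1: "\<beta> * (1 / (lam - \<epsilon>)) \<le> \<beta> / lam + \<eta> / 4 * S"
    proof -
      have l2: "0 < lam - \<epsilon>" "Imin / 2 \<le> lam - \<epsilon>" using lam \<epsilon> Imin by linarith+
      have "1 / (lam - \<epsilon>) = 1 / lam + \<epsilon> / (lam - \<epsilon>) / lam" using l2 lam0 by (simp add: field_simps)
      then have "\<beta> * (1 / (lam - \<epsilon>)) = \<beta> / lam + \<epsilon> / (lam - \<epsilon>) * (\<beta> / lam)" by (simp add: distrib_left mult.commute)
      also have "\<epsilon> / (lam - \<epsilon>) * (\<beta> / lam) \<le> \<eta> / 4 * S"
      proof (rule mult_mono)
        have "\<epsilon> / (lam - \<epsilon>) \<le> \<epsilon> / (Imin / 2)" using l2 \<epsilon> Imin by (intro divide_left_mono) auto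
        also have "\<dots> \<le> \<eta> / 4" using \<epsilon> Imin by (simp add: pos_divide_le_eq)
        finally show "\<epsilon> / (lam - \<epsilon>) \<le> \<eta> / 4" .
      qed (use S \<beta>lam \<eta> in auto)
      finally show ?thesis by simp
    qed
    have 2: "C * (1 + ln W) \<le> \<eta> / 8 * S"
    proof -
      have "ln W \<le> ln (B * S)" using W B S1 by (subst ln_le_cancel_iff) auto
      \<comment> \<open>Splitting off the factor \<delta> keeps the linear part of the bound for the
        logarithm small.\<close>
      also have "\<dots> = ln B + (ln (1 / \<delta>) + ln (\<delta> * S))" using B S1 \<delta> by (simp add: ln_mult_pos ln_divide_pos)
      also have "ln (\<delta> * S) \<le> \<delta> * S" using \<delta> S1 by (intro ln_bound) simp
      finally have "1 + ln W \<le> (1 + \<bar>ln B\<bar> + \<bar>ln (1 / \<delta>)\<bar>) + \<delta> * S" by linarith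
      then have "C * (1 + ln W) \<le> C * ((1 + \<bar>ln B\<bar> + \<bar>ln (1 / \<delta>)\<bar>) + \<delta> * S)" using C by (intro mult_left_mono) auto
      also have "\<dots> = b + C * \<delta> * S" by (simp add: b_def distrib_left)
      also have "C * \<delta> = \<eta> / 16" using C by (simp add: \<delta>_def)
      also have "b \<le> \<eta> / 16 * S"
      proof -
        have "\<eta> / 16 * (16 / \<eta> * b) \<le> \<eta> / 16 * S" using S S0 \<eta> by (intro mult_left_mono) auto
        then show ?thesis using \<eta> by simp
      qed
      finally show ?thesis by (simp add: mult.commute)
    qed
    have 3: "C * (\<alpha> * W) \<le> \<eta> / 8 * S"
    proof -
      have "\<alpha> * W \<le> \<eta> / (8 * B * C) * (B * S)" using \<alpha> W by (intro mult_mono) (auto simp: \<alpha>\<^sub>0_def)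
      then have "C * (\<alpha> * W) \<le> C * (\<eta> / (8 * B * C) * (B * S))" using C by (intro mult_left_mono) auto
      also have "\<dots> = \<eta> / 8 * S" using B C by simp
      finally show ?thesis .
    qed
    have 4: "(1 + \<eta>) * C' \<le> \<eta> / 8 * S"
    proof -
      have "\<eta> / 8 * (8 / \<eta> * ((1 + \<eta>) * C')) \<le> \<eta> / 8 * S" using S S0 \<eta> by (intro mult_left_mono) auto
      then show ?thesis using \<eta> by simp
    qed
    have 5: "(1 + \<eta>) * (2 * \<alpha> * w) \<le> \<eta> / 8 * S"
    proof -
      have "\<alpha> * w \<le> \<eta> * c / (16 * (1 + \<eta>)) * (S / c)" using \<alpha> S w by (intro mult_mono) (auto simp: \<alpha>\<^sub>0_def)
      then have "(2 * (1 + \<eta>)) * (\<alpha> * w) \<le> (2 * (1 + \<eta>)) * (\<eta> * c / (16 * (1 + \<eta>)) * (S / c))" using \<eta> by (intro mult_left_mono) auto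
      also have "\<dots> = \<eta> / 8 * S" using \<eta> c by (simp add: field_simps)
      finally show ?thesis by (simp add: mult.commute mult.left_commute)
    qed
    have \<eta>S: "0 < \<eta> * S" using \<eta> S1 by simp
    have "q * w + \<beta> * (1 / (lam - \<epsilon>)) + C * (1 + ln W + \<alpha> * W) = q * w + \<beta> * (1 / (lam - \<epsilon>)) + C * (1 + ln W) + C * (\<alpha> * W)"
      by (simp add: distrib_left)
    also have "\<dots> \<le> S + \<eta> / 4 * S + \<eta> / 8 * S + \<eta> / 8 * S" using 1 2 3 unfolding S_def by linarith
    also have "\<dots> \<le> (1 + \<eta>) * S - \<eta> / 8 * S - \<eta> / 8 * S" using \<eta>S unfolding distrib_right by linarith
    also have "\<dots> \<le> (1 + \<eta>) * (S - C' - 2 * \<alpha> * w)" using 4 5 unfolding right_diff_distrib by linarith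
    finally have main: "q * w + \<beta> * (1 / (lam - \<epsilon>)) + C * (1 + ln W + \<alpha> * W) \<le> (1 + \<eta>) * (S - C' - 2 * \<alpha> * w)" .
    have "(1 + \<eta>) * (C' + 2 * \<alpha> * w) \<le> \<eta> / 4 * S" using 4 5 unfolding distrib_left by linarith
    also have "\<dots> < (1 + \<eta>) * S" using \<eta>S S1 unfolding distrib_right by linarith
    finally have "C' + 2 * \<alpha> * w < S" using \<eta> by (simp add: mult_less_cancel_left)
    then have "q * w + \<beta> * (1 / (lam - \<epsilon>)) + C * (1 + ln (n + w + \<beta> / Imin) + \<alpha> * (n + w + \<beta> / Imin))
        \<le> (1 + \<eta>) * (q * w + \<beta> / lam - C' - 2 * \<alpha> * w) \<and> 0 < q * w + \<beta> / lam - C' - 2 * \<alpha> * w"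
      using main unfolding S_def W_def by linarith
    then show "q * w + \<beta> * (1 / (lam - \<epsilon>)) + C * (1 + ln (n + w + \<beta> / Imin) + \<alpha> * (n + w + \<beta> / Imin))
        \<le> (1 + \<eta>) * (q * w + \<beta> / lam - C' - 2 * \<alpha> * w)" "0 < q * w + \<beta> / lam - C' - 2 * \<alpha> * w" by simp_all
  qed
qed

lemma time_ratio_bounds:
  assumes "b \<le> a" "a \<le> ennreal r * b" "0 < b" "a < \<top>"
  shows "1 \<le> time_ratio a b" "time_ratio a b \<le> ennreal r"
proof -
  have b: "b \<noteq> 0" "b \<noteq> \<top>" "b < \<top>" using assms by auto
  have eq: "time_ratio a b = a / b" using assms by (auto simp: time_ratio_def)
  have "b / b \<le> a / b" using assms(1) by (intro divide_right_mono_ennreal)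
  then show "1 \<le> time_ratio a b" using b by (simp add: eq ennreal_divide_self)
  have "a / b \<le> ennreal r * b / b" using assms(2) by (intro divide_right_mono_ennreal)
  also have "\<dots> = ennreal r" using b by (simp add: ennreal_times_divide[symmetric] ennreal_divide_self)
  finally show "time_ratio a b \<le> ennreal r" by (simp add: eq)
qed

section \<open>The ratio of expected times for a single model\<close>

context bounded_setup
begin

abbreviation "E \<equiv> expected_time P T"
abbreviation "opt \<equiv> optimal_time K \<mu> f g (memory_link \<kappa> \<Psi> s\<^sub>0 \<pi>\<^sub>0) \<alpha>"

lemma optimal_le: "opt \<le> E"
  unfolding optimal_time_def by (rule INF_lower2[OF admissible]) simp

text \<open>Without any chance of a change after time 0, every admissible procedure has infinite
  mean once \<alpha> is below the probability 1 - \<open>\<pi>\<^sub>0\<close> \<ge> c that no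
  change occurs; the ratio is then 1 by convention.\<close>

lemma time_ratio_impossible_change:
  assumes p: "pmax = 0" and \<alpha>c: "\<alpha> < c"
  shows "time_ratio E opt = 1"
proof -
  have inf: "expected_time (path_law \<mu> f g (memory_link \<kappa> \<Psi> s\<^sub>0 \<pi>\<^sub>0) X') T' = \<top>"
    if "(X', T') \<in> admissible K \<mu> f g (memory_link \<kappa> \<Psi> s\<^sub>0 \<pi>\<^sub>0) \<alpha>" for X' :: "nat \<Rightarrow> 'a path \<Rightarrow> nat" and T'
  proof -
    have X': "assignment_rule K X'" and T': "obs_stopping_time X' T'"
      and err: "measure (path_law \<mu> f g (memory_link \<kappa> \<Psi> s\<^sub>0 \<pi>\<^sub>0) X') {\<omega>. T' \<omega> < change_point \<omega>} \<le> \<alpha>"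
      using that by (auto simp: Defs.admissible_def)
    interpret m: change_model K \<kappa> \<mu> f g \<Psi> s\<^sub>0 \<pi>\<^sub>0 X' using s0 \<pi>0 X' by unfold_locales auto
    have "\<Psi> x s = 0" if "x \<in> {1..K}" "s \<in> states \<kappa> K" for x s
      using pmax(1)[OF that] \<Psi>[OF that] p by auto
    then show ?thesis by (intro m.expected_time_infinite[OF T' err]) (use \<alpha>c \<alpha> \<pi>0c in auto)
  qed
  have "E = \<top>" by (rule inf[OF admissible])
  moreover have "opt = \<top>" unfolding optimal_time_def by (rule antisym[OF top_greatest]) (rule INF_greatest, clarify, simp add: inf)
  ultimately show ?thesis by (simp add: time_ratio_def)
qed

lemma time_ratio_near_1:
  assumes \<epsilon>: "0 < \<epsilon>" "2 * \<epsilon> \<le> Imin" "2 * \<epsilon> \<le> Jmin"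
    and M: "0 \<le> M"
      "\<And>x B. x \<in> {1..K} \<Longrightarrow> M \<le> B \<Longrightarrow> (\<integral>\<^sup>+y. ennreal (B - min (ln (g x y / f x y)) M) * ennreal (g x y) \<partial>\<mu>) \<le> ennreal (B - (I x - \<epsilon>))"
      "\<And>x B. x \<in> {1..K} \<Longrightarrow> M \<le> B \<Longrightarrow> (\<integral>\<^sup>+y. ennreal (B - min (ln (f x y / g x y)) M) * ennreal (f x y) \<partial>\<mu>) \<le> ennreal (B - (J x - \<epsilon>))"
    and large: "11 + 8 * (1 / Imin + 1 / Jmin) + 1 / c \<le> 1 / \<alpha>" "11 + 8 * (1 / Imin + 1 / Jmin) + 1 / c \<le> Imin * (\<beta> / Rmax)"
    and \<alpha>c: "\<alpha> < c" "2 * \<alpha> < 1" and \<eta>: "0 \<le> \<eta>"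
    and C: "threshold_bounds.overhead Imin Jmin Rmax M (M + Om + C\<phi>) (\<kappa> + 1) \<le> C"
    and est: "\<And>(w::real) lam q. 1 \<le> w \<Longrightarrow> Imin \<le> lam \<Longrightarrow> lam \<le> Rmax \<Longrightarrow> c \<le> q \<Longrightarrow>
      q * w + \<beta> * (1 / (lam - \<epsilon>)) + C * (1 + ln (2 * \<kappa> + w + \<beta> / Imin) + \<alpha> * (2 * \<kappa> + w + \<beta> / Imin))
        \<le> (1 + \<eta>) * (q * w + \<beta> / lam - ((ln 2 - ln c + 1) / Imin + 3 * \<kappa> + 1) - 2 * \<alpha> * w)
      \<and> 0 < q * w + \<beta> / lam - ((ln 2 - ln c + 1) / Imin + 3 * \<kappa> + 1) - 2 * \<alpha> * w"
  shows "1 \<le> time_ratio E opt \<and> time_ratio E opt \<le> ennreal (1 + \<eta>)"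
proof (cases "pmax = 0")
  case True
  then show ?thesis using time_ratio_impossible_change \<alpha>c \<eta> by simp
next
  case False
  then have p: "0 < pmax" using pmax(3) by simp
  let ?W = "2 * \<kappa> + w\<^sub>0 + \<beta> / Imin"
  let ?low = "(1 - \<pi>\<^sub>0) * w\<^sub>0 + \<beta> / lam - ((ln 2 - ln c + 1) / Imin + 3 * \<kappa> + 1) - 2 * \<alpha> * w\<^sub>0"
  have \<beta>: "0 \<le> \<beta>"
  proof -
    have "0 \<le> 8 * (1 / Imin + 1 / Jmin)" "0 \<le> 1 / c" using Imin_pos Jmin_pos c by auto
    then have "1 \<le> exp \<beta>" using large(1) exp_\<beta> by linarith
    then show ?thesis by simp
  qed
  note w = w0[OF p]
  have "0 \<le> \<beta> / Imin" using \<beta> Imin_pos by simp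
  then have W: "1 \<le> ?W" using w by linarith
  have q: "c \<le> 1 - \<pi>\<^sub>0" using \<pi>0c by simp
  note e = est[OF w(4) lam_range(2,3) q]
  have "E \<le> ennreal ((1 - \<pi>\<^sub>0) * w\<^sub>0 + \<beta> * (1 / (lam - \<epsilon>)) + C * (1 + ln ?W + \<alpha> * ?W))"
  proof (rule order_trans[OF upper_estimate[OF p \<epsilon> M large]])
    have "0 \<le> ln ?W" "0 \<le> \<alpha> * ?W" using W \<alpha> mult_nonneg_nonneg[of \<alpha> ?W] by auto
    then have "0 \<le> 1 + ln ?W + \<alpha> * ?W" by linarith
    then show "ennreal ((1 - \<pi>\<^sub>0) * w\<^sub>0 + \<beta> * (1 / (lam - \<epsilon>))
      + threshold_bounds.overhead Imin Jmin Rmax M (M + Om + C\<phi>) (\<kappa> + 1) * (1 + ln ?W + \<alpha> * ?W))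
      \<le> ennreal ((1 - \<pi>\<^sub>0) * w\<^sub>0 + \<beta> * (1 / (lam - \<epsilon>)) + C * (1 + ln ?W + \<alpha> * ?W))"
      using C by (intro ennreal_leI add_left_mono mult_right_mono) auto
  qed
  also have "\<dots> \<le> ennreal ((1 + \<eta>) * ?low)" using e by (intro ennreal_leI) blast
  also have "\<dots> = ennreal (1 + \<eta>) * ennreal ?low" using \<eta> e by (intro ennreal_mult) (auto intro: less_imp_le)
  finally have E: "E \<le> ennreal (1 + \<eta>) * ennreal ?low" .
  have low: "ennreal ?low \<le> opt" by (rule optimal_time_ge[OF p \<alpha>c(2)])
  have "0 < ennreal ?low" using e by simp
  then have "0 < opt" using low by (rule less_le_trans)
  moreover have "E \<le> ennreal (1 + \<eta>) * opt" by (rule order_trans[OF E]) (intro mult_left_mono low, simp)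
  moreover have "E < \<top>" by (rule le_less_trans[OF E]) (simp add: ennreal_mult_less_top)
  ultimately show ?thesis using time_ratio_bounds[OF optimal_le] by blast
qed

end

text \<open>The order of quantifiers matters: the bound on \<alpha> is chosen before the link
  function, the prior, the policies and the procedure, all of which may vary with \<alpha>.\<close>

lemma (in informative_densities) time_ratio_eventually_near_1:
  assumes \<eta>: "0 < \<eta>" and c: "0 < c" "c < 1"
  shows "\<exists>\<alpha>\<^sub>0>0. \<forall>\<Psi> s\<^sub>0 \<pi>\<^sub>0 \<alpha> \<upsilon> \<upsilon>' lam h A b1 b2 d X T. \<alpha> \<le> \<alpha>\<^sub>0 \<longrightarrow> bounded_setup K \<kappa> \<mu> f g \<Psi> s\<^sub>0 \<pi>\<^sub>0 \<alpha> \<upsilon> \<upsilon>' lam h A b1 b2 d X T c \<longrightarrow>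
    1 \<le> time_ratio (expected_time (path_law \<mu> f g (memory_link \<kappa> \<Psi> s\<^sub>0 \<pi>\<^sub>0) X) T) (optimal_time K \<mu> f g (memory_link \<kappa> \<Psi> s\<^sub>0 \<pi>\<^sub>0) \<alpha>) \<and>
    time_ratio (expected_time (path_law \<mu> f g (memory_link \<kappa> \<Psi> s\<^sub>0 \<pi>\<^sub>0) X) T) (optimal_time K \<mu> f g (memory_link \<kappa> \<Psi> s\<^sub>0 \<pi>\<^sub>0) \<alpha>) \<le> ennreal (1 + \<eta>)"
proof -
  define \<epsilon> where "\<epsilon> = min (min (Imin / 2) (Jmin / 2)) (\<eta> * Imin / 8)"
  have "0 < \<epsilon>" "\<epsilon> \<le> Imin / 2" "\<epsilon> \<le> Jmin / 2" "\<epsilon> \<le> \<eta> * Imin / 8" using Imin_pos Jmin_pos \<eta> by (simp_all add: \<epsilon>_def min.coboundedI1)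
  then have \<epsilon>: "0 < \<epsilon>" "2 * \<epsilon> \<le> Imin" "2 * \<epsilon> \<le> Jmin" "8 * \<epsilon> \<le> \<eta> * Imin" by simp_all
  obtain M where M: "0 \<le> M"
    "\<And>x B. x \<in> {1..K} \<Longrightarrow> M \<le> B \<Longrightarrow> (\<integral>\<^sup>+y. ennreal (B - min (ln (g x y / f x y)) M) * ennreal (g x y) \<partial>\<mu>) \<le> ennreal (B - (I x - \<epsilon>))"
    "\<And>x B. x \<in> {1..K} \<Longrightarrow> M \<le> B \<Longrightarrow> (\<integral>\<^sup>+y. ennreal (B - min (ln (f x y / g x y)) M) * ennreal (f x y) \<partial>\<mu>) \<le> ennreal (B - (J x - \<epsilon>))"
    by (rule truncation_level[OF \<epsilon>(1)]) blast
  define r where "r = Imax - ln c"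
  define C where "C = max 1 (threshold_bounds.overhead Imin Jmin r M (M + - ln c + real (2 * K ^ \<kappa> + \<kappa>) * r) (\<kappa> + 1))"
  define C' where "C' = (ln 2 - ln c + 1) / Imin + 3 * \<kappa> + 1"
  define b where "b = 11 + 8 * (1 / Imin + 1 / Jmin) + 1 / c"
  have lnc: "0 < - ln c" using c by simp
  have "1 \<in> {1..K}" using K by simp
  then have "Imin \<le> Imax" using I_bounds[of 1] by linarith
  then have r: "0 < r" using Imin_pos lnc by (simp add: r_def)
  have b: "11 \<le> b" using Imin_pos Jmin_pos c by (simp add: b_def)
  have "0 \<le> ln 2 - ln c + 1" using lnc ln_gt_zero[of "2::real"] by linarith
  then have "0 \<le> (ln 2 - ln c + 1) / Imin" using Imin_pos by (intro divide_nonneg_pos)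
  then have C': "0 \<le> C'" unfolding C'_def by linarith
  have C: "0 < C" by (simp add: C_def)
  have n: "0 \<le> real (2 * \<kappa>)" by simp
  obtain \<beta>\<^sub>0 \<alpha>\<^sub>0 where est: "0 < \<alpha>\<^sub>0"
    "\<forall>\<alpha> \<beta> w lam q. 0 < \<alpha> \<longrightarrow> \<alpha> \<le> \<alpha>\<^sub>0 \<longrightarrow> \<beta>\<^sub>0 \<le> \<beta> \<longrightarrow> 1 \<le> w \<longrightarrow> Imin \<le> lam \<longrightarrow> lam \<le> r \<longrightarrow> c \<le> q \<longrightarrow>
      q * w + \<beta> * (1 / (lam - \<epsilon>)) + C * (1 + ln (real (2 * \<kappa>) + w + \<beta> / Imin) + \<alpha> * (real (2 * \<kappa>) + w + \<beta> / Imin))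
        \<le> (1 + \<eta>) * (q * w + \<beta> / lam - C' - 2 * \<alpha> * w) \<and> 0 < q * w + \<beta> / lam - C' - 2 * \<alpha> * w"
    using ratio_estimate[OF Imin_pos r c(1) C C' \<eta> \<epsilon>(1,2,4) n] by (elim exE conjE) (rule that)
  define \<beta>\<^sub>1 where "\<beta>\<^sub>1 = max \<beta>\<^sub>0 (b * r / Imin)"
  \<comment> \<open>The last bound forces \<beta> to be at least \<open>\<beta>\<^sub>1\<close>,
    because 1 + exp \<beta> = 1 / \<alpha>.\<close>
  define \<alpha>\<^sub>1 where "\<alpha>\<^sub>1 = min (min \<alpha>\<^sub>0 (c / 2)) (min (1 / b) (1 / (1 + exp \<beta>\<^sub>1)))"
  show ?thesis
  proof (intro exI[of _ \<alpha>\<^sub>1] conjI allI impI)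
    show "0 < \<alpha>\<^sub>1" using est(1) c b by (simp add: \<alpha>\<^sub>1_def add_pos_pos)
    fix \<Psi> s\<^sub>0 \<pi>\<^sub>0 \<alpha> \<upsilon> \<upsilon>' lam h A b1 b2 d and X :: "nat \<Rightarrow> 'a path \<Rightarrow> nat" and T
    assume le: "\<alpha> \<le> \<alpha>\<^sub>1" and st: "bounded_setup K \<kappa> \<mu> f g \<Psi> s\<^sub>0 \<pi>\<^sub>0 \<alpha> \<upsilon> \<upsilon>' lam h A b1 b2 d X T c"
    interpret bounded_setup K \<kappa> \<mu> f g \<Psi> s\<^sub>0 \<pi>\<^sub>0 \<alpha> \<upsilon> \<upsilon>' lam h A b1 b2 d X T c by (rule st)
    have R: "Rmax = r" by (simp add: Rmax_def Om_def r_def)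
    have \<alpha>_le: "\<alpha> \<le> \<alpha>\<^sub>0" "\<alpha> \<le> c / 2" "\<alpha> \<le> 1 / b" "\<alpha> \<le> 1 / (1 + exp \<beta>\<^sub>1)" using le by (simp_all add: \<alpha>\<^sub>1_def)
    have "b \<le> 1 / \<alpha>" using \<alpha>_le(3) \<alpha>(1) b by (simp add: pos_le_divide_eq mult.commute)
    have "1 + exp \<beta>\<^sub>1 \<le> 1 / \<alpha>" using \<alpha>_le(4) \<alpha>(1) by (simp add: pos_le_divide_eq mult.commute add_pos_pos)
    then have "exp \<beta>\<^sub>1 \<le> exp \<beta>" using exp_\<beta>(2) by linarith
    then have "\<beta>\<^sub>1 \<le> \<beta>" by simp
    then have \<beta>: "\<beta>\<^sub>0 \<le> \<beta>" "b * r / Imin \<le> \<beta>" by (simp_all add: \<beta>\<^sub>1_def)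
    then have "b \<le> Imin * (\<beta> / r)" using Imin_pos r by (simp add: pos_divide_le_eq pos_le_divide_eq mult.commute)
    then have large: "b \<le> 1 / \<alpha>" "b \<le> Imin * (\<beta> / Rmax)" using \<open>b \<le> 1 / \<alpha>\<close> R by simp_all
    have "1 \<le> time_ratio E opt \<and> time_ratio E opt \<le> ennreal (1 + \<eta>)"
    proof (rule time_ratio_near_1[OF \<epsilon>(1-3) M large[unfolded b_def]])
      show "\<alpha> < c" using \<alpha>_le c by linarith
      show "2 * \<alpha> < 1" using \<alpha>_le c by linarith
      show "0 \<le> \<eta>" using \<eta> by simp
      show "threshold_bounds.overhead Imin Jmin Rmax M (M + Om + C\<phi>) (\<kappa> + 1) \<le> C" by (simp add: C_def R Om_def C\<phi>_def)
      show "q * w + \<beta> * (1 / (lam - \<epsilon>)) + C * (1 + ln (2 * \<kappa> + w + \<beta> / Imin) + \<alpha> * (2 * \<kappa> + w + \<beta> / Imin))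
        \<le> (1 + \<eta>) * (q * w + \<beta> / lam - ((ln 2 - ln c + 1) / Imin + 3 * \<kappa> + 1) - 2 * \<alpha> * w)
      \<and> 0 < q * w + \<beta> / lam - ((ln 2 - ln c + 1) / Imin + 3 * \<kappa> + 1) - 2 * \<alpha> * w"
        if "1 \<le> w" "Imin \<le> lam" "lam \<le> Rmax" "c \<le> q" for w lam q :: real
        using est(2)[rule_format, OF \<alpha>(1) \<alpha>_le(1) \<beta>(1) that(1,2) that(3)[unfolded R] that(4)] unfolding C'_def .
    qed
    then show "1 \<le> time_ratio E opt" "time_ratio E opt \<le> ennreal (1 + \<eta>)" by simp_all
  qed
qed

theorem corollary6p3:
  fixes K \<kappa> :: nat
    and \<mu> :: "'y::polish_space measure"
    and f g :: "nat \<Rightarrow> 'y \<Rightarrow> real"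
    and s\<^sub>0 :: "nat list"
    and \<Psi> :: "real \<Rightarrow> nat \<Rightarrow> nat list \<Rightarrow> real"
    and \<pi>\<^sub>0 :: "real \<Rightarrow> real"
    and \<pi> :: "real \<Rightarrow> nat list \<Rightarrow> real"
    and c :: real
    and I J :: "nat \<Rightarrow> real"
    and \<upsilon> \<upsilon>' :: "real \<Rightarrow> nat list \<Rightarrow> nat"
    and lam :: "real \<Rightarrow> real"
    and h :: "real \<Rightarrow> nat list \<Rightarrow> real"
    and r :: "real \<Rightarrow> nat \<Rightarrow> nat list \<Rightarrow> real"
    and z\<^sub>0 \<Xi>\<^sub>1 \<Xi>\<^sub>2 :: "real \<Rightarrow> nat list"
    and D :: "real \<Rightarrow> nat list \<Rightarrow> real"
    and A b1 b2 d :: "real \<Rightarrow> ereal"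
    and X :: "real \<Rightarrow> nat \<Rightarrow> 'y path \<Rightarrow> nat"
    and T :: "real \<Rightarrow> 'y path \<Rightarrow> enat"
  assumes K: "2 \<le> K"
    and \<mu>: "sigma_finite_measure \<mu>" "sets \<mu> = sets borel"
    and densities: "\<And>x. x \<in> {1..K} \<Longrightarrow> is_density \<mu> (f x) \<and> is_density \<mu> (g x)"
    and V_I: "\<And>x. x \<in> {1..K} \<Longrightarrow>
        0 < llr_variance \<mu> (g x) (f x) \<and> llr_variance \<mu> (g x) (f x) < \<infinity>"
    and V_J: "\<And>x. x \<in> {1..K} \<Longrightarrow> llr_variance \<mu> (f x) (g x) < \<infinity>"
    and I_def: "\<And>x. I x = kl_number \<mu> (g x) (f x)"
    and J_def: "\<And>x. J x = kl_number \<mu> (f x) (g x)"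
    \<comment> \<open>the finite memory model\<close>
    and s0: "s\<^sub>0 \<in> states \<kappa> K"
    and \<Psi>: "\<And>\<alpha> x s. \<alpha> \<in> {0<..<1} \<Longrightarrow> x \<in> {1..K} \<Longrightarrow> s \<in> states \<kappa> K \<Longrightarrow> \<Psi> \<alpha> x s \<in> {0..<1}"
    and \<pi>0: "\<And>\<alpha>. \<alpha> \<in> {0<..<1} \<Longrightarrow> \<pi>\<^sub>0 \<alpha> \<in> {0..<1}"
    and \<pi>_def: "\<And>\<alpha>. \<pi> \<alpha> = memory_link \<kappa> (\<Psi> \<alpha>) s\<^sub>0 (\<pi>\<^sub>0 \<alpha>)"
    and c: "0 < c" "c < 1"
    and \<pi>_bound: "\<forall>\<^sub>F \<alpha> in at_right 0. (SUP z\<in>lists {1..K}. \<pi> \<alpha> z) \<le> 1 - c"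
    \<comment> \<open>initial sequence and acceleration block\<close>
    and \<upsilon>: "\<And>\<alpha> s. \<alpha> \<in> {0<..<1} \<Longrightarrow> s \<in> states \<kappa> K \<Longrightarrow>
        is_arg_min (\<lambda>x. ereal (1 - \<Psi> \<alpha> x s) * (1 + mean_change_value \<kappa> K (\<Psi> \<alpha>) (shift \<kappa> x s)))
          (\<lambda>x. x \<in> {1..K}) (\<upsilon> \<alpha> s)"
    and z0_def: "\<And>\<alpha>. z\<^sub>0 \<alpha> = policy_prefix \<kappa> (\<upsilon> \<alpha>) s\<^sub>0"
    and \<Xi>1_def: "\<And>\<alpha>. \<Xi>\<^sub>1 \<alpha> = policy_block \<kappa> (\<upsilon> \<alpha>) s\<^sub>0"
    \<comment> \<open>detection block\<close>
    and r_def: "\<And>\<alpha> x s. r \<alpha> x s = I x + survival_rate (\<Psi> \<alpha> x s)"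
    and bellman: "\<And>\<alpha> s. \<alpha> \<in> {0<..<1} \<Longrightarrow> s \<in> states \<kappa> K \<Longrightarrow>
        lam \<alpha> + h \<alpha> s = (MAX x\<in>{1..K}. r \<alpha> x s + h \<alpha> (shift \<kappa> x s))"
    and \<upsilon>': "\<And>\<alpha> s. \<alpha> \<in> {0<..<1} \<Longrightarrow> s \<in> states \<kappa> K \<Longrightarrow>
        is_arg_max (\<lambda>x. r \<alpha> x s + h \<alpha> (shift \<kappa> x s)) (\<lambda>x. x \<in> {1..K}) (\<upsilon>' \<alpha> s)"
    and \<Xi>2_def: "\<And>\<alpha>. \<Xi>\<^sub>2 \<alpha> = policy_block \<kappa> (\<upsilon>' \<alpha>) s\<^sub>0"
    \<comment> \<open>thresholds\<close>
    and D_def: "\<And>\<alpha> \<Xi>. D \<alpha> \<Xi> = block_average I \<Xi> + block_drift \<kappa> (\<Psi> \<alpha>) \<Xi>"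
    and A_def: "\<And>\<alpha>. A \<alpha> = worst_mean_change K (\<pi> \<alpha>) (\<Xi>\<^sub>1 \<alpha>) + ereal (ln ((1 - \<alpha>) / \<alpha>) / D \<alpha> (\<Xi>\<^sub>2 \<alpha>))"
    and b2_def: "\<And>\<alpha>. b2 \<alpha> = ereal ((1 - \<alpha>) / \<alpha>)"
    and b1_def: "\<And>\<alpha>. b1 \<alpha> =
        (if D \<alpha> (\<Xi>\<^sub>1 \<alpha>) = D \<alpha> (\<Xi>\<^sub>2 \<alpha>) then b2 \<alpha>
         else min (b2 \<alpha>) (A \<alpha> / ereal (1 / D \<alpha> (\<Xi>\<^sub>1 \<alpha>) - 1 / D \<alpha> (\<Xi>\<^sub>2 \<alpha>)) - 1))"
    and d_def: "\<And>\<alpha>. d \<alpha> =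
        b1 \<alpha> * (A \<alpha> / ereal (1 / D \<alpha> (\<Xi>\<^sub>2 \<alpha>) + 1 / block_average J (\<Xi>\<^sub>2 \<alpha>)))"
    and procedure: "\<And>\<alpha>. \<alpha> \<in> {0<..<1} \<Longrightarrow>
        proposed_procedure \<mu> f g (\<pi> \<alpha>) (z\<^sub>0 \<alpha>) (\<Xi>\<^sub>1 \<alpha>) (\<Xi>\<^sub>2 \<alpha>) (b1 \<alpha>) (b2 \<alpha>) (d \<alpha>) (X \<alpha>) (T \<alpha>)"
  shows "(\<forall>\<alpha>\<in>{0<..<1}. (X \<alpha>, T \<alpha>) \<in> admissible K \<mu> f g (\<pi> \<alpha>) \<alpha>) \<and>
    ((\<lambda>\<alpha>. time_ratio (expected_time (path_law \<mu> f g (\<pi> \<alpha>) (X \<alpha>)) (T \<alpha>))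
                      (optimal_time K \<mu> f g (\<pi> \<alpha>) \<alpha>)) \<longlongrightarrow> 1) (at_right 0)"
proof -
  interpret informative_densities K \<mu> f g
    by (intro informative_densities.intro densities.intro informative_densities_axioms.intro K \<mu> V_I V_J
      densities[THEN conjunct1] densities[THEN conjunct2])
  have I: "I = (\<lambda>x. kl_number \<mu> (g x) (f x))" and J: "J = (\<lambda>x. kl_number \<mu> (f x) (g x))"
    by (auto simp: I_def J_def)
  have less1: "\<forall>\<^sub>F \<alpha> in at_right (0::real). \<alpha> \<in> {0<..<1}"
    by (rule eventually_at_rightI[of 0 1]) auto
  have set: "proposed_setup K \<kappa> \<mu> f g (\<Psi> \<alpha>) s\<^sub>0 (\<pi>\<^sub>0 \<alpha>) \<alpha> (\<upsilon> \<alpha>) (\<upsilon>' \<alpha>) (lam \<alpha>) (h \<alpha>) (A \<alpha>) (b1 \<alpha>) (b2 \<alpha>) (d \<alpha>) (X \<alpha>) (T \<alpha>)"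
    if \<alpha>: "\<alpha> \<in> {0<..<1}" for \<alpha>
  proof -
    interpret mm: memory_model K \<kappa> "\<Psi> \<alpha>" using K \<Psi>[OF \<alpha>] by unfold_locales auto
    have D: "D \<alpha> = mm.drift (\<lambda>x. kl_number \<mu> (g x) (f x))" by (rule ext) (simp add: D_def I mm.drift_def)
    have r: "r \<alpha> = mm.reward (\<lambda>x. kl_number \<mu> (g x) (f x))" by (intro ext) (simp add: r_def mm.reward_def I)
    show ?thesis
    proof (intro proposed_setup.intro proposed_setup_axioms.intro informative_densities_axioms mm.memory_model_axioms)
      show "s\<^sub>0 \<in> states \<kappa> K" by (rule s0)
      show "0 \<le> \<pi>\<^sub>0 \<alpha>" "\<pi>\<^sub>0 \<alpha> < 1" using \<pi>0[OF \<alpha>] by auto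
      show "0 < \<alpha>" "\<alpha> < 1" using \<alpha> by auto
      show "is_arg_min (\<lambda>x. ereal (1 - \<Psi> \<alpha> x s) * (1 + mean_change_value \<kappa> K (\<Psi> \<alpha>) (shift \<kappa> x s))) (\<lambda>x. x \<in> {1..K}) (\<upsilon> \<alpha> s)"
        if "s \<in> states \<kappa> K" for s by (rule \<upsilon>[OF \<alpha> that])
      show "lam \<alpha> + h \<alpha> s = (MAX x\<in>{1..K}. mm.reward (\<lambda>x. kl_number \<mu> (g x) (f x)) x s + h \<alpha> (shift \<kappa> x s))"
        if "s \<in> states \<kappa> K" for s using bellman[OF \<alpha> that] by (simp only: r)
      show "is_arg_max (\<lambda>x. mm.reward (\<lambda>x. kl_number \<mu> (g x) (f x)) x s + h \<alpha> (shift \<kappa> x s)) (\<lambda>x. x \<in> {1..K}) (\<upsilon>' \<alpha> s)"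
        if "s \<in> states \<kappa> K" for s using \<upsilon>'[OF \<alpha> that] by (simp only: r)
      show "A \<alpha> = worst_mean_change K (memory_link \<kappa> (\<Psi> \<alpha>) s\<^sub>0 (\<pi>\<^sub>0 \<alpha>)) (policy_block \<kappa> (\<upsilon> \<alpha>) s\<^sub>0)
          + ereal (ln ((1 - \<alpha>) / \<alpha>) / mm.drift (\<lambda>x. kl_number \<mu> (g x) (f x)) (policy_block \<kappa> (\<upsilon>' \<alpha>) s\<^sub>0))"
        unfolding A_def \<pi>_def \<Xi>1_def \<Xi>2_def D ..
      show "b2 \<alpha> = ereal ((1 - \<alpha>) / \<alpha>)" by (rule b2_def)
      show "b1 \<alpha> = (if mm.drift (\<lambda>x. kl_number \<mu> (g x) (f x)) (policy_block \<kappa> (\<upsilon> \<alpha>) s\<^sub>0) = mm.drift (\<lambda>x. kl_number \<mu> (g x) (f x)) (policy_block \<kappa> (\<upsilon>' \<alpha>) s\<^sub>0) then b2 \<alpha>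
          else min (b2 \<alpha>) (A \<alpha> / ereal (1 / mm.drift (\<lambda>x. kl_number \<mu> (g x) (f x)) (policy_block \<kappa> (\<upsilon> \<alpha>) s\<^sub>0) - 1 / mm.drift (\<lambda>x. kl_number \<mu> (g x) (f x)) (policy_block \<kappa> (\<upsilon>' \<alpha>) s\<^sub>0)) - 1))"
        unfolding b1_def \<Xi>1_def \<Xi>2_def D ..
      show "d \<alpha> = b1 \<alpha> * (A \<alpha> / ereal (1 / mm.drift (\<lambda>x. kl_number \<mu> (g x) (f x)) (policy_block \<kappa> (\<upsilon>' \<alpha>) s\<^sub>0) + 1 / block_average (\<lambda>x. kl_number \<mu> (f x) (g x)) (policy_block \<kappa> (\<upsilon>' \<alpha>) s\<^sub>0)))"
        unfolding d_def \<Xi>2_def D J ..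
      show "proposed_procedure \<mu> f g (memory_link \<kappa> (\<Psi> \<alpha>) s\<^sub>0 (\<pi>\<^sub>0 \<alpha>)) (policy_prefix \<kappa> (\<upsilon> \<alpha>) s\<^sub>0) (policy_block \<kappa> (\<upsilon> \<alpha>) s\<^sub>0)
          (policy_block \<kappa> (\<upsilon>' \<alpha>) s\<^sub>0) (b1 \<alpha>) (b2 \<alpha>) (d \<alpha>) (X \<alpha>) (T \<alpha>)"
        using procedure[OF \<alpha>] unfolding \<pi>_def z0_def \<Xi>1_def \<Xi>2_def .
    qed
  qed
  have bound: "\<forall>\<^sub>F \<alpha> in at_right 0. \<alpha> \<in> {0<..<1} \<and>
    bounded_setup K \<kappa> \<mu> f g (\<Psi> \<alpha>) s\<^sub>0 (\<pi>\<^sub>0 \<alpha>) \<alpha> (\<upsilon> \<alpha>) (\<upsilon>' \<alpha>) (lam \<alpha>) (h \<alpha>) (A \<alpha>) (b1 \<alpha>) (b2 \<alpha>) (d \<alpha>) (X \<alpha>) (T \<alpha>) c"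
    using \<pi>_bound less1
  proof eventually_elim
    case (elim \<alpha>)
    interpret proposed_setup K \<kappa> \<mu> f g "\<Psi> \<alpha>" s\<^sub>0 "\<pi>\<^sub>0 \<alpha>" \<alpha> "\<upsilon> \<alpha>" "\<upsilon>' \<alpha>" "lam \<alpha>" "h \<alpha>" "A \<alpha>" "b1 \<alpha>" "b2 \<alpha>" "d \<alpha>" "X \<alpha>" "T \<alpha>" by (rule set[OF elim(2)])
    \<comment> \<open>A real supremum bounds the values only if the set is bounded above.\<close>
    have bdd: "bdd_above (\<pi> \<alpha> ` lists {1..K})"
      by (rule bdd_aboveI[of _ 1]) (auto simp: \<pi>_def intro!: less_imp_le \<pi>[THEN conjunct2])
    have le: "\<pi> \<alpha> z \<le> 1 - c" if "z \<in> lists {1..K}" for z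
      using cSUP_upper[OF that bdd] elim(1) by linarith
    have "\<Psi> \<alpha> x s \<le> 1 - c" if x: "x \<in> {1..K}" and s: "s \<in> states \<kappa> K" for x s
    proof -
      \<comment> \<open>This history leads to the state s and then applies x, so the bound on the
        link function reaches every value of \<open>\<Psi>\<close>.\<close>
      have "rev s @ [x] \<in> lists {1..K}" using x s by (auto simp: states_def)
      from le[OF this] show ?thesis using state_after_reaches[OF s0 s] by (simp add: \<pi>_def memory_link_def)
    qed
    moreover have "\<pi>\<^sub>0 \<alpha> \<le> 1 - c" using le[of "[]"] by (simp add: \<pi>_def memory_link_Nil)
    ultimately have "bounded_setup K \<kappa> \<mu> f g (\<Psi> \<alpha>) s\<^sub>0 (\<pi>\<^sub>0 \<alpha>) \<alpha> (\<upsilon> \<alpha>) (\<upsilon>' \<alpha>) (lam \<alpha>) (h \<alpha>) (A \<alpha>) (b1 \<alpha>) (b2 \<alpha>) (d \<alpha>) (X \<alpha>) (T \<alpha>) c"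
      using c by unfold_locales auto
    then show ?case by (rule conjI[OF elim(2)])
  qed
  let ?ratio = "\<lambda>\<alpha>. time_ratio (expected_time (path_law \<mu> f g (\<pi> \<alpha>) (X \<alpha>)) (T \<alpha>)) (optimal_time K \<mu> f g (\<pi> \<alpha>) \<alpha>)"
  have ev: "\<forall>\<^sub>F \<alpha> in at_right 0. 1 \<le> ?ratio \<alpha> \<and> ?ratio \<alpha> \<le> ennreal (1 + \<eta>)" if \<eta>: "0 < \<eta>" for \<eta>
  proof -
    from time_ratio_eventually_near_1[where \<kappa>=\<kappa>, OF \<eta> c] obtain \<alpha>\<^sub>0 where \<alpha>0: "0 < \<alpha>\<^sub>0" and near:
      "\<forall>\<Psi> s\<^sub>0 \<pi>\<^sub>0 \<alpha> \<upsilon> \<upsilon>' lam h A b1 b2 d X T. \<alpha> \<le> \<alpha>\<^sub>0 \<longrightarrow> bounded_setup K \<kappa> \<mu> f g \<Psi> s\<^sub>0 \<pi>\<^sub>0 \<alpha> \<upsilon> \<upsilon>' lam h A b1 b2 d X T c \<longrightarrow>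
    1 \<le> time_ratio (expected_time (path_law \<mu> f g (memory_link \<kappa> \<Psi> s\<^sub>0 \<pi>\<^sub>0) X) T) (optimal_time K \<mu> f g (memory_link \<kappa> \<Psi> s\<^sub>0 \<pi>\<^sub>0) \<alpha>) \<and>
    time_ratio (expected_time (path_law \<mu> f g (memory_link \<kappa> \<Psi> s\<^sub>0 \<pi>\<^sub>0) X) T) (optimal_time K \<mu> f g (memory_link \<kappa> \<Psi> s\<^sub>0 \<pi>\<^sub>0) \<alpha>) \<le> ennreal (1 + \<eta>)"
      by (elim exE conjE) (rule that)
    have "\<forall>\<^sub>F \<alpha> in at_right 0. \<alpha> < \<alpha>\<^sub>0" by (rule eventually_at_rightI[OF _ \<alpha>0]) simp
    with bound show ?thesis
    proof eventually_elim
      case (elim \<alpha>)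
      show ?case unfolding \<pi>_def
        by (rule near[rule_format, OF less_imp_le[OF elim(2)] conjunct2[OF elim(1)]])
    qed
  qed
  have "(?ratio \<longlongrightarrow> 1) (at_right 0)"
  proof (rule order_tendstoI)
    fix a :: ennreal assume "a < 1"
    from ev[OF zero_less_one] show "\<forall>\<^sub>F \<alpha> in at_right 0. a < ?ratio \<alpha>"
    proof eventually_elim
      case (elim \<alpha>)
      with \<open>a < 1\<close> show ?case by (blast intro: less_le_trans)
    qed
  next
    fix a :: ennreal assume a: "1 < a"
    obtain v where v: "1 < v" "v < a" using dense[OF a] by blast
    \<comment> \<open>The tolerance is x - 1 for a real x strictly between 1 and a.\<close>
    then obtain x where x: "v = ennreal x" "0 \<le> x" by (cases v) auto
    with v(1) have "1 < x" using ennreal_less_iff[of 1 x] by simp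
    then have "\<forall>\<^sub>F \<alpha> in at_right 0. 1 \<le> ?ratio \<alpha> \<and> ?ratio \<alpha> \<le> ennreal (1 + (x - 1))" by (intro ev) simp
    then show "\<forall>\<^sub>F \<alpha> in at_right 0. ?ratio \<alpha> < a"
    proof eventually_elim
      case (elim \<alpha>)
      then show ?case using le_less_trans[OF _ v(2)] x by simp
    qed
  qed
  moreover have "(X \<alpha>, T \<alpha>) \<in> admissible K \<mu> f g (\<pi> \<alpha>) \<alpha>" if "\<alpha> \<in> {0<..<1}" for \<alpha>
    unfolding \<pi>_def by (rule proposed_setup.admissible[OF set[OF that]])
  ultimately show ?thesis by blast
qed

end
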